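(* Let $r\ge 1$, let $X_0,X_1,\ldots,X_r$ be symplectic manifolds, and let $(f_1,\ldots,f_r)$ be a composable sequence of canonical relations, with $f_i$ a canonical relation to $X_{i-1}$ from $X_i$ (so $f_i\subseteq X_{i-1}\times X_i$) for $i=1,\ldots,r$. Then there exist a symplectic manifold $Q$, a canonical relation $A\subseteq X_0\times Q$ (to $X_0$ from $Q$) and a canonical relation $B\subseteq Q\times X_r$ (to $Q$ from $X_r$) such that $A$ is a reduction, $B$ is a coreduction, and $$[f_1,\ldots,f_r]=[A,B]$$ as morphisms to $X_0$ from $X_r$ in the Wehrheim-Woodward category $WW(\mathbf{SREL})$.
   Context: **Relations.** A relation $f$ to $X$ from $Y$ (target $X$, source $Y$, written $X\stackrel{f}{\longleftarrow}Y$) is a subset $f\subseteq X\times Y$. The composition of $f\subseteq X\times Y$ and $g\subseteq Y\times Z$ is $f\circ g=\{(x,z) : (x,y)\in f \text{ and } (y,z)\in g \text{ for some } y\in Y\}$. The identity relation $1_X$ is the diagonal $\Delta_X\subseteq X\times X$. The transpose is $f^{\mathrm t}=\{(y,x):(x,y)\in f\}\subseteq Y\times X$. A relation $f\subseteq X\times Y$ is surjective if every $x\in X$ occurs in some $(x,y)\in f$. It is coinjective if for each $y\in Y$ there is at most one $x$ with $(x,y)\in f$. **Smooth relations.** A relation $f\subseteq X\times Y$ between smooth manifolds is smooth if it is a closed submanifold of $X\times Y$. Its differential is the tangent bundle $Tf$, regarded as a smooth relation $Tf\subseteq TX\times TY$. A smooth relation $f\subseteq X\times Y$ is a reduction if both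 $f$ and $Tf$ are surjective and coinjective, and the projection $f\to Y$ is proper (as well as injective). It is a coreduction if $f^{\mathrm t}$ is a reduction. **Strong transversality.** For smooth relations $f\subseteq X\times Y$ and $g\subseteq Y\times Z$, the pair $(f,g)$ is transversal if $f\times g$ is transversal to $X\times\Delta_Y\times Z$ in $X\times Y\times Y\times Z$. In that case the fibre product $f\times_Y g=(f\times g)\cap(X\times\Delta_Y\times Z)$ is a manifold. A transversal pair is strongly transversal if the projection $f\times_Y g\to X\times Z$ is an embedding onto a closed submanifold (which is $f\circ g$). **Canonical relations.** For a symplectic manifold $Y=(Y,\omega_Y)$, write $\overline{Y}=(Y,-\omega_Y)$. A canonical relation to $X$ from $Y$, for symplectic manifolds $X,Y$, is a smooth relation $f\subseteq X\times Y$ that is a lagrangian submanifold of $X\times\overline{Y}$. If $(f,g)$ is a strongly transversal pair of canonical relations, then $f\circ g$ is again a canonical relation. $\mathbf{SREL}$ is the category whose objects are symplectic manifolds and whose morphisms to $X$ from $Y$ are all subsets of $X\times Y$, with the composition above. **The path category $P(\mathbf{SREL})$.** A canonical path is a bi-infinite sequence $(\ldots,f_{-1},f_0,f_1,\ldots)$ of canonical relations, composable in the sense that the source of $f_j$ is the target of $f_{j+1}$ for all $j$, with only finitely many $f_j$ different from identity morphisms. Hence for all sufficiently negative $j$ the entries are $1_X$ for a fixed $X$ (the target of the path), and for all sufficiently large $j$ they are $1_Y$ for a fixed $Y$ (the source of the path). Two canonical paths are identified if one is obtained from the other by inserting and removing finitely many identity morphisms. The equivalence classes are the morphisms of the category $P(\mathbf{SREL})$,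 whose objects are symplectic manifolds. Composition is by concatenation: remove all but finitely many copies of $1_Y$ from the positive end of the first sequence and from the negative end of the second, and concatenate. The identity of $X$ is the class of the constant sequence $1_X$. A finite composable sequence $(f_r,\ldots,f_s)$ of canonical relations defines a morphism $\langle f_r,\ldots,f_s\rangle$ by extending it with identity morphisms at both ends. **The Wehrheim-Woodward category $WW(\mathbf{SREL})$.** This is the quotient category of $P(\mathbf{SREL})$ by the smallest equivalence relation for which two paths are equivalent whenever a sequence representing one is obtained from a sequence representing the other by replacing two successive entries forming a strongly transversal pair $(p,q)$ by the single entry $p\circ q$. The class in $WW(\mathbf{SREL})$ of $\langle f_r,\ldots,f_s\rangle$ is denoted $[f_r,\ldots,f_s]$. *)

theory Defs
  imports "HOL-Analysis.Analysis" "HOL-Library.Infinite_Typeclass"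
begin

section \<open>Smooth functions on open subsets of Euclidean space\<close>

text \<open>Dimensions vary freely, so Euclidean \<open>n\<close>-space is the library's \<^const>\<open>Euclidean_space\<close>: the
  sequences \<open>nat \<Rightarrow> real\<close> vanishing from index \<open>n\<close> on. In particular the spaces are nested,
  and \<open>topspace (Euclidean_space k)\<close> is the standard \<open>k\<close>-plane in every larger one.\<close>

definition partial_deriv :: "nat \<Rightarrow> ((nat \<Rightarrow> real) \<Rightarrow> real) \<Rightarrow> (nat \<Rightarrow> real) \<Rightarrow> real" where
  "partial_deriv i g x = deriv (\<lambda>t. g (x(i := t))) (x i)"

fun Ck_on :: "nat \<Rightarrow> nat \<Rightarrow> (nat \<Rightarrow> real) set \<Rightarrow> ((nat \<Rightarrow> real) \<Rightarrow> real) \<Rightarrow> bool" where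
  "Ck_on n 0 V g \<longleftrightarrow> continuous_map (subtopology (Euclidean_space n) V) euclideanreal g"
| "Ck_on n (Suc k) V g \<longleftrightarrow>
     continuous_map (subtopology (Euclidean_space n) V) euclideanreal g \<and>
     (\<forall>i<n. (\<forall>x\<in>V. (\<lambda>t. g (x(i := t))) differentiable (at (x i))) \<and>
            Ck_on n k V (partial_deriv i g))"

definition smooth_on :: "nat \<Rightarrow> (nat \<Rightarrow> real) set \<Rightarrow> ((nat \<Rightarrow> real) \<Rightarrow> real) \<Rightarrow> bool" where
  "smooth_on n V g \<longleftrightarrow> (\<forall>k. Ck_on n k V g)"


section \<open>Smooth manifolds\<close>

text \<open>A chart is a pair \<open>(U, \<phi>)\<close>; the values of \<open>\<phi>\<close> outside \<open>U\<close> are irrelevant.\<close>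

type_synonym 'a chart = "'a set \<times> ('a \<Rightarrow> nat \<Rightarrow> real)"

definition chart_on :: "'a topology \<Rightarrow> nat \<Rightarrow> 'a chart \<Rightarrow> bool" where
  "chart_on T n = (\<lambda>(U, \<phi>).
     openin T U \<and> openin (Euclidean_space n) (\<phi> ` U) \<and>
     homeomorphic_map (subtopology T U) (subtopology (Euclidean_space n) (\<phi> ` U)) \<phi>)"

definition smooth_transition :: "nat \<Rightarrow> 'a chart \<Rightarrow> 'a chart \<Rightarrow> bool" where
  "smooth_transition n = (\<lambda>(U, \<phi>) (V, \<psi>).
     \<forall>j<n. smooth_on n (\<phi> ` (U \<inter> V)) (\<lambda>x. \<psi> (inv_into U \<phi> x) j))"

definition maximal_atlas :: "'a topology \<Rightarrow> nat \<Rightarrow> 'a chart set \<Rightarrow> 'a chart set" where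
  "maximal_atlas T n \<A> =
     {c. chart_on T n c \<and> (\<forall>d\<in>\<A>. smooth_transition n c d \<and> smooth_transition n d c)}"

record 'a manifold =
  mtop :: "'a topology"
  mdim :: nat
  matlas :: "'a chart set"

abbreviation points :: "('a, 'm) manifold_scheme \<Rightarrow> 'a set" where
  "points M \<equiv> topspace (mtop M)"

text \<open>The two inclusions say that \<open>matlas M\<close> consists of compatible charts and that it is maximal. The
  dimension is constant on \<open>M\<close>; the empty manifold may carry any dimension.\<close>

definition smooth_manifold :: "('a, 'm) manifold_scheme \<Rightarrow> bool" where
  "smooth_manifold M \<longleftrightarrow>
     Hausdorff_space (mtop M) \<and> second_countable (mtop M) \<and>
     (\<Union>(U, \<phi>)\<in>matlas M. U) = points M \<and>
     matlas M \<subseteq> maximal_atlas (mtop M) (mdim M) (matlas M) \<and>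
     maximal_atlas (mtop M) (mdim M) (matlas M) \<subseteq> matlas M"

definition prod_chart :: "nat \<Rightarrow> 'a chart \<Rightarrow> 'b chart \<Rightarrow> ('a \<times> 'b) chart" where
  "prod_chart m = (\<lambda>(U, \<phi>) (V, \<psi>).
     (U \<times> V, \<lambda>(x, y) i. if i < m then \<phi> x i else \<psi> y (i - m)))"

definition prod_manifold ::
    "('a, 'm) manifold_scheme \<Rightarrow> ('b, 'n) manifold_scheme \<Rightarrow> ('a \<times> 'b) manifold" where
  "prod_manifold M N =
     \<lparr> mtop = prod_topology (mtop M) (mtop N),
       mdim = mdim M + mdim N,
       matlas = maximal_atlas (prod_topology (mtop M) (mtop N)) (mdim M + mdim N)
                  {prod_chart (mdim M) c d | c d. c \<in> matlas M \<and> d \<in> matlas N} \<rparr>"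


section \<open>Tangent vectors and smooth maps\<close>

definition smooth_near :: "('a, 'm) manifold_scheme \<Rightarrow> 'a \<Rightarrow> ('a \<Rightarrow> real) \<Rightarrow> bool" where
  "smooth_near M p g \<longleftrightarrow>
     (\<exists>(U, \<phi>)\<in>matlas M. p \<in> U \<and> smooth_on (mdim M) (\<phi> ` U) (\<lambda>x. g (inv_into U \<phi> x)))"

text \<open>Tangent vectors at \<open>p\<close> are the operators \<open>\<Sum>i. v\<^sub>i \<partial>/\<partial>x\<^sub>i\<close> at \<open>p\<close> on functions smooth near \<open>p\<close>,
  for the coordinates \<open>x\<^sub>i\<close> of a chart at \<open>p\<close>. They are extended by \<open>0\<close> to all other functions, so
  that equal operators are equal as HOL functions.\<close>

type_synonym 'a tvec = "('a \<Rightarrow> real) \<Rightarrow> real"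

definition coord_vector ::
    "('a, 'm) manifold_scheme \<Rightarrow> 'a chart \<Rightarrow> 'a \<Rightarrow> (nat \<Rightarrow> real) \<Rightarrow> 'a tvec" where
  "coord_vector M = (\<lambda>(U, \<phi>) p v g.
     if smooth_near M p g
     then \<Sum>i<mdim M. v i * partial_deriv i (\<lambda>x. g (inv_into U \<phi> x)) (\<phi> p) else 0)"

definition tangent_space :: "('a, 'm) manifold_scheme \<Rightarrow> 'a \<Rightarrow> 'a tvec set" where
  "tangent_space M p = {coord_vector M c p v | c v. c \<in> matlas M \<and> p \<in> fst c}"

definition tangent_bundle :: "('a, 'm) manifold_scheme \<Rightarrow> ('a \<times> 'a tvec) set" where
  "tangent_bundle M = (SIGMA p:points M. tangent_space M p)"

text \<open>The differential at \<open>p\<close> of a map \<open>F\<close> with values in \<open>N\<close>.\<close>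

definition pushforward ::
    "('b, 'n) manifold_scheme \<Rightarrow> ('a \<Rightarrow> 'b) \<Rightarrow> 'a \<Rightarrow> 'a tvec \<Rightarrow> 'b tvec" where
  "pushforward N F p u = (\<lambda>g. if smooth_near N (F p) g then u (g \<circ> F) else 0)"

definition smooth_map ::
    "('a, 'm) manifold_scheme \<Rightarrow> ('b, 'n) manifold_scheme \<Rightarrow> ('a \<Rightarrow> 'b) \<Rightarrow> bool" where
  "smooth_map M N F \<longleftrightarrow>
     continuous_map (mtop M) (mtop N) F \<and>
     (\<forall>p\<in>points M. \<forall>(V, \<psi>)\<in>matlas N. F p \<in> V \<longrightarrow>
        (\<forall>j<mdim N. smooth_near M p (\<lambda>x. \<psi> (F x) j)))"

definition smooth_embedding ::
    "('a, 'm) manifold_scheme \<Rightarrow> ('b, 'n) manifold_scheme \<Rightarrow> ('a \<Rightarrow> 'b) \<Rightarrow> bool" where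
  "smooth_embedding M N F \<longleftrightarrow>
     smooth_map M N F \<and> embedding_map (mtop M) (mtop N) F \<and>
     (\<forall>p\<in>points M. inj_on (pushforward N F p) (tangent_space M p))"


section \<open>Submanifolds\<close>

definition slice_charts :: "nat \<Rightarrow> ('a, 'm) manifold_scheme \<Rightarrow> 'a set \<Rightarrow> 'a chart set" where
  "slice_charts k M S =
     {(U, \<phi>) \<in> matlas M. \<phi> ` (U \<inter> S) = \<phi> ` U \<inter> topspace (Euclidean_space k)}"

definition submanifold :: "nat \<Rightarrow> ('a, 'm) manifold_scheme \<Rightarrow> 'a set \<Rightarrow> bool" where
  "submanifold k M S \<longleftrightarrow>
     S \<subseteq> points M \<and> k \<le> mdim M \<and> (\<forall>p\<in>S. \<exists>(U, \<phi>)\<in>slice_charts k M S. p \<in> U)"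

definition closed_submanifold :: "('a, 'm) manifold_scheme \<Rightarrow> 'a set \<Rightarrow> bool" where
  "closed_submanifold M S \<longleftrightarrow> closedin (mtop M) S \<and> (\<exists>k. submanifold k M S)"

text \<open>The dimension is determined by \<open>S\<close> unless \<open>S\<close> is empty; the empty set is a submanifold of every
  dimension \<open>k \<le> mdim M\<close>.\<close>

definition submanifold_dim :: "('a, 'm) manifold_scheme \<Rightarrow> 'a set \<Rightarrow> nat" where
  "submanifold_dim M S = (LEAST k. submanifold k M S)"

text \<open>A submanifold as a manifold in its own right. As a slice chart maps \<open>S\<close> into the standard
  \<open>k\<close>-plane, its restriction to \<open>S\<close> is a chart without further projection.\<close>

definition induced_manifold :: "('a, 'm) manifold_scheme \<Rightarrow> 'a set \<Rightarrow> 'a manifold" where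
  "induced_manifold M S = (let k = submanifold_dim M S in
     \<lparr> mtop = subtopology (mtop M) S,
       mdim = k,
       matlas = maximal_atlas (subtopology (mtop M) S) k
                  {(U \<inter> S, \<phi>) | U \<phi>. (U, \<phi>) \<in> slice_charts k M S} \<rparr>)"

text \<open>The tangent space of \<open>S\<close> at \<open>p\<close>, as a subspace of that of \<open>M\<close>.\<close>

definition tangent_subspace :: "('a, 'm) manifold_scheme \<Rightarrow> 'a set \<Rightarrow> 'a \<Rightarrow> 'a tvec set" where
  "tangent_subspace M S p =
     pushforward M (\<lambda>x. x) p ` tangent_space (induced_manifold M S) p"

definition transversal_submanifolds :: "('a, 'm) manifold_scheme \<Rightarrow> 'a set \<Rightarrow> 'a set \<Rightarrow> bool" where
  "transversal_submanifolds M S S' \<longleftrightarrow>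
     (\<forall>p\<in>S \<inter> S'. \<forall>u\<in>tangent_space M p.
        \<exists>v\<in>tangent_subspace M S p. \<exists>w\<in>tangent_subspace M S' p. u = (\<lambda>g. v g + w g))"


section \<open>Smooth relations\<close>

text \<open>A relation to \<open>X\<close> from \<open>Y\<close> is a subset of \<open>X \<times> Y\<close>, target first; with this reading
  composition of relations is \<^const>\<open>relcomp\<close>, the identity \<^const>\<open>Id_on\<close> and the transpose
  \<^const>\<open>converse\<close>.\<close>

definition surjective_rel :: "'a set \<Rightarrow> ('a \<times> 'b) set \<Rightarrow> bool" where
  "surjective_rel A f \<longleftrightarrow> (\<forall>x\<in>A. \<exists>y. (x, y) \<in> f)"

definition coinjective_rel :: "('a \<times> 'b) set \<Rightarrow> bool" where
  "coinjective_rel f \<longleftrightarrow> (\<forall>y x x'. (x, y) \<in> f \<longrightarrow> (x', y) \<in> f \<longrightarrow> x = x')"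

definition smooth_relation ::
    "('a, 'm) manifold_scheme \<Rightarrow> ('b, 'n) manifold_scheme \<Rightarrow> ('a \<times> 'b) set \<Rightarrow> bool" where
  "smooth_relation X Y f \<longleftrightarrow> closed_submanifold (prod_manifold X Y) f"

text \<open>The tangent bundle of \<open>f\<close>, under the identification of \<open>T(X \<times> Y)\<close> with \<open>TX \<times> TY\<close> by the
  differentials of the two projections.\<close>

definition tangent_relation ::
    "('a, 'm) manifold_scheme \<Rightarrow> ('b, 'n) manifold_scheme \<Rightarrow> ('a \<times> 'b) set
      \<Rightarrow> (('a \<times> 'a tvec) \<times> ('b \<times> 'b tvec)) set" where
  "tangent_relation X Y f =
     {((x, pushforward X fst (x, y) w), (y, pushforward Y snd (x, y) w)) | x y w.
        (x, y) \<in> f \<and> w \<in> tangent_subspace (prod_manifold X Y) f (x, y)}"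

definition reduction ::
    "('a, 'm) manifold_scheme \<Rightarrow> ('b, 'n) manifold_scheme \<Rightarrow> ('a \<times> 'b) set \<Rightarrow> bool" where
  "reduction X Y f \<longleftrightarrow>
     smooth_relation X Y f \<and>
     surjective_rel (points X) f \<and> coinjective_rel f \<and>
     surjective_rel (tangent_bundle X) (tangent_relation X Y f) \<and>
     coinjective_rel (tangent_relation X Y f) \<and>
     proper_map (subtopology (prod_topology (mtop X) (mtop Y)) f) (mtop Y) snd"

definition coreduction ::
    "('a, 'm) manifold_scheme \<Rightarrow> ('b, 'n) manifold_scheme \<Rightarrow> ('a \<times> 'b) set \<Rightarrow> bool" where
  "coreduction X Y f \<longleftrightarrow> smooth_relation X Y f \<and> reduction Y X (f\<inverse>)"

definition middle_diagonal ::
    "('a, 'l) manifold_scheme \<Rightarrow> ('b, 'm) manifold_scheme \<Rightarrow> ('c, 'n) manifold_scheme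
      \<Rightarrow> (('a \<times> 'b) \<times> ('b \<times> 'c)) set" where
  "middle_diagonal X Y Z =
     {((x, y), (y, z)) | x y z. x \<in> points X \<and> y \<in> points Y \<and> z \<in> points Z}"

definition transversal_pair ::
    "('a, 'l) manifold_scheme \<Rightarrow> ('b, 'm) manifold_scheme \<Rightarrow> ('c, 'n) manifold_scheme
      \<Rightarrow> ('a \<times> 'b) set \<Rightarrow> ('b \<times> 'c) set \<Rightarrow> bool" where
  "transversal_pair X Y Z f g \<longleftrightarrow>
     smooth_relation X Y f \<and> smooth_relation Y Z g \<and>
     transversal_submanifolds (prod_manifold (prod_manifold X Y) (prod_manifold Y Z))
       (f \<times> g) (middle_diagonal X Y Z)"

text \<open>The image of the fibre product under the projection is \<open>f O g\<close>.\<close>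

definition strongly_transversal ::
    "('a, 'l) manifold_scheme \<Rightarrow> ('b, 'm) manifold_scheme \<Rightarrow> ('c, 'n) manifold_scheme
      \<Rightarrow> ('a \<times> 'b) set \<Rightarrow> ('b \<times> 'c) set \<Rightarrow> bool" where
  "strongly_transversal X Y Z f g \<longleftrightarrow>
     transversal_pair X Y Z f g \<and>
     smooth_embedding
       (induced_manifold (prod_manifold (prod_manifold X Y) (prod_manifold Y Z))
         ((f \<times> g) \<inter> middle_diagonal X Y Z))
       (prod_manifold X Z)
       (\<lambda>((x, y), (y', z)). (x, z)) \<and>
     closed_submanifold (prod_manifold X Z) (f O g)"


section \<open>Symplectic manifolds and canonical relations\<close>

record 'a symplectic = "'a manifold" +
  form :: "'a \<Rightarrow> 'a tvec \<Rightarrow> 'a tvec \<Rightarrow> real"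

definition form_coeff ::
    "('a, 'm) symplectic_scheme \<Rightarrow> 'a chart \<Rightarrow> nat \<Rightarrow> nat \<Rightarrow> (nat \<Rightarrow> real) \<Rightarrow> real" where
  "form_coeff M c i j x =
     (let p = inv_into (fst c) (snd c) x; e = (\<lambda>i. coord_vector M c p (\<lambda>l. if l = i then 1 else 0))
      in form M p (e i) (e j))"

text \<open>The form is smooth and closed if its coefficients \<open>\<omega>\<^sub>i\<^sub>j\<close> in every chart are smooth and the
  coefficients \<open>\<partial>\<^sub>i \<omega>\<^sub>j\<^sub>k + \<partial>\<^sub>j \<omega>\<^sub>k\<^sub>i + \<partial>\<^sub>k \<omega>\<^sub>i\<^sub>j\<close> of its exterior derivative vanish. It is
  \<open>0\<close> off the tangent spaces, so that equality of records is equality of symplectic manifolds. Evenness of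
  the dimension is a condition only on the empty manifold.\<close>

definition symplectic_manifold :: "('a, 'm) symplectic_scheme \<Rightarrow> bool" where
  "symplectic_manifold M \<longleftrightarrow>
     smooth_manifold M \<and> even (mdim M) \<and>
     (\<forall>p u v. \<not> (p \<in> points M \<and> u \<in> tangent_space M p \<and> v \<in> tangent_space M p) \<longrightarrow> form M p u v = 0) \<and>
     (\<forall>p\<in>points M. \<forall>u\<in>tangent_space M p. \<forall>v\<in>tangent_space M p.
        form M p u u = 0 \<and> form M p v u = - form M p u v \<and>
        (\<forall>w\<in>tangent_space M p. \<forall>a b.
           form M p (\<lambda>g. a * u g + b * v g) w = a * form M p u w + b * form M p v w)) \<and>
     (\<forall>p\<in>points M. \<forall>u\<in>tangent_space M p.
        (\<forall>v\<in>tangent_space M p. form M p u v = 0) \<longrightarrow> u = (\<lambda>g. 0)) \<and>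
     (\<forall>(U, \<phi>)\<in>matlas M. \<forall>i<mdim M. \<forall>j<mdim M.
        smooth_on (mdim M) (\<phi> ` U) (form_coeff M (U, \<phi>) i j)) \<and>
     (\<forall>(U, \<phi>)\<in>matlas M. \<forall>x\<in>\<phi> ` U. \<forall>i<mdim M. \<forall>j<mdim M. \<forall>k<mdim M.
        partial_deriv i (form_coeff M (U, \<phi>) j k) x +
        partial_deriv j (form_coeff M (U, \<phi>) k i) x +
        partial_deriv k (form_coeff M (U, \<phi>) i j) x = 0)"

definition opposite :: "'a symplectic \<Rightarrow> 'a symplectic" where
  "opposite M = M\<lparr>form := \<lambda>p u v. - form M p u v\<rparr>"

definition prod_symplectic :: "'a symplectic \<Rightarrow> 'b symplectic \<Rightarrow> ('a \<times> 'b) symplectic" where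
  "prod_symplectic M N = manifold.extend (prod_manifold M N)
     \<lparr> form = \<lambda>p u v.
         if p \<in> points (prod_manifold M N) \<and>
            u \<in> tangent_space (prod_manifold M N) p \<and> v \<in> tangent_space (prod_manifold M N) p
         then form M (fst p) (pushforward M fst p u) (pushforward M fst p v) +
              form N (snd p) (pushforward N snd p u) (pushforward N snd p v)
         else 0 \<rparr>"

definition lagrangian :: "'a symplectic \<Rightarrow> 'a set \<Rightarrow> bool" where
  "lagrangian M L \<longleftrightarrow>
     (\<exists>k. submanifold k M L \<and> 2 * k = mdim M) \<and>
     (\<forall>p\<in>L. \<forall>u\<in>tangent_subspace M L p. \<forall>v\<in>tangent_subspace M L p. form M p u v = 0)"

definition canonical_relation :: "'a symplectic \<Rightarrow> 'b symplectic \<Rightarrow> ('a \<times> 'b) set \<Rightarrow> bool" where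
  "canonical_relation X Y f \<longleftrightarrow>
     symplectic_manifold X \<and> symplectic_manifold Y \<and>
     smooth_relation X Y f \<and> lagrangian (prod_symplectic X (opposite Y)) f"


section \<open>The path category\<close>

text \<open>All objects have their points in one type \<open>'a\<close>, which plays the role of the universe. If \<open>'a\<close>
  has at least the cardinality of the continuum, every symplectic manifold is isomorphic to one with
  points in \<open>'a\<close>. A morphism of \<open>SREL\<close> is a relation together with its target and source.\<close>

record 'a srel =
  tgt :: "'a symplectic"
  rel :: "('a \<times> 'a) set"
  src :: "'a symplectic"

definition srel_id :: "'a symplectic \<Rightarrow> 'a srel" where
  "srel_id X = \<lparr> tgt = X, rel = Id_on (points X), src = X \<rparr>"

definition srel_comp :: "'a srel \<Rightarrow> 'a srel \<Rightarrow> 'a srel" where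
  "srel_comp p q = \<lparr> tgt = tgt p, rel = rel p O rel q, src = src q \<rparr>"

definition canonical_path :: "(int \<Rightarrow> 'a srel) \<Rightarrow> bool" where
  "canonical_path c \<longleftrightarrow>
     (\<forall>j. canonical_relation (tgt (c j)) (src (c j)) (rel (c j)) \<and> src (c j) = tgt (c (j + 1))) \<and>
     finite {j. c j \<noteq> srel_id (tgt (c j))}"

definition insert_identity :: "int \<Rightarrow> (int \<Rightarrow> 'a srel) \<Rightarrow> int \<Rightarrow> 'a srel" where
  "insert_identity j c = (\<lambda>i. if i < j then c i else if i = j then srel_id (tgt (c j)) else c (i - 1))"

text \<open>A shift of a path arises by inserting an identity far out at the negative end.\<close>

definition identity_inserted :: "(int \<Rightarrow> 'a srel) \<Rightarrow> (int \<Rightarrow> 'a srel) \<Rightarrow> bool" where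
  "identity_inserted c c' \<longleftrightarrow>
     canonical_path c \<and> canonical_path c' \<and> (\<exists>j. c' = insert_identity j c)"

definition path_class :: "(int \<Rightarrow> 'a srel) \<Rightarrow> (int \<Rightarrow> 'a srel) set" where
  "path_class c = {c'. equivclp identity_inserted c c'}"

definition path_of_list :: "'a srel list \<Rightarrow> int \<Rightarrow> 'a srel" where
  "path_of_list fs = (\<lambda>j. if j < 0 then srel_id (tgt (hd fs))
                          else if j < int (length fs) then fs ! nat j
                          else srel_id (src (last fs)))"


section \<open>The Wehrheim-Woodward category\<close>

definition compose_at :: "int \<Rightarrow> (int \<Rightarrow> 'a srel) \<Rightarrow> int \<Rightarrow> 'a srel" where
  "compose_at j c =
     (\<lambda>i. if i < j then c i else if i = j then srel_comp (c j) (c (j + 1)) else c (i + 1))"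

text \<open>The generating relation, on morphisms of the path category.\<close>

definition WW_step :: "(int \<Rightarrow> 'a srel) set \<Rightarrow> (int \<Rightarrow> 'a srel) set \<Rightarrow> bool" where
  "WW_step P P' \<longleftrightarrow>
     (\<exists>c c' j. canonical_path c \<and> canonical_path c' \<and> P = path_class c \<and> P' = path_class c' \<and>
        strongly_transversal (tgt (c j)) (src (c j)) (src (c (j + 1))) (rel (c j)) (rel (c (j + 1))) \<and>
        c' = compose_at j c)"

definition WW_class :: "'a srel list \<Rightarrow> (int \<Rightarrow> 'a srel) set set" where
  "WW_class fs = {P. equivclp WW_step (path_class (path_of_list fs)) P}"

end

theory Submission
  imports Defs
begin

text \<open>A canonical relation \<open>c\<close> to \<open>Q\<close> from \<open>Y\<close> is bent: in \<open>Q \<times> Y\<^sup>- \<times> Y\<close> the set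
  \<open>{(q, y, y)}\<close> reduces onto \<open>Q\<close> and the cylinder \<open>{(q, y, y'). (q, y) \<in> c}\<close> onto \<open>Y\<close>, and the resulting
  reduction and coreduction form a strongly transversal pair with composite \<open>c\<close>. A coreduction followed by any canonical
  relation, and any canonical relation followed by a reduction, is strongly transversal as soon as the composite is
  canonical. So a reduction, a coreduction and one more relation of the path are rewritten by composing the last two,
  bending the composite and composing the first two; induction along the path shortens it to two entries.

  Bending yields no surjective reduction if \<open>c\<close> is empty. But a path with an empty entry collapses to the empty relation,
  and this is the composite of a reduction and a coreduction through the disjoint union of \<open>X \<times> V\<close> and \<open>U \<times> Y\<close>, for
  coordinate domains \<open>U \<subseteq> X\<close> and \<open>V \<subseteq> Y\<close>, each supported on one of the two components.\<close>

text \<open>Two entries of a path may be composed only where the pair is strongly transversal, and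
  nothing of the kind is known of consecutive entries. A coreduction whose coisotropic part is a
  cylinder over \<open>c\<close> avoids the difficulty: its composite with a canonical
  \<open>f\<close> is, after reordering factors, the product \<open>c \<times> f\<close>, hence
  lagrangian and closed whatever the relative position of \<open>c\<close> and \<open>f\<close>.
  Absorbing a bent diagonal into a reduction merely replaces its coisotropic part \<open>K\<close>
  by a bent version of \<open>K\<close>. Strong transversality of nonempty composites comes from one
  criterion, \<open>strongly_transversalI\<close>: the intermediate point is a smooth function of
  the outer pair, so the fibre product is a graph over the composite. Reductions are therefore kept
  as pairs \<open>(K, r)\<close> with \<open>r\<close> smooth on all of \<open>Q\<close>, which
  makes the relations graphs over \<open>K\<close>. All objects share the point type
  \<open>'a\<close>; as \<open>'a\<close> is infinite, bijections carry pairs and triples of points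
  back into it, and every new space is a copy under such a bijection.\<close>

abbreviation (input) eucl :: "nat \<Rightarrow> (nat \<Rightarrow> real) set" where "eucl n \<equiv> topspace (Euclidean_space n)"
abbreviation (input) "open_eucl n \<equiv> openin (Euclidean_space n)"
abbreviation (input) "near_eucl n \<equiv> nhdsin (Euclidean_space n)"

section \<open>Topology of the Euclidean spaces of sequences\<close>

text \<open>The class topology on \<open>nat \<Rightarrow> real\<close> is the product topology, so
  \<open>open\<close>, \<open>continuous_on\<close> and the facts about them become
  available.\<close>

lemma Euclidean_space_top_of_set: "Euclidean_space n = top_of_set (eucl n)"
  by (simp add: Euclidean_space_def euclidean_product_topology)

lemma in_Euclidean_space: "x \<in> eucl n \<longleftrightarrow> (\<forall>i\<ge>n. x i = 0)"
  by (simp add: topspace_Euclidean_space)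

lemma continuous_map_Euclidean_iff:
  fixes g :: "(nat \<Rightarrow> real) \<Rightarrow> 'b::topological_space"
  assumes "V \<subseteq> eucl n"
  shows "continuous_map (subtopology (Euclidean_space n) V) euclidean g \<longleftrightarrow> continuous_on V g"
  by (metis Euclidean_space_top_of_set assms continuous_map_iff_continuous inf.absorb_iff2 subtopology_subtopology)

lemma continuous_on_fun_upd: "continuous_on A (\<lambda>t. (x::nat \<Rightarrow> real)(i := t))"
proof (rule continuous_on_coordinatewise_then_product)
  show "continuous_on A (\<lambda>t. (x(i := t)) j)" for j by (cases "j = i") (auto intro!: continuous_intros)
qed

text \<open>Varying one coordinate below \<open>n\<close> stays in an open set for a while. This
  makes partial derivatives local, although \<open>partial_deriv\<close> looks at \<open>g\<close>
  along a whole line.\<close>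

lemma eventually_fun_upd:
  assumes "open_eucl n V" "x \<in> V" "i < n"
  shows "\<forall>\<^sub>F t in nhds (x i). x(i := t) \<in> V"
proof -
  obtain O' where O': "open O'" "V = O' \<inter> eucl n"
    using assms(1) by (metis Euclidean_space_top_of_set inf_commute openin_open)
  have "open ((\<lambda>t. x(i := t)) -` O')"
    using continuous_on_fun_upd[of UNIV x i] O'(1) continuous_on_open_vimage[OF open_UNIV] by fastforce
  moreover have "x i \<in> (\<lambda>t. x(i := t)) -` O'" using assms O' by auto
  ultimately have "\<forall>\<^sub>F t in nhds (x i). t \<in> (\<lambda>t. x(i := t)) -` O'"
    using eventually_nhds by blast
  then show ?thesis
    by (rule eventually_mono) (use assms O' in \<open>auto simp: in_Euclidean_space\<close>)
qed

text \<open>A basic open set of the product restricts each coordinate separately. Coordinates from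
  \<open>n\<close> on are constantly 0, which leaves finitely many intervals and hence a common
  radius.\<close>

lemma Euclidean_box:
  assumes "open_eucl n V" "x \<in> V"
  obtains e where "e > 0" "\<And>y. y \<in> eucl n \<Longrightarrow> (\<And>i. i < n \<Longrightarrow> \<bar>y i - x i\<bar> < e) \<Longrightarrow> y \<in> V"
proof -
  obtain O' where O': "open O'" "V = O' \<inter> eucl n"
    using assms(1) by (metis Euclidean_space_top_of_set inf_commute openin_open)
  then obtain B where B: "x \<in> Pi\<^sub>E UNIV B" "\<And>i. open (B i)" "Pi\<^sub>E UNIV B \<subseteq> O'"
    using product_topology_open_contains_basis[of "\<lambda>_. euclideanreal" UNIV O' x] assms
    by (auto simp: euclidean_product_topology)
  have "\<exists>e>0. \<forall>t. \<bar>t - x i\<bar> < e \<longrightarrow> t \<in> B i" for i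
  proof -
    have "x i \<in> B i" using B(1) by auto
    then obtain e where "e > 0" "ball (x i) e \<subseteq> B i" using B(2) openE by blast
    then show ?thesis by (intro exI[of _ e]) (auto simp: ball_def dist_real_def abs_minus_commute subset_iff)
  qed
  then obtain e where e: "\<And>i. e i > 0" "\<And>i t. \<bar>t - x i\<bar> < e i \<Longrightarrow> t \<in> B i" by metis
  \<comment> \<open>The 1 keeps the minimum defined for \<open>n = 0\<close>.\<close>
  define d where "d = Min (insert 1 (e ` {..<n}))"
  have d: "d > 0" "\<And>i. i < n \<Longrightarrow> d \<le> e i" using e(1) by (auto simp: d_def Min_gr_iff)
  show thesis
  proof (rule that[OF d(1)])
    fix y assume y: "y \<in> eucl n" "\<And>i. i < n \<Longrightarrow> \<bar>y i - x i\<bar> < d"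
    have "y i \<in> B i" for i
    proof (cases "i < n")
      case True then show ?thesis using e(2) d(2) y(2) by (meson less_le_trans)
    next
      case False
      then have "y i = x i" using y(1) assms by (auto simp: O' in_Euclidean_space)
      then show ?thesis using B(1) by auto
    qed
    then show "y \<in> V" using B(3) y(1) O'(2) by auto
  qed
qed

section \<open>Finitely often differentiable functions\<close>

lemma Ck_on_continuous: "Ck_on n k V g \<Longrightarrow> V \<subseteq> eucl n \<Longrightarrow> continuous_on V g"
  by (cases k) (simp_all add: continuous_map_Euclidean_iff)

lemma Ck_on_Suc_imp: "Ck_on n (Suc k) V g \<Longrightarrow> Ck_on n k V g"
proof (induction k arbitrary: g)
  case (Suc k)
  then show ?case unfolding Ck_on.simps(2)[of n "Suc k"] Ck_on.simps(2)[of n k] by blast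
qed auto

lemma Ck_on_mono: "Ck_on n k V g \<Longrightarrow> l \<le> k \<Longrightarrow> Ck_on n l V g"
  by (induction k) (auto simp: le_Suc_eq simp del: Ck_on.simps dest: Ck_on_Suc_imp)

lemma Ck_on_subset: "Ck_on n k V g \<Longrightarrow> W \<subseteq> V \<Longrightarrow> Ck_on n k W g"
proof (induction k arbitrary: g)
  case 0 then show ?case by (auto intro: continuous_map_from_subtopology_mono)
next
  case (Suc k) then show ?case by (auto intro: continuous_map_from_subtopology_mono)
qed

lemma partial_deriv_cong:
  assumes "open_eucl n V" "x \<in> V" "i < n" "\<And>y. y \<in> V \<Longrightarrow> g y = h y"
  shows "partial_deriv i g x = partial_deriv i h x"
  unfolding partial_deriv_def
  by (rule deriv_cong_ev) (auto intro: eventually_mono[OF eventually_fun_upd[OF assms(1-3)]] assms(4))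

lemma differentiable_fun_upd_cong:
  assumes "open_eucl n V" "x \<in> V" "i < n" "\<And>y. y \<in> V \<Longrightarrow> g y = h y"
    "(\<lambda>t. g (x(i := t))) differentiable (at (x i))"
  shows "(\<lambda>t. (h (x(i := t)) :: real)) differentiable (at (x i))"
proof -
  obtain D where D: "((\<lambda>t. g (x(i := t))) has_real_derivative D) (at (x i))"
    using assms(5) real_differentiable_def by blast
  have "\<forall>\<^sub>F t in nhds (x i). g (x(i := t)) = h (x(i := t))"
    using eventually_mono[OF eventually_fun_upd[OF assms(1-3)]] assms(4) by simp
  then have "((\<lambda>t. h (x(i := t))) has_real_derivative D) (at (x i))"
    using DERIV_cong_ev[OF refl _ refl] D by fast
  then show ?thesis using real_differentiable_def by blast
qed

text \<open>On an open \<open>V\<close> equality of the functions passes to their partial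
  derivatives, which drives the induction.\<close>

lemma Ck_on_cong:
  assumes "open_eucl n V" "\<And>y. y \<in> V \<Longrightarrow> g y = h y"
  shows "Ck_on n k V g \<Longrightarrow> Ck_on n k V h"
  using assms(2)
proof (induction k arbitrary: g h)
  case 0
  have "continuous_on V g \<longleftrightarrow> continuous_on V h" using 0 by (intro continuous_on_cong) auto
  then show ?case using 0 openin_subset[OF assms(1)] by (simp add: continuous_map_Euclidean_iff)
next
  case (Suc k)
  have c: "continuous_on V g \<longleftrightarrow> continuous_on V h" using Suc by (intro continuous_on_cong) auto
  have "Ck_on n k V (partial_deriv i h)" if "i < n" for i
  proof (rule Suc.IH)
    show "Ck_on n k V (partial_deriv i g)" using Suc.prems(1) that by simp
  qed (rule partial_deriv_cong[OF assms(1) _ that Suc.prems(2)])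
  moreover have "(\<lambda>t. h (x(i := t))) differentiable (at (x i))" if "i < n" "x \<in> V" for i x
    by (rule differentiable_fun_upd_cong[OF assms(1) that(2,1) Suc.prems(2)])
      (use Suc.prems(1) that Ck_on.simps(2) in blast)+
  ultimately show ?case using Suc.prems(1) openin_subset[OF assms(1)] c by (simp add: continuous_map_Euclidean_iff)
qed

lemma continuous_on_openin_UN:
  assumes "open_eucl n V" "\<And>x. x \<in> V \<Longrightarrow> \<exists>W. open_eucl n W \<and> x \<in> W \<and> continuous_on W g"
  shows "continuous_on V (g::_ \<Rightarrow> real)"
proof -
  have "continuous (at x within V) g" if x: "x \<in> V" for x
  proof -
    obtain W where W: "open_eucl n W" "x \<in> W" "continuous_on W g" using assms(2) x by blast
    obtain A B where "open A" "open B" "V = A \<inter> eucl n" "W = B \<inter> eucl n"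
      using assms(1) W(1) by (metis Euclidean_space_top_of_set inf_commute openin_open)
    then have "at x within V = at x within W"
      using x W(2) by (intro at_within_nhd[of x "A \<inter> B"]) auto
    then show ?thesis using W by (simp add: continuous_on_eq_continuous_within)
  qed
  then show ?thesis by (simp add: continuous_on_eq_continuous_within)
qed

section \<open>Mean value theorem and chain rule\<close>

text \<open>The endpoints come in either order and may coincide, so increments of unknown sign can
  be inserted without case distinctions.\<close>

lemma mvt_segment:
  fixes f :: "real \<Rightarrow> real"
  assumes "\<And>s. min a b \<le> s \<Longrightarrow> s \<le> max a b \<Longrightarrow> (f has_real_derivative f' s) (at s)"
  obtains s where "min a b \<le> s" "s \<le> max a b" "f b - f a = f' s * (b - a)"
proof -
  consider "a < b" | "b < a" | "a = b" by linarith
  then show thesis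
  proof cases
    case 1
    then obtain z where "z > a" "z < b" "f b - f a = (b - a) * f' z"
      using MVT2[of a b f f'] assms by auto
    then show thesis using that[of z] by simp
  next
    case 2
    then obtain z where "z > b" "z < a" "f a - f b = (a - b) * f' z"
      using MVT2[of b a f f'] assms by auto
    then show thesis using that[of z] by (simp add: algebra_simps)
  next
    case 3 then show thesis using that[of a] by simp
  qed
qed

text \<open>Stated at \<open>x(i := s)\<close> rather than at \<open>x\<close>, the form in which
  the mean value theorem along a coordinate line meets it.\<close>

lemma has_derivative_fun_upd:
  assumes "Ck_on n (Suc 0) V g" "x(i := s) \<in> V" "i < n"
  shows "((\<lambda>t. g (x(i := t))) has_real_derivative partial_deriv i g (x(i := s))) (at s)"
proof -
  have "(\<lambda>t. g ((x(i := s))(i := t))) differentiable (at ((x(i := s)) i))"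
    using assms Ck_on.simps(2) by blast
  then show ?thesis
    by (simp add: partial_deriv_def real_differentiable_def DERIV_deriv_iff_real_differentiable)
qed

text \<open>The coordinates are moved from \<open>a\<close> to \<open>c t\<close> one after the
  other: \<open>p k t\<close> has the first \<open>k\<close> of them moved. A single move is handled
  by the mean value theorem, and continuity of the partial derivative at \<open>a\<close> controls
  the intermediate point.\<close>

lemma chain_rule:
  fixes c :: "real \<Rightarrow> nat \<Rightarrow> real"
  assumes W: "open_eucl m W" and G: "Ck_on m (Suc 0) W G" and c0: "c t0 \<in> W"
    and dc: "\<And>j. j < m \<Longrightarrow> ((\<lambda>t. c t j) has_real_derivative c' j) (at t0)"
    and cm: "\<And>t j. j \<ge> m \<Longrightarrow> c t j = 0"
  shows "((\<lambda>t. G (c t)) has_real_derivative (\<Sum>j<m. partial_deriv j G (c t0) * c' j)) (at t0)"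
proof -
  define a where "a = c t0"
  define p where "p k t = (\<lambda>j. if j < k then c t j else a j)" for k t
  have pm: "p m = c" using cm by (auto simp: p_def a_def fun_eq_iff not_less)
  have p0: "p 0 t = a" for t by (simp add: p_def)
  have pSuc: "p (Suc k) t = (p k t)(k := c t k)" for k t by (auto simp: p_def fun_eq_iff less_Suc_eq)
  have pE: "p k t \<in> eucl m" if "k \<le> m" for k t
    using that cm by (auto simp: p_def in_Euclidean_space a_def)
  have "((\<lambda>t. G (p k t)) has_real_derivative (\<Sum>j<k. partial_deriv j G a * c' j)) (at t0)" if "k \<le> m" for k
    using that
  proof (induction k)
    case 0 then show ?case by (simp add: p0)
  next
    case (Suc k)
    then have k: "k < m" by simp
    define D where "D t = G (p (Suc k) t) - G (p k t)" for t
    \<comment> \<open>The value at a vanishing increment makes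
      \<open>D t = q t * (c t k - a k)\<close> hold without exception and is the limit
      itself.\<close>
    define q where "q t = (if c t k = a k then partial_deriv k G a else D t / (c t k - a k))" for t
    have D: "D t = q t * (c t k - a k)" for t
      
    proof (cases "c t k = a k")
      case True
      then have "(p k t)(k := c t k) = p k t" by (intro fun_upd_idem) (simp add: p_def)
      then show ?thesis using True by (simp add: D_def pSuc)
    qed (simp add: q_def)
    have "(q \<longlongrightarrow> partial_deriv k G a) (at t0)"
    proof (rule tendstoI)
      fix e :: real assume e: "e > 0"
      have "Ck_on m 0 W (partial_deriv k G)" using G k by auto
      then have "continuous_on W (partial_deriv k G)"
        using Ck_on_continuous openin_subset[OF W] by blast
      then have "openin (top_of_set W) (W \<inter> partial_deriv k G -` ball (partial_deriv k G a) e)"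
        using continuous_openin_preimage_gen by blast
      then have "open_eucl m (W \<inter> partial_deriv k G -` ball (partial_deriv k G a) e)"
        by (metis Euclidean_space_top_of_set W openin_trans)
      from Euclidean_box[OF this, of a] obtain d where d: "d > 0"
        "\<And>y. y \<in> eucl m \<Longrightarrow> (\<And>i. i < m \<Longrightarrow> \<bar>y i - a i\<bar> < d) \<Longrightarrow>
            y \<in> W \<inter> partial_deriv k G -` ball (partial_deriv k G a) e"
        using c0 e a_def by auto
      have "\<forall>\<^sub>F t in at t0. \<bar>c t j - a j\<bar> < d" if "j < m" for j
      proof -
        have "((\<lambda>t. c t j) \<longlongrightarrow> a j) (at t0)"
          using DERIV_isCont[OF dc[OF that]] by (simp add: isCont_def a_def)
        from tendstoD[OF this d(1)] show ?thesis by (simp add: dist_real_def)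
      qed
      then have "\<forall>\<^sub>F t in at t0. \<forall>j\<in>{..<m}. \<bar>c t j - a j\<bar> < d" by (intro eventually_ball_finite) auto
      then show "\<forall>\<^sub>F t in at t0. dist (q t) (partial_deriv k G a) < e"
      proof (rule eventually_mono)
        fix t assume t: "\<forall>j\<in>{..<m}. \<bar>c t j - a j\<bar> < d"
        \<comment> \<open>A point between \<open>a k\<close> and \<open>c t k\<close> is no farther
          from \<open>a k\<close> than \<open>c t k\<close> is, so it stays in the box on which the
          partial derivative varies by less than \<open>e\<close>.\<close>
        have box: "(p k t)(k := s) \<in> W \<and> \<bar>partial_deriv k G ((p k t)(k := s)) - partial_deriv k G a\<bar> < e"
          if "min (a k) (c t k) \<le> s" "s \<le> max (a k) (c t k)" for s
        proof -
          have "(p k t)(k := s) \<in> W \<inter> partial_deriv k G -` ball (partial_deriv k G a) e"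
          proof (rule d(2))
            show "(p k t)(k := s) \<in> eucl m"
              using pE[of k t] k by (auto simp: in_Euclidean_space)
            fix i assume i: "i < m"
            have "\<bar>s - a k\<bar> \<le> \<bar>c t k - a k\<bar>" using that by linarith
            moreover have "\<bar>c t k - a k\<bar> < d" using t k by blast
            ultimately have "\<bar>s - a k\<bar> < d" by linarith
            then show "\<bar>((p k t)(k := s)) i - a i\<bar> < d" using t i d(1) by (auto simp: p_def)
          qed
          then show ?thesis by (simp add: dist_real_def abs_minus_commute)
        qed
        have der: "((\<lambda>s. G ((p k t)(k := s))) has_real_derivative partial_deriv k G ((p k t)(k := s))) (at s)"
          if "min (a k) (c t k) \<le> s" "s \<le> max (a k) (c t k)" for s
          using has_derivative_fun_upd[OF G _ k] box that by blast
        obtain s where s: "min (a k) (c t k) \<le> s" "s \<le> max (a k) (c t k)"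
          "G ((p k t)(k := c t k)) - G ((p k t)(k := a k)) = partial_deriv k G ((p k t)(k := s)) * (c t k - a k)"
          using mvt_segment[of "a k" "c t k" "\<lambda>s. G ((p k t)(k := s))", OF der] by metis
        have "(p k t)(k := a k) = p k t" by (auto simp: p_def)
        then have "D t = partial_deriv k G ((p k t)(k := s)) * (c t k - a k)"
          using s(3) by (simp add: D_def pSuc)
        then have "q t = partial_deriv k G a \<or> q t = partial_deriv k G ((p k t)(k := s))"
          by (auto simp: q_def)
        then show "dist (q t) (partial_deriv k G a) < e" using box[OF s(1,2)] e by (auto simp: dist_real_def)
      qed
    qed
    moreover have "((\<lambda>t. (c t k - c t0 k) / (t - t0)) \<longlongrightarrow> c' k) (at t0)"
      using dc[OF k] by (simp add: has_field_derivative_iff)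
    ultimately have "((\<lambda>t. q t * ((c t k - a k) / (t - t0))) \<longlongrightarrow> partial_deriv k G a * c' k) (at t0)"
      unfolding a_def by (rule tendsto_mult)
    moreover have D0: "D t0 = 0" by (simp add: D a_def)
    have "(D t - D t0) / (t - t0) = q t * ((c t k - a k) / (t - t0))" for t
      unfolding D0 by (simp add: D)
    ultimately have "(D has_real_derivative partial_deriv k G a * c' k) (at t0)"
      by (simp only: has_field_derivative_iff)
    with Suc.IH k have "((\<lambda>t. G (p k t) + D t) has_real_derivative
        (\<Sum>j<k. partial_deriv j G a * c' j) + partial_deriv k G a * c' k) (at t0)"
      by (intro DERIV_add) auto
    then show ?case by (simp add: D_def)
  qed
  from this[of m] show ?thesis by (simp add: pm a_def)
qed

lemma Ck_on_const [simp]: "Ck_on n k V (\<lambda>x. c)"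
proof (induction k arbitrary: c)
  case (Suc k)
  have "partial_deriv i (\<lambda>x. c) = (\<lambda>x. 0)" for i by (simp add: partial_deriv_def fun_eq_iff)
  then show ?case using Suc by simp
qed simp

lemma partial_deriv_coord: "partial_deriv i (\<lambda>x. x j) = (\<lambda>x. if i = j then 1 else 0)"
  by (auto simp: partial_deriv_def fun_eq_iff)

lemma Ck_on_coord: "V \<subseteq> eucl n \<Longrightarrow> Ck_on n k V (\<lambda>x. x j)"
proof (cases k)
  assume V: "V \<subseteq> eucl n"
  have c: "continuous_map (subtopology (Euclidean_space n) V) euclideanreal (\<lambda>x. x j)"
    unfolding continuous_map_Euclidean_iff[OF V]
    by (rule continuous_on_product_then_coordinatewise[OF continuous_on_id])
  case 0 with c show ?thesis by simp
next
  assume V: "V \<subseteq> eucl n"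
  have c: "continuous_map (subtopology (Euclidean_space n) V) euclideanreal (\<lambda>x. x j)"
    unfolding continuous_map_Euclidean_iff[OF V]
    by (rule continuous_on_product_then_coordinatewise[OF continuous_on_id])
  case (Suc l)
  have "(\<lambda>t. (x(i := t)) j) differentiable at (x i)" for x :: "nat \<Rightarrow> real" and i
    by (cases "i = j") auto
  then show ?thesis unfolding Suc Ck_on.simps(2) partial_deriv_coord using c by auto
qed

lemma partial_derivI:
  "((\<lambda>t. g (x(i := t))) has_real_derivative d) (at (x i)) \<Longrightarrow> partial_deriv i g x = d"
  by (simp add: partial_deriv_def DERIV_imp_deriv)

lemma Ck_on_has_partial:
  assumes "Ck_on n (Suc k) V g" "x \<in> V" "i < n"
  shows "((\<lambda>t. g (x(i := t))) has_real_derivative partial_deriv i g x) (at (x i))"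
proof -
  have "Ck_on n (Suc 0) V g" by (rule Ck_on_mono[OF assms(1)]) simp
  then show ?thesis using has_derivative_fun_upd[of n V g x i "x i"] assms by simp
qed

text \<open>Derivatives may be supplied as explicit formulas \<open>d i\<close>. By uniqueness they
  agree with \<open>partial_deriv\<close> on \<open>V\<close>, and \<open>Ck_on_cong\<close> carries
  the regularity over.\<close>

lemma Ck_on_SucI:
  assumes V: "open_eucl n V" and "Ck_on n k V g"
    and "\<And>i x. i < n \<Longrightarrow> x \<in> V \<Longrightarrow> ((\<lambda>t. g (x(i := t))) has_real_derivative d i x) (at (x i))"
    and "\<And>i. i < n \<Longrightarrow> Ck_on n k V (d i)"
  shows "Ck_on n (Suc k) V g"
proof -
  have "Ck_on n k V (partial_deriv i g)" if "i < n" for i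
    by (rule Ck_on_cong[OF V _ assms(4)[OF that]]) (metis assms(3) partial_derivI that)
  moreover have "continuous_map (subtopology (Euclidean_space n) V) euclideanreal g"
    using Ck_on_mono[OF assms(2), of 0] by simp
  ultimately show ?thesis using assms(3) real_differentiable_def by auto
qed

lemma Ck_on_add:
  assumes V: "open_eucl n V"
  shows "Ck_on n k V g \<Longrightarrow> Ck_on n k V h \<Longrightarrow> Ck_on n k V (\<lambda>x. g x + h x)"
proof (induction k arbitrary: g h)
  case 0 then show ?case by (auto intro: continuous_map_add)
next
  case (Suc k)
  show ?case
  proof (rule Ck_on_SucI[OF V])
    show "Ck_on n k V (\<lambda>x. g x + h x)" using Suc Ck_on_Suc_imp by blast
    fix i assume i: "i < n"
    show "((\<lambda>t. g (x(i := t)) + h (x(i := t))) has_real_derivative partial_deriv i g x + partial_deriv i h x) (at (x i))"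
      if "x \<in> V" for x by (rule DERIV_add[OF Ck_on_has_partial[OF Suc.prems(1) that i] Ck_on_has_partial[OF Suc.prems(2) that i]])
    show "Ck_on n k V (\<lambda>x. partial_deriv i g x + partial_deriv i h x)" using Suc i by simp
  qed
qed

lemma Ck_on_mult:
  assumes V: "open_eucl n V"
  shows "Ck_on n k V g \<Longrightarrow> Ck_on n k V h \<Longrightarrow> Ck_on n k V (\<lambda>x. g x * h x)"
proof (induction k arbitrary: g h)
  case 0 then show ?case by (auto intro: continuous_map_real_mult)
next
  case (Suc k)
  have gh: "Ck_on n k V g" "Ck_on n k V h" using Suc.prems Ck_on_Suc_imp by blast+
  show ?case
  proof (rule Ck_on_SucI[OF V])
    show "Ck_on n k V (\<lambda>x. g x * h x)" using Suc gh by blast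
    fix i assume i: "i < n"
    show "((\<lambda>t. g (x(i := t)) * h (x(i := t))) has_real_derivative partial_deriv i g x * h x + partial_deriv i h x * g x) (at (x i))"
      if "x \<in> V" for x
      using DERIV_mult[OF Ck_on_has_partial[OF Suc.prems(1) that i] Ck_on_has_partial[OF Suc.prems(2) that i]]
      unfolding fun_upd_triv .
    show "Ck_on n k V (\<lambda>x. partial_deriv i g x * h x + partial_deriv i h x * g x)"
      using Suc i gh Ck_on_add[OF V] by simp
  qed
qed

lemma Ck_on_sum:
  assumes V: "open_eucl n V"
  shows "(\<And>a. a \<in> A \<Longrightarrow> Ck_on n k V (g a)) \<Longrightarrow> Ck_on n k V (\<lambda>x. \<Sum>a\<in>A. g a x)"
  by (induction A rule: infinite_finite_induct) (simp_all add: Ck_on_add[OF V])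

text \<open>Induction on \<open>k\<close>: by the chain rule each partial derivative is a sum of
  products of \<open>partial_deriv j G\<close>, composed with the same inner map and of one order
  less, with a partial derivative of \<open>h j\<close>. The inner map is padded by zeros so that it
  lands in \<open>Euclidean_space m\<close>.\<close>

lemma Ck_on_compose:
  assumes V: "open_eucl n V" and W: "open_eucl m W"
  shows "Ck_on m k W G \<Longrightarrow> (\<And>j. j < m \<Longrightarrow> Ck_on n k V (h j)) \<Longrightarrow>
    (\<And>x. x \<in> V \<Longrightarrow> (\<lambda>j. if j < m then h j x else 0) \<in> W) \<Longrightarrow>
    Ck_on n k V (\<lambda>x. G (\<lambda>j. if j < m then h j x else 0))"
proof (induction k arbitrary: G)
  case 0
  have "continuous_on V (\<lambda>x. (\<lambda>j. if j < m then h j x else 0) j)" for j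
    using Ck_on_continuous[OF 0(2) openin_subset[OF V]] by (cases "j < m") (simp_all del: Ck_on.simps)
  then have c: "continuous_on V (\<lambda>x j. if j < m then h j x else 0)"
    by (rule continuous_on_coordinatewise_then_product)
  have "continuous_on W G" using 0(1) Ck_on_continuous openin_subset[OF W] by blast
  moreover note c
  moreover have "(\<lambda>x j. if j < m then h j x else 0) ` V \<subseteq> W" using 0(3) by blast
  ultimately have "continuous_on V (\<lambda>x. G (\<lambda>j. if j < m then h j x else 0))"
    by (rule continuous_on_compose2)
  then show ?case using openin_subset[OF V] by (simp add: continuous_map_Euclidean_iff)
next
  case (Suc k)
  have h: "\<And>j. j < m \<Longrightarrow> Ck_on n k V (h j)" using Suc.prems(2) Ck_on_Suc_imp by blast
  show ?case
  proof (rule Ck_on_SucI[OF V])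
    show "Ck_on n k V (\<lambda>x. G (\<lambda>j. if j < m then h j x else 0))"
      using Suc.prems(1,3) Ck_on_Suc_imp h by (intro Suc.IH) blast+
    fix i assume i: "i < n"
    show "((\<lambda>t. G (\<lambda>j. if j < m then h j (x(i := t)) else 0)) has_real_derivative
        (\<Sum>j<m. partial_deriv j G (\<lambda>j. if j < m then h j x else 0) * partial_deriv i (h j) x)) (at (x i))"
      if "x \<in> V" for x
    proof -
      have "((\<lambda>t. G ((\<lambda>t j. if j < m then h j (x(i := t)) else 0) t)) has_real_derivative
        (\<Sum>j<m. partial_deriv j G ((\<lambda>t j. if j < m then h j (x(i := t)) else 0) (x i)) * partial_deriv i (h j) x)) (at (x i))"
      proof (rule chain_rule[OF W])
        show "Ck_on m (Suc 0) W G" by (rule Ck_on_mono[OF Suc.prems(1)]) simp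
        show "(\<lambda>j. if j < m then h j (x(i := x i)) else 0) \<in> W" using Suc.prems(3)[OF that] unfolding fun_upd_triv .
        show "((\<lambda>t. if j < m then h j (x(i := t)) else 0) has_real_derivative partial_deriv i (h j) x) (at (x i))"
          if j: "j < m" for j
          unfolding if_P[OF j] by (rule Ck_on_has_partial[OF Suc.prems(2)[OF j] \<open>x \<in> V\<close> i])
      qed auto
      then show ?thesis unfolding fun_upd_triv .
    qed
    have "Ck_on m k W (partial_deriv j G)" if "j < m" for j using Suc.prems(1) that by simp
    then have "Ck_on n k V (\<lambda>x. partial_deriv j G (\<lambda>j. if j < m then h j x else 0))" if "j < m" for j
      using Suc.prems(3) h that by (intro Suc.IH) auto
    then show "Ck_on n k V (\<lambda>x. \<Sum>j<m. partial_deriv j G (\<lambda>j. if j < m then h j x else 0) * partial_deriv i (h j) x)"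
      using Suc.prems(2) i by (intro Ck_on_sum[OF V] Ck_on_mult[OF V]) auto
  qed
qed

section \<open>Symmetry of second partial derivatives\<close>

text \<open>The mean value theorem in direction \<open>i\<close>, applied to the increment in
  direction \<open>j\<close>, and then once more in direction \<open>j\<close>.\<close>

lemma second_difference:
  assumes g: "Ck_on n (Suc (Suc 0)) V g" and ij: "i < n" "j < n" "i \<noteq> j"
    and box: "\<And>s t. a \<le> s \<Longrightarrow> s \<le> a + h \<Longrightarrow> b \<le> t \<Longrightarrow> t \<le> b + h \<Longrightarrow> x(i := s, j := t) \<in> V" and h: "h > 0"
  obtains s t where "a \<le> s" "s \<le> a + h" "b \<le> t" "t \<le> b + h"
    "g (x(i := a + h, j := b + h)) - g (x(i := a + h, j := b)) - (g (x(i := a, j := b + h)) - g (x(i := a, j := b)))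
     = h * h * partial_deriv j (partial_deriv i g) (x(i := s, j := t))"
proof -
  have g1: "Ck_on n (Suc 0) V g" and g2: "Ck_on n (Suc 0) V (partial_deriv i g)"
    using g ij Ck_on_Suc_imp[OF g] Ck_on.simps(2) by blast+
  have sw: "x(i := s, j := t) = x(j := t, i := s)" for s t using ij(3) by (rule fun_upd_twist)
  have "((\<lambda>s. g (x(i := s, j := b + h)) - g (x(i := s, j := b))) has_real_derivative
      partial_deriv i g (x(i := s, j := b + h)) - partial_deriv i g (x(i := s, j := b))) (at s)"
    if "min a (a + h) \<le> s" "s \<le> max a (a + h)" for s
    unfolding sw using box[of s "b + h"] box[of s b] that h
    by (intro DERIV_diff has_derivative_fun_upd[OF g1 _ ij(1)]) (simp_all add: sw)
  from mvt_segment[OF this] obtain s where s: "min a (a + h) \<le> s" "s \<le> max a (a + h)"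
    "g (x(i := a + h, j := b + h)) - g (x(i := a + h, j := b)) - (g (x(i := a, j := b + h)) - g (x(i := a, j := b)))
      = (partial_deriv i g (x(i := s, j := b + h)) - partial_deriv i g (x(i := s, j := b))) * (a + h - a)"
    by blast
  have "((\<lambda>t. partial_deriv i g (x(i := s, j := t))) has_real_derivative
      partial_deriv j (partial_deriv i g) (x(i := s, j := t))) (at t)"
    if "min b (b + h) \<le> t" "t \<le> max b (b + h)" for t
    using box[of s t] that s h by (intro has_derivative_fun_upd[OF g2 _ ij(2)]) auto
  from mvt_segment[OF this] obtain t where t: "min b (b + h) \<le> t" "t \<le> max b (b + h)"
    "partial_deriv i g (x(i := s, j := b + h)) - partial_deriv i g (x(i := s, j := b)) =
      partial_deriv j (partial_deriv i g) (x(i := s, j := t)) * (b + h - b)"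
    by blast
  show thesis using s t h by (intro that[of s t]) (auto simp: algebra_simps)
qed

text \<open>The second difference over a small square does not depend on the order of the two
  directions, and it is \<open>h * h\<close> times either mixed derivative at some point of the
  square. Both mixed derivatives are continuous at \<open>x\<close>.\<close>

lemma partial_deriv_commute:
  assumes V: "open_eucl n V" and g: "Ck_on n (Suc (Suc 0)) V g" and "x \<in> V" "i < n" "j < n"
  shows "partial_deriv i (partial_deriv j g) x = partial_deriv j (partial_deriv i g) x"
proof (cases "i = j")
  case False
  have near: "\<exists>d>0. \<forall>y. y \<in> eucl n \<longrightarrow> (\<forall>l<n. \<bar>y l - x l\<bar> < d) \<longrightarrow>
      y \<in> V \<and> \<bar>partial_deriv i (partial_deriv j g) y - partial_deriv i (partial_deriv j g) x\<bar> < e"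
    if "i < n" "j < n" "e > 0" for i j e
  proof -
    have "Ck_on n 0 V (partial_deriv i (partial_deriv j g))" using g that by auto
    then have "continuous_on V (partial_deriv i (partial_deriv j g))"
      using Ck_on_continuous openin_subset[OF V] by blast
    then have "openin (top_of_set V) (V \<inter> partial_deriv i (partial_deriv j g) -` ball (partial_deriv i (partial_deriv j g) x) e)"
      using continuous_openin_preimage_gen by blast
    then have op: "open_eucl n (V \<inter> partial_deriv i (partial_deriv j g) -` ball (partial_deriv i (partial_deriv j g) x) e)"
      by (metis Euclidean_space_top_of_set V openin_trans)
    have "x \<in> V \<inter> partial_deriv i (partial_deriv j g) -` ball (partial_deriv i (partial_deriv j g) x) e"
      using assms(3) that by simp
    from Euclidean_box[OF op this] obtain d where d: "d > 0" "\<And>y. y \<in> eucl n \<Longrightarrow> (\<And>l. l < n \<Longrightarrow> \<bar>y l - x l\<bar> < d)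
      \<Longrightarrow> y \<in> V \<inter> partial_deriv i (partial_deriv j g) -` ball (partial_deriv i (partial_deriv j g) x) e"
      by blast
    have "y \<in> V \<and> \<bar>partial_deriv i (partial_deriv j g) y - partial_deriv i (partial_deriv j g) x\<bar> < e"
      if "y \<in> eucl n" "\<forall>l<n. \<bar>y l - x l\<bar> < d" for y
      using d(2)[OF that(1)] that(2) by (auto simp: dist_real_def)
    then show ?thesis using d(1) by blast
  qed
  have "\<bar>partial_deriv i (partial_deriv j g) x - partial_deriv j (partial_deriv i g) x\<bar> \<le> 2 * e" if e: "e > 0" for e
  proof -
    obtain d1 where d1: "d1 > 0" "\<And>y. y \<in> eucl n \<Longrightarrow> (\<And>l. l < n \<Longrightarrow> \<bar>y l - x l\<bar> < d1) \<Longrightarrow>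
      y \<in> V \<and> \<bar>partial_deriv i (partial_deriv j g) y - partial_deriv i (partial_deriv j g) x\<bar> < e"
      using near[OF assms(4,5) e] by auto
    obtain d2 where d2: "d2 > 0" "\<And>y. y \<in> eucl n \<Longrightarrow> (\<And>l. l < n \<Longrightarrow> \<bar>y l - x l\<bar> < d2) \<Longrightarrow>
      y \<in> V \<and> \<bar>partial_deriv j (partial_deriv i g) y - partial_deriv j (partial_deriv i g) x\<bar> < e"
      using near[OF assms(5,4) e] by auto
    define h where "h = min d1 d2 / 2"
    have h: "h > 0" "h < d1" "h < d2" using d1(1) d2(1) by (auto simp: h_def)
    have xE: "x \<in> eucl n" using assms(3) openin_subset[OF V] by blast
    have pE: "x(i := s, j := t) \<in> eucl n" for s t
      using xE assms(4,5) by (auto simp: in_Euclidean_space)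
    have pd: "\<bar>(x(i := s, j := t)) l - x l\<bar> \<le> h" if "x i \<le> s" "s \<le> x i + h" "x j \<le> t" "t \<le> x j + h" for s t l
      using that h by auto
    have box: "x(i := s, j := t) \<in> V" if "x i \<le> s" "s \<le> x i + h" "x j \<le> t" "t \<le> x j + h" for s t
      using d1(2)[OF pE, of s t] pd[OF that] h(2) by (meson le_less_trans)
    have sw: "x(i := s, j := t) = x(j := t, i := s)" for s t using False by (rule fun_upd_twist)
    obtain s t where st: "x i \<le> s" "s \<le> x i + h" "x j \<le> t" "t \<le> x j + h"
      "g (x(i := x i + h, j := x j + h)) - g (x(i := x i + h, j := x j)) - (g (x(i := x i, j := x j + h)) - g (x(i := x i, j := x j)))
       = h * h * partial_deriv j (partial_deriv i g) (x(i := s, j := t))"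
      using second_difference[OF g assms(4,5) False box h(1)] by blast
    have box': "x(j := t, i := s) \<in> V" if "x j \<le> t" "t \<le> x j + h" "x i \<le> s" "s \<le> x i + h" for s t
      using box that by (simp add: sw)
    obtain t' s' where st': "x j \<le> t'" "t' \<le> x j + h" "x i \<le> s'" "s' \<le> x i + h"
      "g (x(j := x j + h, i := x i + h)) - g (x(j := x j + h, i := x i)) - (g (x(j := x j, i := x i + h)) - g (x(j := x j, i := x i)))
       = h * h * partial_deriv i (partial_deriv j g) (x(j := t', i := s'))"
      using second_difference[OF g assms(5,4) False[symmetric] box' h(1)] by blast
    have "h * h * partial_deriv j (partial_deriv i g) (x(i := s, j := t)) = h * h * partial_deriv i (partial_deriv j g) (x(i := s', j := t'))"
      using st(5) st'(5) unfolding sw by linarith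
    then have eq: "partial_deriv j (partial_deriv i g) (x(i := s, j := t)) = partial_deriv i (partial_deriv j g) (x(i := s', j := t'))"
      using h by simp
    have "\<bar>partial_deriv i (partial_deriv j g) (x(i := s', j := t')) - partial_deriv i (partial_deriv j g) x\<bar> < e"
      using d1(2)[OF pE, of s' t'] pd[OF st'(3,4,1,2)] h(2) by (meson le_less_trans)
    moreover have "\<bar>partial_deriv j (partial_deriv i g) (x(i := s, j := t)) - partial_deriv j (partial_deriv i g) x\<bar> < e"
      using d2(2)[OF pE, of s t] pd[OF st(1-4)] h(3) by (meson le_less_trans)
    ultimately show ?thesis using eq by linarith
  qed
  \<comment> \<open>With a quarter of the gap as \<open>e\<close>, the gap is bounded by half of
    itself.\<close>
  from this[of "\<bar>partial_deriv i (partial_deriv j g) x - partial_deriv j (partial_deriv i g) x\<bar> / 4"]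
  show ?thesis by fastforce
qed simp

section \<open>Germs of smooth functions\<close>

lemma Ck_on_local:
  assumes V: "open_eucl n V"
  shows "(\<And>x. x \<in> V \<Longrightarrow> \<exists>W. open_eucl n W \<and> x \<in> W \<and> Ck_on n k W g) \<Longrightarrow> Ck_on n k V g"
proof (induction k arbitrary: g)
  case 0
  have "continuous_on V g"
  proof (rule continuous_on_openin_UN[OF V])
    fix x assume "x \<in> V"
    with 0 obtain W where W: "open_eucl n W" "x \<in> W" "Ck_on n 0 W g" by blast
    then show "\<exists>W. open_eucl n W \<and> x \<in> W \<and> continuous_on W g"
      using Ck_on_continuous[OF W(3) openin_subset[OF W(1)]] by blast
  qed
  then show ?case using openin_subset[OF V] by (simp add: continuous_map_Euclidean_iff)
next
  case (Suc k)
  show ?case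
  proof (rule Ck_on_SucI[OF V])
    show "Ck_on n k V g"
    proof (rule Suc.IH)
      fix x assume "x \<in> V"
      with Suc.prems obtain W where W: "open_eucl n W" "x \<in> W" "Ck_on n (Suc k) W g" by blast
      with Ck_on_Suc_imp[OF W(3)] show "\<exists>W. open_eucl n W \<and> x \<in> W \<and> Ck_on n k W g" by blast
    qed
    fix i assume i: "i < n"
    show "((\<lambda>t. g (x(i := t))) has_real_derivative partial_deriv i g x) (at (x i))" if x: "x \<in> V" for x
    proof -
      obtain W where W: "x \<in> W" "Ck_on n (Suc k) W g" using Suc.prems[OF x] by blast
      show ?thesis by (rule Ck_on_has_partial[OF W(2,1) i])
    qed
    show "Ck_on n k V (partial_deriv i g)"
    proof (rule Suc.IH)
      fix x assume "x \<in> V"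
      with Suc.prems obtain W where W: "open_eucl n W" "x \<in> W" "Ck_on n (Suc k) W g" by blast
      then have "Ck_on n k W (partial_deriv i g)" using i by simp
      with W show "\<exists>W. open_eucl n W \<and> x \<in> W \<and> Ck_on n k W (partial_deriv i g)" by blast
    qed
  qed
qed

text \<open>Germ version of \<open>smooth_on\<close>: it is closed under the operations below
  without a common domain in the statements, and \<open>smooth_on_iff_at\<close> leads back to open
  sets.\<close>

definition smooth_at :: "nat \<Rightarrow> ((nat \<Rightarrow> real) \<Rightarrow> real) \<Rightarrow> (nat \<Rightarrow> real) \<Rightarrow> bool" where
  "smooth_at n g a \<longleftrightarrow> (\<exists>V. open_eucl n V \<and> a \<in> V \<and> smooth_on n V g)"

lemma smooth_on_subset: "smooth_on n V g \<Longrightarrow> W \<subseteq> V \<Longrightarrow> smooth_on n W g"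
  using Ck_on_subset unfolding smooth_on_def by blast

lemma smooth_on_iff_at:
  assumes V: "open_eucl n V"
  shows "smooth_on n V g \<longleftrightarrow> (\<forall>a\<in>V. smooth_at n g a)"
proof
  assume "smooth_on n V g" then show "\<forall>a\<in>V. smooth_at n g a" using V smooth_at_def by blast
next
  assume r: "\<forall>a\<in>V. smooth_at n g a"
  have "Ck_on n k V g" for k
  proof (rule Ck_on_local[OF V])
    fix x assume "x \<in> V"
    with r obtain W where "open_eucl n W" "x \<in> W" "smooth_on n W g"
      unfolding smooth_at_def by blast
    then show "\<exists>W. open_eucl n W \<and> x \<in> W \<and> Ck_on n k W g" by (auto simp: smooth_on_def)
  qed
  then show "smooth_on n V g" by (simp add: smooth_on_def)
qed

lemma smooth_at_topspace: "smooth_at n g a \<Longrightarrow> a \<in> eucl n"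
  unfolding smooth_at_def using openin_subset by blast

lemma smooth_at_witness:
  assumes "smooth_at n g a" "smooth_at n h a"
  obtains V where "open_eucl n V" "a \<in> V" "smooth_on n V g" "smooth_on n V h"
proof -
  obtain V W where "open_eucl n V" "a \<in> V" "smooth_on n V g"
    "open_eucl n W" "a \<in> W" "smooth_on n W h"
    using assms unfolding smooth_at_def by blast
  then have "open_eucl n (V \<inter> W)" "a \<in> V \<inter> W" "smooth_on n (V \<inter> W) g" "smooth_on n (V \<inter> W) h"
    using smooth_on_subset by blast+
  then show thesis using that by blast
qed

lemma smooth_on_cong:
  assumes V: "open_eucl n V" and "\<And>x. x \<in> V \<Longrightarrow> g x = h x" "smooth_on n V g"
  shows "smooth_on n V h"
  using Ck_on_cong[OF V, of g h] assms(2,3) unfolding smooth_on_def by blast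

lemma smooth_at_cong:
  assumes ev: "\<forall>\<^sub>F x in near_eucl n a. g x = h x" and g: "smooth_at n g a"
  shows "smooth_at n h a"
proof -
  obtain V where V: "open_eucl n V" "a \<in> V" "smooth_on n V g" using g smooth_at_def by blast
  obtain W where W: "open_eucl n W" "a \<in> W" "\<forall>x\<in>W. g x = h x"
    using ev smooth_at_topspace[OF g] by (auto simp: eventually_nhdsin)
  have VW: "open_eucl n (V \<inter> W)" using V W by blast
  have "smooth_on n (V \<inter> W) h"
    by (rule smooth_on_cong[OF VW, of g]) (use W smooth_on_subset[OF V(3)] in auto)
  then show ?thesis using VW V W smooth_at_def by blast
qed

lemma smooth_at_const: "a \<in> eucl n \<Longrightarrow> smooth_at n (\<lambda>x. c) a"
  unfolding smooth_at_def smooth_on_def using Ck_on_const by blast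

lemma smooth_at_coord: "a \<in> eucl n \<Longrightarrow> smooth_at n (\<lambda>x. x j) a"
  unfolding smooth_at_def smooth_on_def using Ck_on_coord by blast

lemma smooth_at_add:
  assumes "smooth_at n g a" "smooth_at n h a" shows "smooth_at n (\<lambda>x. g x + h x) a"
proof -
  from smooth_at_witness[OF assms] obtain V where
    V: "open_eucl n V" "a \<in> V" "smooth_on n V g" "smooth_on n V h" .
  then have "smooth_on n V (\<lambda>x. g x + h x)" using Ck_on_add[OF V(1)] unfolding smooth_on_def by blast
  then show ?thesis using V smooth_at_def by blast
qed

lemma smooth_at_mult:
  assumes "smooth_at n g a" "smooth_at n h a" shows "smooth_at n (\<lambda>x. g x * h x) a"
proof -
  from smooth_at_witness[OF assms] obtain V where
    V: "open_eucl n V" "a \<in> V" "smooth_on n V g" "smooth_on n V h" .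
  then have "smooth_on n V (\<lambda>x. g x * h x)" using Ck_on_mult[OF V(1)] unfolding smooth_on_def by blast
  then show ?thesis using V smooth_at_def by blast
qed

lemma smooth_at_minus: "smooth_at n g a \<Longrightarrow> smooth_at n (\<lambda>x. - g x) a"
  using smooth_at_mult[OF smooth_at_const[OF smooth_at_topspace, of n g a "-1"], of g] by simp

lemma smooth_at_diff: "smooth_at n g a \<Longrightarrow> smooth_at n h a \<Longrightarrow> smooth_at n (\<lambda>x. g x - h x) a"
  using smooth_at_add[OF _ smooth_at_minus] by fastforce

lemma smooth_at_sum:
  "a \<in> eucl n \<Longrightarrow> (\<And>i. i \<in> A \<Longrightarrow> smooth_at n (g i) a) \<Longrightarrow> smooth_at n (\<lambda>x. \<Sum>i\<in>A. g i x) a"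
  by (induction A rule: infinite_finite_induct) (simp_all add: smooth_at_const smooth_at_add)

lemma smooth_on_partial: "smooth_on n V g \<Longrightarrow> i < n \<Longrightarrow> smooth_on n V (partial_deriv i g)"
proof -
  assume g: "smooth_on n V g" and i: "i < n"
  have "Ck_on n k V (partial_deriv i g)" for k
  proof -
    have "Ck_on n (Suc k) V g" using g smooth_on_def by blast
    then show ?thesis using i by simp
  qed
  then show ?thesis by (simp add: smooth_on_def)
qed

lemma smooth_at_partial: "smooth_at n g a \<Longrightarrow> i < n \<Longrightarrow> smooth_at n (partial_deriv i g) a"
  unfolding smooth_at_def using smooth_on_partial by blast

lemma smooth_at_has_partial:
  assumes "smooth_at n g a" "i < n"
  shows "((\<lambda>t. g (a(i := t))) has_real_derivative partial_deriv i g a) (at (a i))"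
proof -
  obtain V where V: "a \<in> V" "Ck_on n (Suc 0) V g" using assms unfolding smooth_at_def smooth_on_def by blast
  show ?thesis by (rule Ck_on_has_partial[OF V(2,1) assms(2)])
qed

lemma smooth_at_commute:
  assumes "smooth_at n g a" "i < n" "j < n"
  shows "partial_deriv i (partial_deriv j g) a = partial_deriv j (partial_deriv i g) a"
proof -
  obtain V where V: "open_eucl n V" "a \<in> V" "Ck_on n (Suc (Suc 0)) V g"
    using assms unfolding smooth_at_def smooth_on_def by blast
  show ?thesis by (rule partial_deriv_commute[OF V(1,3,2) assms(2,3)])
qed

lemma partial_deriv_add:
  "smooth_at n g a \<Longrightarrow> smooth_at n h a \<Longrightarrow> i < n \<Longrightarrow>
    partial_deriv i (\<lambda>x. g x + h x) a = partial_deriv i g a + partial_deriv i h a"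
  by (intro partial_derivI DERIV_add smooth_at_has_partial)

lemma partial_deriv_mult:
  assumes "smooth_at n g a" "smooth_at n h a" "i < n"
  shows "partial_deriv i (\<lambda>x. g x * h x) a = partial_deriv i g a * h a + partial_deriv i h a * g a"
  by (rule partial_derivI)
    (use DERIV_mult[OF smooth_at_has_partial[OF assms(1,3)] smooth_at_has_partial[OF assms(2,3)]] in \<open>unfold fun_upd_triv\<close>)

lemma partial_deriv_const: "partial_deriv i (\<lambda>x. c) a = 0"
  by (simp add: partial_deriv_def)

lemma partial_deriv_sum:
  "a \<in> eucl n \<Longrightarrow> (\<And>b. b \<in> A \<Longrightarrow> smooth_at n (g b) a) \<Longrightarrow> i < n \<Longrightarrow>
    partial_deriv i (\<lambda>x. \<Sum>b\<in>A. g b x) a = (\<Sum>b\<in>A. partial_deriv i (g b) a)"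
  by (induction A rule: infinite_finite_induct) (simp_all add: partial_deriv_const partial_deriv_add[of n] smooth_at_sum)

lemma partial_deriv_cong_ev:
  assumes "\<forall>\<^sub>F x in near_eucl n a. g x = h x" "a \<in> eucl n" "i < n"
  shows "partial_deriv i g a = partial_deriv i h a"
proof -
  obtain W where W: "open_eucl n W" "a \<in> W" "\<forall>x\<in>W. g x = h x"
    using assms by (auto simp: eventually_nhdsin)
  then show ?thesis using partial_deriv_cong[OF W(1,2) assms(3)] by blast
qed

section \<open>Composition of germs\<close>

text \<open>Projection of arbitrary sequences into \<open>Euclidean_space m\<close>. A map into that
  space can thus be given by a family of component functions, whatever the family is from index
  \<open>m\<close> on.\<close>

definition trunc :: "nat \<Rightarrow> (nat \<Rightarrow> real) \<Rightarrow> nat \<Rightarrow> real" where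
  "trunc m y = (\<lambda>j. if j < m then y j else 0)"

lemma trunc_in [simp]: "trunc m y \<in> eucl m"
  by (simp add: trunc_def in_Euclidean_space)

lemma trunc_id: "y \<in> eucl m \<Longrightarrow> trunc m y = y"
  by (auto simp: trunc_def in_Euclidean_space fun_eq_iff)

lemma trunc_nth [simp]: "j < m \<Longrightarrow> trunc m y j = y j" "\<not> j < m \<Longrightarrow> trunc m y j = 0"
  by (simp_all add: trunc_def)

lemma smooth_common_nhd:
  assumes a: "a \<in> eucl n" and h: "\<And>j. j < (m::nat) \<Longrightarrow> smooth_at n (h j) a"
  obtains V where "open_eucl n V" "a \<in> V" "\<And>j. j < m \<Longrightarrow> smooth_on n V (h j)"
proof -
  have "\<exists>V. open_eucl n V \<and> a \<in> V \<and> (j < m \<longrightarrow> smooth_on n V (h j))" for j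
  proof (cases "j < m")
    case True then show ?thesis using h[OF True] unfolding smooth_at_def by blast
  next
    case False then show ?thesis using a by blast
  qed
  then obtain V where V: "\<And>j. open_eucl n (V j)" "\<And>j. a \<in> V j" "\<And>j. j < m \<Longrightarrow> smooth_on n (V j) (h j)"
    by metis
  \<comment> \<open>The whole space keeps the family nonempty when \<open>m = 0\<close>.\<close>
  define V0 where "V0 = \<Inter> (insert (eucl n) (V ` {..<m}))"
  show thesis
  proof
    show "open_eucl n V0" unfolding V0_def by (rule openin_Inter) (use V(1) in auto)
    show "a \<in> V0" using a V(2) by (auto simp: V0_def)
    show "smooth_on n V0 (h j)" if "j < m" for j
      by (rule smooth_on_subset[OF V(3)[OF that]]) (use that in \<open>auto simp: V0_def\<close>)
  qed
qed

lemma smooth_preimage_open: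
  assumes V: "open_eucl n V" and h: "\<And>j. j < m \<Longrightarrow> smooth_on n V (h j)"
    and W: "open_eucl m W"
  shows "open_eucl n {x \<in> V. trunc m (\<lambda>j. h j x) \<in> W}"
proof -
  have "continuous_on V (\<lambda>x. trunc m (\<lambda>j. h j x) j)" for j
  proof (cases "j < m")
    case True
    then have "Ck_on n 0 V (h j)" using h smooth_on_def by blast
    then show ?thesis using True Ck_on_continuous openin_subset[OF V] by (simp del: Ck_on.simps)
  qed simp
  then have "continuous_on V (\<lambda>x. trunc m (\<lambda>j. h j x))" by (rule continuous_on_coordinatewise_then_product)
  then have "continuous_map (subtopology (Euclidean_space n) V) (Euclidean_space m) (\<lambda>x. trunc m (\<lambda>j. h j x))"
    using continuous_map_Euclidean_iff[OF openin_subset[OF V]] 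
    by (subst Euclidean_space_top_of_set[of m]) (auto simp: continuous_map_in_subtopology)
  from openin_continuous_map_preimage[OF this W]
  have "openin (subtopology (Euclidean_space n) V) {x \<in> V. trunc m (\<lambda>j. h j x) \<in> W}"
    using openin_subset[OF V] by (simp add: inf.absorb2)
  then show ?thesis using openin_trans_full[OF _ V] by blast
qed

lemma smooth_at_compose:
  assumes a: "a \<in> eucl n" and G: "smooth_at m G (trunc m (\<lambda>j. h j a))"
    and h: "\<And>j. j < m \<Longrightarrow> smooth_at n (h j) a"
  shows "smooth_at n (\<lambda>x. G (trunc m (\<lambda>j. h j x))) a"
proof -
  obtain W where W: "open_eucl m W" "trunc m (\<lambda>j. h j a) \<in> W" "smooth_on m W G"
    using G smooth_at_def by blast
  from smooth_common_nhd[of a n m h, OF a h] obtain V where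
    V: "open_eucl n V" "a \<in> V" "\<And>j. j < m \<Longrightarrow> smooth_on n V (h j)" by metis
  define V' where "V' = {x \<in> V. trunc m (\<lambda>j. h j x) \<in> W}"
  have V': "open_eucl n V'" unfolding V'_def by (rule smooth_preimage_open[of n V m h W, OF V(1,3) W(1)])
  have "Ck_on n k V' (\<lambda>x. G (\<lambda>j. if j < m then h j x else 0))" for k
  proof (rule Ck_on_compose[OF V' W(1)])
    show "Ck_on m k W G" using W(3) smooth_on_def by blast
    show "Ck_on n k V' (h j)" if "j < m" for j
      using smooth_on_subset[OF V(3)[OF that], of V'] unfolding V'_def smooth_on_def by blast
  qed (auto simp: V'_def trunc_def)
  then have "smooth_on n V' (\<lambda>x. G (trunc m (\<lambda>j. h j x)))" by (simp add: smooth_on_def trunc_def)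
  moreover have "a \<in> V'" using V W by (simp add: V'_def)
  ultimately show ?thesis using V' smooth_at_def by blast
qed

lemma partial_deriv_compose:
  assumes a: "a \<in> eucl n" and G: "smooth_at m G (trunc m (\<lambda>j. h j a))"
    and h: "\<And>j. j < m \<Longrightarrow> smooth_at n (h j) a" and i: "i < n"
  shows "partial_deriv i (\<lambda>x. G (trunc m (\<lambda>j. h j x))) a =
    (\<Sum>j<m. partial_deriv j G (trunc m (\<lambda>j. h j a)) * partial_deriv i (h j) a)"
proof (rule partial_derivI)
  obtain W where W: "open_eucl m W" "trunc m (\<lambda>j. h j a) \<in> W" "Ck_on m (Suc 0) W G"
    using G unfolding smooth_at_def smooth_on_def by blast
  have "((\<lambda>t. G ((\<lambda>t. trunc m (\<lambda>j. h j (a(i := t)))) t)) has_real_derivative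
    (\<Sum>j<m. partial_deriv j G ((\<lambda>t. trunc m (\<lambda>j. h j (a(i := t)))) (a i)) * partial_deriv i (h j) a)) (at (a i))"
  proof (rule chain_rule[OF W(1,3)])
    show "trunc m (\<lambda>j. h j (a(i := a i))) \<in> W" unfolding fun_upd_triv by (rule W(2))
    show "((\<lambda>t. trunc m (\<lambda>j. h j (a(i := t))) j) has_real_derivative partial_deriv i (h j) a) (at (a i))" if j: "j < m" for j
      unfolding trunc_nth(1)[OF j] by (rule smooth_at_has_partial[OF h[OF j] i])
  qed auto
  then show "((\<lambda>t. G (trunc m (\<lambda>j. h j (a(i := t))))) has_real_derivative
    (\<Sum>j<m. partial_deriv j G (trunc m (\<lambda>j. h j a)) * partial_deriv i (h j) a)) (at (a i))"
    unfolding fun_upd_triv .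
qed

section \<open>Closed two-forms in coordinates\<close>

definition closed_form_at :: "nat \<Rightarrow> (nat \<Rightarrow> nat \<Rightarrow> (nat \<Rightarrow> real) \<Rightarrow> real) \<Rightarrow> (nat \<Rightarrow> real) \<Rightarrow> bool" where
  "closed_form_at n \<omega> a \<longleftrightarrow>
     (\<forall>i<n. \<forall>j<n. smooth_at n (\<omega> i j) a) \<and>
     (\<forall>i<n. \<forall>j<n. \<forall>k<n. partial_deriv i (\<omega> j k) a + partial_deriv j (\<omega> k i) a + partial_deriv k (\<omega> i j) a = 0)"

lemma closed_form_at_add:
  assumes "closed_form_at n \<omega> a" "closed_form_at n \<eta> a"
  shows "closed_form_at n (\<lambda>i j x. \<omega> i j x + \<eta> i j x) a"
  using assms unfolding closed_form_at_def
  by (simp add: smooth_at_add partial_deriv_add[of n]) (smt (verit))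

lemma closed_form_at_cmult:
  assumes "closed_form_at n \<omega> a"
  shows "closed_form_at n (\<lambda>i j x. c * \<omega> i j x) a"
proof -
  have s: "smooth_at n (\<omega> i j) a" "smooth_at n (\<lambda>x. c) a" if "i < n" "j < n" for i j
    using assms that smooth_at_const[OF smooth_at_topspace] unfolding closed_form_at_def by blast+
  have "partial_deriv i (\<lambda>x. c * \<omega> j k x) a = c * partial_deriv i (\<omega> j k) a" if "i < n" "j < n" "k < n" for i j k
    using partial_deriv_mult[OF s(2,1)] that by (simp add: partial_deriv_const)
  then show ?thesis using assms s smooth_at_mult unfolding closed_form_at_def
    by (auto simp: distrib_left[symmetric])
qed

lemma closed_form_at_cong:
  assumes "\<forall>\<^sub>F x in near_eucl n a. \<forall>i<n. \<forall>j<n. \<omega> i j x = \<eta> i j x" "closed_form_at n \<omega> a"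
    "a \<in> eucl n"
  shows "closed_form_at n \<eta> a"
proof -
  have e: "\<forall>\<^sub>F x in near_eucl n a. \<omega> i j x = \<eta> i j x" if "i < n" "j < n" for i j
    using assms(1) by (rule eventually_mono) (use that in auto)
  have "partial_deriv k (\<omega> i j) a = partial_deriv k (\<eta> i j) a" if "i < n" "j < n" "k < n" for i j k
    using partial_deriv_cong_ev[OF e assms(3)] that by blast
  then show ?thesis using assms(2) smooth_at_cong[OF e] unfolding closed_form_at_def by auto
qed

lemma closed_form_at_const: "a \<in> eucl n \<Longrightarrow> closed_form_at n (\<lambda>i j x. c i j) a"
  by (simp add: closed_form_at_def smooth_at_const partial_deriv_const)

text \<open>Commutation of pullback with the exterior derivative, on coefficients. In the
  application \<open>W c a b\<close> is the c-th derivative of \<open>w a b\<close>,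
  \<open>F c k\<close> is the Jacobian and \<open>H k i a\<close> holds the second derivatives of
  the a-th component of the map; \<open>T k i j\<close> is then the product rule for the k-th
  derivative of the pulled back coefficient at \<open>i\<close>, \<open>j\<close>. The terms with
  \<open>W\<close> cancel by closedness, those with \<open>H\<close> by its symmetry and the
  antisymmetry of \<open>w\<close>.\<close>

lemma closed_pullback_algebra:
  fixes W H :: "nat \<Rightarrow> nat \<Rightarrow> nat \<Rightarrow> real" and w F :: "nat \<Rightarrow> nat \<Rightarrow> real"
  assumes W: "\<And>a b c. a < m \<Longrightarrow> b < m \<Longrightarrow> c < m \<Longrightarrow> W a b c + W b c a + W c a b = 0"
    and w: "\<And>a b. a < m \<Longrightarrow> b < m \<Longrightarrow> w b a = - w a b"
    and H: "\<And>i j a. a < m \<Longrightarrow> H i j a = H j i a"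
  defines "T \<equiv> \<lambda>k i j. \<Sum>a<m. \<Sum>b<m. (\<Sum>c<m. W c a b * F c k) * F a i * F b j + w a b * (H k i a * F b j + F a i * H k j b)"
  shows "T i j k + T j k i + T k i j = 0"
proof -
  define A where "A k i j = (\<Sum>a<m. \<Sum>b<m. \<Sum>c<m. W c a b * F c k * F a i * F b j)" for k i j
  define B where "B k i j = (\<Sum>a<m. \<Sum>b<m. w a b * H k i a * F b j)" for k i j
  \<comment> \<open>Swapping the summation indices and using the antisymmetry of \<open>w\<close>
    turns the second Hessian term into the first one with \<open>i\<close> and \<open>j\<close>
    exchanged and the opposite sign.\<close>
  have BT: "(\<Sum>a<m. \<Sum>b<m. w a b * F a i * H k j b) = - B k j i" for k i j
  proof -
    have e: "w a b * F a i * H k j b = - (w b a * H k j b * F a i)" if "b \<in> {..<m}" "a \<in> {..<m}" for a b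
      using w[of a b] that by simp
    have "(\<Sum>a<m. \<Sum>b<m. w a b * F a i * H k j b) = (\<Sum>b<m. \<Sum>a<m. w a b * F a i * H k j b)"
      by (rule sum.swap)
    also have "\<dots> = (\<Sum>b<m. \<Sum>a<m. - (w b a * H k j b * F a i))"
      by (intro sum.cong refl e)
    finally show ?thesis by (simp add: B_def sum_negf)
  qed
  have T: "T k i j = A k i j + B k i j - B k j i" for k i j
    using BT[where i=i and j=j and k=k]
    by (simp add: T_def A_def B_def sum.distrib distrib_left sum_distrib_right sum_distrib_left mult.assoc)
  have Bs: "B k i j = B i k j" for k i j
    unfolding B_def by (intro sum.cong refl) (simp add: H[of _ k i])
  \<comment> \<open>Cyclic renamings of the summation indices give all three terms the common factor
    \<open>F a i * F b j * F c k\<close>.\<close>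
  have A1: "A k i j = (\<Sum>a<m. \<Sum>b<m. \<Sum>c<m. W b c a * F b k * F c i * F a j)" for k i j
  proof -
    have "A k i j = (\<Sum>b<m. \<Sum>a<m. \<Sum>c<m. W c a b * F c k * F a i * F b j)"
      unfolding A_def by (rule sum.swap)
    also have "\<dots> = (\<Sum>b<m. \<Sum>c<m. \<Sum>a<m. W c a b * F c k * F a i * F b j)"
      by (intro sum.cong refl sum.swap)
    finally show ?thesis .
  qed
  have A2: "A k i j = (\<Sum>a<m. \<Sum>b<m. \<Sum>c<m. W a b c * F a k * F b i * F c j)" for k i j
    unfolding A1[of k i j]
    by (rule trans[OF sum.swap]) (intro sum.cong refl sum.swap)
  have "A i j k + A j k i + A k i j = 
    (\<Sum>a<m. \<Sum>b<m. \<Sum>c<m. (W a b c + W b c a + W c a b) * (F a i * F b j * F c k))"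
    unfolding A2[of i j k] A1[of j k i] A_def[of k i j]
    unfolding sum.distrib[symmetric]
    by (intro sum.cong refl) (simp add: algebra_simps)
  also have "\<dots> = 0" by (intro sum.neutral ballI) (simp add: W)
  finally show ?thesis unfolding T using Bs[of i j k] Bs[of j k i] Bs[of k i j] by linarith
qed

lemma closed_form_at_pullback:
  assumes a: "a \<in> eucl n" and \<omega>: "closed_form_at m \<omega> (trunc m (\<lambda>j. F j a))"
    and F: "\<And>j. j < m \<Longrightarrow> smooth_at n (F j) a"
    and anti: "\<And>i j. i < m \<Longrightarrow> j < m \<Longrightarrow> \<omega> j i (trunc m (\<lambda>j. F j a)) = - \<omega> i j (trunc m (\<lambda>j. F j a))"
  shows "closed_form_at n (\<lambda>i j x. \<Sum>b<m. \<Sum>c<m. \<omega> b c (trunc m (\<lambda>j. F j x)) * (partial_deriv i (F b) x * partial_deriv j (F c) x)) a"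
    (is "closed_form_at n ?\<eta> a")
proof -
  let ?y = "trunc m (\<lambda>j. F j a)"
  have \<omega>s: "smooth_at m (\<omega> b c) ?y" if "b < m" "c < m" for b c using \<omega> that unfolding closed_form_at_def by blast
  have \<omega>F: "smooth_at n (\<lambda>x. \<omega> b c (trunc m (\<lambda>j. F j x))) a" if "b < m" "c < m" for b c
    by (rule smooth_at_compose[OF a \<omega>s[OF that] F])
  have P: "smooth_at n (partial_deriv i (F b)) a" if "i < n" "b < m" for i b
    using smooth_at_partial[OF F] that by blast
  have FF: "smooth_at n (\<lambda>x. partial_deriv i (F b) x * partial_deriv j (F c) x) a" if "i < n" "j < n" "b < m" "c < m" for i j b c
    by (intro smooth_at_mult P that)
  have t: "smooth_at n (\<lambda>x. \<omega> b c (trunc m (\<lambda>j. F j x)) * (partial_deriv i (F b) x * partial_deriv j (F c) x)) a"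
    if "i < n" "j < n" "b < m" "c < m" for i j b c
    by (intro smooth_at_mult[OF \<omega>F FF] that)
  have s: "smooth_at n (?\<eta> i j) a" if "i < n" "j < n" for i j
    by (intro smooth_at_sum[OF a] t that) auto
  define W where "W d b c = partial_deriv d (\<omega> b c) ?y" for d b c
  define H where "H k i b = partial_deriv k (partial_deriv i (F b)) a" for k i b
  define G where "G b i = partial_deriv i (F b) a" for b i
  have d: "partial_deriv k (?\<eta> i j) a = (\<Sum>b<m. \<Sum>c<m. (\<Sum>d<m. W d b c * G d k) * G b i * G c j + \<omega> b c ?y * (H k i b * G c j + G b i * H k j c))"
    if ijk: "i < n" "j < n" "k < n" for i j k
  proof -
    have "partial_deriv k (\<lambda>x. \<omega> b c (trunc m (\<lambda>j. F j x)) * (partial_deriv i (F b) x * partial_deriv j (F c) x)) a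
      = (\<Sum>d<m. W d b c * G d k) * G b i * G c j + \<omega> b c ?y * (H k i b * G c j + G b i * H k j c)"
      if bc: "b < m" "c < m" for b c
    proof -
      have pc: "partial_deriv k (\<lambda>x. \<omega> b c (trunc m (\<lambda>j. F j x))) a = (\<Sum>d<m. W d b c * G d k)"
        unfolding W_def G_def by (rule partial_deriv_compose[of a n m "\<omega> b c" F k, OF a \<omega>s[OF bc] F ijk(3)])
      show ?thesis
      unfolding partial_deriv_mult[OF \<omega>F[OF bc] FF[OF ijk(1,2) bc] ijk(3)]
        partial_deriv_mult[OF P[OF ijk(1) bc(1)] P[OF ijk(2) bc(2)] ijk(3)] pc
      by (simp add: H_def G_def algebra_simps)
    qed
    moreover have "partial_deriv k (?\<eta> i j) a = (\<Sum>b<m. \<Sum>c<m. partial_deriv k (\<lambda>x. \<omega> b c (trunc m (\<lambda>j. F j x)) * (partial_deriv i (F b) x * partial_deriv j (F c) x)) a)"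
    proof -
      have "partial_deriv k (?\<eta> i j) a = (\<Sum>b<m. partial_deriv k (\<lambda>x. \<Sum>c<m. \<omega> b c (trunc m (\<lambda>j. F j x)) * (partial_deriv i (F b) x * partial_deriv j (F c) x)) a)"
        by (rule partial_deriv_sum[OF a _ ijk(3)]) (rule smooth_at_sum[OF a], rule t, use ijk in auto)
      also have "\<dots> = (\<Sum>b<m. \<Sum>c<m. partial_deriv k (\<lambda>x. \<omega> b c (trunc m (\<lambda>j. F j x)) * (partial_deriv i (F b) x * partial_deriv j (F c) x)) a)"
        by (rule sum.cong[OF refl], rule partial_deriv_sum[OF a _ ijk(3)], rule t) (use ijk in auto)
      finally show ?thesis .
    qed
    ultimately show ?thesis by simp
  qed
  have "partial_deriv i (?\<eta> j k) a + partial_deriv j (?\<eta> k i) a + partial_deriv k (?\<eta> i j) a = 0"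
    if ijk: "i < n" "j < n" "k < n" for i j k
  proof -
    \<comment> \<open>Cut off outside the valid range: \<open>closed_pullback_algebra\<close> asks
      for symmetry at all \<open>i\<close> and \<open>j\<close>, while second derivatives commute
      for indices below \<open>n\<close>.\<close>
    let ?H = "\<lambda>k i b. if k < n \<and> i < n then H k i b else 0"
    have "(\<lambda>k i j. \<Sum>b<m. \<Sum>c<m. (\<Sum>d<m. W d b c * G d k) * G b i * G c j + \<omega> b c ?y * (?H k i b * G c j + G b i * ?H k j c)) i j k +
      (\<lambda>k i j. \<Sum>b<m. \<Sum>c<m. (\<Sum>d<m. W d b c * G d k) * G b i * G c j + \<omega> b c ?y * (?H k i b * G c j + G b i * ?H k j c)) j k i +
      (\<lambda>k i j. \<Sum>b<m. \<Sum>c<m. (\<Sum>d<m. W d b c * G d k) * G b i * G c j + \<omega> b c ?y * (?H k i b * G c j + G b i * ?H k j c)) k i j = 0"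
    proof (rule closed_pullback_algebra)
      show "W a b c + W b c a + W c a b = 0" if "a < m" "b < m" "c < m" for a b c
        using \<omega> that unfolding W_def closed_form_at_def by auto
      show "?H k i b = ?H i k b" if "b < m" for k i b
        using smooth_at_commute[OF F[OF that], of k i] by (simp add: H_def)
    qed (use anti in blast)
    then show ?thesis using d ijk by simp
  qed
  then show ?thesis using s unfolding closed_form_at_def by blast
qed

section \<open>Charts and atlases\<close>

text \<open>The numbering recurs in all chart arguments: (3) open image, (4) injectivity, (5) values
  in Euclidean space, (6) left inverse, (7) images and (8) preimages of open sets.\<close>

lemma chart_onD:
  assumes "chart_on T n (U, \<phi>)"
  shows "openin T U" "U \<subseteq> topspace T" "open_eucl n (\<phi> ` U)" "inj_on \<phi> U"
    "\<And>p. p \<in> U \<Longrightarrow> \<phi> p \<in> eucl n"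
    "\<And>p. p \<in> U \<Longrightarrow> inv_into U \<phi> (\<phi> p) = p"
    "\<And>W. openin T W \<Longrightarrow> open_eucl n (\<phi> ` (U \<inter> W))"
    "\<And>V. open_eucl n V \<Longrightarrow> openin T {p \<in> U. \<phi> p \<in> V}"
proof -
  have o: "openin T U" "open_eucl n (\<phi> ` U)"
    and h: "homeomorphic_map (subtopology T U) (subtopology (Euclidean_space n) (\<phi> ` U)) \<phi>"
    using assms by (auto simp: chart_on_def)
  have U: "topspace (subtopology T U) = U" using openin_subset[OF o(1)] by auto
  have c: "continuous_map (subtopology T U) (subtopology (Euclidean_space n) (\<phi> ` U)) \<phi>"
    "open_map (subtopology T U) (subtopology (Euclidean_space n) (\<phi> ` U)) \<phi>" and i: "inj_on \<phi> U"
    using homeomorphic_imp_continuous_map[OF h] homeomorphic_imp_open_map[OF h]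
      homeomorphic_imp_injective_map[OF h] unfolding U by blast+
  show "openin T U" "U \<subseteq> topspace T" "open_eucl n (\<phi> ` U)" "inj_on \<phi> U"
    using o i openin_subset by auto
  show "\<And>p. p \<in> U \<Longrightarrow> \<phi> p \<in> eucl n" using openin_subset[OF o(2)] by auto
  show "\<And>p. p \<in> U \<Longrightarrow> inv_into U \<phi> (\<phi> p) = p" using i by simp
  show "open_eucl n (\<phi> ` (U \<inter> W))" if "openin T W" for W
  proof -
    have "openin (subtopology T U) (U \<inter> W)" using that openin_subtopology_Int2 by blast
    then have "openin (subtopology (Euclidean_space n) (\<phi> ` U)) (\<phi> ` (U \<inter> W))"
      using c(2) by (simp add: open_map_def)
    then show ?thesis using openin_trans_full[OF _ o(2)] by blast
  qed
  show "openin T {p \<in> U. \<phi> p \<in> V}" if "open_eucl n V" for V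
  proof -
    have "openin (subtopology T U) {p \<in> topspace (subtopology T U). \<phi> p \<in> V}"
      using openin_continuous_map_preimage that c(1) continuous_map_in_subtopology by blast
    then show ?thesis unfolding U using openin_trans_full[OF _ o(1)] by blast
  qed
qed

lemma chart_onI:
  assumes U: "openin T U" and i: "inj_on \<phi> U" and E: "\<And>p. p \<in> U \<Longrightarrow> \<phi> p \<in> eucl n"
    and o: "\<And>W. openin T W \<Longrightarrow> W \<subseteq> U \<Longrightarrow> open_eucl n (\<phi> ` W)"
    and c: "\<And>V. open_eucl n V \<Longrightarrow> openin T {p \<in> U. \<phi> p \<in> V}"
  shows "chart_on T n (U, \<phi>)"
proof -
  have tU: "topspace (subtopology T U) = U" using openin_subset[OF U] by auto
  have im: "open_eucl n (\<phi> ` U)" using o[OF U] by auto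
  have timg: "topspace (subtopology (Euclidean_space n) (\<phi> ` U)) = \<phi> ` U" using openin_subset[OF im] by auto
  have "continuous_map (subtopology T U) (subtopology (Euclidean_space n) (\<phi> ` U)) \<phi>"
    unfolding continuous_map_in_subtopology
    unfolding continuous_map_def tU
    using E c by (auto simp: openin_open_subtopology[OF U])
  moreover have "open_map (subtopology T U) (subtopology (Euclidean_space n) (\<phi> ` U)) \<phi>"
    unfolding open_map_def using o by (auto simp: openin_open_subtopology[OF U] openin_open_subtopology[OF im])
  ultimately have "homeomorphic_map (subtopology T U) (subtopology (Euclidean_space n) (\<phi> ` U)) \<phi>"
    using i by (intro bijective_open_imp_homeomorphic_map) (simp_all only: tU timg)
  then show ?thesis using U im by (simp add: chart_on_def)
qed

text \<open>A chart is a homeomorphism onto an open set, so germs on the manifold correspond to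
  germs in coordinates.\<close>

lemma eventually_chart:
  assumes c: "chart_on T n (U, \<phi>)" and p: "p \<in> U"
  shows "(\<forall>\<^sub>F q in nhdsin T p. P q) \<longleftrightarrow> (\<forall>\<^sub>F x in near_eucl n (\<phi> p). P (inv_into U \<phi> x))"
proof
  note d = chart_onD[OF c]
  assume "\<forall>\<^sub>F q in nhdsin T p. P q"
  then obtain W where W: "openin T W" "p \<in> W" "\<forall>q\<in>W. P q"
    using p d(2) by (auto simp: eventually_nhdsin)
  have "\<forall>x\<in>\<phi> ` (U \<inter> W). P (inv_into U \<phi> x)" using W d(6) by auto
  then show "\<forall>\<^sub>F x in near_eucl n (\<phi> p). P (inv_into U \<phi> x)"
    using d(7)[OF W(1)] p W(2) unfolding eventually_nhdsin by blast
next
  note d = chart_onD[OF c]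
  assume "\<forall>\<^sub>F x in near_eucl n (\<phi> p). P (inv_into U \<phi> x)"
  then obtain V where V: "open_eucl n V" "\<phi> p \<in> V" "\<forall>x\<in>V. P (inv_into U \<phi> x)"
    using p d(5) by (auto simp: eventually_nhdsin)
  have "\<forall>q\<in>{q \<in> U. \<phi> q \<in> V}. P q" using V(3) d(6) by force
  then show "\<forall>\<^sub>F q in nhdsin T p. P q"
    using d(8)[OF V(1)] p V(2) unfolding eventually_nhdsin by blast
qed

lemma eventually_in_open: "openin T W \<Longrightarrow> p \<in> W \<Longrightarrow> \<forall>\<^sub>F q in nhdsin T p. q \<in> W"
  unfolding eventually_nhdsin by blast

text \<open>Transitions at a single point compose like germs, so overlaps of three chart domains
  need not be tracked.\<close>

definition smooth_transition_at :: "nat \<Rightarrow> 'a chart \<Rightarrow> 'a chart \<Rightarrow> 'a \<Rightarrow> bool" where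
  "smooth_transition_at n c d p \<longleftrightarrow>
     (\<forall>j<n. smooth_at n (\<lambda>x. snd d (inv_into (fst c) (snd c) x) j) (snd c p))"

lemma smooth_transition_iff_at:
  assumes c: "chart_on T n c" and d: "chart_on T n d"
  shows "smooth_transition n c d \<longleftrightarrow> (\<forall>p\<in>fst c \<inter> fst d. smooth_transition_at n c d p)"
proof -
  obtain U \<phi> V \<psi> where cd: "c = (U, \<phi>)" "d = (V, \<psi>)" by (cases c, cases d)
  have "open_eucl n (\<phi> ` (U \<inter> V))"
    using chart_onD(7)[OF c[unfolded cd]] chart_onD(1)[OF d[unfolded cd]] by blast
  from smooth_on_iff_at[OF this] show ?thesis
    by (auto simp: cd smooth_transition_def smooth_transition_at_def)
qed

lemma smooth_transition_at_trans:
  assumes c: "chart_on T n c" "chart_on T n d" "chart_on T n e" and p: "p \<in> fst c" "p \<in> fst d" "p \<in> fst e"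
    and cd: "smooth_transition_at n c d p" and de: "smooth_transition_at n d e p"
  shows "smooth_transition_at n c e p"
  unfolding smooth_transition_at_def
proof (intro allI impI)
  fix j assume j: "j < n"
  obtain U \<phi> V \<psi> W \<theta> where e: "c = (U, \<phi>)" "d = (V, \<psi>)" "e = (W, \<theta>)" by (cases c, cases d, cases e)
  note C = chart_onD[OF c(1)[unfolded e]] and D = chart_onD[OF c(2)[unfolded e]]
  have pp: "p \<in> U" "p \<in> V" "p \<in> W" using p by (auto simp: e)
  have t: "trunc n (\<lambda>j. \<psi> q j) = \<psi> q" if "q \<in> V" for q using trunc_id[OF D(5)[OF that]] by simp
  have "smooth_at n (\<lambda>x. (\<lambda>y. \<theta> (inv_into V \<psi> y) j) (trunc n (\<lambda>i. \<psi> (inv_into U \<phi> x) i))) (\<phi> p)"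
  proof (rule smooth_at_compose)
    show "\<phi> p \<in> eucl n" using C(5) pp by blast
    show "smooth_at n (\<lambda>x. \<psi> (inv_into U \<phi> x) i) (\<phi> p)" if "i < n" for i
      using cd that by (simp add: e smooth_transition_at_def)
    show "smooth_at n (\<lambda>y. \<theta> (inv_into V \<psi> y) j) (trunc n (\<lambda>i. \<psi> (inv_into U \<phi> (\<phi> p)) i))"
      using de j pp C(6) t by (simp add: e smooth_transition_at_def)
  qed
  moreover have "\<forall>\<^sub>F x in near_eucl n (\<phi> p). inv_into U \<phi> x \<in> V"
    using eventually_chart[OF c(1)[unfolded e] pp(1), of "\<lambda>q. q \<in> V"] eventually_in_open[OF D(1) pp(2)] by simp
  then have "\<forall>\<^sub>F x in near_eucl n (\<phi> p).
      (\<lambda>y. \<theta> (inv_into V \<psi> y) j) (trunc n (\<lambda>i. \<psi> (inv_into U \<phi> x) i)) = \<theta> (inv_into U \<phi> x) j"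
    by (rule eventually_mono) (simp add: t D(6))
  ultimately show "smooth_at n (\<lambda>x. snd e (inv_into (fst c) (snd c) x) j) (snd c p)"
    unfolding e fst_conv snd_conv by (rule smooth_at_cong[rotated])
qed

text \<open>Two charts compatible with all of \<open>\<A>\<close> are compatible with each other,
  because near a common point the transition between them factors through a chart of
  \<open>\<A>\<close>.\<close>

lemma smooth_manifold_atlasI:
  assumes T: "Hausdorff_space T" "second_countable T" and A: "\<And>c. c \<in> \<A> \<Longrightarrow> chart_on T n c"
    and cov: "\<And>p. p \<in> topspace T \<Longrightarrow> \<exists>c\<in>\<A>. p \<in> fst c"
    and comp: "\<And>c d p. c \<in> \<A> \<Longrightarrow> d \<in> \<A> \<Longrightarrow> p \<in> fst c \<Longrightarrow> p \<in> fst d \<Longrightarrow> smooth_transition_at n c d p"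
  shows "smooth_manifold \<lparr>mtop = T, mdim = n, matlas = maximal_atlas T n \<A>\<rparr>"
    "\<A> \<subseteq> maximal_atlas T n \<A>"
proof -
  let ?M = "maximal_atlas T n \<A>"
  have ch: "chart_on T n c" if "c \<in> ?M" for c using that by (auto simp: maximal_atlas_def)
  show sub: "\<A> \<subseteq> ?M"
    unfolding maximal_atlas_def using A comp smooth_transition_iff_at[OF A A] by blast
  have tr: "smooth_transition_at n c d p" if "c \<in> ?M" "d \<in> ?M" "p \<in> fst c" "p \<in> fst d" for c d p
  proof -
    have "p \<in> topspace T" using ch[OF that(1)] that(3) chart_onD(2) by (metis prod.collapse subsetD)
    then obtain e where e: "e \<in> \<A>" "p \<in> fst e" using cov by blast
    have "smooth_transition n c e" "smooth_transition n e d"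
      using that(1,2) e(1) by (auto simp: maximal_atlas_def)
    then have "smooth_transition_at n c e p" "smooth_transition_at n e d p"
      using smooth_transition_iff_at[OF ch[OF that(1)] A[OF e(1)]]
        smooth_transition_iff_at[OF A[OF e(1)] ch[OF that(2)]] e(2) that(3,4) by blast+
    then show ?thesis
      by (rule smooth_transition_at_trans[OF ch[OF that(1)] A[OF e(1)] ch[OF that(2)] that(3) e(2) that(4)])
  qed
  have "smooth_transition n c d" if "c \<in> ?M" "d \<in> ?M" for c d
    using smooth_transition_iff_at[OF ch[OF that(1)] ch[OF that(2)]] tr[OF that] by blast
  then have 1: "?M \<subseteq> maximal_atlas T n ?M"
    using ch unfolding maximal_atlas_def[of T n ?M] by blast
  have 2: "maximal_atlas T n ?M \<subseteq> ?M"
    using sub by (auto simp: maximal_atlas_def)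
  have 3: "(\<Union>(U, \<phi>)\<in>?M. U) = topspace T"
  proof (intro set_eqI iffI)
    fix p assume "p \<in> (\<Union>(U, \<phi>)\<in>?M. U)"
    then obtain U \<phi> where U: "(U, \<phi>) \<in> ?M" "p \<in> U" by blast
    from chart_onD(2)[OF ch[OF U(1)]] U(2) show "p \<in> topspace T" by blast
  next
    fix p assume "p \<in> topspace T"
    then obtain c where "c \<in> \<A>" "p \<in> fst c" using cov by blast
    then show "p \<in> (\<Union>(U, \<phi>)\<in>?M. U)" using sub by (intro UN_I[of c]) (auto simp: split_beta)
  qed
  show "smooth_manifold \<lparr>mtop = T, mdim = n, matlas = ?M\<rparr>"
    unfolding smooth_manifold_def using T 1 2 3 by simp
qed

lemma matlas_chart_on: "smooth_manifold M \<Longrightarrow> c \<in> matlas M \<Longrightarrow> chart_on (mtop M) (mdim M) c"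
  unfolding smooth_manifold_def maximal_atlas_def by blast

lemmas matlas_chartD = chart_onD[OF matlas_chart_on]

lemma matlas_transition:
  assumes M: "smooth_manifold M" and "c \<in> matlas M" "d \<in> matlas M" "p \<in> fst c" "p \<in> fst d"
  shows "smooth_transition_at (mdim M) c d p"
proof -
  have "smooth_transition (mdim M) c d"
    using assms unfolding smooth_manifold_def maximal_atlas_def by blast
  then show ?thesis
    using smooth_transition_iff_at[OF matlas_chart_on[OF M assms(2)] matlas_chart_on[OF M assms(3)]] assms(4,5) by blast
qed

lemma chart_exists:
  assumes "smooth_manifold M" "p \<in> points M"
  obtains U \<phi> where "(U, \<phi>) \<in> matlas M" "p \<in> U"
  using assms unfolding smooth_manifold_def by blast

text \<open>Transitions compose, so compatibility with one chart around each point spreads to all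
  charts there; the maximality of \<open>matlas M\<close> then admits \<open>c\<close>.\<close>

lemma matlasI:
  assumes M: "smooth_manifold M" and c: "chart_on (mtop M) (mdim M) c"
    and tr: "\<And>p. p \<in> fst c \<Longrightarrow> \<exists>d\<in>matlas M. p \<in> fst d \<and> smooth_transition_at (mdim M) c d p \<and> smooth_transition_at (mdim M) d c p"
  shows "c \<in> matlas M"
proof -
  have "smooth_transition (mdim M) c d \<and> smooth_transition (mdim M) d c" if d: "d \<in> matlas M" for d
  proof -
    have "smooth_transition_at (mdim M) c d p \<and> smooth_transition_at (mdim M) d c p" if p: "p \<in> fst c" "p \<in> fst d" for p
    proof -
      obtain e where e: "e \<in> matlas M" "p \<in> fst e" "smooth_transition_at (mdim M) c e p" "smooth_transition_at (mdim M) e c p"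
        using tr[OF p(1)] by blast
      note ch = matlas_chart_on[OF M d] matlas_chart_on[OF M e(1)]
      note ed = matlas_transition[OF M e(1) d e(2) p(2)] matlas_transition[OF M d e(1) p(2) e(2)]
      show ?thesis
        using smooth_transition_at_trans[OF c ch(2,1) p(1) e(2) p(2) e(3) ed(1)]
          smooth_transition_at_trans[OF ch c p(2) e(2) p(1) ed(2) e(4)] by blast
    qed
    then show ?thesis
      using smooth_transition_iff_at[OF c matlas_chart_on[OF M d]] smooth_transition_iff_at[OF matlas_chart_on[OF M d] c] by blast
  qed
  then have "c \<in> maximal_atlas (mtop M) (mdim M) (matlas M)" using c by (simp add: maximal_atlas_def)
  then show ?thesis using M unfolding smooth_manifold_def by blast
qed

lemma inv_into_subset: "inj_on \<phi> U \<Longrightarrow> W \<subseteq> U \<Longrightarrow> x \<in> \<phi> ` W \<Longrightarrow> inv_into W \<phi> x = inv_into U \<phi> x"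
  by (metis f_inv_into_f inv_into_f_eq inv_into_into subsetD)

lemma chart_restrict:
  assumes M: "smooth_manifold M" and c: "(U, \<phi>) \<in> matlas M" and W: "openin (mtop M) W" "W \<subseteq> U"
  shows "(W, \<phi>) \<in> matlas M"
proof -
  let ?n = "mdim M"
  note C = matlas_chartD[OF M c]
  have i: "inj_on \<phi> W" using inj_on_subset[OF C(4) W(2)] .
  have cW: "chart_on (mtop M) ?n (W, \<phi>)"
  proof (rule chart_onI[OF W(1) i])
    fix W' assume W': "openin (mtop M) W'" "W' \<subseteq> W"
    then have "U \<inter> W' = W'" using W(2) by blast
    then show "open_eucl ?n (\<phi> ` W')" using C(7)[OF W'(1)] by simp
  next
    fix V assume "open_eucl ?n V"
    from openin_Int[OF C(8)[OF this] W(1)] show "openin (mtop M) {p \<in> W. \<phi> p \<in> V}"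
      by (rule back_subst[of "openin (mtop M)"]) (use W(2) in auto)
  qed (use C(5) W(2) in auto)
  show ?thesis
  proof (rule matlasI[OF M cW], rule bexI[OF _ c], intro conjI)
    fix p assume "p \<in> fst (W, \<phi>)"
    then have p: "p \<in> W" "p \<in> U" using W(2) by auto
    show "p \<in> fst (U, \<phi>)" using p by simp
    have t: "smooth_transition_at ?n (U, \<phi>) (U, \<phi>) p" using matlas_transition[OF M c c] p by simp
    show "smooth_transition_at ?n (U, \<phi>) (W, \<phi>) p" using t by (simp add: smooth_transition_at_def)
    have "open_eucl ?n (\<phi> ` W)" using C(7)[OF W(1)] W(2) by (simp add: inf.absorb2)
    then have "\<forall>\<^sub>F x in near_eucl ?n (\<phi> p). x \<in> \<phi> ` W" by (rule eventually_in_open) (use p(1) in blast)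
    then have e: "\<forall>\<^sub>F x in near_eucl ?n (\<phi> p). \<phi> (inv_into U \<phi> x) j = \<phi> (inv_into W \<phi> x) j" for j
      by (rule eventually_mono) (simp add: inv_into_subset[OF C(4) W(2)])
    show "smooth_transition_at ?n (W, \<phi>) (U, \<phi>) p"
      unfolding smooth_transition_at_def fst_conv snd_conv
      using t smooth_at_cong[OF e] by (simp add: smooth_transition_at_def)
  qed
qed

section \<open>Functions smooth near a point\<close>

text \<open>The definition of \<open>smooth_near\<close> offers some chart; coordinate changes being
  smooth, any chart at \<open>p\<close> serves. Conversely, smoothness near \<open>\<phi> p\<close>
  becomes smoothness on a full chart image after shrinking the chart, and the shrunk chart belongs
  to the atlas by maximality.\<close>

lemma smooth_near_iff:
  assumes M: "smooth_manifold M" and c: "(U, \<phi>) \<in> matlas M" and p: "p \<in> U"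
  shows "smooth_near M p g \<longleftrightarrow> smooth_at (mdim M) (\<lambda>x. g (inv_into U \<phi> x)) (\<phi> p)"
proof
  let ?n = "mdim M"
  note C = matlas_chartD[OF M c]
  assume "smooth_near M p g"
  then obtain V \<psi> where d: "(V, \<psi>) \<in> matlas M" "p \<in> V" "smooth_on ?n (\<psi> ` V) (\<lambda>x. g (inv_into V \<psi> x))"
    by (auto simp: smooth_near_def)
  note D = matlas_chartD[OF M d(1)]
  have t: "trunc ?n (\<lambda>j. \<psi> q j) = \<psi> q" if "q \<in> V" for q using trunc_id[OF D(5)[OF that]] by simp
  have gs: "smooth_at ?n (\<lambda>x. g (inv_into V \<psi> x)) (\<psi> p)"
    using d(3) smooth_on_iff_at[OF D(3)] d(2) by blast
  have "smooth_at ?n (\<lambda>x. (\<lambda>y. g (inv_into V \<psi> y)) (trunc ?n (\<lambda>i. \<psi> (inv_into U \<phi> x) i))) (\<phi> p)"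
  proof (rule smooth_at_compose)
    show "\<phi> p \<in> eucl ?n" using C(5) p by blast
    show "smooth_at ?n (\<lambda>x. \<psi> (inv_into U \<phi> x) i) (\<phi> p)" if "i < ?n" for i
      using matlas_transition[OF M c d(1)] p d(2) that by (simp add: smooth_transition_at_def)
    show "smooth_at ?n (\<lambda>y. g (inv_into V \<psi> y)) (trunc ?n (\<lambda>i. \<psi> (inv_into U \<phi> (\<phi> p)) i))"
      using gs p C(6) t d(2) by simp
  qed
  moreover have "\<forall>\<^sub>F x in near_eucl ?n (\<phi> p). inv_into U \<phi> x \<in> V"
    using eventually_chart[OF matlas_chart_on[OF M c] p, of "\<lambda>q. q \<in> V"] eventually_in_open[OF D(1) d(2)] by simp
  then have "\<forall>\<^sub>F x in near_eucl ?n (\<phi> p).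
      (\<lambda>y. g (inv_into V \<psi> y)) (trunc ?n (\<lambda>i. \<psi> (inv_into U \<phi> x) i)) = g (inv_into U \<phi> x)"
    by (rule eventually_mono) (simp add: t D(6))
  ultimately show "smooth_at ?n (\<lambda>x. g (inv_into U \<phi> x)) (\<phi> p)" by (rule smooth_at_cong[rotated])
next
  let ?n = "mdim M"
  note C = matlas_chartD[OF M c]
  assume "smooth_at ?n (\<lambda>x. g (inv_into U \<phi> x)) (\<phi> p)"
  then obtain V where V: "open_eucl ?n V" "\<phi> p \<in> V" "smooth_on ?n V (\<lambda>x. g (inv_into U \<phi> x))"
    unfolding smooth_at_def by blast
  define W where "W = {q \<in> U. \<phi> q \<in> V}"
  have W: "openin (mtop M) W" "W \<subseteq> U" "p \<in> W" using C(8)[OF V(1)] p V(2) by (auto simp: W_def)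
  have cW: "(W, \<phi>) \<in> matlas M" by (rule chart_restrict[OF M c W(1,2)])
  have "smooth_on ?n (\<phi> ` W) (\<lambda>x. g (inv_into U \<phi> x))" by (rule smooth_on_subset[OF V(3)]) (auto simp: W_def)
  then have "smooth_on ?n (\<phi> ` W) (\<lambda>x. g (inv_into W \<phi> x))"
    by (rule smooth_on_cong[OF matlas_chartD(3)[OF M cW], rotated])
      (simp add: inv_into_subset[OF C(4) W(2)])
  then show "smooth_near M p g" using cW W(3) by (auto simp: smooth_near_def)
qed

lemma smooth_near_points: "smooth_manifold M \<Longrightarrow> smooth_near M p g \<Longrightarrow> p \<in> points M"
proof -
  assume M: "smooth_manifold M" and "smooth_near M p g"
  then obtain U \<phi> where "(U, \<phi>) \<in> matlas M" "p \<in> U" by (auto simp: smooth_near_def)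
  with matlas_chartD(2)[OF M] show ?thesis by blast
qed

lemma smooth_near_cong:
  assumes M: "smooth_manifold M" and ev: "\<forall>\<^sub>F q in nhdsin (mtop M) p. g q = h q" and g: "smooth_near M p g"
  shows "smooth_near M p h"
proof -
  obtain U \<phi> where c: "(U, \<phi>) \<in> matlas M" "p \<in> U" using chart_exists M smooth_near_points[OF M g] by metis
  have "\<forall>\<^sub>F x in near_eucl (mdim M) (\<phi> p). g (inv_into U \<phi> x) = h (inv_into U \<phi> x)"
    using eventually_chart[OF matlas_chart_on[OF M c(1)] c(2), of "\<lambda>q. g q = h q"] ev by simp
  from smooth_at_cong[OF this] show ?thesis using g smooth_near_iff[OF M c] by blast
qed

lemma smooth_near_compose:
  assumes M: "smooth_manifold M" and p: "p \<in> points M"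
    and G: "smooth_at m G (trunc m (\<lambda>j. h j p))" and h: "\<And>j. j < m \<Longrightarrow> smooth_near M p (h j)"
  shows "smooth_near M p (\<lambda>q. G (trunc m (\<lambda>j. h j q)))"
proof -
  obtain U \<phi> where c: "(U, \<phi>) \<in> matlas M" "p \<in> U" using chart_exists M p by metis
  note C = matlas_chartD[OF M c(1)]
  have "smooth_at (mdim M) (\<lambda>x. G (trunc m (\<lambda>j. h j (inv_into U \<phi> x)))) (\<phi> p)"
  proof (rule smooth_at_compose)
    show "\<phi> p \<in> eucl (mdim M)" using C(5) c by blast
    show "smooth_at m G (trunc m (\<lambda>j. h j (inv_into U \<phi> (\<phi> p))))" using G C(6) c by simp
    show "smooth_at (mdim M) (\<lambda>x. h j (inv_into U \<phi> x)) (\<phi> p)" if "j < m" for j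
      using h[OF that] smooth_near_iff[OF M c] by blast
  qed
  then show ?thesis using smooth_near_iff[OF M c] by blast
qed

lemma smooth_near_coord:
  assumes M: "smooth_manifold M" and c: "(U, \<phi>) \<in> matlas M" "p \<in> U"
  shows "smooth_near M p (\<lambda>q. \<phi> q j)"
proof -
  note C = matlas_chartD[OF M c(1)]
  have "\<forall>\<^sub>F x in near_eucl (mdim M) (\<phi> p). x \<in> \<phi> ` U"
    using eventually_in_open[OF C(3)] c(2) by blast
  then have "\<forall>\<^sub>F x in near_eucl (mdim M) (\<phi> p). x j = \<phi> (inv_into U \<phi> x) j"
    by (rule eventually_mono) (simp add: f_inv_into_f)
  from smooth_at_cong[OF this smooth_at_coord] show ?thesis
    unfolding smooth_near_iff[OF M c] using C(5) c(2) by blast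
qed

lemma smooth_near_add:
  assumes M: "smooth_manifold M" and gh: "smooth_near M p g" "smooth_near M p h"
  shows "smooth_near M p (\<lambda>q. g q + h q)"
proof -
  obtain U \<phi> where c: "(U, \<phi>) \<in> matlas M" "p \<in> U" using chart_exists M smooth_near_points[OF M gh(1)] by metis
  show ?thesis using gh unfolding smooth_near_iff[OF M c] by (rule smooth_at_add)
qed

lemma smooth_near_diff:
  assumes M: "smooth_manifold M" and gh: "smooth_near M p g" "smooth_near M p h"
  shows "smooth_near M p (\<lambda>q. g q - h q)"
proof -
  obtain U \<phi> where c: "(U, \<phi>) \<in> matlas M" "p \<in> U" using chart_exists M smooth_near_points[OF M gh(1)] by metis
  show ?thesis using gh unfolding smooth_near_iff[OF M c] by (rule smooth_at_diff)
qed

section \<open>Smooth maps\<close>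

lemma smooth_mapD:
  "smooth_map M N F \<Longrightarrow> p \<in> points M \<Longrightarrow> (V, \<psi>) \<in> matlas N \<Longrightarrow> F p \<in> V \<Longrightarrow> j < mdim N \<Longrightarrow>
    smooth_near M p (\<lambda>q. \<psi> (F q) j)"
  unfolding smooth_map_def by blast

lemma smooth_map_continuous: "smooth_map M N F \<Longrightarrow> continuous_map (mtop M) (mtop N) F"
  by (simp add: smooth_map_def)

lemma smooth_map_points: "smooth_map M N F \<Longrightarrow> p \<in> points M \<Longrightarrow> F p \<in> points N"
  using smooth_map_continuous continuous_map_funspace by blast

lemma eventually_continuous_map:
  assumes "continuous_map S T F" "p \<in> topspace S" "\<forall>\<^sub>F q in nhdsin T (F p). P q"
  shows "\<forall>\<^sub>F q in nhdsin S p. P (F q)"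
proof -
  have "F p \<in> topspace T" using assms(1,2) continuous_map_funspace by blast
  then obtain W where W: "openin T W" "F p \<in> W" "\<forall>q\<in>W. P q" using assms(3) by (auto simp: eventually_nhdsin)
  have "openin S {q \<in> topspace S. F q \<in> W}" using assms(1) W(1) openin_continuous_map_preimage by blast
  then show ?thesis unfolding eventually_nhdsin using W assms(2) by blast
qed

lemma smooth_near_pullback:
  assumes M: "smooth_manifold M" and N: "smooth_manifold N" and F: "smooth_map M N F" and p: "p \<in> points M"
    and g: "smooth_near N (F p) g"
  shows "smooth_near M p (\<lambda>q. g (F q))"
proof -
  obtain V \<psi> where d: "(V, \<psi>) \<in> matlas N" "F p \<in> V"
    using chart_exists[OF N smooth_map_points[OF F p]] by metis
  note D = matlas_chartD[OF N d(1)]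
  have t: "trunc (mdim N) (\<lambda>j. \<psi> q j) = \<psi> q" if "q \<in> V" for q using trunc_id[OF D(5)[OF that]] by simp
  have "smooth_near M p (\<lambda>q. (\<lambda>y. g (inv_into V \<psi> y)) (trunc (mdim N) (\<lambda>j. \<psi> (F q) j)))"
  proof (rule smooth_near_compose[OF M p])
    show "smooth_at (mdim N) (\<lambda>y. g (inv_into V \<psi> y)) (trunc (mdim N) (\<lambda>j. \<psi> (F p) j))"
      using g t d smooth_near_iff[OF N d] by simp
    show "smooth_near M p (\<lambda>q. \<psi> (F q) j)" if "j < mdim N" for j
      by (rule smooth_mapD[OF F p d that])
  qed
  moreover have "\<forall>\<^sub>F q in nhdsin (mtop M) p. F q \<in> V"
    using eventually_continuous_map[OF smooth_map_continuous[OF F] p eventually_in_open[OF D(1) d(2)]] .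
  then have "\<forall>\<^sub>F q in nhdsin (mtop M) p. (\<lambda>y. g (inv_into V \<psi> y)) (trunc (mdim N) (\<lambda>j. \<psi> (F q) j)) = g (F q)"
    by (rule eventually_mono) (simp add: t D(6))
  ultimately show ?thesis by (rule smooth_near_cong[OF M, rotated])
qed

text \<open>\<open>smooth_map\<close> quantifies over all charts of \<open>N\<close> at
  \<open>F p\<close>; one is enough because coordinate changes of \<open>N\<close> are
  smooth.\<close>

lemma smooth_mapI:
  assumes M: "smooth_manifold M" and N: "smooth_manifold N" and F: "continuous_map (mtop M) (mtop N) F"
    and ch: "\<And>p. p \<in> points M \<Longrightarrow> \<exists>V \<psi>. (V, \<psi>) \<in> matlas N \<and> F p \<in> V \<and> (\<forall>j<mdim N. smooth_near M p (\<lambda>q. \<psi> (F q) j))"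
  shows "smooth_map M N F"
  unfolding smooth_map_def
proof (intro conjI F ballI, clarify)
  fix p U \<phi> j assume p: "p \<in> points M" and c: "(U, \<phi>) \<in> matlas N" "F p \<in> U" and j: "j < mdim N"
  obtain V \<psi> where d: "(V, \<psi>) \<in> matlas N" "F p \<in> V" "\<And>j. j < mdim N \<Longrightarrow> smooth_near M p (\<lambda>q. \<psi> (F q) j)"
    using ch[OF p] by blast
  note D = matlas_chartD[OF N d(1)]
  have t: "trunc (mdim N) (\<lambda>j. \<psi> q j) = \<psi> q" if "q \<in> V" for q using trunc_id[OF D(5)[OF that]] by simp
  have "smooth_near M p (\<lambda>q. (\<lambda>y. \<phi> (inv_into V \<psi> y) j) (trunc (mdim N) (\<lambda>j. \<psi> (F q) j)))"
  proof (rule smooth_near_compose[OF M p _ d(3)])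
    show "smooth_at (mdim N) (\<lambda>y. \<phi> (inv_into V \<psi> y) j) (trunc (mdim N) (\<lambda>j. \<psi> (F p) j))"
      using smooth_near_coord[OF N c] t d smooth_near_iff[OF N d(1,2)] by simp
  qed
  moreover have "\<forall>\<^sub>F q in nhdsin (mtop M) p. F q \<in> V"
    using eventually_continuous_map[OF F p eventually_in_open[OF D(1) d(2)]] .
  then have "\<forall>\<^sub>F q in nhdsin (mtop M) p. (\<lambda>y. \<phi> (inv_into V \<psi> y) j) (trunc (mdim N) (\<lambda>j. \<psi> (F q) j)) = \<phi> (F q) j"
    by (rule eventually_mono) (simp add: t D(6))
  ultimately show "smooth_near M p (\<lambda>q. \<phi> (F q) j)" by (rule smooth_near_cong[OF M, rotated])
qed

lemma smooth_map_compose: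
  assumes M: "smooth_manifold M" and N: "smooth_manifold N" and P: "smooth_manifold P"
    and F: "smooth_map M N F" and G: "smooth_map N P G"
  shows "smooth_map M P (\<lambda>q. G (F q))"
proof (rule smooth_mapI[OF M P])
  show "continuous_map (mtop M) (mtop P) (\<lambda>q. G (F q))"
    using continuous_map_compose[OF smooth_map_continuous[OF F] smooth_map_continuous[OF G]] by (simp add: o_def)
  fix p assume p: "p \<in> points M"
  obtain V \<psi> where d: "(V, \<psi>) \<in> matlas P" "G (F p) \<in> V"
    using chart_exists[OF P smooth_map_points[OF G smooth_map_points[OF F p]]] by metis
  have "smooth_near N (F p) (\<lambda>q. \<psi> (G q) j)" for j
    using smooth_near_pullback[OF N P G smooth_map_points[OF F p] smooth_near_coord[OF P d]] .
  from smooth_near_pullback[OF M N F p this]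
  show "\<exists>V \<psi>. (V, \<psi>) \<in> matlas P \<and> G (F p) \<in> V \<and> (\<forall>j<mdim P. smooth_near M p (\<lambda>q. \<psi> (G (F q)) j))"
    using d by blast
qed

lemma smooth_map_id: "smooth_manifold M \<Longrightarrow> smooth_map M M (\<lambda>x. x)"
proof (rule smooth_mapI)
  fix p assume M: "smooth_manifold M" and p: "p \<in> points M"
  obtain V \<psi> where d: "(V, \<psi>) \<in> matlas M" "p \<in> V" using chart_exists[OF M p] by metis
  then show "\<exists>V \<psi>. (V, \<psi>) \<in> matlas M \<and> p \<in> V \<and> (\<forall>j<mdim M. smooth_near M p (\<lambda>q. \<psi> q j))"
    using smooth_near_coord[OF M d] by blast
qed simp_all

text \<open>Used through \<open>submanifold_diffeo\<close> to pull submanifolds back under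
  reorderings of factors and under the identification of a copy with its original.\<close>

lemma matlas_diffeo:
  assumes M: "smooth_manifold M" and N: "smooth_manifold N" and F: "smooth_map M N F" and G: "smooth_map N M G"
    and GF: "\<And>p. p \<in> points M \<Longrightarrow> G (F p) = p" and FG: "\<And>q. q \<in> points N \<Longrightarrow> F (G q) = q"
    and dim: "mdim M = mdim N" and c: "(U, \<phi>) \<in> matlas N"
  shows "({p \<in> points M. F p \<in> U}, \<lambda>p. \<phi> (F p)) \<in> matlas M"
proof -
  let ?n = "mdim M" and ?U = "{p \<in> points M. F p \<in> U}" and ?\<phi> = "\<lambda>p. \<phi> (F p)"
  note C = chart_onD[OF matlas_chart_on[OF N c], folded dim]
  have Uo: "openin (mtop M) ?U" using openin_continuous_map_preimage[OF smooth_map_continuous[OF F] C(1)] .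
  have inj: "inj_on ?\<phi> ?U"
  proof (rule inj_onI)
    fix p q assume pq: "p \<in> ?U" "q \<in> ?U" "\<phi> (F p) = \<phi> (F q)"
    then have "F p = F q" using inj_onD[OF C(4)] by blast
    then have "G (F p) = G (F q)" by simp
    then show "p = q" using GF pq by simp
  qed
  have inv: "inv_into ?U ?\<phi> x = G (inv_into U \<phi> x)" if "x \<in> \<phi> ` U" for x
  proof -
    have i: "inv_into U \<phi> x \<in> U" "\<phi> (inv_into U \<phi> x) = x" using that by (auto simp: inv_into_into f_inv_into_f)
    then have "inv_into U \<phi> x \<in> points N" using C(2) by blast
    then show ?thesis
      using i FG smooth_map_points[OF G] by (intro inv_into_f_eq[OF inj]) auto
  qed
  have ch: "chart_on (mtop M) ?n (?U, ?\<phi>)"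
  proof (rule chart_onI[OF Uo inj])
    show "\<phi> (F p) \<in> eucl ?n" if "p \<in> ?U" for p using C(5) that by simp
    fix W assume W: "openin (mtop M) W" "W \<subseteq> ?U"
    have "openin (mtop N) {q \<in> points N. G q \<in> W}"
      using openin_continuous_map_preimage[OF smooth_map_continuous[OF G] W(1)] .
    from C(7)[OF this] have "open_eucl ?n (\<phi> ` (U \<inter> {q \<in> points N. G q \<in> W}))" .
    moreover have "?\<phi> ` W = \<phi> ` (U \<inter> {q \<in> points N. G q \<in> W})"
    proof (intro set_eqI iffI)
      fix x assume "x \<in> ?\<phi> ` W"
      then obtain p where p: "p \<in> W" "x = \<phi> (F p)" by blast
      then have "F p \<in> U \<inter> {q \<in> points N. G q \<in> W}"
        using W(2) GF smooth_map_points[OF F] by auto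
      then show "x \<in> \<phi> ` (U \<inter> {q \<in> points N. G q \<in> W})" using p by blast
    next
      fix x assume "x \<in> \<phi> ` (U \<inter> {q \<in> points N. G q \<in> W})"
      then obtain q where "q \<in> U" "q \<in> points N" "G q \<in> W" "x = \<phi> q" by blast
      then have "x = ?\<phi> (G q)" "G q \<in> W" using FG by auto
      then show "x \<in> ?\<phi> ` W" by blast
    qed
    ultimately show "open_eucl ?n (?\<phi> ` W)" by simp
  next
    fix V assume "open_eucl ?n V"
    from openin_continuous_map_preimage[OF smooth_map_continuous[OF F] C(8)[OF this]]
    show "openin (mtop M) {p \<in> ?U. ?\<phi> p \<in> V}" by (rule back_subst[of "openin (mtop M)"]) auto
  qed
  show ?thesis
  proof (rule matlasI[OF M ch])
    fix p assume "p \<in> fst (?U, ?\<phi>)"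
    then have p: "p \<in> points M" "F p \<in> U" by auto
    obtain V \<psi> where d: "(V, \<psi>) \<in> matlas M" "p \<in> V" using chart_exists[OF M p(1)] by metis
    have "smooth_transition_at ?n (V, \<psi>) (?U, ?\<phi>) p"
      unfolding smooth_transition_at_def fst_conv snd_conv
      using iffD1[OF smooth_near_iff[OF M d] smooth_near_pullback[OF M N F p(1) smooth_near_coord[OF N c p(2)]]] by blast
    moreover have "smooth_transition_at ?n (?U, ?\<phi>) (V, \<psi>) p"
      unfolding smooth_transition_at_def fst_conv snd_conv
    proof (intro allI impI)
      fix j
      have Fp: "F p \<in> points N" "G (F p) \<in> V" using smooth_map_points[OF F p(1)] GF p d by auto
      have "smooth_near N (F p) (\<lambda>q. \<psi> (G q) j)"
        by (rule smooth_near_pullback[OF N M G Fp(1) smooth_near_coord[OF M d(1) Fp(2)]])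
      then have s: "smooth_at ?n (\<lambda>x. \<psi> (G (inv_into U \<phi> x)) j) (\<phi> (F p))"
        using smooth_near_iff[OF N c p(2)] dim by simp
      have "\<forall>\<^sub>F x in near_eucl ?n (\<phi> (F p)). x \<in> \<phi> ` U"
        using eventually_in_open[OF C(3)] p(2) by blast
      then have "\<forall>\<^sub>F x in near_eucl ?n (\<phi> (F p)). \<psi> (G (inv_into U \<phi> x)) j = \<psi> (inv_into ?U ?\<phi> x) j"
        by (rule eventually_mono) (simp add: inv)
      from smooth_at_cong[OF this s]
      show "smooth_at ?n (\<lambda>x. \<psi> (inv_into ?U ?\<phi> x) j) (\<phi> (F p))" .
    qed
    ultimately show "\<exists>d\<in>matlas M. p \<in> fst d \<and> smooth_transition_at ?n (?U, ?\<phi>) d p \<and> smooth_transition_at ?n d (?U, ?\<phi>) p"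
      using d by (intro bexI[OF _ d(1)]) auto
  qed
qed

text \<open>Source of the specially adapted charts: permuted coordinates, the shear along a map, a
  translated origin. The explicit smooth inverse \<open>\<Xi>\<close> gives injectivity, openness of
  images and smoothness of the inverse transition.\<close>

lemma matlas_change_coordinates:
  assumes M: "smooth_manifold M" and c: "(U, \<phi>) \<in> matlas M"
    and \<Theta>: "\<And>p. p \<in> U \<Longrightarrow> \<Theta> (\<phi> p) \<in> eucl (mdim M)" "\<And>p. p \<in> U \<Longrightarrow> \<Xi> (\<Theta> (\<phi> p)) = \<phi> p"
    and o: "open_eucl (mdim M) (\<Theta> ` \<phi> ` U)"
    and s\<Theta>: "\<And>p j. p \<in> U \<Longrightarrow> j < mdim M \<Longrightarrow> smooth_at (mdim M) (\<lambda>x. \<Theta> x j) (\<phi> p)"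
    and s\<Xi>: "\<And>p j. p \<in> U \<Longrightarrow> j < mdim M \<Longrightarrow> smooth_at (mdim M) (\<lambda>x. \<Xi> x j) (\<Theta> (\<phi> p))"
  shows "(U, \<lambda>p. \<Theta> (\<phi> p)) \<in> matlas M"
proof -
  let ?n = "mdim M" and ?\<phi> = "\<lambda>p. \<Theta> (\<phi> p)"
  note C = matlas_chartD[OF M c]
  have inj: "inj_on ?\<phi> U" 
  proof (rule inj_onI)
    fix p q assume pq: "p \<in> U" "q \<in> U" "\<Theta> (\<phi> p) = \<Theta> (\<phi> q)"
    have "\<phi> p = \<Xi> (\<Theta> (\<phi> p))" by (rule \<Theta>(2)[OF pq(1), symmetric])
    also have "\<dots> = \<phi> q" unfolding pq(3) by (rule \<Theta>(2)[OF pq(2)])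
    finally show "p = q" by (rule inj_onD[OF C(4) _ pq(1,2)])
  qed
  have inv: "inv_into U ?\<phi> x = inv_into U \<phi> (\<Xi> x)" if "x \<in> ?\<phi> ` U" for x
  proof -
    from that obtain p where p: "p \<in> U" "x = \<Theta> (\<phi> p)" by (elim imageE)
    have "inv_into U ?\<phi> x = p" unfolding p(2) by (rule inv_into_f_f[OF inj p(1)])
    then show ?thesis using \<Theta>(2)[OF p(1)] C(6)[OF p(1)] p(2) by simp
  qed
  have t\<Theta>: "trunc ?n (\<lambda>j. \<Theta> (\<phi> p) j) = \<Theta> (\<phi> p)" if "p \<in> U" for p using trunc_id[OF \<Theta>(1)[OF that]] by simp
  have t\<phi>: "trunc ?n (\<lambda>j. \<phi> p j) = \<phi> p" if "p \<in> U" for p using trunc_id[OF C(5)[OF that]] by simp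
  have \<Theta>on: "smooth_on ?n (\<phi> ` U) (\<lambda>x. \<Theta> x j)" if "j < ?n" for j
    unfolding smooth_on_iff_at[OF C(3)] using s\<Theta> that by simp
  have \<Xi>on: "smooth_on ?n (\<Theta> ` \<phi> ` U) (\<lambda>x. \<Xi> x j)" if "j < ?n" for j
    unfolding smooth_on_iff_at[OF o] using s\<Xi> that by simp
  have ch: "chart_on (mtop M) ?n (U, ?\<phi>)"
  proof (rule chart_onI[OF C(1) inj \<Theta>(1)])
    fix W assume W: "openin (mtop M) W" "W \<subseteq> U"
    have "open_eucl ?n {x \<in> \<Theta> ` \<phi> ` U. trunc ?n (\<lambda>j. \<Xi> x j) \<in> \<phi> ` (U \<inter> W)}"
      by (rule smooth_preimage_open[OF o, of ?n "\<lambda>j x. \<Xi> x j", OF \<Xi>on C(7)[OF W(1)]])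
    moreover have "{x \<in> \<Theta> ` \<phi> ` U. trunc ?n (\<lambda>j. \<Xi> x j) \<in> \<phi> ` (U \<inter> W)} = ?\<phi> ` W"
    proof (intro set_eqI iffI)
      fix x assume "x \<in> {x \<in> \<Theta> ` \<phi> ` U. trunc ?n (\<lambda>j. \<Xi> x j) \<in> \<phi> ` (U \<inter> W)}"
      then obtain p q where pq: "p \<in> U" "x = ?\<phi> p" "q \<in> U" "q \<in> W" "trunc ?n (\<lambda>j. \<Xi> x j) = \<phi> q" by blast
      then have "\<phi> p = \<phi> q" using \<Theta>(2)[OF pq(1)] t\<phi>[OF pq(1)] by simp
      then show "x \<in> ?\<phi> ` W" using pq by auto
    next
      fix x assume "x \<in> ?\<phi> ` W"
      then obtain p where p: "p \<in> W" "x = ?\<phi> p" by (elim imageE)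
      then have "p \<in> U" using W(2) by blast
      moreover from this have "trunc ?n (\<lambda>j. \<Xi> x j) = \<phi> p" using p \<Theta>(2) t\<phi> by simp
      ultimately show "x \<in> {x \<in> \<Theta> ` \<phi> ` U. trunc ?n (\<lambda>j. \<Xi> x j) \<in> \<phi> ` (U \<inter> W)}" using p by blast
    qed
    ultimately show "open_eucl ?n (?\<phi> ` W)" by simp
  next
    fix V assume V: "open_eucl ?n V"
    have "open_eucl ?n {x \<in> \<phi> ` U. trunc ?n (\<lambda>j. \<Theta> x j) \<in> V}"
      by (rule smooth_preimage_open[OF C(3), of ?n "\<lambda>j x. \<Theta> x j", OF \<Theta>on V])
    from C(8)[OF this] show "openin (mtop M) {p \<in> U. ?\<phi> p \<in> V}"
      by (rule back_subst[of "openin (mtop M)"]) (auto simp: t\<Theta>)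
  qed
  show ?thesis
  proof (rule matlasI[OF M ch])
    fix p assume "p \<in> fst (U, ?\<phi>)"
    then have p: "p \<in> U" by simp
    have t: "smooth_at ?n (\<lambda>x. \<phi> (inv_into U \<phi> x) j) (\<phi> p)" for j
      by (rule iffD1[OF smooth_near_iff[OF M c p] smooth_near_coord[OF M c p]])
    have s1: "smooth_at ?n (\<lambda>x. (\<lambda>y. \<Theta> y j) (trunc ?n (\<lambda>i. \<phi> (inv_into U \<phi> x) i))) (\<phi> p)" if "j < ?n" for j
    proof (rule smooth_at_compose[OF C(5)[OF p] _ t])
      show "smooth_at ?n (\<lambda>y. \<Theta> y j) (trunc ?n (\<lambda>i. \<phi> (inv_into U \<phi> (\<phi> p)) i))"
        unfolding C(6)[OF p] t\<phi>[OF p] by (rule s\<Theta>[OF p that])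
    qed
    have "\<forall>\<^sub>F x in near_eucl ?n (\<phi> p). inv_into U \<phi> x \<in> U"
      using eventually_chart[OF matlas_chart_on[OF M c] p, of "\<lambda>q. q \<in> U"] eventually_in_open[OF C(1) p] by simp
    then have e1: "\<forall>\<^sub>F x in near_eucl ?n (\<phi> p). (\<lambda>y. \<Theta> y j) (trunc ?n (\<lambda>i. \<phi> (inv_into U \<phi> x) i)) = \<Theta> (\<phi> (inv_into U \<phi> x)) j" for j
      by (rule eventually_mono) (simp add: t\<phi>)
    have 1: "smooth_transition_at ?n (U, \<phi>) (U, ?\<phi>) p"
      unfolding smooth_transition_at_def fst_conv snd_conv by (intro allI impI) (rule smooth_at_cong[OF e1 s1])
    have s2: "smooth_at ?n (\<lambda>x. (\<lambda>y. \<phi> (inv_into U \<phi> y) j) (trunc ?n (\<lambda>i. \<Xi> x i))) (?\<phi> p)" for j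
    proof (rule smooth_at_compose[OF \<Theta>(1)[OF p] _ s\<Xi>[OF p]])
      show "smooth_at ?n (\<lambda>y. \<phi> (inv_into U \<phi> y) j) (trunc ?n (\<lambda>i. \<Xi> (\<Theta> (\<phi> p)) i))"
        unfolding \<Theta>(2)[OF p] t\<phi>[OF p] by (rule t)
    qed
    have "\<forall>\<^sub>F x in near_eucl ?n (?\<phi> p). x \<in> \<Theta> ` \<phi> ` U"
      by (rule eventually_in_open[OF o]) (use p in blast)
    then have e2: "\<forall>\<^sub>F x in near_eucl ?n (?\<phi> p). (\<lambda>y. \<phi> (inv_into U \<phi> y) j) (trunc ?n (\<lambda>i. \<Xi> x i)) = \<phi> (inv_into U ?\<phi> x) j" for j
    proof (rule eventually_mono)
      fix x assume "x \<in> \<Theta> ` \<phi> ` U"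
      then obtain q where q: "q \<in> U" "x = \<Theta> (\<phi> q)" by (elim imageE) simp
      show "(\<lambda>y. \<phi> (inv_into U \<phi> y) j) (trunc ?n (\<lambda>i. \<Xi> x i)) = \<phi> (inv_into U ?\<phi> x) j"
        unfolding q(2) \<Theta>(2)[OF q(1)] t\<phi>[OF q(1)] C(6)[OF q(1)] inv_into_f_f[OF inj q(1)] ..
    qed
    have 2: "smooth_transition_at ?n (U, ?\<phi>) (U, \<phi>) p"
      unfolding smooth_transition_at_def fst_conv snd_conv by (intro allI impI) (rule smooth_at_cong[OF e2 s2])
    from 1 2 show "\<exists>d\<in>matlas M. p \<in> fst d \<and> smooth_transition_at ?n (U, ?\<phi>) d p \<and> smooth_transition_at ?n d (U, ?\<phi>) p"
      using p by (intro bexI[OF _ c]) simp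
  qed
qed

section \<open>Products, copies and induced manifolds\<close>

lemma second_countable_prod_topology:
  assumes "second_countable S" "second_countable T" shows "second_countable (prod_topology S T)"
proof -
  obtain A where A: "countable A" "\<And>V. V \<in> A \<Longrightarrow> openin S V" "\<And>U x. openin S U \<Longrightarrow> x \<in> U \<Longrightarrow> \<exists>V\<in>A. x \<in> V \<and> V \<subseteq> U"
    using assms(1) unfolding second_countable_def by metis
  obtain B where B: "countable B" "\<And>V. V \<in> B \<Longrightarrow> openin T V" "\<And>U x. openin T U \<Longrightarrow> x \<in> U \<Longrightarrow> \<exists>V\<in>B. x \<in> V \<and> V \<subseteq> U"
    using assms(2) unfolding second_countable_def by metis
  show ?thesis
    unfolding second_countable_def
  proof (intro exI[of _ "(\<lambda>(a, b). a \<times> b) ` (A \<times> B)"] conjI ballI allI impI)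
    show "countable ((\<lambda>(a, b). a \<times> b) ` (A \<times> B))" using A(1) B(1) by simp
    show "openin (prod_topology S T) V" if "V \<in> (\<lambda>(a, b). a \<times> b) ` (A \<times> B)" for V
      using that A(2) B(2) by (auto simp: openin_prod_Times_iff)
    fix U p assume "openin (prod_topology S T) U \<and> p \<in> U"
    moreover obtain x y where p: "p = (x, y)" by (cases p)
    ultimately obtain V W where VW: "openin S V" "openin T W" "x \<in> V" "y \<in> W" "V \<times> W \<subseteq> U"
      unfolding openin_prod_topology_alt by blast
    obtain a b where ab: "a \<in> A" "x \<in> a" "a \<subseteq> V" "b \<in> B" "y \<in> b" "b \<subseteq> W"
      using A(3)[OF VW(1,3)] B(3)[OF VW(2,4)] by blast
    then have "a \<times> b \<subseteq> U" using VW(5) by blast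
    then show "\<exists>V\<in>(\<lambda>(a, b). a \<times> b) ` (A \<times> B). p \<in> V \<and> V \<subseteq> U"
      using ab p by (intro bexI[of _ "a \<times> b"]) auto
  qed
qed

definition join :: "nat \<Rightarrow> (nat \<Rightarrow> real) \<Rightarrow> (nat \<Rightarrow> real) \<Rightarrow> nat \<Rightarrow> real" where
  "join m a b = (\<lambda>i. if i < m then a i else b (i - m))"

lemma join_in: "a \<in> eucl m \<Longrightarrow> b \<in> eucl n \<Longrightarrow>
    join m a b \<in> eucl (m + n)"
  by (auto simp: join_def in_Euclidean_space)

lemma trunc_join: "a \<in> eucl m \<Longrightarrow> trunc m (join m a b) = a"
  by (auto simp: join_def in_Euclidean_space trunc_def fun_eq_iff)

lemma trunc_join_shift: "b \<in> eucl n \<Longrightarrow> trunc n (\<lambda>j. join m a b (m + j)) = b"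
  by (auto simp: join_def in_Euclidean_space trunc_def fun_eq_iff)

lemma join_trunc: "z \<in> eucl (m + n) \<Longrightarrow> join m (trunc m z) (trunc n (\<lambda>j. z (m + j))) = z"
  by (auto simp: join_def in_Euclidean_space trunc_def fun_eq_iff)

lemma prod_chart_eq:
  "prod_chart m (U, \<phi>) (V, \<psi>) = (U \<times> V, \<lambda>p. join m (\<phi> (fst p)) (\<psi> (snd p)))"
  by (auto simp: prod_chart_def join_def fun_eq_iff)

lemma chart_on_component:
  assumes c: "chart_on S n (U, \<phi>)"
  shows "continuous_map (subtopology S U) euclideanreal (\<lambda>x. \<phi> x i)"
proof -
  note C = chart_onD[OF c]
  have tU: "topspace (subtopology S U) = U" using C(2) by auto
  have "continuous_map (subtopology S U) (Euclidean_space n) \<phi>"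
    unfolding continuous_map_def tU using C(5,8) by (auto simp: openin_open_subtopology[OF C(1)])
  moreover have "continuous_map (Euclidean_space n) euclideanreal (\<lambda>x. x i)"
    unfolding Euclidean_space_def by (intro continuous_map_from_subtopology continuous_map_product_projection) simp
  ultimately show ?thesis using continuous_map_compose[of "subtopology S U" "Euclidean_space n" \<phi> _ "\<lambda>x. x i"] by (simp add: o_def)
qed

lemma openin_join_box:
  assumes "open_eucl m A" "open_eucl n B"
  shows "open_eucl (m + n) {z \<in> eucl (m + n). trunc m z \<in> A \<and> trunc n (\<lambda>j. z (m + j)) \<in> B}"
proof -
  let ?E = "eucl (m + n)"
  have s: "smooth_on (m + n) ?E (\<lambda>z. z j)" for j by (simp add: smooth_on_def Ck_on_coord)
  have "open_eucl (m + n) {z \<in> ?E. trunc m (\<lambda>j. z j) \<in> A}"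
    by (rule smooth_preimage_open[of _ _ m "\<lambda>j z. z j", OF openin_topspace s assms(1)])
  moreover have "open_eucl (m + n) {z \<in> ?E. trunc n (\<lambda>j. z (m + j)) \<in> B}"
    by (rule smooth_preimage_open[of _ _ n "\<lambda>j z. z (m + j)", OF openin_topspace s assms(2)])
  ultimately have "open_eucl (m + n) ({z \<in> ?E. trunc m (\<lambda>j. z j) \<in> A} \<inter> {z \<in> ?E. trunc n (\<lambda>j. z (m + j)) \<in> B})"
    by (rule openin_Int)
  then show ?thesis by (rule back_subst[of "open_eucl (m + n)"]) auto
qed

lemma prod_chart_chart_on:
  assumes c: "chart_on S m (U, \<phi>)" and d: "chart_on T n (V, \<psi>)"
  shows "chart_on (prod_topology S T) (m + n) (prod_chart m (U, \<phi>) (V, \<psi>))"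
  unfolding prod_chart_eq
proof (rule chart_onI)
  let ?\<Phi> = "\<lambda>p. join m (\<phi> (fst p)) (\<psi> (snd p))"
  note C = chart_onD[OF c] and D = chart_onD[OF d]
  show UV: "openin (prod_topology S T) (U \<times> V)" using C(1) D(1) by (simp add: openin_prod_Times_iff)
  show E: "?\<Phi> p \<in> eucl (m + n)" if "p \<in> U \<times> V" for p
    using that C(5) D(5) join_in by (metis mem_Times_iff)
  show "inj_on ?\<Phi> (U \<times> V)"
  proof (rule inj_onI)
    fix p q assume pq: "p \<in> U \<times> V" "q \<in> U \<times> V" "?\<Phi> p = ?\<Phi> q"
    then have e: "fst p \<in> U" "fst q \<in> U" "snd p \<in> V" "snd q \<in> V" by auto
    have "\<phi> (fst p) = \<phi> (fst q)"
      using arg_cong[OF pq(3), of "trunc m"] unfolding trunc_join[OF C(5)[OF e(1)]] trunc_join[OF C(5)[OF e(2)]] .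
    moreover have "\<psi> (snd p) = \<psi> (snd q)"
      using arg_cong[OF pq(3), of "\<lambda>z. trunc n (\<lambda>j. z (m + j))"]
      unfolding trunc_join_shift[OF D(5)[OF e(3)]] trunc_join_shift[OF D(5)[OF e(4)]] .
    ultimately show "p = q" using inj_onD[OF C(4) _ e(1,2)] inj_onD[OF D(4) _ e(3,4)] by (simp add: prod_eq_iff)
  qed
  show "open_eucl (m + n) (?\<Phi> ` W)" if W: "openin (prod_topology S T) W" "W \<subseteq> U \<times> V" for W
  proof (subst openin_subopen, rule ballI)
    fix z assume "z \<in> ?\<Phi> ` W"
    then obtain p where p: "p \<in> W" "z = ?\<Phi> p" by (elim imageE)
    have "(fst p, snd p) \<in> W" using p(1) by simp
    then obtain A B where AB: "openin S A" "openin T B" "fst p \<in> A" "snd p \<in> B" "A \<times> B \<subseteq> W"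
      using W(1) unfolding openin_prod_topology_alt by meson
    have AU: "A \<subseteq> U" and BV: "B \<subseteq> V" using AB W(2) by blast+
    \<comment> \<open>The image of the box \<open>A \<times> B\<close>, described by the two halves
      of the coordinate vector.\<close>
    let ?O = "{z \<in> eucl (m + n). trunc m z \<in> \<phi> ` A \<and> trunc n (\<lambda>j. z (m + j)) \<in> \<psi> ` B}"
    have "open_eucl m (\<phi> ` A)" "open_eucl n (\<psi> ` B)"
      using C(7)[OF AB(1)] D(7)[OF AB(2)] AU BV by (simp_all add: inf.absorb2)
    then have "open_eucl (m + n) ?O" by (rule openin_join_box)
    moreover have "z \<in> ?O"
    proof -
      have "fst p \<in> U" "snd p \<in> V" using AB AU BV by auto
      then show ?thesis
        unfolding p(2) using E[of p] AB(3,4) trunc_join[OF C(5)] trunc_join_shift[OF D(5)] by (simp add: mem_Times_iff)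
    qed
    moreover have "?O \<subseteq> ?\<Phi> ` W"
    proof
      fix z assume z: "z \<in> ?O"
      then obtain x y where xy: "x \<in> A" "y \<in> B" "trunc m z = \<phi> x" "trunc n (\<lambda>j. z (m + j)) = \<psi> y" by blast
      have "z = ?\<Phi> (x, y)" using z join_trunc[of z m n] xy by simp
      then show "z \<in> ?\<Phi> ` W" using xy AB(5) by blast
    qed
    ultimately show "\<exists>O'. open_eucl (m + n) O' \<and> z \<in> O' \<and> O' \<subseteq> ?\<Phi> ` W" by blast
  qed
  show "openin (prod_topology S T) {p \<in> U \<times> V. ?\<Phi> p \<in> W}" if W: "open_eucl (m + n) W" for W
  proof -
    have sub: "subtopology (prod_topology S T) (U \<times> V) = prod_topology (subtopology S U) (subtopology T V)"
      by (simp add: subtopology_Times)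
    have 1: "continuous_map (prod_topology (subtopology S U) (subtopology T V)) euclideanreal (\<lambda>p. \<phi> (fst p) i)" for i
      using continuous_map_compose[OF continuous_map_fst chart_on_component[OF c]] by (simp add: o_def)
    have 2: "continuous_map (prod_topology (subtopology S U) (subtopology T V)) euclideanreal (\<lambda>p. \<psi> (snd p) i)" for i
      using continuous_map_compose[OF continuous_map_snd chart_on_component[OF d]] by (simp add: o_def)
    have "continuous_map (prod_topology (subtopology S U) (subtopology T V)) euclideanreal (\<lambda>p. ?\<Phi> p i)" for i
      using 1 2 by (cases "i < m") (simp_all add: join_def)
    then have "continuous_map (subtopology (prod_topology S T) (U \<times> V)) (Euclidean_space (m + n)) (\<lambda>p i. if i < m + n then ?\<Phi> p i else 0)"
      unfolding sub continuous_map_componentwise_Euclidean_space by blast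
    from openin_continuous_map_preimage[OF this W]
    have "openin (subtopology (prod_topology S T) (U \<times> V)) {p \<in> U \<times> V. trunc (m + n) (?\<Phi> p) \<in> W}"
      by (rule back_subst[of "openin (subtopology (prod_topology S T) (U \<times> V))"])
        (use openin_subset[OF UV] in \<open>auto simp: trunc_def\<close>)
    then have "openin (prod_topology S T) {p \<in> U \<times> V. trunc (m + n) (?\<Phi> p) \<in> W}"
      by (simp add: openin_open_subtopology[OF UV])
    moreover have "trunc (m + n) (?\<Phi> p) = ?\<Phi> p" if "p \<in> U \<times> V" for p
      by (rule trunc_id[OF E[OF that]])
    then have "{p \<in> U \<times> V. trunc (m + n) (?\<Phi> p) \<in> W} = {p \<in> U \<times> V. ?\<Phi> p \<in> W}"
      by (intro Collect_cong conj_cong refl) (simp only:)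
    ultimately show ?thesis by simp
  qed
qed

lemma prod_manifold_simps [simp]:
  "mtop (prod_manifold M N) = prod_topology (mtop M) (mtop N)"
  "mdim (prod_manifold M N) = mdim M + mdim N"
  by (simp_all add: prod_manifold_def)

lemma inv_into_prod_chart:
  assumes c: "chart_on S m (U, \<phi>)" and d: "chart_on T n (V, \<psi>)" and z: "z \<in> fst (prod_chart m (U, \<phi>) (V, \<psi>))"
  defines "\<Phi> \<equiv> snd (prod_chart m (U, \<phi>) (V, \<psi>))"
  shows "\<forall>\<^sub>F x in near_eucl (m + n) (\<Phi> z). inv_into (U \<times> V) \<Phi> x = (inv_into U \<phi> (trunc m x), inv_into V \<psi> (trunc n (\<lambda>j. x (m + j))))"
proof -
  note C = chart_onD[OF c] and D = chart_onD[OF d]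
  have cd: "chart_on (prod_topology S T) (m + n) (U \<times> V, \<Phi>)"
    using prod_chart_chart_on[OF c d] by (simp add: \<Phi>_def prod_chart_eq)
  note P = chart_onD[OF cd]
  have z': "z \<in> U \<times> V" using z by (simp add: prod_chart_eq)
  have "\<forall>\<^sub>F x in near_eucl (m + n) (\<Phi> z). x \<in> \<Phi> ` (U \<times> V)"
    by (rule eventually_in_open[OF P(3)]) (use z' in blast)
  then show ?thesis
  proof (rule eventually_mono)
    fix x assume "x \<in> \<Phi> ` (U \<times> V)"
    then obtain p where p: "p \<in> U \<times> V" "x = \<Phi> p" by (elim imageE)
    then have e: "fst p \<in> U" "snd p \<in> V" by auto
    have j: "\<Phi> p = join m (\<phi> (fst p)) (\<psi> (snd p))" by (simp add: \<Phi>_def prod_chart_eq)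
    show "inv_into (U \<times> V) \<Phi> x = (inv_into U \<phi> (trunc m x), inv_into V \<psi> (trunc n (\<lambda>j. x (m + j))))"
      unfolding p(2) P(6)[OF p(1)] unfolding j trunc_join[OF C(5)[OF e(1)]] trunc_join_shift[OF D(5)[OF e(2)]] C(6)[OF e(1)] D(6)[OF e(2)]
      by simp
  qed
qed

lemma prod_chart_transition:
  assumes c: "chart_on S m c" "chart_on S m c'" and d: "chart_on T n d" "chart_on T n d'"
    and p: "p \<in> fst (prod_chart m c d)" "p \<in> fst (prod_chart m c' d')"
    and t: "smooth_transition_at m c c' (fst p)" "smooth_transition_at n d d' (snd p)"
  shows "smooth_transition_at (m + n) (prod_chart m c d) (prod_chart m c' d') p"
proof -
  obtain U \<phi> V \<psi> U' \<phi>' V' \<psi>' where e: "c = (U, \<phi>)" "d = (V, \<psi>)" "c' = (U', \<phi>')" "d' = (V', \<psi>')"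
    by (cases c, cases d, cases c', cases d')
  note cd = c(1)[unfolded e] d(1)[unfolded e]
  note C = chart_onD[OF cd(1)] and D = chart_onD[OF cd(2)]
  have P: "fst p \<in> U" "snd p \<in> V" using p by (auto simp: e prod_chart_eq)
  let ?\<Phi> = "\<lambda>p. join m (\<phi> (fst p)) (\<psi> (snd p))"
  have E: "?\<Phi> p \<in> eucl (m + n)" using join_in C(5)[OF P(1)] D(5)[OF P(2)] by blast
  have ev: "\<forall>\<^sub>F x in near_eucl (m + n) (?\<Phi> p). inv_into (U \<times> V) ?\<Phi> x = (inv_into U \<phi> (trunc m x), inv_into V \<psi> (trunc n (\<lambda>j. x (m + j))))"
    using inv_into_prod_chart[OF cd p(1)[unfolded e]] unfolding prod_chart_eq snd_conv .
  show ?thesis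
    unfolding smooth_transition_at_def e prod_chart_eq fst_conv snd_conv
  proof (intro allI impI)
    fix j assume j: "j < m + n"
    show "smooth_at (m + n) (\<lambda>x. join m (\<phi>' (fst (inv_into (U \<times> V) ?\<Phi> x))) (\<psi>' (snd (inv_into (U \<times> V) ?\<Phi> x))) j) (?\<Phi> p)"
    proof (cases "j < m")
      case True
      have "smooth_at (m + n) (\<lambda>x. (\<lambda>y. \<phi>' (inv_into U \<phi> y) j) (trunc m (\<lambda>i. x i))) (?\<Phi> p)"
        by (rule smooth_at_compose[OF E _ smooth_at_coord[OF E]])
          (use t(1) True in \<open>simp add: trunc_join[OF C(5)[OF P(1)]] smooth_transition_at_def e\<close>)
      then show ?thesis
        by (rule smooth_at_cong[rotated]) (rule eventually_mono[OF ev], use True in \<open>simp add: join_def\<close>)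
    next
      case False
      have "smooth_at (m + n) (\<lambda>x. (\<lambda>y. \<psi>' (inv_into V \<psi> y) (j - m)) (trunc n (\<lambda>i. x (m + i)))) (?\<Phi> p)"
        by (rule smooth_at_compose[OF E _ smooth_at_coord[OF E]])
          (use t(2) False j in \<open>simp add: trunc_join_shift[OF D(5)[OF P(2)]] smooth_transition_at_def e\<close>)
      then show ?thesis
        by (rule smooth_at_cong[rotated]) (rule eventually_mono[OF ev], use False in \<open>simp add: join_def\<close>)
    qed
  qed
qed

lemma smooth_prod_manifold:
  assumes M: "smooth_manifold M" and N: "smooth_manifold N"
  shows "smooth_manifold (prod_manifold M N)"
    and "c \<in> matlas M \<Longrightarrow> d \<in> matlas N \<Longrightarrow> prod_chart (mdim M) c d \<in> matlas (prod_manifold M N)"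
proof -
  let ?A = "{prod_chart (mdim M) c d | c d. c \<in> matlas M \<and> d \<in> matlas N}"
  let ?T = "prod_topology (mtop M) (mtop N)"
  have T: "Hausdorff_space ?T" "second_countable ?T"
    using M N second_countable_prod_topology by (auto simp: smooth_manifold_def Hausdorff_space_prod_topology)
  have A: "chart_on ?T (mdim M + mdim N) c" if "c \<in> ?A" for c
    using that matlas_chart_on[OF M] matlas_chart_on[OF N] prod_chart_chart_on by fastforce
  have cov: "\<exists>c\<in>?A. p \<in> fst c" if p: "p \<in> topspace ?T" for p
  proof -
    obtain U \<phi> where c: "(U, \<phi>) \<in> matlas M" "fst p \<in> U" by (rule chart_exists[OF M, of "fst p"]) (use p in auto)
    obtain V \<psi> where d: "(V, \<psi>) \<in> matlas N" "snd p \<in> V" by (rule chart_exists[OF N, of "snd p"]) (use p in auto)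
    show ?thesis
    proof (rule bexI)
      show "prod_chart (mdim M) (U, \<phi>) (V, \<psi>) \<in> ?A" using c d by blast
      show "p \<in> fst (prod_chart (mdim M) (U, \<phi>) (V, \<psi>))" using c d by (simp add: prod_chart_eq mem_Times_iff)
    qed
  qed
  have tr: "smooth_transition_at (mdim M + mdim N) a b p" if ab: "a \<in> ?A" "b \<in> ?A" "p \<in> fst a" "p \<in> fst b" for a b p
  proof -
    obtain c d where e: "a = prod_chart (mdim M) c d" and c: "c \<in> matlas M" and d: "d \<in> matlas N" using ab(1) by blast
    obtain c' d' where e': "b = prod_chart (mdim M) c' d'" and c': "c' \<in> matlas M" and d': "d' \<in> matlas N" using ab(2) by blast
    have q: "fst p \<in> fst c" "fst p \<in> fst c'" "snd p \<in> fst d" "snd p \<in> fst d'"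
      using ab(3,4) unfolding e e' by (auto simp: prod_chart_def split_beta)
    show ?thesis unfolding e e'
      by (rule prod_chart_transition[OF matlas_chart_on[OF M c] matlas_chart_on[OF M c'] matlas_chart_on[OF N d] matlas_chart_on[OF N d']
          ab(3)[unfolded e] ab(4)[unfolded e'] matlas_transition[OF M c c' q(1,2)] matlas_transition[OF N d d' q(3,4)]])
  qed
  note S = smooth_manifold_atlasI[OF T A cov tr]
  show "smooth_manifold (prod_manifold M N)" unfolding prod_manifold_def using S(1) by simp
  show "c \<in> matlas M \<Longrightarrow> d \<in> matlas N \<Longrightarrow> prod_chart (mdim M) c d \<in> matlas (prod_manifold M N)"
    unfolding prod_manifold_def manifold.simps using S(2) by blast
qed

lemma prod_chart_matlas:
  assumes "smooth_manifold M" "smooth_manifold N" "(U, \<phi>) \<in> matlas M" "(V, \<psi>) \<in> matlas N"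
  shows "(U \<times> V, \<lambda>p. join (mdim M) (\<phi> (fst p)) (\<psi> (snd p))) \<in> matlas (prod_manifold M N)"
  using smooth_prod_manifold(2)[OF assms] unfolding prod_chart_eq .

lemma smooth_map_fst:
  assumes M: "smooth_manifold M" and N: "smooth_manifold N" shows "smooth_map (prod_manifold M N) M fst"
proof (rule smooth_mapI[OF smooth_prod_manifold(1)[OF M N] M])
  show "continuous_map (mtop (prod_manifold M N)) (mtop M) fst" by (simp add: continuous_map_fst)
  fix p assume "p \<in> points (prod_manifold M N)"
  then have p: "fst p \<in> points M" "snd p \<in> points N" by auto
  obtain U \<phi> where c: "(U, \<phi>) \<in> matlas M" "fst p \<in> U" using chart_exists[OF M p(1)] by metis
  obtain V \<psi> where d: "(V, \<psi>) \<in> matlas N" "snd p \<in> V" using chart_exists[OF N p(2)] by metis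
  have "smooth_near (prod_manifold M N) p (\<lambda>q. \<phi> (fst q) j)" if "j < mdim M" for j
    using smooth_near_coord[OF smooth_prod_manifold(1)[OF M N] prod_chart_matlas[OF M N c(1) d(1)], of p j] c(2) d(2) that
    by (simp add: join_def mem_Times_iff)
  then show "\<exists>V \<psi>. (V, \<psi>) \<in> matlas M \<and> fst p \<in> V \<and> (\<forall>j<mdim M. smooth_near (prod_manifold M N) p (\<lambda>q. \<psi> (fst q) j))"
    using c by (intro exI[of _ U] exI[of _ \<phi>]) simp
qed

lemma smooth_map_snd:
  assumes M: "smooth_manifold M" and N: "smooth_manifold N" shows "smooth_map (prod_manifold M N) N snd"
proof (rule smooth_mapI[OF smooth_prod_manifold(1)[OF M N] N])
  show "continuous_map (mtop (prod_manifold M N)) (mtop N) snd" by (simp add: continuous_map_snd)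
  fix p assume "p \<in> points (prod_manifold M N)"
  then have p: "fst p \<in> points M" "snd p \<in> points N" by auto
  obtain U \<phi> where c: "(U, \<phi>) \<in> matlas M" "fst p \<in> U" using chart_exists[OF M p(1)] by metis
  obtain V \<psi> where d: "(V, \<psi>) \<in> matlas N" "snd p \<in> V" using chart_exists[OF N p(2)] by metis
  have "smooth_near (prod_manifold M N) p (\<lambda>q. \<psi> (snd q) j)" for j
    using smooth_near_coord[OF smooth_prod_manifold(1)[OF M N] prod_chart_matlas[OF M N c(1) d(1)], of p "mdim M + j"] c(2) d(2)
    by (simp add: join_def mem_Times_iff)
  then show "\<exists>V \<psi>. (V, \<psi>) \<in> matlas N \<and> snd p \<in> V \<and> (\<forall>j<mdim N. smooth_near (prod_manifold M N) p (\<lambda>q. \<psi> (snd q) j))"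
    using d by (intro exI[of _ V] exI[of _ \<psi>]) simp
qed

lemma smooth_map_Pair:
  assumes P: "smooth_manifold P" and M: "smooth_manifold M" and N: "smooth_manifold N"
    and F: "smooth_map P M F" and G: "smooth_map P N G"
  shows "smooth_map P (prod_manifold M N) (\<lambda>x. (F x, G x))"
proof (rule smooth_mapI[OF P smooth_prod_manifold(1)[OF M N]])
  show "continuous_map (mtop P) (mtop (prod_manifold M N)) (\<lambda>x. (F x, G x))"
    using smooth_map_continuous[OF F] smooth_map_continuous[OF G] by (simp add: continuous_map_pairedI)
  fix p assume p: "p \<in> points P"
  obtain U \<phi> where c: "(U, \<phi>) \<in> matlas M" "F p \<in> U" using chart_exists[OF M smooth_map_points[OF F p]] by metis
  obtain V \<psi> where d: "(V, \<psi>) \<in> matlas N" "G p \<in> V" using chart_exists[OF N smooth_map_points[OF G p]] by metis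
  have "smooth_near P p (\<lambda>q. join (mdim M) (\<phi> (F q)) (\<psi> (G q)) j)" if "j < mdim M + mdim N" for j
    using smooth_mapD[OF F p c, of j] smooth_mapD[OF G p d, of "j - mdim M"] that
    by (cases "j < mdim M") (simp_all add: join_def)
  then show "\<exists>V \<psi>. (V, \<psi>) \<in> matlas (prod_manifold M N) \<and> (F p, G p) \<in> V \<and> (\<forall>j<mdim (prod_manifold M N). smooth_near P p (\<lambda>q. \<psi> (F q, G q) j))"
    using prod_chart_matlas[OF M N c(1) d(1)] c(2) d(2)
    by (intro exI[of _ "U \<times> V"] exI[of _ "\<lambda>p. join (mdim M) (\<phi> (fst p)) (\<psi> (snd p))"]) simp
qed

section \<open>Submanifolds as manifolds\<close>

lemma openin_Euclidean_restrict:
  assumes "open_eucl n V" "k \<le> n" shows "open_eucl k (V \<inter> eucl k)"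
proof -
  obtain B where B: "open B" "V = B \<inter> eucl n"
    using assms(1) by (metis Euclidean_space_top_of_set inf_commute openin_open)
  have "V \<inter> eucl k = eucl k \<inter> B"
    using assms(2) by (auto simp: B in_Euclidean_space)
  then show ?thesis using B(1) by (subst Euclidean_space_top_of_set) (auto simp: openin_open)
qed

lemma openin_Euclidean_extend:
  assumes "open_eucl k V" "k \<le> n"
  obtains W where "open_eucl n W" "V = W \<inter> eucl k"
proof -
  obtain B where B: "open B" "V = B \<inter> eucl k"
    using assms(1) by (metis Euclidean_space_top_of_set inf_commute openin_open)
  have "open_eucl n (eucl n \<inter> B)"
    using B(1) by (subst Euclidean_space_top_of_set) (auto simp: openin_open)
  moreover have "V = (eucl n \<inter> B) \<inter> eucl k"
    using assms(2) by (auto simp: B in_Euclidean_space)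
  ultimately show thesis by (rule that)
qed

text \<open>Lines in directions below \<open>k\<close> stay inside the standard
  \<open>k\<close>-plane, so the first \<open>k\<close> partial derivatives are the same functions
  in both spaces.\<close>

lemma Ck_on_restrict:
  "open_eucl n V \<Longrightarrow> k \<le> n \<Longrightarrow> Ck_on n l V g \<Longrightarrow> Ck_on k l (V \<inter> eucl k) g"
proof (induction l arbitrary: g)
  case (0 g)
  have "continuous_on V g" by (rule Ck_on_continuous[OF 0(3) openin_subset[OF 0(1)]])
  then have "continuous_on (V \<inter> eucl k) g" using continuous_on_subset by blast
  then show ?case by (simp add: continuous_map_Euclidean_iff)
next
  case (Suc l g)
  have "Ck_on k l (V \<inter> eucl k) (partial_deriv i g)" if "i < k" for i
    using Suc.prems that by (intro Suc.IH) auto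
  moreover have "continuous_on V g" by (rule Ck_on_continuous[OF Suc.prems(3) openin_subset[OF Suc.prems(1)]])
  then have "continuous_on (V \<inter> eucl k) g" using continuous_on_subset by blast
  then have "continuous_map (subtopology (Euclidean_space k) (V \<inter> eucl k)) euclideanreal g"
    by (simp add: continuous_map_Euclidean_iff)
  moreover have "(\<lambda>t. g (x(i := t))) differentiable at (x i)" if "i < k" "x \<in> V" for i x
  proof -
    have "i < n" using that(1) Suc.prems(2) by simp
    from Ck_on_has_partial[OF Suc.prems(3) that(2) this] show ?thesis unfolding real_differentiable_def by blast
  qed
  ultimately show ?case unfolding Ck_on.simps(2) by blast
qed

lemma smooth_at_restrict:
  assumes "smooth_at n g a" "k \<le> n" "a \<in> eucl k" shows "smooth_at k g a"
proof -
  obtain V where V: "open_eucl n V" "a \<in> V" "smooth_on n V g" using assms(1) unfolding smooth_at_def by blast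
  have "smooth_on k (V \<inter> eucl k) g"
    using V(3) Ck_on_restrict[OF V(1) assms(2), of _ g] unfolding smooth_on_def by blast
  then show ?thesis using openin_Euclidean_restrict[OF V(1) assms(2)] V(2) assms(3) unfolding smooth_at_def by blast
qed

lemma submanifold_dim: "submanifold k M S \<Longrightarrow> submanifold (submanifold_dim M S) M S"
  unfolding submanifold_dim_def by (rule LeastI)

text \<open>Open sets of the \<open>k\<close>-plane are the traces of open sets of the larger space,
  which matches the subspace topology of \<open>S\<close>.\<close>

lemma slice_chart_on:
  assumes M: "smooth_manifold M" and c: "(U, \<phi>) \<in> slice_charts k M S" and k: "k \<le> mdim M"
  shows "chart_on (subtopology (mtop M) S) k (U \<inter> S, \<phi>)" 
    and "\<And>x. x \<in> U \<Longrightarrow> x \<in> S \<longleftrightarrow> \<phi> x \<in> eucl k"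
proof -
  have cM: "(U, \<phi>) \<in> matlas M" and im: "\<phi> ` (U \<inter> S) = \<phi> ` U \<inter> eucl k"
    using c by (auto simp: slice_charts_def)
  note C = matlas_chartD[OF M cM]
  show mem: "x \<in> S \<longleftrightarrow> \<phi> x \<in> eucl k" if x: "x \<in> U" for x
  proof
    assume "x \<in> S" then have "\<phi> x \<in> \<phi> ` (U \<inter> S)" using x by blast
    then show "\<phi> x \<in> eucl k" using im by blast
  next
    assume "\<phi> x \<in> eucl k"
    then have "\<phi> x \<in> \<phi> ` (U \<inter> S)" using im x by blast
    then show "x \<in> S" using inj_onD[OF C(4)] x by (auto simp: image_iff)
  qed
  show "chart_on (subtopology (mtop M) S) k (U \<inter> S, \<phi>)"
  proof (rule chart_onI)
    show "openin (subtopology (mtop M) S) (U \<inter> S)" using C(1) by (auto simp: openin_subtopology)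
    show "inj_on \<phi> (U \<inter> S)" by (rule inj_on_subset[OF C(4)]) simp
    show "\<phi> p \<in> eucl k" if "p \<in> U \<inter> S" for p using that mem by blast
    fix W assume W: "openin (subtopology (mtop M) S) W" "W \<subseteq> U \<inter> S"
    then obtain W' where W': "openin (mtop M) W'" "W = W' \<inter> S" by (auto simp: openin_subtopology)
    have "\<phi> ` W = \<phi> ` (U \<inter> W') \<inter> eucl k"
      using W(2) mem by (auto simp: W'(2))
    then show "open_eucl k (\<phi> ` W)" using openin_Euclidean_restrict[OF C(7)[OF W'(1)] k] by simp
  next
    fix V assume "open_eucl k V"
    then obtain V' where V': "open_eucl (mdim M) V'" "V = V' \<inter> eucl k"
      using openin_Euclidean_extend[OF _ k] by metis
    have "{p \<in> U \<inter> S. \<phi> p \<in> V} = {p \<in> U. \<phi> p \<in> V'} \<inter> S" using mem by (auto simp: V'(2))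
    then show "openin (subtopology (mtop M) S) {p \<in> U \<inter> S. \<phi> p \<in> V}"
      using C(8)[OF V'(1)] by (auto simp: openin_subtopology)
  qed
qed

lemma induced_manifold_simps [simp]:
  "mtop (induced_manifold M S) = subtopology (mtop M) S" "mdim (induced_manifold M S) = submanifold_dim M S"
  by (simp_all add: induced_manifold_def Let_def)

text \<open>Transitions between slice charts, restricted to \<open>S\<close>, are transitions of
  \<open>M\<close> restricted to the standard plane, hence smooth there.\<close>

lemma smooth_induced_manifold:
  assumes M: "smooth_manifold M" and S: "submanifold k M S"
  shows "smooth_manifold (induced_manifold M S)"
    and "(U, \<phi>) \<in> slice_charts (submanifold_dim M S) M S \<Longrightarrow> (U \<inter> S, \<phi>) \<in> matlas (induced_manifold M S)"
proof -
  define d where "d = submanifold_dim M S"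
  let ?A = "{(U \<inter> S, \<phi>) | U \<phi>. (U, \<phi>) \<in> slice_charts d M S}"
  let ?T = "subtopology (mtop M) S"
  have S': "submanifold d M S" unfolding d_def by (rule submanifold_dim[OF S])
  then have dM: "d \<le> mdim M" by (auto simp: submanifold_def)
  have T: "Hausdorff_space ?T" "second_countable ?T"
    using M by (auto simp: smooth_manifold_def Hausdorff_space_subtopology second_countable_subtopology)
  have A: "chart_on ?T d c" if "c \<in> ?A" for c
    using that slice_chart_on(1)[OF M _ dM] by auto
  have cov: "\<exists>c\<in>?A. p \<in> fst c" if p: "p \<in> topspace ?T" for p
  proof -
    have "p \<in> S" using p by auto
    then obtain U \<phi> where U: "(U, \<phi>) \<in> slice_charts d M S" "p \<in> U" using S' unfolding submanifold_def by blast
    then have "(U \<inter> S, \<phi>) \<in> ?A" by blast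
    then show ?thesis by (rule bexI[rotated]) (use U \<open>p \<in> S\<close> in simp)
  qed
  have tr: "smooth_transition_at d a b p" if ab: "a \<in> ?A" "b \<in> ?A" "p \<in> fst a" "p \<in> fst b" for a b p
  proof -
    obtain U \<phi> where e: "a = (U \<inter> S, \<phi>)" and c: "(U, \<phi>) \<in> slice_charts d M S" using ab(1) by blast
    obtain V \<psi> where e': "b = (V \<inter> S, \<psi>)" and c': "(V, \<psi>) \<in> slice_charts d M S" using ab(2) by blast
    have cM: "(U, \<phi>) \<in> matlas M" "(V, \<psi>) \<in> matlas M" using c c' by (auto simp: slice_charts_def)
    note C = matlas_chartD[OF M cM(1)]
    have p: "p \<in> U" "p \<in> V" "p \<in> S" using ab(3,4) by (auto simp: e e')
    have E: "\<phi> p \<in> eucl d" using slice_chart_on(2)[OF M c dM p(1)] p(3) by blast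
    show ?thesis
      unfolding smooth_transition_at_def e e' fst_conv snd_conv
    proof (intro allI impI)
      fix j assume j: "j < d"
      have "smooth_at (mdim M) (\<lambda>x. \<psi> (inv_into U \<phi> x) j) (\<phi> p)"
        using matlas_transition[OF M cM, of p] p j dM by (simp add: smooth_transition_at_def)
      then have s: "smooth_at d (\<lambda>x. \<psi> (inv_into U \<phi> x) j) (\<phi> p)" by (rule smooth_at_restrict[OF _ dM E])
      have "\<forall>\<^sub>F x in near_eucl d (\<phi> p). x \<in> \<phi> ` (U \<inter> S)"
        by (rule eventually_in_open[OF chart_onD(3)[OF A[OF ab(1), unfolded e]]]) (use p in blast)
      then have "\<forall>\<^sub>F x in near_eucl d (\<phi> p). \<psi> (inv_into U \<phi> x) j = \<psi> (inv_into (U \<inter> S) \<phi> x) j"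
        by (rule eventually_mono) (simp add: inv_into_subset[OF C(4)])
      from smooth_at_cong[OF this s] show "smooth_at d (\<lambda>x. \<psi> (inv_into (U \<inter> S) \<phi> x) j) (\<phi> p)" .
    qed
  qed
  note S = smooth_manifold_atlasI[OF T A cov tr]
  show "smooth_manifold (induced_manifold M S)"
    unfolding induced_manifold_def Let_def d_def[symmetric] using S(1) by simp
  show "(U, \<phi>) \<in> slice_charts (submanifold_dim M S) M S \<Longrightarrow> (U \<inter> S, \<phi>) \<in> matlas (induced_manifold M S)"
    unfolding induced_manifold_def Let_def d_def[symmetric] manifold.simps using S(2) by blast
qed

lemma smooth_map_inclusion:
  assumes M: "smooth_manifold M" and S: "submanifold k M S"
  shows "smooth_map (induced_manifold M S) M (\<lambda>x. x)"
proof (rule smooth_mapI[OF smooth_induced_manifold(1)[OF M S] M])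
  show "continuous_map (mtop (induced_manifold M S)) (mtop M) (\<lambda>x. x)" by (simp add: continuous_map_from_subtopology)
  fix p assume "p \<in> points (induced_manifold M S)"
  then have p: "p \<in> S" by auto
  then obtain U \<phi> where U: "(U, \<phi>) \<in> slice_charts (submanifold_dim M S) M S" "p \<in> U"
    using submanifold_dim[OF S] unfolding submanifold_def by blast
  then have c: "(U \<inter> S, \<phi>) \<in> matlas (induced_manifold M S)" "(U, \<phi>) \<in> matlas M"
    using smooth_induced_manifold(2)[OF M S] by (auto simp: slice_charts_def)
  have "smooth_near (induced_manifold M S) p (\<lambda>q. \<phi> q j)" for j
    by (rule smooth_near_coord[OF smooth_induced_manifold(1)[OF M S] c(1)]) (use U p in simp)
  then show "\<exists>V \<psi>. (V, \<psi>) \<in> matlas M \<and> p \<in> V \<and> (\<forall>j<mdim M. smooth_near (induced_manifold M S) p (\<lambda>q. \<psi> q j))"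
    using c(2) U(2) by blast
qed

section \<open>Copies of open subsets under a bijection of types\<close>

text \<open>Brings product manifolds back into the universe of points. Passing to an open set
  \<open>W\<close> on the way provides a disjoint union, as an open part of a product with a
  two-point space.\<close>

definition copy_manifold :: "('b \<Rightarrow> 'a) \<Rightarrow> 'b set \<Rightarrow> ('b, 'm) manifold_scheme \<Rightarrow> 'a manifold" where
  "copy_manifold t W M = (let T = pullback_topology UNIV (inv t) (subtopology (mtop M) W) in
     \<lparr> mtop = T, mdim = mdim M,
       matlas = maximal_atlas T (mdim M) {(t ` U, \<lambda>p. \<phi> (inv t p)) | U \<phi>. (U, \<phi>) \<in> matlas M \<and> U \<subseteq> W} \<rparr>)"

lemma mdim_copy_manifold [simp]: "mdim (copy_manifold t W M) = mdim M"
  by (simp add: copy_manifold_def Let_def)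

lemma mtop_copy_manifold: "mtop (copy_manifold t W M) = pullback_topology UNIV (inv t) (subtopology (mtop M) W)"
  by (simp add: copy_manifold_def Let_def)

lemma openin_copy:
  assumes t: "bij t" and W: "openin T W"
  shows "openin (pullback_topology UNIV (inv t) (subtopology T W)) B \<longleftrightarrow> (\<exists>V. openin T V \<and> V \<subseteq> W \<and> B = t ` V)"
proof -
  have "inv t -` V = t ` V" for V using t by (simp add: bij_vimage_eq_inv_image bij_imp_bij_inv inv_inv_eq)
  then show ?thesis by (auto simp: openin_pullback_topology openin_open_subtopology[OF W])
qed

lemma topspace_copy:
  assumes t: "bij t" and W: "openin T W"
  shows "topspace (pullback_topology UNIV (inv t) (subtopology T W)) = t ` W"
proof -
  have "inv t -` V = t ` V" for V using t by (simp add: bij_vimage_eq_inv_image bij_imp_bij_inv inv_inv_eq)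
  then show ?thesis using openin_subset[OF W] by (simp add: topspace_pullback_topology inf.absorb2)
qed

lemma copy_homeomorphic:
  assumes t: "bij t" and W: "openin T W"
  shows "homeomorphic_map (subtopology T W) (pullback_topology UNIV (inv t) (subtopology T W)) t"
proof (rule bijective_open_imp_homeomorphic_map)
  have W': "topspace (subtopology T W) = W" using openin_subset[OF W] by auto
  have inj: "inj t" using t bij_is_inj by blast
  show "open_map (subtopology T W) (pullback_topology UNIV (inv t) (subtopology T W)) t"
    unfolding open_map_def openin_copy[OF t W] openin_open_subtopology[OF W] by blast
  show "continuous_map (subtopology T W) (pullback_topology UNIV (inv t) (subtopology T W)) t"
    unfolding continuous_map_def topspace_copy[OF t W] W' openin_copy[OF t W] openin_open_subtopology[OF W]
  proof (intro conjI allI impI)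
    show "t \<in> W \<rightarrow> t ` W" by blast
    fix B assume "\<exists>V. openin T V \<and> V \<subseteq> W \<and> B = t ` V"
    then obtain V where V: "openin T V" "V \<subseteq> W" "B = t ` V" by blast
    then have "{x \<in> W. t x \<in> B} = V" using inj by (auto dest: injD)
    then show "openin T {x \<in> W. t x \<in> B}" "{x \<in> W. t x \<in> B} \<subseteq> W" using V by auto
  qed
  show "t ` topspace (subtopology T W) = topspace (pullback_topology UNIV (inv t) (subtopology T W))"
    unfolding topspace_copy[OF t W] W' ..
  show "inj_on t (topspace (subtopology T W))" by (rule inj_on_subset[OF inj]) simp
qed

lemma smooth_copy_manifold:
  fixes t :: "'b \<Rightarrow> 'a"
  assumes M: "smooth_manifold M" and t: "bij t" and W: "openin (mtop M) W"
  shows "smooth_manifold (copy_manifold t W M)"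
    and "(U, \<phi>) \<in> matlas M \<Longrightarrow> U \<subseteq> W \<Longrightarrow> (t ` U, \<lambda>p. \<phi> (inv t p)) \<in> matlas (copy_manifold t W M)"
    and "points (copy_manifold t W M) = t ` W"
proof -
  let ?T = "pullback_topology UNIV (inv t) (subtopology (mtop M) W)"
  let ?A = "{(t ` U, \<lambda>p. \<phi> (inv t p)) | U \<phi>. (U, \<phi>) \<in> matlas M \<and> U \<subseteq> W}"
  have inj: "inj t" using t bij_is_inj by blast
  have it [simp]: "inv t (t x) = x" for x using inj by simp
  note h = copy_homeomorphic[OF t W]
  show pts: "points (copy_manifold t W M) = t ` W" unfolding mtop_copy_manifold by (rule topspace_copy[OF t W])
  have "Hausdorff_space (subtopology (mtop M) W)" "second_countable (subtopology (mtop M) W)"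
    using M by (auto simp: smooth_manifold_def Hausdorff_space_subtopology second_countable_subtopology)
  then have T: "Hausdorff_space ?T" "second_countable ?T"
    using homeomorphic_Hausdorff_space homeomorphic_map_imp_homeomorphic_space[OF h]
      second_countable_open_map_image[OF homeomorphic_imp_continuous_map[OF h] homeomorphic_imp_open_map[OF h] homeomorphic_imp_surjective_map[OF h]]
    by blast+
  have A': "chart_on ?T (mdim M) (t ` U, \<lambda>p. \<phi> (inv t p))" if c: "(U, \<phi>) \<in> matlas M" "U \<subseteq> W" for U \<phi>
  proof (rule chart_onI)
    note C = matlas_chartD[OF M c(1)]
    show "openin ?T (t ` U)" unfolding openin_copy[OF t W] using C(1) c(2) by blast
    show "inj_on (\<lambda>p. \<phi> (inv t p)) (t ` U)" using C(4) by (auto simp: inj_on_def)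
    show "\<phi> (inv t p) \<in> eucl (mdim M)" if "p \<in> t ` U" for p using C(5) that by auto
    show "open_eucl (mdim M) ((\<lambda>p. \<phi> (inv t p)) ` B)" if B: "openin ?T B" "B \<subseteq> t ` U" for B
    proof -
      obtain V where V: "openin (mtop M) V" "B = t ` V" using B(1) unfolding openin_copy[OF t W] by blast
      have "V \<subseteq> U" using B(2) inj unfolding V(2) by (simp add: inj_image_subset_iff)
      then have "(\<lambda>p. \<phi> (inv t p)) ` B = \<phi> ` (U \<inter> V)" unfolding V(2) by (auto simp: image_image)
      then show ?thesis using C(7)[OF V(1)] by simp
    qed
    show "openin ?T {p \<in> t ` U. \<phi> (inv t p) \<in> V}" if V: "open_eucl (mdim M) V" for V
    proof -
      have "{p \<in> t ` U. \<phi> (inv t p) \<in> V} = t ` {p \<in> U. \<phi> p \<in> V}" by auto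
      then show ?thesis unfolding openin_copy[OF t W] using C(8)[OF V] c(2) by blast
    qed
  qed
  have A: "chart_on ?T (mdim M) c" if "c \<in> ?A" for c using that A' by auto
  have cov: "\<exists>c\<in>?A. p \<in> fst c" if p: "p \<in> topspace ?T" for p
  proof -
    obtain x where x: "x \<in> W" "p = t x" using p unfolding topspace_copy[OF t W] by blast
    then obtain U \<phi> where c: "(U, \<phi>) \<in> matlas M" "x \<in> U" using chart_exists[OF M] openin_subset[OF W] by blast
    note C = matlas_chartD[OF M c(1)]
    have "(U \<inter> W, \<phi>) \<in> matlas M" by (rule chart_restrict[OF M c(1)]) (use C(1) W in auto)
    then have "(t ` (U \<inter> W), \<lambda>p. \<phi> (inv t p)) \<in> ?A" by blast
    then show ?thesis by (rule bexI[rotated]) (use x c in simp)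
  qed
  have tr: "smooth_transition_at (mdim M) a b p" if ab: "a \<in> ?A" "b \<in> ?A" "p \<in> fst a" "p \<in> fst b" for a b p
  proof -
    obtain U \<phi> where e: "a = (t ` U, \<lambda>p. \<phi> (inv t p))" and c: "(U, \<phi>) \<in> matlas M" using ab(1) by blast
    obtain V \<psi> where e': "b = (t ` V, \<lambda>p. \<psi> (inv t p))" and c': "(V, \<psi>) \<in> matlas M" using ab(2) by blast
    note C = matlas_chartD[OF M c]
    obtain x where x: "x \<in> U" "p = t x" using ab(3) by (auto simp: e)
    then have "x \<in> V" using ab(4) inj by (auto simp: e' dest: injD)
    have i: "inj_on (\<lambda>p. \<phi> (inv t p)) (t ` U)" using C(4) by (auto simp: inj_on_def)
    show ?thesis
      unfolding smooth_transition_at_def e e' fst_conv snd_conv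
    proof (intro allI impI)
      fix j assume j: "j < mdim M"
      have s: "smooth_at (mdim M) (\<lambda>x. \<psi> (inv_into U \<phi> x) j) (\<phi> (inv t p))"
        using matlas_transition[OF M c c', of x] x \<open>x \<in> V\<close> j by (simp add: smooth_transition_at_def)
      have "\<forall>\<^sub>F y in near_eucl (mdim M) (\<phi> (inv t p)). y \<in> \<phi> ` U"
        by (rule eventually_in_open[OF C(3)]) (use x in simp)
      then have ev: "\<forall>\<^sub>F y in near_eucl (mdim M) (\<phi> (inv t p)).
          \<psi> (inv_into U \<phi> y) j = \<psi> (inv t (inv_into (t ` U) (\<lambda>p. \<phi> (inv t p)) y)) j"
      proof (rule eventually_mono)
        fix y assume "y \<in> \<phi> ` U"
        then obtain q where q: "q \<in> U" "y = \<phi> q" by blast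
        have "inv_into (t ` U) (\<lambda>p. \<phi> (inv t p)) y = t q"
          by (rule inv_into_f_eq[OF i]) (use q in auto)
        then show "\<psi> (inv_into U \<phi> y) j = \<psi> (inv t (inv_into (t ` U) (\<lambda>p. \<phi> (inv t p)) y)) j"
          using C(6)[OF q(1)] q(2) by simp
      qed
      show "smooth_at (mdim M) (\<lambda>y. \<psi> (inv t (inv_into (t ` U) (\<lambda>p. \<phi> (inv t p)) y)) j) (\<phi> (inv t p))"
        by (rule smooth_at_cong[OF ev s])
    qed
  qed
  note S = smooth_manifold_atlasI[OF T A cov tr]
  show "smooth_manifold (copy_manifold t W M)" unfolding copy_manifold_def Let_def using S(1) by simp
  show "(U, \<phi>) \<in> matlas M \<Longrightarrow> U \<subseteq> W \<Longrightarrow> (t ` U, \<lambda>p. \<phi> (inv t p)) \<in> matlas (copy_manifold t W M)"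
    unfolding copy_manifold_def Let_def manifold.simps using S(2) by blast
qed

lemma smooth_map_from_copy:
  assumes M: "smooth_manifold M" and t: "bij t" and W: "openin (mtop M) W"
  shows "smooth_map (copy_manifold t W M) M (inv t)"
proof (rule smooth_mapI[OF smooth_copy_manifold(1)[OF assms] M])
  have it [simp]: "inv t (t x) = x" for x using bij_is_inj[OF t] by simp
  show "continuous_map (mtop (copy_manifold t W M)) (mtop M) (inv t)"
    unfolding mtop_copy_manifold continuous_map_def topspace_copy[OF t W]
  proof (intro conjI allI impI)
    show "inv t \<in> t ` W \<rightarrow> points M" using openin_subset[OF W] by auto
    fix V assume "openin (mtop M) V"
    then have "openin (mtop M) (V \<inter> W)" using W by blast
    moreover have "{x \<in> t ` W. inv t x \<in> V} = t ` (V \<inter> W)" by auto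
    ultimately show "openin (pullback_topology UNIV (inv t) (subtopology (mtop M) W)) {x \<in> t ` W. inv t x \<in> V}"
      unfolding openin_copy[OF t W] by blast
  qed
  fix p assume "p \<in> points (copy_manifold t W M)"
  then obtain x where x: "x \<in> W" "p = t x" unfolding smooth_copy_manifold(3)[OF assms] by blast
  then obtain U \<phi> where c: "(U, \<phi>) \<in> matlas M" "x \<in> U" using chart_exists[OF M] openin_subset[OF W] by blast
  note C = matlas_chartD[OF M c(1)]
  have "(U \<inter> W, \<phi>) \<in> matlas M" by (rule chart_restrict[OF M c(1)]) (use C(1) W in auto)
  then have d: "(t ` (U \<inter> W), \<lambda>p. \<phi> (inv t p)) \<in> matlas (copy_manifold t W M)"
    by (rule smooth_copy_manifold(2)[OF assms]) simp
  have "smooth_near (copy_manifold t W M) p (\<lambda>q. \<phi> (inv t q) j)" for j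
    by (rule smooth_near_coord[OF smooth_copy_manifold(1)[OF assms] d]) (use x c in simp)
  then show "\<exists>V \<psi>. (V, \<psi>) \<in> matlas M \<and> inv t p \<in> V \<and> (\<forall>j<mdim M. smooth_near (copy_manifold t W M) p (\<lambda>q. \<psi> (inv t q) j))"
    using c x by (intro exI[of _ U] exI[of _ \<phi>]) simp
qed

lemma smooth_map_into_copy:
  assumes M: "smooth_manifold M" and t: "bij t" and W: "openin (mtop M) W" and N: "smooth_manifold N"
    and F: "smooth_map N M F" and FW: "\<And>p. p \<in> points N \<Longrightarrow> F p \<in> W"
  shows "smooth_map N (copy_manifold t W M) (\<lambda>p. t (F p))"
proof (rule smooth_mapI[OF N smooth_copy_manifold(1)[OF M t W]])
  have it [simp]: "inv t (t x) = x" for x using bij_is_inj[OF t] by simp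
  have "continuous_map (mtop N) (subtopology (mtop M) W) F"
    unfolding continuous_map_in_subtopology using smooth_map_continuous[OF F] FW by blast
  from continuous_map_compose[OF this homeomorphic_imp_continuous_map[OF copy_homeomorphic[OF t W]]]
  show "continuous_map (mtop N) (mtop (copy_manifold t W M)) (\<lambda>p. t (F p))"
    unfolding mtop_copy_manifold by (simp add: o_def)
  fix p assume p: "p \<in> points N"
  obtain U \<phi> where c: "(U, \<phi>) \<in> matlas M" "F p \<in> U" using chart_exists[OF M smooth_map_points[OF F p]] by metis
  note C = matlas_chartD[OF M c(1)]
  have "(U \<inter> W, \<phi>) \<in> matlas M" by (rule chart_restrict[OF M c(1)]) (use C(1) W in auto)
  then have d: "(t ` (U \<inter> W), \<lambda>p. \<phi> (inv t p)) \<in> matlas (copy_manifold t W M)"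
    by (rule smooth_copy_manifold(2)[OF M t W]) simp
  show "\<exists>V \<psi>. (V, \<psi>) \<in> matlas (copy_manifold t W M) \<and> t (F p) \<in> V \<and> (\<forall>j<mdim (copy_manifold t W M). smooth_near N p (\<lambda>q. \<psi> (t (F q)) j))"
    using d smooth_mapD[OF F p c] c(2) FW[OF p]
    by (intro exI[of _ "t ` (U \<inter> W)"] exI[of _ "\<lambda>p. \<phi> (inv t p)"]) simp
qed

section \<open>Tangent vectors\<close>

lemma coord_vector_apply:
  "smooth_near M p g \<Longrightarrow> coord_vector M (U, \<phi>) p v g = (\<Sum>i<mdim M. v i * partial_deriv i (\<lambda>x. g (inv_into U \<phi> x)) (\<phi> p))"
  by (simp add: coord_vector_def)

lemma coord_vector_in: "(U, \<phi>) \<in> matlas M \<Longrightarrow> p \<in> U \<Longrightarrow> coord_vector M (U, \<phi>) p v \<in> tangent_space M p"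
  unfolding tangent_space_def by force

lemma tangent_spaceE:
  assumes "u \<in> tangent_space M p"
  obtains U \<phi> v where "(U, \<phi>) \<in> matlas M" "p \<in> U" "u = coord_vector M (U, \<phi>) p v"
proof -
  obtain c v where "u = coord_vector M c p v" "c \<in> matlas M" "p \<in> fst c"
    using assms unfolding tangent_space_def by blast
  then show thesis using that[of "fst c" "snd c" v] by simp
qed

lemma tangent_points: "smooth_manifold M \<Longrightarrow> u \<in> tangent_space M p \<Longrightarrow> p \<in> points M"
proof -
  assume M: "smooth_manifold M" and u: "u \<in> tangent_space M p"
  from u obtain U \<phi> v where c: "(U, \<phi>) \<in> matlas M" "p \<in> U" by (rule tangent_spaceE)
  then show ?thesis using matlas_chartD(2)[OF M c(1)] by blast
qed

lemma tangent_not_smooth: "u \<in> tangent_space M p \<Longrightarrow> \<not> smooth_near M p g \<Longrightarrow> u g = 0"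
  by (erule tangent_spaceE) (simp add: coord_vector_def)

text \<open>A tangent vector is a combination of partial derivatives in some chart and so inherits
  the chain rule. Independence of the chart (\<open>tangent_eq_coord_vector\<close>), vanishing on
  constants and the shape of pushforwards (\<open>pushforward_in\<close>) are obtained from
  it.\<close>

lemma tangent_chain:
  assumes M: "smooth_manifold M" and u: "u \<in> tangent_space M p"
    and G: "smooth_at m G (trunc m (\<lambda>j. h j p))" and h: "\<And>j. j < m \<Longrightarrow> smooth_near M p (h j)"
  shows "u (\<lambda>q. G (trunc m (\<lambda>j. h j q))) = (\<Sum>j<m. partial_deriv j G (trunc m (\<lambda>j. h j p)) * u (h j))"
proof -
  obtain U \<phi> v where c: "(U, \<phi>) \<in> matlas M" "p \<in> U" and uv: "u = coord_vector M (U, \<phi>) p v"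
    using u by (rule tangent_spaceE)
  note C = matlas_chartD[OF M c(1)]
  let ?n = "mdim M"
  have hs: "smooth_at ?n (\<lambda>x. h j (inv_into U \<phi> x)) (\<phi> p)" if "j < m" for j
    by (rule iffD1[OF smooth_near_iff[OF M c] h[OF that]])
  have G': "smooth_at m G (trunc m (\<lambda>j. h j (inv_into U \<phi> (\<phi> p))))" using G C(6)[OF c(2)] by simp
  have d: "partial_deriv i (\<lambda>x. G (trunc m (\<lambda>j. h j (inv_into U \<phi> x)))) (\<phi> p) =
     (\<Sum>j<m. partial_deriv j G (trunc m (\<lambda>j. h j p)) * partial_deriv i (\<lambda>x. h j (inv_into U \<phi> x)) (\<phi> p))" if "i < ?n" for i
    using partial_deriv_compose[OF C(5)[OF c(2)] G' hs that] C(6)[OF c(2)] by simp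
  have "smooth_near M p (\<lambda>q. G (trunc m (\<lambda>j. h j q)))"
    by (rule smooth_near_compose[OF M _ G h]) (rule tangent_points[OF M u])
  then have "u (\<lambda>q. G (trunc m (\<lambda>j. h j q))) = (\<Sum>i<?n. \<Sum>j<m. v i * (partial_deriv j G (trunc m (\<lambda>j. h j p)) * partial_deriv i (\<lambda>x. h j (inv_into U \<phi> x)) (\<phi> p)))"
    unfolding uv coord_vector_apply[OF \<open>smooth_near M p (\<lambda>q. G (trunc m (\<lambda>j. h j q)))\<close>] by (simp add: d sum_distrib_left)
  also have "\<dots> = (\<Sum>j<m. \<Sum>i<?n. v i * (partial_deriv j G (trunc m (\<lambda>j. h j p)) * partial_deriv i (\<lambda>x. h j (inv_into U \<phi> x)) (\<phi> p)))"
    by (rule sum.swap)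
  also have "\<dots> = (\<Sum>j<m. partial_deriv j G (trunc m (\<lambda>j. h j p)) * u (h j))"
  proof (rule sum.cong[OF refl])
    fix j assume "j \<in> {..<m}"
    then have "j < m" by simp
    show "(\<Sum>i<?n. v i * (partial_deriv j G (trunc m (\<lambda>j. h j p)) * partial_deriv i (\<lambda>x. h j (inv_into U \<phi> x)) (\<phi> p))) = partial_deriv j G (trunc m (\<lambda>j. h j p)) * u (h j)"
      unfolding uv coord_vector_apply[OF h[OF \<open>j < m\<close>]] by (simp add: sum_distrib_left mult.left_commute)
  qed
  finally show ?thesis .
qed

lemma tangent_cong:
  assumes M: "smooth_manifold M" and u: "u \<in> tangent_space M p" and ev: "\<forall>\<^sub>F q in nhdsin (mtop M) p. g q = h q"
  shows "u g = u h"
proof (cases "smooth_near M p g")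
  case True
  then have h: "smooth_near M p h" by (rule smooth_near_cong[OF M ev])
  obtain U \<phi> v where c: "(U, \<phi>) \<in> matlas M" "p \<in> U" and uv: "u = coord_vector M (U, \<phi>) p v"
    using u by (rule tangent_spaceE)
  note C = matlas_chartD[OF M c(1)]
  have "\<forall>\<^sub>F x in near_eucl (mdim M) (\<phi> p). g (inv_into U \<phi> x) = h (inv_into U \<phi> x)"
    using eventually_chart[OF matlas_chart_on[OF M c(1)] c(2), of "\<lambda>q. g q = h q"] ev by simp
  from partial_deriv_cong_ev[OF this C(5)[OF c(2)]] show ?thesis
    unfolding uv coord_vector_apply[OF True] coord_vector_apply[OF h] by simp
next
  case False
  have "\<forall>\<^sub>F q in nhdsin (mtop M) p. h q = g q" using ev by (rule eventually_mono) simp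
  \<comment> \<open>Outside the smooth germs the operators are extended by 0, so the two values
    agree there as well.\<close>
  then have "\<not> smooth_near M p h" using False smooth_near_cong[OF M, where g=h and h=g and p=p] by blast
  then show ?thesis using False tangent_not_smooth[OF u] by simp
qed

lemma tangent_add:
  assumes M: "smooth_manifold M" and u: "u \<in> tangent_space M p" and g: "smooth_near M p g" and h: "smooth_near M p h"
  shows "u (\<lambda>q. g q + h q) = u g + u h"
proof -
  obtain U \<phi> v where c: "(U, \<phi>) \<in> matlas M" "p \<in> U" and uv: "u = coord_vector M (U, \<phi>) p v"
    using u by (rule tangent_spaceE)
  show ?thesis
    unfolding uv coord_vector_apply[OF g] coord_vector_apply[OF h] coord_vector_apply[OF smooth_near_add[OF M g h]]
      sum.distrib[symmetric]
    by (rule sum.cong[OF refl])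
      (simp add: partial_deriv_add[OF iffD1[OF smooth_near_iff[OF M c] g] iffD1[OF smooth_near_iff[OF M c] h]] distrib_left)
qed

text \<open>A constant is a function of no variables: \<open>tangent_chain\<close> with
  \<open>m = 0\<close> yields an empty sum.\<close>

lemma tangent_const:
  assumes M: "smooth_manifold M" and u: "u \<in> tangent_space M p" shows "u (\<lambda>q. c) = 0"
  using tangent_chain[OF M u, of 0 "\<lambda>_. c"] smooth_at_const[OF trunc_in] by simp

lemma tangent_diff:
  assumes M: "smooth_manifold M" and u: "u \<in> tangent_space M p" and g: "smooth_near M p g" and h: "smooth_near M p h"
  shows "u (\<lambda>q. g q - h q) = u g - u h"
  using tangent_add[OF M u smooth_near_diff[OF M g h] h] by simp

lemma coord_vector_coord:
  assumes M: "smooth_manifold M" and c: "(U, \<phi>) \<in> matlas M" "p \<in> U" and j: "j < mdim M"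
  shows "coord_vector M (U, \<phi>) p v (\<lambda>q. \<phi> q j) = v j"
proof -
  note C = matlas_chartD[OF M c(1)]
  have "\<forall>\<^sub>F x in near_eucl (mdim M) (\<phi> p). x \<in> \<phi> ` U"
    by (rule eventually_in_open[OF C(3)]) (use c(2) in blast)
  then have "\<forall>\<^sub>F x in near_eucl (mdim M) (\<phi> p). \<phi> (inv_into U \<phi> x) j = x j"
    by (rule eventually_mono) (simp add: f_inv_into_f)
  from partial_deriv_cong_ev[OF this C(5)[OF c(2)]]
  have "partial_deriv i (\<lambda>x. \<phi> (inv_into U \<phi> x) j) (\<phi> p) = (if i = j then 1 else 0)" if "i < mdim M" for i
    using that by (simp add: partial_deriv_coord)
  then show ?thesis
    unfolding coord_vector_apply[OF smooth_near_coord[OF M c]] using j by (simp add: if_distrib[of "\<lambda>x. _ * x"] sum.delta cong: if_cong)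
qed

text \<open>\<open>tangent_space\<close> collects operators from all charts at \<open>p\<close>.
  Writing a function through \<open>(U, \<phi>)\<close> and applying the chain rule shows that a
  single chart yields them all, the values on its coordinate functions being the components.\<close>

lemma tangent_eq_coord_vector:
  assumes M: "smooth_manifold M" and u: "u \<in> tangent_space M p" and c: "(U, \<phi>) \<in> matlas M" "p \<in> U"
  shows "u = coord_vector M (U, \<phi>) p (\<lambda>i. u (\<lambda>q. \<phi> q i))"
proof
  fix g
  note C = matlas_chartD[OF M c(1)]
  show "u g = coord_vector M (U, \<phi>) p (\<lambda>i. u (\<lambda>q. \<phi> q i)) g"
  proof (cases "smooth_near M p g")
    case True
    have t: "trunc (mdim M) (\<lambda>j. \<phi> q j) = \<phi> q" if "q \<in> U" for q using trunc_id[OF C(5)[OF that]] by simp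
    have gs: "smooth_at (mdim M) (\<lambda>x. g (inv_into U \<phi> x)) (trunc (mdim M) (\<lambda>j. \<phi> p j))"
      unfolding t[OF c(2)] by (rule iffD1[OF smooth_near_iff[OF M c] True])
    have "\<forall>\<^sub>F q in nhdsin (mtop M) p. q \<in> U" by (rule eventually_in_open[OF C(1) c(2)])
    then have ev: "\<forall>\<^sub>F q in nhdsin (mtop M) p. g q = (\<lambda>x. g (inv_into U \<phi> x)) (trunc (mdim M) (\<lambda>j. \<phi> q j))"
      by (rule eventually_mono) (simp add: t C(6))
    have "u g = u (\<lambda>q. (\<lambda>x. g (inv_into U \<phi> x)) (trunc (mdim M) (\<lambda>j. \<phi> q j)))"
      by (rule tangent_cong[OF M u ev])
    also have "\<dots> = (\<Sum>j<mdim M. partial_deriv j (\<lambda>x. g (inv_into U \<phi> x)) (trunc (mdim M) (\<lambda>j. \<phi> p j)) * u (\<lambda>q. \<phi> q j))"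
      by (rule tangent_chain[OF M u gs smooth_near_coord[OF M c]])
    finally show ?thesis unfolding coord_vector_apply[OF True] t[OF c(2)] by (simp add: mult.commute)
  qed (use tangent_not_smooth[OF u] in \<open>simp add: coord_vector_def\<close>)
qed

lemma tangent_apply:
  assumes "smooth_manifold M" "u \<in> tangent_space M p" "(U, \<phi>) \<in> matlas M" "p \<in> U" "smooth_near M p g"
  shows "u g = (\<Sum>i<mdim M. u (\<lambda>q. \<phi> q i) * partial_deriv i (\<lambda>x. g (inv_into U \<phi> x)) (\<phi> p))"
  by (subst tangent_eq_coord_vector[OF assms(1-4)]) (rule coord_vector_apply[OF assms(5)])

lemma coord_vector_cong:
  "(\<And>i. i < mdim M \<Longrightarrow> v i = w i) \<Longrightarrow> coord_vector M c p v = coord_vector M c p w"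
  by (cases c) (auto simp: coord_vector_def fun_eq_iff intro!: sum.cong)

lemma tangent_eqI:
  assumes M: "smooth_manifold M" and u: "u \<in> tangent_space M p" "v \<in> tangent_space M p"
    and c: "(U, \<phi>) \<in> matlas M" "p \<in> U" and eq: "\<And>j. j < mdim M \<Longrightarrow> u (\<lambda>q. \<phi> q j) = v (\<lambda>q. \<phi> q j)"
  shows "u = v"
proof -
  have "u = coord_vector M (U, \<phi>) p (\<lambda>i. u (\<lambda>q. \<phi> q i))" by (rule tangent_eq_coord_vector[OF M u(1) c])
  also have "\<dots> = coord_vector M (U, \<phi>) p (\<lambda>i. v (\<lambda>q. \<phi> q i))" by (rule coord_vector_cong[OF eq])
  also have "\<dots> = v" by (rule tangent_eq_coord_vector[OF M u(2) c, symmetric])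
  finally show ?thesis .
qed

lemma tangent_linear_comb:
  assumes M: "smooth_manifold M" and u: "u \<in> tangent_space M p" "v \<in> tangent_space M p"
  shows "(\<lambda>g. a * u g + b * v g) \<in> tangent_space M p"
proof -
  obtain U \<phi> where c: "(U, \<phi>) \<in> matlas M" "p \<in> U" using chart_exists[OF M tangent_points[OF M u(1)]] by metis
  have "(\<lambda>g. a * u g + b * v g) = coord_vector M (U, \<phi>) p (\<lambda>i. a * u (\<lambda>q. \<phi> q i) + b * v (\<lambda>q. \<phi> q i))"
  proof
    fix g
    show "a * u g + b * v g = coord_vector M (U, \<phi>) p (\<lambda>i. a * u (\<lambda>q. \<phi> q i) + b * v (\<lambda>q. \<phi> q i)) g"
    proof (cases "smooth_near M p g")
      case True
      show ?thesis
        unfolding coord_vector_apply[OF True] tangent_apply[OF M u(1) c True] tangent_apply[OF M u(2) c True]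
        by (simp add: sum_distrib_left sum.distrib distrib_right mult.assoc)
    qed (use tangent_not_smooth[OF u(1)] tangent_not_smooth[OF u(2)] in \<open>simp add: coord_vector_def\<close>)
  qed
  then show ?thesis using coord_vector_in[OF c] by simp
qed

lemma tangent_zero: "smooth_manifold M \<Longrightarrow> p \<in> points M \<Longrightarrow> (\<lambda>g. 0) \<in> tangent_space M p"
proof -
  assume M: "smooth_manifold M" and p: "p \<in> points M"
  obtain U \<phi> where c: "(U, \<phi>) \<in> matlas M" "p \<in> U" using chart_exists[OF M p] by metis
  from tangent_linear_comb[OF M coord_vector_in[OF c] coord_vector_in[OF c], of 0 _ 0] show ?thesis by simp
qed

lemma pushforward_apply: "smooth_near N (F p) g \<Longrightarrow> pushforward N F p u g = u (\<lambda>q. g (F q))"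
  by (simp add: pushforward_def o_def)

text \<open>By the chain rule the image is the coordinate vector whose components are the
  derivatives of \<open>\<psi> (F q) j\<close> along \<open>u\<close>.\<close>

lemma pushforward_in:
  assumes M: "smooth_manifold M" and N: "smooth_manifold N" and F: "smooth_map M N F" and u: "u \<in> tangent_space M p"
  shows "pushforward N F p u \<in> tangent_space N (F p)"
proof -
  have p: "p \<in> points M" by (rule tangent_points[OF M u])
  obtain V \<psi> where d: "(V, \<psi>) \<in> matlas N" "F p \<in> V" using chart_exists[OF N smooth_map_points[OF F p]] by metis
  note D = matlas_chartD[OF N d(1)]
  have t: "trunc (mdim N) (\<lambda>j. \<psi> q j) = \<psi> q" if "q \<in> V" for q using trunc_id[OF D(5)[OF that]] by simp
  have "pushforward N F p u = coord_vector N (V, \<psi>) (F p) (\<lambda>j. u (\<lambda>q. \<psi> (F q) j))"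
  proof
    fix g
    show "pushforward N F p u g = coord_vector N (V, \<psi>) (F p) (\<lambda>j. u (\<lambda>q. \<psi> (F q) j)) g"
    proof (cases "smooth_near N (F p) g")
      case True
      have gs: "smooth_at (mdim N) (\<lambda>x. g (inv_into V \<psi> x)) (trunc (mdim N) (\<lambda>j. \<psi> (F p) j))"
        unfolding t[OF d(2)] by (rule iffD1[OF smooth_near_iff[OF N d] True])
      have "\<forall>\<^sub>F q in nhdsin (mtop M) p. F q \<in> V"
        by (rule eventually_continuous_map[OF smooth_map_continuous[OF F] p eventually_in_open[OF D(1) d(2)]])
      then have ev: "\<forall>\<^sub>F q in nhdsin (mtop M) p. g (F q) = (\<lambda>x. g (inv_into V \<psi> x)) (trunc (mdim N) (\<lambda>j. \<psi> (F q) j))"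
        by (rule eventually_mono) (simp add: t D(6))
      have "u (\<lambda>q. g (F q)) = u (\<lambda>q. (\<lambda>x. g (inv_into V \<psi> x)) (trunc (mdim N) (\<lambda>j. \<psi> (F q) j)))"
        by (rule tangent_cong[OF M u ev])
      also have "\<dots> = (\<Sum>j<mdim N. partial_deriv j (\<lambda>x. g (inv_into V \<psi> x)) (trunc (mdim N) (\<lambda>j. \<psi> (F p) j)) * u (\<lambda>q. \<psi> (F q) j))"
        by (rule tangent_chain[OF M u gs smooth_mapD[OF F p d]])
      finally show ?thesis
        unfolding coord_vector_apply[OF True] pushforward_apply[of N F p, OF True] t[OF d(2)] by (simp add: mult.commute)
    qed (simp add: pushforward_def coord_vector_def)
  qed
  then show ?thesis using coord_vector_in[OF d] by simp
qed

lemma pushforward_linear_comb: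
  "pushforward N F p (\<lambda>g. a * u g + b * v g) = (\<lambda>g. a * pushforward N F p u g + b * pushforward N F p v g)"
  by (auto simp: pushforward_def fun_eq_iff)

text \<open>Valid for every operator \<open>u\<close>: if \<open>g\<close> is smooth near
  \<open>G (F p)\<close>, then its pullback along \<open>G\<close> is smooth near
  \<open>F p\<close>, so the cut-offs by 0 agree.\<close>

lemma pushforward_compose:
  assumes M: "smooth_manifold M" and N: "smooth_manifold N" and P: "smooth_manifold P"
    and F: "smooth_map M N F" and G: "smooth_map N P G" and p: "p \<in> points M"
  shows "pushforward P G (F p) (pushforward N F p u) = pushforward P (\<lambda>x. G (F x)) p u"
proof
  fix g show "pushforward P G (F p) (pushforward N F p u) g = pushforward P (\<lambda>x. G (F x)) p u g"
    using smooth_near_pullback[OF N P G smooth_map_points[OF F p], of g] by (simp add: pushforward_def o_def)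
qed

lemma pushforward_cong:
  assumes M: "smooth_manifold M" and u: "u \<in> tangent_space M p" and ev: "\<And>q. q \<in> points M \<Longrightarrow> F q = G q"
  shows "pushforward N F p u = pushforward N G p u"
proof
  fix g :: "_ \<Rightarrow> real"
  have p: "p \<in> points M" by (rule tangent_points[OF M u])
  have "\<forall>\<^sub>F q in nhdsin (mtop M) p. q \<in> points M" by (rule eventually_in_open[OF openin_topspace p])
  then have "\<forall>\<^sub>F q in nhdsin (mtop M) p. g (F q) = g (G q)" by (rule eventually_mono) (simp add: ev)
  from tangent_cong[OF M u, of "\<lambda>q. g (F q)" "\<lambda>q. g (G q)", OF this] show "pushforward N F p u g = pushforward N G p u g"
    by (simp add: pushforward_def o_def ev[OF p])
qed

lemma pushforward_id:
  assumes "u \<in> tangent_space M p" shows "pushforward M (\<lambda>x. x) p u = u"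
  using tangent_not_smooth[OF assms] by (auto simp: pushforward_def fun_eq_iff o_def)

lemma pushforward_inverse:
  assumes M: "smooth_manifold M" and N: "smooth_manifold N" and F: "smooth_map M N F" and G: "smooth_map N M G"
    and GF: "\<And>p. p \<in> points M \<Longrightarrow> G (F p) = p" and u: "u \<in> tangent_space M p"
  shows "pushforward M G (F p) (pushforward N F p u) = u"
proof -
  have "pushforward M G (F p) (pushforward N F p u) = pushforward M (\<lambda>x. G (F x)) p u"
    by (rule pushforward_compose[OF M N M F G tangent_points[OF M u]])
  also have "\<dots> = pushforward M (\<lambda>x. x) p u" by (rule pushforward_cong[OF M u GF])
  finally show ?thesis using pushforward_id[OF u] by simp
qed

text \<open>Together with \<open>tangent_prod_ex\<close> this identifies the tangent space of a
  product with the product of the tangent spaces, by means of the two projections.\<close>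

lemma tangent_prod_eqI:
  assumes M: "smooth_manifold M" and N: "smooth_manifold N"
    and u: "u \<in> tangent_space (prod_manifold M N) p" "v \<in> tangent_space (prod_manifold M N) p"
    and f: "pushforward M fst p u = pushforward M fst p v" and s: "pushforward N snd p u = pushforward N snd p v"
  shows "u = v"
proof -
  note MN = smooth_prod_manifold(1)[OF M N]
  have p: "fst p \<in> points M" "snd p \<in> points N" using tangent_points[OF MN u(1)] by auto
  obtain U \<phi> where c: "(U, \<phi>) \<in> matlas M" "fst p \<in> U" using chart_exists[OF M p(1)] by metis
  obtain V \<psi> where d: "(V, \<psi>) \<in> matlas N" "snd p \<in> V" using chart_exists[OF N p(2)] by metis
  have 1: "w (\<lambda>q. \<phi> (fst q) j) = pushforward M fst p w (\<lambda>q. \<phi> q j)" for w j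
    by (rule pushforward_apply[symmetric]) (rule smooth_near_coord[OF M c])
  have 2: "w (\<lambda>q. \<psi> (snd q) j) = pushforward N snd p w (\<lambda>q. \<psi> q j)" for w j
    by (rule pushforward_apply[symmetric]) (rule smooth_near_coord[OF N d])
  show ?thesis
  proof (rule tangent_eqI[OF MN u prod_chart_matlas[OF M N c(1) d(1)]])
    show "p \<in> U \<times> V" using c d by (simp add: mem_Times_iff)
    show "u (\<lambda>q. join (mdim M) (\<phi> (fst q)) (\<psi> (snd q)) j) = v (\<lambda>q. join (mdim M) (\<phi> (fst q)) (\<psi> (snd q)) j)" for j
      unfolding join_def by (cases "j < mdim M") (simp_all add: 1 2 f s)
  qed
qed

lemma tangent_prod_ex:
  assumes M: "smooth_manifold M" and N: "smooth_manifold N"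
    and a: "a \<in> tangent_space M (fst p)" and b: "b \<in> tangent_space N (snd p)"
  obtains u where "u \<in> tangent_space (prod_manifold M N) p" "pushforward M fst p u = a" "pushforward N snd p u = b"
proof -
  note MN = smooth_prod_manifold(1)[OF M N]
  obtain U \<phi> where c: "(U, \<phi>) \<in> matlas M" "fst p \<in> U" using chart_exists[OF M tangent_points[OF M a]] by metis
  obtain V \<psi> where d: "(V, \<psi>) \<in> matlas N" "snd p \<in> V" using chart_exists[OF N tangent_points[OF N b]] by metis
  let ?\<Phi> = "\<lambda>p. join (mdim M) (\<phi> (fst p)) (\<psi> (snd p))"
  note C = prod_chart_matlas[OF M N c(1) d(1)]
  have p: "p \<in> U \<times> V" using c d by (simp add: mem_Times_iff)
  define u where "u = coord_vector (prod_manifold M N) (U \<times> V, ?\<Phi>) p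
    (\<lambda>i. if i < mdim M then a (\<lambda>q. \<phi> q i) else b (\<lambda>q. \<psi> q (i - mdim M)))"
  have u: "u \<in> tangent_space (prod_manifold M N) p" unfolding u_def by (rule coord_vector_in[OF C p])
  have uc: "u (\<lambda>q. ?\<Phi> q j) = (if j < mdim M then a (\<lambda>q. \<phi> q j) else b (\<lambda>q. \<psi> q (j - mdim M)))" if "j < mdim M + mdim N" for j
    unfolding u_def using coord_vector_coord[OF MN C p] that by simp
  have 1: "pushforward M fst p u = a"
  proof (rule tangent_eqI[OF M pushforward_in[OF MN M smooth_map_fst[OF M N] u] a c])
    fix j assume j: "j < mdim M"
    have "pushforward M fst p u (\<lambda>q. \<phi> q j) = u (\<lambda>q. \<phi> (fst q) j)"
      by (rule pushforward_apply[of M fst p, OF smooth_near_coord[OF M c]])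
    then show "pushforward M fst p u (\<lambda>q. \<phi> q j) = a (\<lambda>q. \<phi> q j)" using uc[of j] j by (simp add: join_def)
  qed
  have 2: "pushforward N snd p u = b"
  proof (rule tangent_eqI[OF N pushforward_in[OF MN N smooth_map_snd[OF M N] u] b d])
    fix j assume j: "j < mdim N"
    have "pushforward N snd p u (\<lambda>q. \<psi> q j) = u (\<lambda>q. \<psi> (snd q) j)"
      by (rule pushforward_apply[of N snd p, OF smooth_near_coord[OF N d]])
    then show "pushforward N snd p u (\<lambda>q. \<psi> q j) = b (\<lambda>q. \<psi> q j)" using uc[of "mdim M + j"] j by (simp add: join_def)
  qed
  show thesis by (rule that[OF u 1 2])
qed

section \<open>Tangent spaces of submanifolds\<close>

text \<open>Intrinsic form of the tangent space of \<open>S\<close>: the vectors annihilating the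
  germs that vanish on \<open>S\<close>. It refers to no dimension and no slice chart, and so
  mediates between \<open>tangent_subspace\<close> and arbitrary adapted charts.\<close>

definition conormal_kernel :: "('a, 'm) manifold_scheme \<Rightarrow> 'a set \<Rightarrow> 'a \<Rightarrow> 'a tvec set" where
  "conormal_kernel M S p = {u \<in> tangent_space M p. \<forall>g. smooth_near M p g \<longrightarrow>
     (\<forall>\<^sub>F q in nhdsin (mtop M) p. q \<in> S \<longrightarrow> g q = 0) \<longrightarrow> u g = 0}"

text \<open>Generalises slice charts by letting an arbitrary set \<open>J\<close> of coordinates
  vanish. Products, graphs and slices can then be described without renumbering, which is done once,
  in \<open>adapted_submanifold\<close>.\<close>

definition adapted_chart :: "('a, 'm) manifold_scheme \<Rightarrow> 'a set \<Rightarrow> 'a \<Rightarrow> 'a set \<Rightarrow> ('a \<Rightarrow> nat \<Rightarrow> real) \<Rightarrow> nat set \<Rightarrow> bool" where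
  "adapted_chart M S p U \<phi> J \<longleftrightarrow>
     (U, \<phi>) \<in> matlas M \<and> p \<in> U \<and> J \<subseteq> {..<mdim M} \<and> (\<forall>x\<in>U. x \<in> S \<longleftrightarrow> (\<forall>j\<in>J. \<phi> x j = 0))"

text \<open>The coordinates in \<open>J\<close> vanish on \<open>S\<close>, which gives one
  inclusion. For the other, a coordinate line through \<open>p\<close> in a direction outside
  \<open>J\<close> stays in \<open>S\<close>, so a germ vanishing on \<open>S\<close> has derivative
  0 along it.\<close>

lemma conormal_kernel_adapted:
  assumes M: "smooth_manifold M" and a: "adapted_chart M S p U \<phi> J" and p: "p \<in> S"
  shows "conormal_kernel M S p = {u \<in> tangent_space M p. \<forall>j\<in>J. u (\<lambda>q. \<phi> q j) = 0}"
proof (intro equalityI subsetI)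
  have c: "(U, \<phi>) \<in> matlas M" "p \<in> U" and S: "\<And>x. x \<in> U \<Longrightarrow> x \<in> S \<longleftrightarrow> (\<forall>j\<in>J. \<phi> x j = 0)"
    using a by (auto simp: adapted_chart_def)
  note C = matlas_chartD[OF M c(1)]
  have evU: "\<forall>\<^sub>F q in nhdsin (mtop M) p. q \<in> U" by (rule eventually_in_open[OF C(1) c(2)])
  {
    fix u assume u: "u \<in> conormal_kernel M S p"
    have "u (\<lambda>q. \<phi> q j) = 0" if j: "j \<in> J" for j
    proof -
      have "\<forall>\<^sub>F q in nhdsin (mtop M) p. q \<in> S \<longrightarrow> \<phi> q j = 0" using evU by (rule eventually_mono) (use S j in blast)
      then show ?thesis using u smooth_near_coord[OF M c, of j] unfolding conormal_kernel_def by simp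
    qed
    then show "u \<in> {u \<in> tangent_space M p. \<forall>j\<in>J. u (\<lambda>q. \<phi> q j) = 0}" using u by (simp add: conormal_kernel_def)
  }
  fix u assume "u \<in> {u \<in> tangent_space M p. \<forall>j\<in>J. u (\<lambda>q. \<phi> q j) = 0}"
  then have u: "u \<in> tangent_space M p" and u0: "\<And>j. j \<in> J \<Longrightarrow> u (\<lambda>q. \<phi> q j) = 0" by auto
  have "u g = 0" if g: "smooth_near M p g" and ev: "\<forall>\<^sub>F q in nhdsin (mtop M) p. q \<in> S \<longrightarrow> g q = 0" for g
  proof -
    have "u (\<lambda>q. \<phi> q i) * partial_deriv i (\<lambda>x. g (inv_into U \<phi> x)) (\<phi> p) = 0" if i: "i < mdim M" for i
    proof (cases "i \<in> J")
      case False
      from ev have "\<forall>\<^sub>F x in near_eucl (mdim M) (\<phi> p). inv_into U \<phi> x \<in> S \<longrightarrow> g (inv_into U \<phi> x) = 0"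
        using eventually_chart[OF matlas_chart_on[OF M c(1)] c(2), of "\<lambda>q. q \<in> S \<longrightarrow> g q = 0"] by blast
      then obtain V where V: "open_eucl (mdim M) V" "\<phi> p \<in> V" "\<forall>x\<in>V. inv_into U \<phi> x \<in> S \<longrightarrow> g (inv_into U \<phi> x) = 0"
        using C(5)[OF c(2)] by (auto simp: eventually_nhdsin)
      have o: "open_eucl (mdim M) (V \<inter> \<phi> ` U)" and m: "\<phi> p \<in> V \<inter> \<phi> ` U"
        using V C(3) c(2) by auto
      have "\<forall>\<^sub>F t in nhds (\<phi> p i). g (inv_into U \<phi> ((\<phi> p)(i := t))) = 0"
        using eventually_fun_upd[OF o m i]
      proof (rule eventually_mono)
        fix t assume t: "(\<phi> p)(i := t) \<in> V \<inter> \<phi> ` U"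
        then have im: "(\<phi> p)(i := t) \<in> \<phi> ` U" by blast
        note q = inv_into_into[OF im] f_inv_into_f[OF im]
        have "((\<phi> p)(i := t)) j = 0" if "j \<in> J" for j using False that S[OF c(2)] p by auto
        then have "inv_into U \<phi> ((\<phi> p)(i := t)) \<in> S" unfolding S[OF q(1)] q(2) by blast
        then show "g (inv_into U \<phi> ((\<phi> p)(i := t))) = 0" using V(3) t by blast
      qed
      then have "deriv (\<lambda>t. g (inv_into U \<phi> ((\<phi> p)(i := t)))) (\<phi> p i) = deriv (\<lambda>t. 0) (\<phi> p i)"
        by (rule deriv_cong_ev) simp
      then show ?thesis by (simp add: partial_deriv_def)
    qed (simp add: u0)
    then show ?thesis unfolding tangent_apply[OF M u c g] by (intro sum.neutral) simp
  qed
  then show "u \<in> conormal_kernel M S p" using u unfolding conormal_kernel_def by blast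
qed

lemma submanifold_slice:
  assumes "submanifold k M S" "p \<in> S"
  obtains U \<phi> where "(U, \<phi>) \<in> slice_charts (submanifold_dim M S) M S" "p \<in> U" "submanifold_dim M S \<le> mdim M"
  using submanifold_dim[OF assms(1)] assms(2) unfolding submanifold_def by blast

text \<open>Frees tangent spaces from the induced manifold, whose dimension is a LEAST and whose
  atlas is generated by slice charts. The inclusion is injective on tangent vectors because one and
  the same slice chart gives coordinates on \<open>M\<close> and on \<open>S\<close>.\<close>

lemma tangent_subspace_eq_conormal_kernel:
  assumes M: "smooth_manifold M" and S: "submanifold k M S" and p: "p \<in> S"
  shows "tangent_subspace M S p = conormal_kernel M S p"
    and "inj_on (pushforward M (\<lambda>x. x) p) (tangent_space (induced_manifold M S) p)"
proof -
  let ?I = "induced_manifold M S" and ?d = "submanifold_dim M S"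
  note I = smooth_induced_manifold(1)[OF M S] and inc = smooth_map_inclusion[OF M S]
  obtain U \<phi> where U: "(U, \<phi>) \<in> slice_charts ?d M S" "p \<in> U" "?d \<le> mdim M" using submanifold_slice[OF S p] by metis
  have c: "(U, \<phi>) \<in> matlas M" using U by (auto simp: slice_charts_def)
  have d: "(U \<inter> S, \<phi>) \<in> matlas ?I" "p \<in> U \<inter> S" using smooth_induced_manifold(2)[OF M S U(1)] U p by auto
  note mem = slice_chart_on(2)[OF M U(1,3)]
  note C = matlas_chartD[OF M c]
  have push: "pushforward M (\<lambda>x. x) p u (\<lambda>q. \<phi> q j) = u (\<lambda>q. \<phi> q j)" for u j
    by (rule pushforward_apply[of M "\<lambda>x. x" p, OF smooth_near_coord[OF M c U(2)]])
  have z: "\<phi> q j = 0" if "q \<in> U" "q \<in> S" "j \<ge> ?d" for q j using mem that by (auto simp: in_Euclidean_space)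
  have evI: "\<forall>\<^sub>F q in nhdsin (mtop ?I) p. q \<in> U \<inter> S"
    by (rule eventually_in_open) (use C(1) U(2) p in \<open>auto simp: openin_subtopology\<close>)
  show "inj_on (pushforward M (\<lambda>x. x) p) (tangent_space ?I p)"
  proof (rule inj_onI)
    fix u v assume uv: "u \<in> tangent_space ?I p" "v \<in> tangent_space ?I p" "pushforward M (\<lambda>x. x) p u = pushforward M (\<lambda>x. x) p v"
    show "u = v"
      by (rule tangent_eqI[OF I uv(1,2) d]) (metis push uv(3))
  qed
  show "tangent_subspace M S p = conormal_kernel M S p"
  proof (intro equalityI subsetI)
    fix w assume "w \<in> tangent_subspace M S p"
    then obtain u where u: "u \<in> tangent_space ?I p" "w = pushforward M (\<lambda>x. x) p u" unfolding tangent_subspace_def by blast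
    have "w \<in> tangent_space M p" unfolding u(2) by (rule pushforward_in[OF I M inc u(1)])
    moreover have "w g = 0" if g: "smooth_near M p g" and ev: "\<forall>\<^sub>F q in nhdsin (mtop M) p. q \<in> S \<longrightarrow> g q = 0" for g
    proof -
      have pI: "p \<in> points ?I" by (rule tangent_points[OF I u(1)])
      have "\<forall>\<^sub>F q in nhdsin (mtop ?I) p. q \<in> S \<longrightarrow> g q = 0"
        by (rule eventually_continuous_map[OF smooth_map_continuous[OF inc] pI ev])
      with evI have "\<forall>\<^sub>F q in nhdsin (mtop ?I) p. g q = 0" by eventually_elim simp
      from tangent_cong[OF I u(1) this] have "u g = 0" using tangent_const[OF I u(1)] by simp
      then show ?thesis unfolding u(2) pushforward_apply[of M "\<lambda>x. x" p, OF g] by simp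
    qed
    ultimately show "w \<in> conormal_kernel M S p" unfolding conormal_kernel_def by blast
  next
    fix w assume w: "w \<in> conormal_kernel M S p"
    then have wT: "w \<in> tangent_space M p" by (simp add: conormal_kernel_def)
    \<comment> \<open>The vector of the induced manifold with the components of \<open>w\<close>.
      The further components of \<open>w\<close> are 0, as the corresponding coordinates vanish on
      \<open>S\<close>.\<close>
    define u where "u = coord_vector ?I (U \<inter> S, \<phi>) p (\<lambda>i. w (\<lambda>q. \<phi> q i))"
    have u: "u \<in> tangent_space ?I p" unfolding u_def by (rule coord_vector_in[OF d])
    have "w = pushforward M (\<lambda>x. x) p u"
    proof (rule tangent_eqI[OF M wT pushforward_in[OF I M inc u] c U(2)])
      fix j
      show "w (\<lambda>q. \<phi> q j) = pushforward M (\<lambda>x. x) p u (\<lambda>q. \<phi> q j)"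
      proof (cases "j < ?d")
        case True
        then show ?thesis unfolding push u_def using coord_vector_coord[OF I d] by simp
      next
        case False
        have "\<forall>\<^sub>F q in nhdsin (mtop M) p. q \<in> S \<longrightarrow> \<phi> q j = 0"
          using eventually_in_open[OF C(1) U(2)] by (rule eventually_mono) (use z False in auto)
        then have "w (\<lambda>q. \<phi> q j) = 0" using w smooth_near_coord[OF M c U(2), of j] by (simp add: conormal_kernel_def)
        moreover have "\<forall>\<^sub>F q in nhdsin (mtop ?I) p. \<phi> q j = 0" using evI by (rule eventually_mono) (use z False in auto)
        from tangent_cong[OF I u this] have "u (\<lambda>q. \<phi> q j) = 0" using tangent_const[OF I u] by simp
        ultimately show ?thesis unfolding push by simp
      qed
    qed
    then show "w \<in> tangent_subspace M S p" unfolding tangent_subspace_def using u by blast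
  qed
qed

lemma tangent_subspace_adapted:
  assumes "smooth_manifold M" "submanifold k M S" "p \<in> S" "adapted_chart M S p U \<phi> J"
  shows "tangent_subspace M S p = {u \<in> tangent_space M p. \<forall>j\<in>J. u (\<lambda>q. \<phi> q j) = 0}"
  using tangent_subspace_eq_conormal_kernel(1)[OF assms(1-3)] conormal_kernel_adapted[OF assms(1,4,3)] by simp

lemma submanifold_adapted:
  assumes M: "smooth_manifold M" and S: "submanifold k M S" and p: "p \<in> S"
  obtains U \<phi> J where "adapted_chart M S p U \<phi> J" "card J + k = mdim M"
proof -
  obtain U \<phi> where U: "(U, \<phi>) \<in> slice_charts k M S" "p \<in> U" and k: "k \<le> mdim M"
    using S p unfolding submanifold_def by blast
  have c: "(U, \<phi>) \<in> matlas M" using U by (auto simp: slice_charts_def)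
  note C = matlas_chartD[OF M c]
  have "adapted_chart M S p U \<phi> {k..<mdim M}"
    unfolding adapted_chart_def
  proof (intro conjI ballI c U(2))
    fix x assume x: "x \<in> U"
    have "\<phi> x j = 0" if "j \<ge> mdim M" for j using C(5)[OF x] that by (auto simp: in_Euclidean_space)
    then show "x \<in> S \<longleftrightarrow> (\<forall>j\<in>{k..<mdim M}. \<phi> x j = 0)"
      unfolding slice_chart_on(2)[OF M U(1) k x] in_Euclidean_space by (metis atLeastLessThan_iff not_less)
  qed auto
  then show thesis using that k by simp
qed

text \<open>A permutation moves the coordinates in \<open>J\<close> to the last places and turns an
  adapted chart into a slice chart.\<close>

lemma adapted_submanifold:
  assumes M: "smooth_manifold M" and S: "S \<subseteq> points M" and k: "k \<le> mdim M"
    and ad: "\<And>p. p \<in> S \<Longrightarrow> \<exists>U \<phi> J. adapted_chart M S p U \<phi> J \<and> card J + k = mdim M"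
  shows "submanifold k M S"
  unfolding submanifold_def
proof (intro conjI S k ballI)
  fix p assume "p \<in> S"
  then obtain U \<phi> J where a: "adapted_chart M S p U \<phi> J" and cJ: "card J + k = mdim M" using ad by blast
  let ?n = "mdim M"
  have c: "(U, \<phi>) \<in> matlas M" "p \<in> U" and J: "J \<subseteq> {..<?n}" and mem: "\<And>x. x \<in> U \<Longrightarrow> x \<in> S \<longleftrightarrow> (\<forall>j\<in>J. \<phi> x j = 0)"
    using a by (auto simp: adapted_chart_def)
  note C = matlas_chartD[OF M c(1)]
  have fJ: "finite J" using J finite_subset by blast
  have cd: "card ({..<?n} - J) = card {..<k}" using cJ J fJ by (simp add: card_Diff_subset)
  have "\<exists>f. bij_betw f {..<k} ({..<?n} - J)" "\<exists>g. bij_betw g {k..<?n} J"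
    by (rule finite_same_card_bij; use cd cJ fJ in simp)+
  then obtain f g where f: "bij_betw f {..<k} ({..<?n} - J)" and g: "bij_betw g {k..<?n} J" by blast
  \<comment> \<open>The coordinates outside \<open>J\<close> are numbered by the first
    \<open>k\<close> indices and those in \<open>J\<close> by the remaining ones.\<close>
  define \<sigma> where "\<sigma> i = (if i < k then f i else g i)" for i
  have s1: "bij_betw \<sigma> {..<k} ({..<?n} - J)"
    using f by (rule bij_betw_cong[THEN iffD1, rotated]) (simp add: \<sigma>_def)
  have s2: "bij_betw \<sigma> {k..<?n} J"
    using g by (rule bij_betw_cong[THEN iffD1, rotated]) (simp add: \<sigma>_def)
  have "bij_betw \<sigma> ({..<k} \<union> {k..<?n}) (({..<?n} - J) \<union> J)" by (rule bij_betw_combine[OF s1 s2]) blast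
  moreover have "{..<k} \<union> {k..<?n} = {..<?n}" "({..<?n} - J) \<union> J = {..<?n}" using k J by auto
  ultimately have \<sigma>: "bij_betw \<sigma> {..<?n} {..<?n}" by simp
  define \<tau> where "\<tau> = inv_into {..<?n} \<sigma>"
  have \<tau>: "bij_betw \<tau> {..<?n} {..<?n}" unfolding \<tau>_def by (rule bij_betw_inv_into[OF \<sigma>])
  have \<sigma>n: "\<sigma> i < ?n" if "i < ?n" for i using bij_betwE[OF \<sigma>] that by auto
  have \<tau>n: "\<tau> i < ?n" if "i < ?n" for i using bij_betwE[OF \<tau>] that by auto
  have \<sigma>\<tau>: "\<sigma> (\<tau> i) = i" if "i < ?n" for i unfolding \<tau>_def using bij_betw_inv_into_right[OF \<sigma>] that by simp
  have \<tau>\<sigma>: "\<tau> (\<sigma> i) = i" if "i < ?n" for i unfolding \<tau>_def using bij_betw_inv_into_left[OF \<sigma>] that by simp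
  define \<Theta> where "\<Theta> x = trunc ?n (\<lambda>i. x (\<sigma> i))" for x :: "nat \<Rightarrow> real"
  define \<Xi> where "\<Xi> x = trunc ?n (\<lambda>i. x (\<tau> i))" for x :: "nat \<Rightarrow> real"
  have \<Theta>\<Xi>: "\<Theta> (\<Xi> x) = x" "\<Xi> (\<Theta> x) = x" if "x \<in> eucl ?n" for x
    using that by (auto simp: \<Theta>_def \<Xi>_def trunc_def fun_eq_iff \<sigma>n \<tau>n \<sigma>\<tau> \<tau>\<sigma> in_Euclidean_space)
  have cs: "smooth_at ?n (\<lambda>x. trunc ?n (\<lambda>i. x (\<rho> i)) j) a" if "a \<in> eucl ?n" "j < ?n" for \<rho> j a
    using smooth_at_coord[OF that(1), of "\<rho> j"] that(2) by simp
  have ch: "(U, \<lambda>p. \<Theta> (\<phi> p)) \<in> matlas M"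
  proof (rule matlas_change_coordinates[OF M c(1), of \<Theta> \<Xi>])
    show "\<Theta> (\<phi> p) \<in> eucl ?n" if "p \<in> U" for p by (simp add: \<Theta>_def)
    show "\<Xi> (\<Theta> (\<phi> p)) = \<phi> p" if "p \<in> U" for p by (rule \<Theta>\<Xi>(2)[OF C(5)[OF that]])
    have "open_eucl ?n {x \<in> eucl ?n. trunc ?n (\<lambda>i. x (\<tau> i)) \<in> \<phi> ` U}"
      by (rule smooth_preimage_open[of _ _ ?n "\<lambda>i x. x (\<tau> i)", OF openin_topspace _ C(3)]) (simp add: smooth_on_def Ck_on_coord)
    moreover have "{x \<in> eucl ?n. trunc ?n (\<lambda>i. x (\<tau> i)) \<in> \<phi> ` U} = \<Theta> ` \<phi> ` U"
    proof (intro set_eqI iffI)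
      fix x assume "x \<in> {x \<in> eucl ?n. trunc ?n (\<lambda>i. x (\<tau> i)) \<in> \<phi> ` U}"
      then have "x \<in> eucl ?n" "\<Xi> x \<in> \<phi> ` U" by (auto simp: \<Xi>_def)
      then show "x \<in> \<Theta> ` \<phi> ` U" using \<Theta>\<Xi>(1) by (metis image_eqI)
    next
      fix x assume "x \<in> \<Theta> ` \<phi> ` U"
      then obtain q where q: "q \<in> U" "x = \<Theta> (\<phi> q)" by blast
      then have "\<Xi> x = \<phi> q" using \<Theta>\<Xi>(2)[OF C(5)[OF q(1)]] by simp
      then show "x \<in> {x \<in> eucl ?n. trunc ?n (\<lambda>i. x (\<tau> i)) \<in> \<phi> ` U}"
        using q by (simp add: \<Xi>_def \<Theta>_def)
    qed
    ultimately show "open_eucl ?n (\<Theta> ` \<phi> ` U)" by simp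
    show "smooth_at ?n (\<lambda>x. \<Theta> x j) (\<phi> p)" if "p \<in> U" "j < ?n" for p j
      unfolding \<Theta>_def by (rule cs[OF C(5)[OF that(1)] that(2)])
    show "smooth_at ?n (\<lambda>x. \<Xi> x j) (\<Theta> (\<phi> p))" if "p \<in> U" "j < ?n" for p j
      unfolding \<Xi>_def by (rule cs[OF _ that(2)]) (simp add: \<Theta>_def)
  qed
  have "x \<in> S \<longleftrightarrow> \<Theta> (\<phi> x) \<in> eucl k" if x: "x \<in> U" for x
  proof -
    have "\<Theta> (\<phi> x) \<in> eucl k \<longleftrightarrow> (\<forall>i\<in>{k..<?n}. \<phi> x (\<sigma> i) = 0)"
      by (auto simp: \<Theta>_def in_Euclidean_space trunc_def)
    also have "\<dots> \<longleftrightarrow> (\<forall>j\<in>\<sigma> ` {k..<?n}. \<phi> x j = 0)" by blast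
    also have "\<sigma> ` {k..<?n} = J" using s2 by (simp add: bij_betw_def)
    finally show ?thesis using mem[OF x] by simp
  qed
  then have "(\<lambda>p. \<Theta> (\<phi> p)) ` (U \<inter> S) = (\<lambda>p. \<Theta> (\<phi> p)) ` U \<inter> eucl k" by auto
  then have "(U, \<lambda>p. \<Theta> (\<phi> p)) \<in> slice_charts k M S" using ch by (simp add: slice_charts_def)
  then show "\<exists>(U, \<phi>)\<in>slice_charts k M S. p \<in> U" using c(2) by blast
qed

section \<open>Constructions of submanifolds\<close>

lemma submanifold_whole:
  assumes M: "smooth_manifold M" shows "submanifold (mdim M) M (points M)"
proof (rule adapted_submanifold[OF M])
  fix p assume "p \<in> points M"
  then obtain U \<phi> where c: "(U, \<phi>) \<in> matlas M" "p \<in> U" using chart_exists[OF M] by metis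
  then have "adapted_chart M (points M) p U \<phi> {}"
    using matlas_chartD(2)[OF M c(1)] by (auto simp: adapted_chart_def)
  then show "\<exists>U \<phi> J. adapted_chart M (points M) p U \<phi> J \<and> card J + mdim M = mdim M"
    by (intro exI[of _ U] exI[of _ \<phi>] exI[of _ "{}"]) simp
qed auto

lemma tangent_subspace_subset:
  assumes "smooth_manifold M" "submanifold k M S" "p \<in> S"
  shows "tangent_subspace M S p \<subseteq> tangent_space M p"
  unfolding tangent_subspace_eq_conormal_kernel(1)[OF assms] by (auto simp: conormal_kernel_def)

lemma tangent_subspace_whole:
  assumes M: "smooth_manifold M" and p: "p \<in> points M" shows "tangent_subspace M (points M) p = tangent_space M p"
proof -
  obtain U \<phi> where c: "(U, \<phi>) \<in> matlas M" "p \<in> U" using chart_exists[OF M p] by metis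
  then have "adapted_chart M (points M) p U \<phi> {}"
    using matlas_chartD(2)[OF M c(1)] by (auto simp: adapted_chart_def)
  from tangent_subspace_adapted[OF M submanifold_whole[OF M] p this] show ?thesis by simp
qed

lemma adapted_chart_prod:
  assumes M: "smooth_manifold M" and N: "smooth_manifold N"
    and a: "adapted_chart M S (fst p) U \<phi> J" and b: "adapted_chart N S' (snd p) V \<psi> J'"
  shows "adapted_chart (prod_manifold M N) (S \<times> S') p (U \<times> V) (\<lambda>p. join (mdim M) (\<phi> (fst p)) (\<psi> (snd p))) (J \<union> (+) (mdim M) ` J')"
  unfolding adapted_chart_def
proof (intro conjI ballI)
  have a': "(U, \<phi>) \<in> matlas M" "fst p \<in> U" "J \<subseteq> {..<mdim M}" "\<And>x. x \<in> U \<Longrightarrow> x \<in> S \<longleftrightarrow> (\<forall>j\<in>J. \<phi> x j = 0)"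
    using a by (auto simp: adapted_chart_def)
  have b': "(V, \<psi>) \<in> matlas N" "snd p \<in> V" "J' \<subseteq> {..<mdim N}" "\<And>x. x \<in> V \<Longrightarrow> x \<in> S' \<longleftrightarrow> (\<forall>j\<in>J'. \<psi> x j = 0)"
    using b by (auto simp: adapted_chart_def)
  show "(U \<times> V, \<lambda>p. join (mdim M) (\<phi> (fst p)) (\<psi> (snd p))) \<in> matlas (prod_manifold M N)"
    by (rule prod_chart_matlas[OF M N a'(1) b'(1)])
  show "p \<in> U \<times> V" using a' b' by (simp add: mem_Times_iff)
  show "J \<union> (+) (mdim M) ` J' \<subseteq> {..<mdim (prod_manifold M N)}" using a'(3) b'(3) by force
  fix x assume x: "x \<in> U \<times> V"
  have J: "join (mdim M) (\<phi> (fst x)) (\<psi> (snd x)) j = \<phi> (fst x) j" if "j \<in> J" for j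
    using that a'(3) by (auto simp: join_def)
  have "x \<in> S \<times> S' \<longleftrightarrow> (\<forall>j\<in>J. \<phi> (fst x) j = 0) \<and> (\<forall>j\<in>J'. \<psi> (snd x) j = 0)"
    using x a'(4)[of "fst x"] b'(4)[of "snd x"] by (auto simp: mem_Times_iff)
  also have "\<dots> \<longleftrightarrow> (\<forall>j\<in>J \<union> (+) (mdim M) ` J'. join (mdim M) (\<phi> (fst x)) (\<psi> (snd x)) j = 0)"
    unfolding ball_Un by (simp add: J) (simp add: join_def)
  finally show "x \<in> S \<times> S' \<longleftrightarrow> (\<forall>j\<in>J \<union> (+) (mdim M) ` J'. join (mdim M) (\<phi> (fst x)) (\<psi> (snd x)) j = 0)" .
qed

lemma submanifold_subset: "submanifold k M S \<Longrightarrow> S \<subseteq> points M" "submanifold k M S \<Longrightarrow> k \<le> mdim M"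
  by (simp_all add: submanifold_def)

lemma adapted_chart_finite: "adapted_chart M S p U \<phi> J \<Longrightarrow> finite J"
  unfolding adapted_chart_def by (meson finite_lessThan finite_subset)

lemma submanifold_prod:
  assumes M: "smooth_manifold M" and N: "smooth_manifold N" and S: "submanifold k M S" and S': "submanifold l N S'"
  shows "submanifold (k + l) (prod_manifold M N) (S \<times> S')"
    and "p \<in> S \<times> S' \<Longrightarrow> tangent_subspace (prod_manifold M N) (S \<times> S') p =
      {u \<in> tangent_space (prod_manifold M N) p. pushforward M fst p u \<in> tangent_subspace M S (fst p) \<and>
         pushforward N snd p u \<in> tangent_subspace N S' (snd p)}"
proof -
  note MN = smooth_prod_manifold(1)[OF M N]
  show sub: "submanifold (k + l) (prod_manifold M N) (S \<times> S')"
  proof (rule adapted_submanifold[OF MN])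
    show "S \<times> S' \<subseteq> points (prod_manifold M N)" using submanifold_subset(1)[OF S] submanifold_subset(1)[OF S'] by auto
    show "k + l \<le> mdim (prod_manifold M N)" using submanifold_subset(2)[OF S] submanifold_subset(2)[OF S'] by simp
    fix p assume "p \<in> S \<times> S'"
    then have p: "fst p \<in> S" "snd p \<in> S'" by auto
    obtain U \<phi> J where a: "adapted_chart M S (fst p) U \<phi> J" "card J + k = mdim M" using submanifold_adapted[OF M S p(1)] by metis
    obtain V \<psi> J' where b: "adapted_chart N S' (snd p) V \<psi> J'" "card J' + l = mdim N" using submanifold_adapted[OF N S' p(2)] by metis
    have "J \<inter> (+) (mdim M) ` J' = {}" using a(1) by (auto simp: adapted_chart_def)
    then have "card (J \<union> (+) (mdim M) ` J') = card J + card J'"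
      using adapted_chart_finite[OF a(1)] adapted_chart_finite[OF b(1)] by (simp add: card_Un_disjoint card_image)
    then have "card (J \<union> (+) (mdim M) ` J') + (k + l) = mdim (prod_manifold M N)" using a(2) b(2) by simp
    with adapted_chart_prod[OF M N a(1) b(1)]
    show "\<exists>U \<phi> J. adapted_chart (prod_manifold M N) (S \<times> S') p U \<phi> J \<and> card J + (k + l) = mdim (prod_manifold M N)" by blast
  qed
  assume pS: "p \<in> S \<times> S'"
  then have p: "fst p \<in> S" "snd p \<in> S'" by auto
  obtain U \<phi> J where a: "adapted_chart M S (fst p) U \<phi> J" "card J + k = mdim M" using submanifold_adapted[OF M S p(1)] by metis
  obtain V \<psi> J' where b: "adapted_chart N S' (snd p) V \<psi> J'" "card J' + l = mdim N" using submanifold_adapted[OF N S' p(2)] by metis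
  have c: "(U, \<phi>) \<in> matlas M" "fst p \<in> U" "J \<subseteq> {..<mdim M}" "(V, \<psi>) \<in> matlas N" "snd p \<in> V"
    using a(1) b(1) by (auto simp: adapted_chart_def)
  have 1: "pushforward M fst p w (\<lambda>q. \<phi> q j) = w (\<lambda>q. \<phi> (fst q) j)" for w j
    by (rule pushforward_apply) (rule smooth_near_coord[OF M c(1,2)])
  have 2: "pushforward N snd p w (\<lambda>q. \<psi> q j) = w (\<lambda>q. \<psi> (snd q) j)" for w j
    by (rule pushforward_apply) (rule smooth_near_coord[OF N c(4,5)])
  have J1: "w (\<lambda>q. join (mdim M) (\<phi> (fst q)) (\<psi> (snd q)) j) = w (\<lambda>q. \<phi> (fst q) j)" if "j \<in> J" for j and w :: "_ \<Rightarrow> real"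
    using that c(3) by (auto simp: join_def)
  have J2: "w (\<lambda>q. join (mdim M) (\<phi> (fst q)) (\<psi> (snd q)) (mdim M + j)) = w (\<lambda>q. \<psi> (snd q) j)" for j and w :: "_ \<Rightarrow> real"
    by (simp add: join_def)
  show "tangent_subspace (prod_manifold M N) (S \<times> S') p =
      {u \<in> tangent_space (prod_manifold M N) p. pushforward M fst p u \<in> tangent_subspace M S (fst p) \<and>
         pushforward N snd p u \<in> tangent_subspace N S' (snd p)}"
    unfolding tangent_subspace_adapted[OF MN sub pS adapted_chart_prod[OF M N a(1) b(1)]]
      tangent_subspace_adapted[OF M S p(1) a(1)] tangent_subspace_adapted[OF N S' p(2) b(1)] mem_Collect_eq 1 2
      ball_Un ball_simps(9) J2
    using pushforward_in[OF MN M smooth_map_fst[OF M N], of _ p] pushforward_in[OF MN N smooth_map_snd[OF M N], of _ p]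
    by (auto simp: J1)
qed

section \<open>Graphs and preimages\<close>

text \<open>In coordinates the chart is the shear sending (x, y) to (x, y - F x), which flattens the
  graph of \<open>F\<close>; its inverse adds \<open>F x\<close> again.\<close>

lemma graph_chart:
  assumes M: "smooth_manifold M" and N: "smooth_manifold N" and F: "smooth_map M N F"
    and c: "(U, \<phi>) \<in> matlas M" and d: "(V, \<psi>) \<in> matlas N" and UV: "\<And>p. p \<in> U \<Longrightarrow> F p \<in> V"
  obtains \<Phi> where "(U \<times> V, \<Phi>) \<in> matlas (prod_manifold M N)"
    "\<And>q j. q \<in> U \<times> V \<Longrightarrow> j < mdim M \<Longrightarrow> \<Phi> q j = \<phi> (fst q) j"
    "\<And>q j. q \<in> U \<times> V \<Longrightarrow> j < mdim N \<Longrightarrow> \<Phi> q (mdim M + j) = \<psi> (snd q) j - \<psi> (F (fst q)) j"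
proof -
  let ?m = "mdim M" and ?n = "mdim N" and ?E = "eucl (mdim M + mdim N)"
  note MN = smooth_prod_manifold(1)[OF M N]
  note C = matlas_chartD[OF M c]
  let ?\<Phi> = "\<lambda>p. join ?m (\<phi> (fst p)) (\<psi> (snd p))"
  note P = prod_chart_matlas[OF M N c d]
  note PC = chart_onD[OF matlas_chart_on[OF MN P], unfolded prod_manifold_simps]
  \<comment> \<open>The shift depends only on the first \<open>mdim M\<close> coordinates, which it
    leaves unchanged, so subtracting and adding it are inverse to each other.\<close>
  define h where "h j z = (if j < ?m then 0 else \<psi> (F (inv_into U \<phi> (trunc ?m z))) (j - ?m))" for j z
  define \<Theta> where "\<Theta> z = trunc (?m + ?n) (\<lambda>j. z j - h j z)" for z
  define \<Xi> where "\<Xi> z = trunc (?m + ?n) (\<lambda>j. z j + h j z)" for z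
  have hm: "h j z = 0" if "j < ?m" for j z using that by (simp add: h_def)
  have tr: "trunc ?m (\<Theta> z) = trunc ?m z" "trunc ?m (\<Xi> z) = trunc ?m z" for z
    by (auto simp: \<Theta>_def \<Xi>_def trunc_def hm fun_eq_iff)
  have h_tr: "h j z = h j z'" if "trunc ?m z = trunc ?m z'" for j z z' using that by (simp add: h_def)
  have inv: "\<Xi> (\<Theta> z) = z" "\<Theta> (\<Xi> z) = z" if "z \<in> ?E" for z
  proof -
    have n: "\<Theta> y j = (if j < ?m + ?n then y j - h j y else 0)" "\<Xi> y j = (if j < ?m + ?n then y j + h j y else 0)" for y j
      by (simp_all add: \<Theta>_def \<Xi>_def trunc_def)
    show "\<Xi> (\<Theta> z) = z" "\<Theta> (\<Xi> z) = z"
      using that by (auto simp: n h_tr[OF tr(1)] h_tr[OF tr(2)] in_Euclidean_space fun_eq_iff)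
  qed
  have sh: "smooth_at (?m + ?n) (h j) z" if j: "j < ?m + ?n" and z: "z \<in> ?E" and zU: "trunc ?m z \<in> \<phi> ` U" for j z
  proof (cases "j < ?m")
    case True
    then show ?thesis using smooth_at_const[OF z] by (simp add: h_def[abs_def])
  next
    case False
    obtain p where p: "p \<in> U" "trunc ?m z = \<phi> p" using zU by blast
    have "smooth_near M p (\<lambda>q. \<psi> (F q) (j - ?m))"
      by (rule smooth_mapD[OF F _ d UV[OF p(1)]]) (use p(1) C(2) j False in auto)
    then have s: "smooth_at ?m (\<lambda>x. \<psi> (F (inv_into U \<phi> x)) (j - ?m)) (trunc ?m (\<lambda>i. z i))"
      unfolding p(2) by (rule iffD1[OF smooth_near_iff[OF M c p(1)]])
    from smooth_at_compose[OF z s smooth_at_coord[OF z]] False show ?thesis by (simp add: h_def[abs_def])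
  qed
  have s\<Theta>: "smooth_at (?m + ?n) (\<lambda>z. \<Theta> z j) z" "smooth_at (?m + ?n) (\<lambda>z. \<Xi> z j) z"
    if "j < ?m + ?n" "z \<in> ?E" "trunc ?m z \<in> \<phi> ` U" for j z
    unfolding \<Theta>_def \<Xi>_def trunc_nth(1)[OF that(1)]
    by (rule smooth_at_diff[OF smooth_at_coord[OF that(2)] sh[OF that]], rule smooth_at_add[OF smooth_at_coord[OF that(2)] sh[OF that]])
  have tU: "trunc ?m (?\<Phi> q) = \<phi> (fst q)" if "q \<in> U \<times> V" for q
    by (rule trunc_join[OF C(5)]) (use that in auto)
  have ch: "(U \<times> V, \<lambda>q. \<Theta> (?\<Phi> q)) \<in> matlas (prod_manifold M N)"
  proof (rule matlas_change_coordinates[OF MN P, of \<Theta> \<Xi>, unfolded prod_manifold_simps])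
    fix q assume q: "q \<in> U \<times> V"
    have qE: "?\<Phi> q \<in> ?E" by (rule PC(5)[OF q])
    have qU: "trunc ?m (?\<Phi> q) \<in> \<phi> ` U" using q unfolding tU[OF q] by auto
    show "\<Theta> (?\<Phi> q) \<in> ?E" by (simp add: \<Theta>_def)
    show "\<Xi> (\<Theta> (?\<Phi> q)) = ?\<Phi> q" by (rule inv(1)[OF qE])
    show "smooth_at (?m + ?n) (\<lambda>z. \<Theta> z j) (?\<Phi> q)" if "j < ?m + ?n" for j by (rule s\<Theta>(1)[OF that qE qU])
    show "smooth_at (?m + ?n) (\<lambda>z. \<Xi> z j) (\<Theta> (?\<Phi> q))" if "j < ?m + ?n" for j
      by (rule s\<Theta>(2)[OF that]) (use qU in \<open>simp_all add: tr, simp add: \<Theta>_def\<close>)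
  next
    \<comment> \<open>An open set on which the inverse \<open>\<Xi>\<close> is smooth; the image of
      the sheared chart is the part of it that \<open>\<Xi>\<close> maps into the image of the
      product chart.\<close>
    let ?D = "{z \<in> ?E. trunc ?m z \<in> \<phi> ` U \<and> trunc ?n (\<lambda>j. z (?m + j)) \<in> eucl ?n}"
    have oD: "open_eucl (?m + ?n) ?D" by (rule openin_join_box[OF C(3) openin_topspace])
    have "smooth_on (?m + ?n) ?D (\<lambda>z. \<Xi> z j)" if "j < ?m + ?n" for j
      unfolding smooth_on_iff_at[OF oD] using s\<Theta>(2)[OF that] by blast
    from smooth_preimage_open[OF oD this PC(3)]
    have "open_eucl (?m + ?n) {z \<in> ?D. trunc (?m + ?n) (\<lambda>j. \<Xi> z j) \<in> ?\<Phi> ` (U \<times> V)}" .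
    moreover have "{z \<in> ?D. trunc (?m + ?n) (\<lambda>j. \<Xi> z j) \<in> ?\<Phi> ` (U \<times> V)} = \<Theta> ` ?\<Phi> ` (U \<times> V)"
    proof (intro set_eqI iffI)
      fix z assume z: "z \<in> {z \<in> ?D. trunc (?m + ?n) (\<lambda>j. \<Xi> z j) \<in> ?\<Phi> ` (U \<times> V)}"
      moreover have "trunc (?m + ?n) (\<lambda>j. \<Xi> z j) = \<Xi> z" by (rule trunc_id) (simp add: \<Xi>_def)
      ultimately have "\<Xi> z \<in> ?\<Phi> ` (U \<times> V)" "\<Theta> (\<Xi> z) = z" using inv(2) by auto
      then show "z \<in> \<Theta> ` ?\<Phi> ` (U \<times> V)" by (metis image_eqI)
    next
      fix z assume "z \<in> \<Theta> ` ?\<Phi> ` (U \<times> V)"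
      then obtain q where q: "q \<in> U \<times> V" "z = \<Theta> (?\<Phi> q)" by blast
      have qE: "?\<Phi> q \<in> ?E" by (rule PC(5)[OF q(1)])
      have "\<Xi> z = ?\<Phi> q" unfolding q(2) by (rule inv(1)[OF qE])
      moreover have "trunc ?m z = \<phi> (fst q)" unfolding q(2) tr by (rule tU[OF q(1)])
      moreover have "z \<in> ?E" by (simp add: q(2) \<Theta>_def)
      ultimately show "z \<in> {z \<in> ?D. trunc (?m + ?n) (\<lambda>j. \<Xi> z j) \<in> ?\<Phi> ` (U \<times> V)}"
        using q(1) trunc_id[OF qE] by auto
    qed
    ultimately show "open_eucl (?m + ?n) (\<Theta> ` ?\<Phi> ` (U \<times> V))" by simp
  qed
  show thesis
  proof (rule that[OF ch])
    fix q j assume q: "q \<in> U \<times> V"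
    show "\<Theta> (?\<Phi> q) j = \<phi> (fst q) j" if "j < ?m" using that by (simp add: \<Theta>_def hm join_def)
    have "fst q \<in> U" using q by auto
    then show "\<Theta> (?\<Phi> q) (?m + j) = \<psi> (snd q) j - \<psi> (F (fst q)) j" if "j < ?n"
      using that tU[OF q] C(6) by (simp add: \<Theta>_def h_def join_def)
  qed
qed

lemma graph_adapted:
  assumes M: "smooth_manifold M" and N: "smooth_manifold N" and F: "smooth_map M N F"
    and S: "submanifold k M S" and p: "p \<in> S"
  obtains U \<phi> J V \<psi> \<Phi> where "adapted_chart M S p U \<phi> J" "card J + k = mdim M" "(V, \<psi>) \<in> matlas N" "F p \<in> V"
    "adapted_chart (prod_manifold M N) {(x, F x) | x. x \<in> S} (p, F p) (U \<times> V) \<Phi> (J \<union> {mdim M..<mdim M + mdim N})"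
    "\<forall>q\<in>U \<times> V. \<forall>j<mdim M. \<Phi> q j = \<phi> (fst q) j"
    "\<forall>q\<in>U \<times> V. \<forall>j<mdim N. \<Phi> q (mdim M + j) = \<psi> (snd q) j - \<psi> (F (fst q)) j"
proof -
  have pM: "p \<in> points M" using submanifold_subset(1)[OF S] p by blast
  obtain U0 \<phi> J where a0: "adapted_chart M S p U0 \<phi> J" "card J + k = mdim M" using submanifold_adapted[OF M S p] by metis
  obtain V \<psi> where d: "(V, \<psi>) \<in> matlas N" "F p \<in> V" using chart_exists[OF N smooth_map_points[OF F pM]] by metis
  note D = matlas_chartD[OF N d(1)]
  have a0': "(U0, \<phi>) \<in> matlas M" "p \<in> U0" "J \<subseteq> {..<mdim M}" "\<And>x. x \<in> U0 \<Longrightarrow> x \<in> S \<longleftrightarrow> (\<forall>j\<in>J. \<phi> x j = 0)"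
    using a0(1) by (auto simp: adapted_chart_def)
  note C0 = matlas_chartD[OF M a0'(1)]
  \<comment> \<open>Shrunk so that \<open>F\<close> maps the whole domain into the one chart
    \<open>V\<close>, as \<open>graph_chart\<close> demands.\<close>
  define U where "U = U0 \<inter> {q \<in> points M. F q \<in> V}"
  have U: "openin (mtop M) U" unfolding U_def
    by (rule openin_Int[OF C0(1) openin_continuous_map_preimage[OF smooth_map_continuous[OF F] D(1)]])
  have c: "(U, \<phi>) \<in> matlas M" by (rule chart_restrict[OF M a0'(1) U]) (simp add: U_def)
  have UV: "F q \<in> V" if "q \<in> U" for q using that by (simp add: U_def)
  have a: "adapted_chart M S p U \<phi> J" using a0' c d(2) pM by (auto simp: adapted_chart_def U_def)
  from graph_chart[OF M N F c d(1) UV] obtain \<Phi> where \<Phi>: "(U \<times> V, \<Phi>) \<in> matlas (prod_manifold M N)"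
    "\<And>q j. q \<in> U \<times> V \<Longrightarrow> j < mdim M \<Longrightarrow> \<Phi> q j = \<phi> (fst q) j"
    "\<And>q j. q \<in> U \<times> V \<Longrightarrow> j < mdim N \<Longrightarrow> \<Phi> q (mdim M + j) = \<psi> (snd q) j - \<psi> (F (fst q)) j" by metis
  have ag: "adapted_chart (prod_manifold M N) {(x, F x) | x. x \<in> S} (p, F p) (U \<times> V) \<Phi> (J \<union> {mdim M..<mdim M + mdim N})"
    unfolding adapted_chart_def
  proof (intro conjI ballI \<Phi>(1))
    show "(p, F p) \<in> U \<times> V" using a d(2) by (simp add: adapted_chart_def)
    show "J \<union> {mdim M..<mdim M + mdim N} \<subseteq> {..<mdim (prod_manifold M N)}" using a0'(3) by auto
    fix q assume q: "q \<in> U \<times> V"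
    then have q': "fst q \<in> U0" "snd q \<in> V" "fst q \<in> U" "F (fst q) \<in> V" by (auto simp: U_def)
    have \<psi>: "snd q = F (fst q) \<longleftrightarrow> (\<forall>j<mdim N. \<psi> (snd q) j = \<psi> (F (fst q)) j)"
    proof
      assume e: "\<forall>j<mdim N. \<psi> (snd q) j = \<psi> (F (fst q)) j"
      have "\<psi> (snd q) = \<psi> (F (fst q))"
      proof
        fix j show "\<psi> (snd q) j = \<psi> (F (fst q)) j"
          using e D(5)[OF q'(2)] D(5)[OF q'(4)] by (cases "j < mdim N") (auto simp: in_Euclidean_space)
      qed
      then show "snd q = F (fst q)" using inj_onD[OF D(4)] q' by blast
    qed simp
    have "q \<in> {(x, F x) | x. x \<in> S} \<longleftrightarrow> fst q \<in> S \<and> snd q = F (fst q)" by (cases q) auto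
    also have "\<dots> \<longleftrightarrow> (\<forall>j\<in>J. \<phi> (fst q) j = 0) \<and> (\<forall>j<mdim N. \<psi> (snd q) j - \<psi> (F (fst q)) j = 0)"
      unfolding \<psi> a0'(4)[OF q'(1)] by simp
    also have "\<dots> \<longleftrightarrow> (\<forall>j\<in>J. \<Phi> q j = 0) \<and> (\<forall>j<mdim N. \<Phi> q (mdim M + j) = 0)"
      using \<Phi>(2,3)[OF q] a0'(3) by (auto simp: subset_iff)
    also have "(\<forall>j<mdim N. \<Phi> q (mdim M + j) = 0) \<longleftrightarrow> (\<forall>j\<in>{mdim M..<mdim M + mdim N}. \<Phi> q j = 0)"
    proof (intro iffI ballI allI impI)
      fix j assume "\<forall>j<mdim N. \<Phi> q (mdim M + j) = 0" "j \<in> {mdim M..<mdim M + mdim N}"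
      then show "\<Phi> q j = 0" by (metis add_diff_inverse_nat add_less_cancel_left atLeastLessThan_iff not_less)
    qed simp
    finally show "q \<in> {(x, F x) | x. x \<in> S} \<longleftrightarrow> (\<forall>j\<in>J \<union> {mdim M..<mdim M + mdim N}. \<Phi> q j = 0)" by blast
  qed
  show thesis by (rule that[OF a a0(2) d ag]) (use \<Phi>(2,3) in blast)+
qed

text \<open>The graph over \<open>S\<close> is cut out by the equations of \<open>S\<close> together
  with the equality of \<open>\<psi> y\<close> and \<open>\<psi> (F x)\<close>; differentiating
  these equations describes its tangent vectors.\<close>

lemma submanifold_graph:
  assumes M: "smooth_manifold M" and N: "smooth_manifold N" and F: "smooth_map M N F" and S: "submanifold k M S"
  shows "submanifold k (prod_manifold M N) {(x, F x) | x. x \<in> S}"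
    and "p \<in> S \<Longrightarrow> tangent_subspace (prod_manifold M N) {(x, F x) | x. x \<in> S} (p, F p) =
      {u \<in> tangent_space (prod_manifold M N) (p, F p). pushforward M fst (p, F p) u \<in> tangent_subspace M S p \<and>
         pushforward N snd (p, F p) u = pushforward N F p (pushforward M fst (p, F p) u)}"
proof -
  note MN = smooth_prod_manifold(1)[OF M N]
  let ?G = "{(x, F x) | x. x \<in> S}"
  show sub: "submanifold k (prod_manifold M N) ?G"
  proof (rule adapted_submanifold[OF MN])
    show "?G \<subseteq> points (prod_manifold M N)" using submanifold_subset(1)[OF S] smooth_map_points[OF F] by auto
    show "k \<le> mdim (prod_manifold M N)" using submanifold_subset(2)[OF S] by simp
    fix q assume "q \<in> ?G"
    then obtain p where p: "p \<in> S" "q = (p, F p)" by blast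
    obtain U \<phi> J V \<psi> \<Phi> where a: "adapted_chart M S p U \<phi> J" "card J + k = mdim M" and "(V, \<psi>) \<in> matlas N" "F p \<in> V" and
      ag: "adapted_chart (prod_manifold M N) ?G (p, F p) (U \<times> V) \<Phi> (J \<union> {mdim M..<mdim M + mdim N})"
      and "\<forall>q\<in>U \<times> V. \<forall>j<mdim M. \<Phi> q j = \<phi> (fst q) j"
      "\<forall>q\<in>U \<times> V. \<forall>j<mdim N. \<Phi> q (mdim M + j) = \<psi> (snd q) j - \<psi> (F (fst q)) j"
      by (rule graph_adapted[OF M N F S p(1)]) (rule that)
    have "J \<inter> {mdim M..<mdim M + mdim N} = {}" using a(1) by (auto simp: adapted_chart_def)
    then have "card (J \<union> {mdim M..<mdim M + mdim N}) + k = mdim (prod_manifold M N)"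
      using a(2) adapted_chart_finite[OF a(1)] by (simp add: card_Un_disjoint)
    then show "\<exists>U \<phi> J. adapted_chart (prod_manifold M N) ?G q U \<phi> J \<and> card J + k = mdim (prod_manifold M N)"
      using ag p(2) by blast
  qed
  assume p: "p \<in> S"
  obtain U \<phi> J V \<psi> \<Phi> where a1: "adapted_chart M S p U \<phi> J" and "card J + k = mdim M" and a2: "(V, \<psi>) \<in> matlas N" "F p \<in> V"
    "adapted_chart (prod_manifold M N) ?G (p, F p) (U \<times> V) \<Phi> (J \<union> {mdim M..<mdim M + mdim N})"
    and \<Phi>': "\<forall>q\<in>U \<times> V. \<forall>j<mdim M. \<Phi> q j = \<phi> (fst q) j"
    "\<forall>q\<in>U \<times> V. \<forall>j<mdim N. \<Phi> q (mdim M + j) = \<psi> (snd q) j - \<psi> (F (fst q)) j"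
    by (rule graph_adapted[OF M N F S p]) (rule that)
  note a = a1 a2
  have \<Phi>: "\<Phi> q j = \<phi> (fst q) j" if "q \<in> U \<times> V" "j < mdim M" for q j using \<Phi>'(1) that by blast
  have \<Phi>2: "\<Phi> q (mdim M + j) = \<psi> (snd q) j - \<psi> (F (fst q)) j" if "q \<in> U \<times> V" "j < mdim N" for q j using \<Phi>'(2) that by blast
  have c: "(U, \<phi>) \<in> matlas M" "p \<in> U" and J: "J \<subseteq> {..<mdim M}" using a(1) by (auto simp: adapted_chart_def)
  have o: "openin (mtop (prod_manifold M N)) (U \<times> V)"
    by (rule matlas_chartD(1)[OF MN]) (use a(4) in \<open>auto simp: adapted_chart_def\<close>)
  let ?q = "(p, F p)"
  have pM: "p \<in> points M" using submanifold_subset(1)[OF S] p by blast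
  have ev: "\<forall>\<^sub>F q in nhdsin (mtop (prod_manifold M N)) ?q. q \<in> U \<times> V"
    by (rule eventually_in_open[OF o]) (use c a(3) in simp)
  have 1: "u (\<lambda>q. \<Phi> q j) = pushforward M fst ?q u (\<lambda>q. \<phi> q j)" if u: "u \<in> tangent_space (prod_manifold M N) ?q" and j: "j < mdim M" for u j
  proof -
    have "u (\<lambda>q. \<Phi> q j) = u (\<lambda>q. \<phi> (fst q) j)"
      by (rule tangent_cong[OF MN u]) (use ev in \<open>rule eventually_mono\<close>, rule \<Phi>[OF _ j])
    also have "\<dots> = pushforward M fst ?q u (\<lambda>q. \<phi> q j)"
      by (rule pushforward_apply[symmetric]) (simp add: smooth_near_coord[OF M c])
    finally show ?thesis .
  qed
  \<comment> \<open>The last coordinates of the sheared chart measure how far the second component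
    of \<open>u\<close> is from the image of the first one under the differential of
    \<open>F\<close>.\<close>
  have 2: "u (\<lambda>q. \<Phi> q (mdim M + j)) = pushforward N snd ?q u (\<lambda>q. \<psi> q j) - pushforward N F p (pushforward M fst ?q u) (\<lambda>q. \<psi> q j)"
    if u: "u \<in> tangent_space (prod_manifold M N) ?q" and j: "j < mdim N" for u j
  proof -
    have sF: "smooth_near M p (\<lambda>q. \<psi> (F q) j)" by (rule smooth_mapD[OF F pM a(2,3) j])
    have s\<psi>: "smooth_near N (F p) (\<lambda>q. \<psi> q j)" by (rule smooth_near_coord[OF N a(2,3)])
    have qP: "?q \<in> points (prod_manifold M N)" using pM smooth_map_points[OF F pM] by simp
    have s1: "smooth_near (prod_manifold M N) ?q (\<lambda>q. \<psi> (snd q) j)"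
      by (rule smooth_near_pullback[OF MN N smooth_map_snd[OF M N] qP, of "\<lambda>q. \<psi> q j"]) (simp add: s\<psi>)
    have s2: "smooth_near (prod_manifold M N) ?q (\<lambda>q. \<psi> (F (fst q)) j)"
      by (rule smooth_near_pullback[OF MN M smooth_map_fst[OF M N] qP, of "\<lambda>q. \<psi> (F q) j"]) (simp add: sF)
    have "u (\<lambda>q. \<Phi> q (mdim M + j)) = u (\<lambda>q. \<psi> (snd q) j - \<psi> (F (fst q)) j)"
      by (rule tangent_cong[OF MN u]) (use ev in \<open>rule eventually_mono\<close>, use \<Phi>2[OF _ j] in simp)
    also have "\<dots> = u (\<lambda>q. \<psi> (snd q) j) - u (\<lambda>q. \<psi> (F (fst q)) j)" by (rule tangent_diff[OF MN u s1 s2])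
    also have "u (\<lambda>q. \<psi> (snd q) j) = pushforward N snd ?q u (\<lambda>q. \<psi> q j)"
      by (rule pushforward_apply[symmetric]) (simp add: s\<psi>)
    also have "u (\<lambda>q. \<psi> (F (fst q)) j) = pushforward M fst ?q u (\<lambda>q. \<psi> (F q) j)"
      by (subst pushforward_apply) (simp_all add: sF)
    also have "\<dots> = pushforward N F p (pushforward M fst ?q u) (\<lambda>q. \<psi> q j)"
      by (subst pushforward_apply) (simp_all add: s\<psi>)
    finally show ?thesis .
  qed
  have "(\<forall>j\<in>J \<union> {mdim M..<mdim M + mdim N}. u (\<lambda>q. \<Phi> q j) = 0) \<longleftrightarrow>
      (\<forall>j\<in>J. pushforward M fst ?q u (\<lambda>q. \<phi> q j) = 0) \<and> pushforward N snd ?q u = pushforward N F p (pushforward M fst ?q u)"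
    if u: "u \<in> tangent_space (prod_manifold M N) ?q" for u
  proof -
    have T1: "pushforward M fst ?q u \<in> tangent_space M p"
      using pushforward_in[OF MN M smooth_map_fst[OF M N] u] by simp
    have T: "pushforward N snd ?q u \<in> tangent_space N (F p)" "pushforward N F p (pushforward M fst ?q u) \<in> tangent_space N (F p)"
      using pushforward_in[OF MN N smooth_map_snd[OF M N] u] pushforward_in[OF M N F T1] by simp_all
    have "(\<forall>j\<in>{mdim M..<mdim M + mdim N}. u (\<lambda>q. \<Phi> q j) = 0) \<longleftrightarrow> (\<forall>j<mdim N. u (\<lambda>q. \<Phi> q (mdim M + j)) = 0)"
    proof (intro iffI ballI allI impI)
      fix j assume "\<forall>j<mdim N. u (\<lambda>q. \<Phi> q (mdim M + j)) = 0" "j \<in> {mdim M..<mdim M + mdim N}"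
      then show "u (\<lambda>q. \<Phi> q j) = 0" by (metis add_diff_inverse_nat add_less_cancel_left atLeastLessThan_iff not_less)
    qed simp
    also have "\<dots> \<longleftrightarrow> (\<forall>j<mdim N. pushforward N snd ?q u (\<lambda>q. \<psi> q j) = pushforward N F p (pushforward M fst ?q u) (\<lambda>q. \<psi> q j))"
      using 2[OF u] by simp
    also have "\<dots> \<longleftrightarrow> pushforward N snd ?q u = pushforward N F p (pushforward M fst ?q u)"
      using tangent_eqI[OF N T a(2,3)] by auto
    finally show ?thesis unfolding ball_Un using 1[OF u] J by (auto simp: subset_iff)
  qed
  then show "tangent_subspace (prod_manifold M N) ?G ?q =
      {u \<in> tangent_space (prod_manifold M N) ?q. pushforward M fst ?q u \<in> tangent_subspace M S p \<and>
         pushforward N snd ?q u = pushforward N F p (pushforward M fst ?q u)}"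
    unfolding tangent_subspace_adapted[OF M S p a(1)]
    using p pushforward_in[OF MN M smooth_map_fst[OF M N], of _ ?q]
    by (subst tangent_subspace_adapted[OF MN sub _ a(4)]) auto
qed

text \<open>An adapted chart of \<open>S\<close> composed with \<open>F\<close> is adapted to the
  preimage, with the same set \<open>J\<close>.\<close>

lemma submanifold_diffeo:
  assumes M: "smooth_manifold M" and N: "smooth_manifold N" and F: "smooth_map M N F" and G: "smooth_map N M G"
    and GF: "\<And>p. p \<in> points M \<Longrightarrow> G (F p) = p" and FG: "\<And>q. q \<in> points N \<Longrightarrow> F (G q) = q"
    and dim: "mdim M = mdim N" and S: "submanifold k N S"
  shows "submanifold k M {p \<in> points M. F p \<in> S}"
    and "p \<in> points M \<Longrightarrow> F p \<in> S \<Longrightarrow> tangent_subspace M {p \<in> points M. F p \<in> S} p =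
      {u \<in> tangent_space M p. pushforward N F p u \<in> tangent_subspace N S (F p)}"
proof -
  let ?S = "{p \<in> points M. F p \<in> S}"
  have ad: "adapted_chart M ?S p {p \<in> points M. F p \<in> U} (\<lambda>p. \<phi> (F p)) J"
    if "p \<in> points M" "adapted_chart N S (F p) U \<phi> J" for p U \<phi> J
    using that matlas_diffeo[OF M N F G GF FG dim, of U \<phi>] dim by (auto simp: adapted_chart_def)
  show sub: "submanifold k M ?S"
  proof (rule adapted_submanifold[OF M])
    show "k \<le> mdim M" using submanifold_subset(2)[OF S] dim by simp
    fix p assume p: "p \<in> ?S"
    then obtain U \<phi> J where a: "adapted_chart N S (F p) U \<phi> J" "card J + k = mdim N"
      using submanifold_adapted[OF N S, of "F p"] by blast
    show "\<exists>U \<phi> J. adapted_chart M ?S p U \<phi> J \<and> card J + k = mdim M"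
      using ad[OF _ a(1)] p a(2) unfolding dim by blast
  qed auto
  assume p: "p \<in> points M" "F p \<in> S"
  then obtain U \<phi> J where a: "adapted_chart N S (F p) U \<phi> J" using submanifold_adapted[OF N S, of "F p"] by blast
  then have c: "(U, \<phi>) \<in> matlas N" "F p \<in> U" by (auto simp: adapted_chart_def)
  have 1: "pushforward N F p u (\<lambda>q. \<phi> q j) = u (\<lambda>q. \<phi> (F q) j)" for u j
    by (rule pushforward_apply) (rule smooth_near_coord[OF N c])
  have pS: "p \<in> ?S" using p by simp
  show "tangent_subspace M ?S p = {u \<in> tangent_space M p. pushforward N F p u \<in> tangent_subspace N S (F p)}"
    unfolding tangent_subspace_adapted[OF M sub pS ad[OF p(1) a]] tangent_subspace_adapted[OF N S p(2) a]
    using pushforward_in[OF M N F] by (auto simp: 1)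
qed

section \<open>Strong transversality\<close>

text \<open>Once the second copy of \<open>Y\<close> is moved to the end, the middle diagonal is the
  graph of the projection to the first copy, and \<open>submanifold_graph\<close> describes its
  tangent vectors by equal components in the two copies.\<close>

lemma middle_diagonal_tangent:
  assumes X: "smooth_manifold X" and Y: "smooth_manifold Y" and Z: "smooth_manifold Z"
    and p: "p \<in> middle_diagonal X Y Z" and u: "u \<in> tangent_space (prod_manifold (prod_manifold X Y) (prod_manifold Y Z)) p"
    and eq: "pushforward Y (\<lambda>p. snd (fst p)) p u = pushforward Y (\<lambda>p. fst (snd p)) p u"
  shows "u \<in> tangent_subspace (prod_manifold (prod_manifold X Y) (prod_manifold Y Z)) (middle_diagonal X Y Z) p"
proof -
  note XY = smooth_prod_manifold(1)[OF X Y] and YZ = smooth_prod_manifold(1)[OF Y Z]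
  let ?XY = "prod_manifold X Y" and ?P = "prod_manifold (prod_manifold X Y) (prod_manifold Y Z)"
  let ?A = "prod_manifold (prod_manifold X Y) Z"
  let ?D = "prod_manifold ?A Y"
  note P = smooth_prod_manifold(1)[OF XY YZ] and A = smooth_prod_manifold(1)[OF XY Z]
  note D = smooth_prod_manifold(1)[OF A Y]
  let ?\<Phi> = "\<lambda>p. ((fst p, snd (snd p)), fst (snd p))" and ?\<Psi> = "\<lambda>d. (fst (fst d), (snd d, snd (fst d)))"
  have \<Phi>: "smooth_map ?P ?D ?\<Phi>"
    by (intro smooth_map_Pair[OF P A Y] smooth_map_Pair[OF P XY Z] smooth_map_fst[OF XY YZ]
        smooth_map_compose[OF P YZ Z smooth_map_snd[OF XY YZ] smooth_map_snd[OF Y Z]]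
        smooth_map_compose[OF P YZ Y smooth_map_snd[OF XY YZ] smooth_map_fst[OF Y Z]])
  have \<Psi>: "smooth_map ?D ?P ?\<Psi>"
    by (intro smooth_map_Pair[OF D XY YZ] smooth_map_Pair[OF D Y Z] smooth_map_snd[OF A Y]
        smooth_map_compose[OF D A XY smooth_map_fst[OF A Y] smooth_map_fst[OF XY Z]]
        smooth_map_compose[OF D A Z smooth_map_fst[OF A Y] smooth_map_snd[OF XY Z]])
  let ?F = "\<lambda>a. snd (fst a)"
  have F: "smooth_map ?A Y ?F"
    by (rule smooth_map_compose[OF A XY Y smooth_map_fst[OF XY Z] smooth_map_snd[OF X Y]])
  let ?G = "{(a, ?F a) | a. a \<in> points ?A}"
  note G = submanifold_graph[OF A Y F submanifold_whole[OF A]]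
  have md: "middle_diagonal X Y Z = {p \<in> points ?P. ?\<Phi> p \<in> ?G}"
    by (auto simp: middle_diagonal_def)
  have pP: "p \<in> points ?P" and pG: "?\<Phi> p \<in> ?G" using p unfolding md by auto
  then have pA: "(fst p, snd (snd p)) \<in> points ?A" and e: "(((fst p, snd (snd p)), ?F (fst p, snd (snd p)))) = ?\<Phi> p" by auto
  have dim: "mdim ?P = mdim ?D" by simp
  note T = submanifold_diffeo(2)[OF P D \<Phi> \<Psi> _ _ dim G(1) pP pG, folded md]
  have "pushforward ?D ?\<Phi> p u \<in> tangent_subspace ?D ?G (?\<Phi> p)"
  proof -
    have Tu: "pushforward ?D ?\<Phi> p u \<in> tangent_space ?D (?\<Phi> p)" by (rule pushforward_in[OF P D \<Phi> u])
    have 1: "pushforward ?A fst (?\<Phi> p) (pushforward ?D ?\<Phi> p u) = pushforward ?A (\<lambda>p. (fst p, snd (snd p))) p u"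
      using pushforward_compose[OF P D A \<Phi> smooth_map_fst[OF A Y] pP, of u] by simp
    have s: "smooth_map ?P ?A (\<lambda>p. (fst p, snd (snd p)))"
      using smooth_map_compose[OF P D A \<Phi> smooth_map_fst[OF A Y]] by simp
    have 2: "pushforward Y ?F (fst p, snd (snd p)) (pushforward ?A (\<lambda>p. (fst p, snd (snd p))) p u) = pushforward Y (\<lambda>p. snd (fst p)) p u"
      using pushforward_compose[OF P A Y s F pP, of u] by simp
    have 3: "pushforward Y snd (?\<Phi> p) (pushforward ?D ?\<Phi> p u) = pushforward Y (\<lambda>p. fst (snd p)) p u"
      using pushforward_compose[OF P D Y \<Phi> smooth_map_snd[OF A Y] pP, of u] by simp
    have 4: "pushforward ?A fst (?\<Phi> p) (pushforward ?D ?\<Phi> p u) \<in> tangent_space ?A (fst p, snd (snd p))"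
      using pushforward_in[OF D A smooth_map_fst[OF A Y] Tu] by simp
    show ?thesis
      unfolding G(2)[OF pA, unfolded e] tangent_subspace_whole[OF A pA] using Tu 4 1 2 3 eq by simp
  qed
  then show ?thesis using u T by simp
qed

lemma outer_projection_eq: "(\<lambda>((x, y), (y', z)). (x, z)) = (\<lambda>p. (fst (fst p), snd (snd p)))"
  by (simp add: fun_eq_iff split_beta)

text \<open>If the intermediate point is a smooth function \<open>s\<close> of the outer pair, the
  fibre product is, up to the order of factors, the graph of \<open>(s, s)\<close> over
  \<open>f O g\<close>. This makes it a manifold, and the projection to \<open>X \<times> Z\<close>
  an embedding with an inverse built from \<open>s\<close>. Transversality comes down to
  \<open>trans\<close>: every tangent vector of \<open>Y\<close> is a difference of middle
  components of vectors tangent to \<open>f\<close> and to \<open>g\<close>.\<close>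

lemma strongly_transversalI:
  assumes X: "smooth_manifold X" and Y: "smooth_manifold Y" and Z: "smooth_manifold Z"
    and f: "submanifold k (prod_manifold X Y) f" "closedin (mtop (prod_manifold X Y)) f"
    and g: "submanifold l (prod_manifold Y Z) g" "closedin (mtop (prod_manifold Y Z)) g"
    and h: "submanifold m (prod_manifold X Z) (f O g)" "closedin (mtop (prod_manifold X Z)) (f O g)"
    and s: "smooth_map (prod_manifold X Z) Y s" and sec: "\<And>x y z. (x, y) \<in> f \<Longrightarrow> (y, z) \<in> g \<Longrightarrow> y = s (x, z)"
    and trans: "\<And>x y z \<eta>. (x, y) \<in> f \<Longrightarrow> (y, z) \<in> g \<Longrightarrow> \<eta> \<in> tangent_space Y y \<Longrightarrow>
      \<exists>a\<in>tangent_subspace (prod_manifold X Y) f (x, y). \<exists>b\<in>tangent_subspace (prod_manifold Y Z) g (y, z).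
        \<eta> = (\<lambda>w. pushforward Y snd (x, y) a w - pushforward Y fst (y, z) b w)"
  shows "strongly_transversal X Y Z f g"
proof -
  let ?XY = "prod_manifold X Y" and ?YZ = "prod_manifold Y Z" and ?XZ = "prod_manifold X Z" and ?YY = "prod_manifold Y Y"
  let ?P = "prod_manifold ?XY ?YZ" and ?D = "prod_manifold ?XZ ?YY"
  note XY = smooth_prod_manifold(1)[OF X Y] and YZ = smooth_prod_manifold(1)[OF Y Z] and XZ = smooth_prod_manifold(1)[OF X Z]
    and YY = smooth_prod_manifold(1)[OF Y Y]
  note P = smooth_prod_manifold(1)[OF XY YZ] and D = smooth_prod_manifold(1)[OF XZ YY]
  let ?MD = "middle_diagonal X Y Z"
  have m12: "smooth_map ?P Y (\<lambda>p. snd (fst p))"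
    by (rule smooth_map_compose[OF P XY Y smooth_map_fst[OF XY YZ] smooth_map_snd[OF X Y]])
  have m21: "smooth_map ?P Y (\<lambda>p. fst (snd p))"
    by (rule smooth_map_compose[OF P YZ Y smooth_map_snd[OF XY YZ] smooth_map_fst[OF Y Z]])
  have tp: "transversal_pair X Y Z f g"
    unfolding transversal_pair_def smooth_relation_def closed_submanifold_def transversal_submanifolds_def
  proof (intro conjI ballI)
    fix p u assume p: "p \<in> f \<times> g \<inter> ?MD" and u: "u \<in> tangent_space ?P p"
    obtain x y z where e: "p = ((x, y), (y, z))" "(x, y) \<in> f" "(y, z) \<in> g" using p by (auto simp: middle_diagonal_def)
    have pP: "p \<in> points ?P" by (rule tangent_points[OF P u])
    \<comment> \<open>The disagreement of the two middle components of \<open>u\<close>;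
      \<open>trans\<close> realises it by vectors tangent to \<open>f\<close> and
      \<open>g\<close>.\<close>
    let ?\<eta> = "\<lambda>w. 1 * pushforward Y (\<lambda>p. snd (fst p)) p u w + (-1) * pushforward Y (\<lambda>p. fst (snd p)) p u w"
    have "pushforward Y (\<lambda>p. snd (fst p)) p u \<in> tangent_space Y y" "pushforward Y (\<lambda>p. fst (snd p)) p u \<in> tangent_space Y y"
      using pushforward_in[OF P Y m12 u] pushforward_in[OF P Y m21 u] by (simp_all add: e)
    then have "?\<eta> \<in> tangent_space Y y" by (rule tangent_linear_comb[OF Y])
    from trans[OF e(2,3) this] obtain a b where a: "a \<in> tangent_subspace ?XY f (x, y)" and b: "b \<in> tangent_subspace ?YZ g (y, z)"
      and ab: "?\<eta> = (\<lambda>w. pushforward Y snd (x, y) a w - pushforward Y fst (y, z) b w)" by blast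
    have aT: "a \<in> tangent_space ?XY (fst p)" "b \<in> tangent_space ?YZ (snd p)"
      using a b tangent_subspace_subset[OF XY f(1) e(2)] tangent_subspace_subset[OF YZ g(1) e(3)] by (auto simp: e(1))
    obtain v where v: "v \<in> tangent_space ?P p" "pushforward ?XY fst p v = a" "pushforward ?YZ snd p v = b"
      by (rule tangent_prod_ex[OF XY YZ aT])
    have v1: "v \<in> tangent_subspace ?P (f \<times> g) p"
      using submanifold_prod(2)[OF XY YZ f(1) g(1), of p] v a b e by simp
    \<comment> \<open>After subtracting \<open>v\<close> the middle components agree, so the rest is
      tangent to the middle diagonal.\<close>
    let ?w = "\<lambda>w. 1 * u w + (-1) * v w"
    have w: "?w \<in> tangent_space ?P p" by (rule tangent_linear_comb[OF P u v(1)])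
    have "pushforward Y (\<lambda>p. snd (fst p)) p v = pushforward Y snd (x, y) a"
      using pushforward_compose[OF P XY Y smooth_map_fst[OF XY YZ] smooth_map_snd[OF X Y] pP, of v] v by (simp add: e)
    moreover have "pushforward Y (\<lambda>p. fst (snd p)) p v = pushforward Y fst (y, z) b"
      using pushforward_compose[OF P YZ Y smooth_map_snd[OF XY YZ] smooth_map_fst[OF Y Z] pP, of v] v by (simp add: e)
    moreover have "pushforward Y (\<lambda>p. snd (fst p)) p u w - pushforward Y (\<lambda>p. fst (snd p)) p u w =
      pushforward Y snd (x, y) a w - pushforward Y fst (y, z) b w" for w using fun_cong[OF ab, of w] by simp
    ultimately have eq: "pushforward Y (\<lambda>p. snd (fst p)) p ?w = pushforward Y (\<lambda>p. fst (snd p)) p ?w"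
      unfolding pushforward_linear_comb by (auto simp: fun_eq_iff algebra_simps)
    have w1: "?w \<in> tangent_subspace ?P ?MD p"
      by (rule middle_diagonal_tangent[OF X Y Z _ w eq]) (use p in blast)
    show "\<exists>v\<in>tangent_subspace ?P (f \<times> g) p. \<exists>w\<in>tangent_subspace ?P ?MD p. u = (\<lambda>g. v g + w g)"
      by (rule bexI[OF bexI[OF _ w1] v1]) (simp add: fun_eq_iff)
  qed (use f g in auto)
  let ?pr = "\<lambda>p. (fst (fst p), snd (snd p))"
  \<comment> \<open>Outer pair first, the two copies of the intermediate point last: in this order
    the fibre product becomes a graph.\<close>
  let ?\<Phi> = "\<lambda>p. (?pr p, (snd (fst p), fst (snd p)))"
  let ?\<Psi> = "\<lambda>d. ((fst (fst d), fst (snd d)), (snd (snd d), snd (fst d)))"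
  have pr: "smooth_map ?P ?XZ ?pr"
    by (intro smooth_map_Pair[OF P X Z] smooth_map_compose[OF P XY X smooth_map_fst[OF XY YZ] smooth_map_fst[OF X Y]]
        smooth_map_compose[OF P YZ Z smooth_map_snd[OF XY YZ] smooth_map_snd[OF Y Z]])
  have \<Phi>: "smooth_map ?P ?D ?\<Phi>" by (intro smooth_map_Pair[OF P XZ YY] pr smooth_map_Pair[OF P Y Y] m12 m21)
  have \<Psi>: "smooth_map ?D ?P ?\<Psi>"
    by (intro smooth_map_Pair[OF D XY YZ] smooth_map_Pair[OF D X Y] smooth_map_Pair[OF D Y Z]
        smooth_map_compose[OF D XZ X smooth_map_fst[OF XZ YY] smooth_map_fst[OF X Z]]
        smooth_map_compose[OF D XZ Z smooth_map_fst[OF XZ YY] smooth_map_snd[OF X Z]]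
        smooth_map_compose[OF D YY Y smooth_map_snd[OF XZ YY] smooth_map_fst[OF Y Y]]
        smooth_map_compose[OF D YY Y smooth_map_snd[OF XZ YY] smooth_map_snd[OF Y Y]])
  let ?F = "\<lambda>q. (s q, s q)"
  have F: "smooth_map ?XZ ?YY ?F" by (rule smooth_map_Pair[OF XZ Y Y s s])
  let ?G = "{(q, ?F q) | q. q \<in> f O g}"
  note G = submanifold_graph[OF XZ YY F h(1)]
  let ?I = "f \<times> g \<inter> ?MD"
  have fp: "\<And>x y. (x, y) \<in> f \<Longrightarrow> x \<in> points X \<and> y \<in> points Y" using submanifold_subset(1)[OF f(1)] by auto
  have gp: "\<And>x y. (x, y) \<in> g \<Longrightarrow> x \<in> points Y \<and> y \<in> points Z" using submanifold_subset(1)[OF g(1)] by auto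
  have I: "?I = {p \<in> points ?P. ?\<Phi> p \<in> ?G}"
  proof (intro set_eqI iffI)
    fix p assume "p \<in> ?I"
    then obtain x y z where e: "p = ((x, y), (y, z))" "(x, y) \<in> f" "(y, z) \<in> g" by (auto simp: middle_diagonal_def)
    then show "p \<in> {p \<in> points ?P. ?\<Phi> p \<in> ?G}" using fp[OF e(2)] gp[OF e(3)] sec[OF e(2,3)] by auto
  next
    fix p assume p: "p \<in> {p \<in> points ?P. ?\<Phi> p \<in> ?G}"
    obtain x y y' z where e1: "p = ((x, y), (y', z))" by (metis surj_pair)
    with p have "(x, z) \<in> f O g \<and> y = s (x, z) \<and> y' = s (x, z)" by simp
    note e = e1 this[THEN conjunct1] this[THEN conjunct2, THEN conjunct1] this[THEN conjunct2, THEN conjunct2]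
    then obtain w where w: "(x, w) \<in> f" "(w, z) \<in> g" by blast
    then have "w = s (x, z)" by (rule sec)
    then show "p \<in> ?I" using w e fp[OF w(1)] gp[OF w(2)] by (auto simp: middle_diagonal_def)
  qed
  have dim: "mdim ?P = mdim ?D" by simp
  have subI: "submanifold m ?P ?I" unfolding I by (rule submanifold_diffeo(1)[OF P D \<Phi> \<Psi> _ _ dim G(1)]) auto
  have TI: "tangent_subspace ?P ?I p = {u \<in> tangent_space ?P p. pushforward ?D ?\<Phi> p u \<in> tangent_subspace ?D ?G (?\<Phi> p)}" if "p \<in> ?I" for p
  proof -
    have "p \<in> points ?P" "?\<Phi> p \<in> ?G" using that unfolding I by blast+
    then show ?thesis unfolding I by (intro submanifold_diffeo(2)[OF P D \<Phi> \<Psi> _ _ dim G(1)]) auto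
  qed
  let ?J = "induced_manifold ?P ?I"
  note J = smooth_induced_manifold(1)[OF P subI] and inc = smooth_map_inclusion[OF P subI]
  have ptsJ: "points ?J = ?I" using submanifold_subset(1)[OF subI] by auto
  have prJ: "smooth_map ?J ?XZ ?pr" by (rule smooth_map_compose[OF J P XZ inc pr])
  have inj: "inj_on (pushforward ?XZ ?pr p) (tangent_space ?J p)" if p: "p \<in> points ?J" for p
  proof (rule inj_onI)
    fix u v assume uv: "u \<in> tangent_space ?J p" "v \<in> tangent_space ?J p" "pushforward ?XZ ?pr p u = pushforward ?XZ ?pr p v"
    have pI: "p \<in> ?I" using p ptsJ by blast
    then have pP: "p \<in> points ?P" and pG: "?\<Phi> p \<in> ?G" unfolding I by blast+
    define u' v' where "u' = pushforward ?P (\<lambda>x. x) p u" and "v' = pushforward ?P (\<lambda>x. x) p v"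
    have "u' \<in> tangent_subspace ?P ?I p" "v' \<in> tangent_subspace ?P ?I p" using uv by (auto simp: u'_def v'_def tangent_subspace_def)
    then have TP: "u' \<in> tangent_space ?P p" "v' \<in> tangent_space ?P p"
      and TG: "pushforward ?D ?\<Phi> p u' \<in> tangent_subspace ?D ?G (?\<Phi> p)" "pushforward ?D ?\<Phi> p v' \<in> tangent_subspace ?D ?G (?\<Phi> p)"
      unfolding TI[OF pI] by auto
    have pr': "pushforward ?XZ ?pr p u' = pushforward ?XZ ?pr p v'"
      using pushforward_compose[OF J P XZ inc pr p, of u] pushforward_compose[OF J P XZ inc pr p, of v] uv(3)
      by (simp add: u'_def v'_def)
    have fs: "pushforward ?XZ fst (?\<Phi> p) (pushforward ?D ?\<Phi> p w) = pushforward ?XZ ?pr p w" for w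
      using pushforward_compose[OF P D XZ \<Phi> smooth_map_fst[OF XZ YY] pP, of w] by simp
    have q: "?pr p \<in> f O g" and eq: "(?pr p, ?F (?pr p)) = ?\<Phi> p" using pG by auto
    have sn: "pushforward ?YY snd (?\<Phi> p) w = pushforward ?YY ?F (?pr p) (pushforward ?XZ fst (?\<Phi> p) w)"
      if "w \<in> tangent_subspace ?D ?G (?\<Phi> p)" for w
      using that unfolding G(2)[OF q, unfolded eq] by blast
    \<comment> \<open>For vectors tangent to the graph the last two components are determined by the
      outer ones, on which \<open>u'\<close> and \<open>v'\<close> agree.\<close>
    have "pushforward ?D ?\<Phi> p u' = pushforward ?D ?\<Phi> p v'"
      by (rule tangent_prod_eqI[OF XZ YY pushforward_in[OF P D \<Phi> TP(1)] pushforward_in[OF P D \<Phi> TP(2)]])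
        (simp_all only: fs pr' sn[OF TG(1)] sn[OF TG(2)])
    then have "pushforward ?P ?\<Psi> (?\<Phi> p) (pushforward ?D ?\<Phi> p u') = pushforward ?P ?\<Psi> (?\<Phi> p) (pushforward ?D ?\<Phi> p v')" by simp
    moreover have "pushforward ?P ?\<Psi> (?\<Phi> p) (pushforward ?D ?\<Phi> p w) = w" if "w \<in> tangent_space ?P p" for w
      by (rule pushforward_inverse[OF P D \<Phi> \<Psi> _ that]) simp
    ultimately have "u' = v'" using TP by simp
    then show "u = v" using inj_onD[OF tangent_subspace_eq_conormal_kernel(2)[OF P subI pI] _ uv(1,2)] by (simp add: u'_def v'_def)
  qed
  have prI: "?pr ` ?I = f O g"
  proof (intro set_eqI iffI)
    fix q assume "q \<in> ?pr ` ?I"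
    then obtain p where "p \<in> ?I" "q = ?pr p" by (elim imageE)
    then show "q \<in> f O g" by (auto simp: middle_diagonal_def)
  next
    fix q assume "q \<in> f O g"
    then obtain x y z where e: "q = (x, z)" "(x, y) \<in> f" "(y, z) \<in> g" by blast
    then have "((x, y), (y, z)) \<in> ?I" using fp[OF e(2)] gp[OF e(3)] by (auto simp: middle_diagonal_def)
    then show "q \<in> ?pr ` ?I" using e by (intro image_eqI[of _ _ "((x, y), (y, z))"]) auto
  qed
  have emb: "embedding_map (mtop ?J) (mtop ?XZ) ?pr"
    unfolding embedding_map_def ptsJ prI
  proof (rule homeomorphic_maps_imp_map)
    \<comment> \<open>The inverse of the projection. It is smooth on all of
      \<open>X \<times> Z\<close>, so its restriction to \<open>f O g\<close> is continuous.\<close>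
    let ?k = "\<lambda>q. ((fst q, s q), (s q, snd q))"
    have k: "smooth_map ?XZ ?P ?k"
      by (intro smooth_map_Pair[OF XZ XY YZ] smooth_map_Pair[OF XZ X Y] smooth_map_Pair[OF XZ Y Z]
          smooth_map_fst[OF X Z] smooth_map_snd[OF X Z] s)
    have kI: "?k q \<in> ?I \<and> ?pr (?k q) = q" if "q \<in> f O g" for q
    proof -
      obtain x y z where e: "q = (x, z)" "(x, y) \<in> f" "(y, z) \<in> g" using \<open>q \<in> f O g\<close> by blast
      then show ?thesis using fp[OF e(2)] gp[OF e(3)] sec[OF e(2,3)] by (auto simp: middle_diagonal_def)
    qed
    have pk: "?k (?pr p) = p" if "p \<in> ?I" for p
      using that sec by (auto simp: middle_diagonal_def)
    show "homeomorphic_maps (mtop ?J) (subtopology (mtop ?XZ) (f O g)) ?pr ?k"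
      unfolding homeomorphic_maps_def
    proof (intro conjI ballI)
      show "continuous_map (mtop ?J) (subtopology (mtop ?XZ) (f O g)) ?pr"
        unfolding continuous_map_in_subtopology using smooth_map_continuous[OF prJ] prI ptsJ by blast
      show "continuous_map (subtopology (mtop ?XZ) (f O g)) (mtop ?J) ?k"
        unfolding induced_manifold_simps continuous_map_in_subtopology
        using continuous_map_from_subtopology[OF smooth_map_continuous[OF k]] kI by auto
      show "?k (?pr p) = p" if "p \<in> points ?J" for p using pk that ptsJ by blast
      show "?pr (?k q) = q" for q by simp
    qed
  qed
  show ?thesis
    unfolding strongly_transversal_def smooth_embedding_def closed_submanifold_def outer_projection_eq
  proof (intro conjI ballI exI)
    show "inj_on (pushforward ?XZ ?pr p) (tangent_space ?J p)" if "p \<in> points ?J" for p by (rule inj[OF that])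
  qed (rule tp prJ emb h)+
qed

lemma submanifold_empty: "k \<le> mdim M \<Longrightarrow> submanifold k M {}"
  by (simp add: submanifold_def)

text \<open>An empty composite means an empty fibre product. Transversality and the embedding
  conditions become vacuous, and the empty set is a closed submanifold.\<close>

lemma strongly_transversal_empty:
  assumes X: "smooth_manifold X" and Y: "smooth_manifold Y" and Z: "smooth_manifold Z"
    and f: "smooth_relation X Y f" and g: "smooth_relation Y Z g" and e: "f O g = {}"
  shows "strongly_transversal X Y Z f g"
proof -
  let ?P = "prod_manifold (prod_manifold X Y) (prod_manifold Y Z)"
  have I: "f \<times> g \<inter> middle_diagonal X Y Z = {}" using e by (auto simp: middle_diagonal_def)
  have "points (induced_manifold ?P {}) = {}" by simp
  moreover have "embedding_map (mtop (induced_manifold ?P {})) (mtop (prod_manifold X Z)) (\<lambda>((x, y), y', z). (x, z))"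
    unfolding embedding_map_def by (rule homeomorphic_maps_imp_map[of _ _ _ undefined]) (simp add: homeomorphic_maps_def)
  ultimately show ?thesis
    unfolding strongly_transversal_def transversal_pair_def transversal_submanifolds_def I smooth_embedding_def smooth_map_def e closed_submanifold_def
    using f g submanifold_empty[of 0 "prod_manifold X Z"] by auto
qed

section \<open>Canonical relations\<close>

lemma pushforward_scheme_cong: "smooth_near M = smooth_near N \<Longrightarrow> pushforward M = pushforward N"
  by (simp add: pushforward_def fun_eq_iff)

text \<open>The notions of differential topology read three fields only. This identifies them for a
  product manifold and its symplectic version, whose record types differ, and for a manifold and its
  opposite.\<close>

lemma manifold_scheme_cong:
  assumes e: "mtop M = mtop N" "mdim M = mdim N" "matlas M = matlas N"
  shows "smooth_near M = smooth_near N" "coord_vector M = coord_vector N" "tangent_space M = tangent_space N"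
    "pushforward M = pushforward N" "submanifold k M = submanifold k N" "submanifold_dim M = submanifold_dim N"
    "slice_charts k M = slice_charts k N" "induced_manifold M = induced_manifold N" "tangent_subspace M = tangent_subspace N"
proof -
  show s: "smooth_near M = smooth_near N" by (simp add: smooth_near_def e fun_eq_iff)
  show c: "coord_vector M = coord_vector N" by (simp add: coord_vector_def e s fun_eq_iff)
  show t: "tangent_space M = tangent_space N" by (simp add: tangent_space_def c e fun_eq_iff)
  show "pushforward M = pushforward N" by (rule pushforward_scheme_cong[OF s])
  show sl: "slice_charts k M = slice_charts k N" for k by (simp add: slice_charts_def e fun_eq_iff)
  show su: "submanifold k M = submanifold k N" for k by (simp add: submanifold_def sl e fun_eq_iff)
  show sd: "submanifold_dim M = submanifold_dim N" by (simp add: submanifold_dim_def su fun_eq_iff)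
  show i: "induced_manifold M = induced_manifold N" by (simp add: induced_manifold_def sl sd e fun_eq_iff)
  show "tangent_subspace M = tangent_subspace N" by (simp add: tangent_subspace_def i pushforward_scheme_cong[OF s] fun_eq_iff)
qed

lemma opposite_simps [simp]:
  "mtop (opposite M) = mtop M" "mdim (opposite M) = mdim M" "matlas (opposite M) = matlas M"
  "form (opposite M) p u v = - form M p u v"
  by (simp_all add: opposite_def)

lemma prod_manifold_opposite [simp]: "prod_manifold M (opposite N) = prod_manifold M N"
  by (simp add: prod_manifold_def)

lemma prod_symplectic_simps:
  "mtop (prod_symplectic M N) = mtop (prod_manifold M N)" "mdim (prod_symplectic M N) = mdim (prod_manifold M N)"
  "matlas (prod_symplectic M N) = matlas (prod_manifold M N)"
  "form (prod_symplectic M N) p u v =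
         (if p \<in> points (prod_manifold M N) \<and>
            u \<in> tangent_space (prod_manifold M N) p \<and> v \<in> tangent_space (prod_manifold M N) p
         then form M (fst p) (pushforward M fst p u) (pushforward M fst p v) +
              form N (snd p) (pushforward N snd p u) (pushforward N snd p v)
         else 0)"
  by (simp_all add: prod_symplectic_def manifold.extend_def)

lemmas prod_symplectic_cong = manifold_scheme_cong[OF prod_symplectic_simps(1-3)]
lemmas opposite_cong = manifold_scheme_cong[OF opposite_simps(1-3)]

lemma symplectic_smooth: "symplectic_manifold M \<Longrightarrow> smooth_manifold M"
  by (simp add: symplectic_manifold_def)

text \<open>The form on \<open>prod_symplectic X (opposite Y)\<close> is the difference of the two
  pulled back forms, so isotropy of \<open>f\<close> says that they agree on its tangent
  vectors.\<close>

lemma canonical_relationI: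
  assumes X: "symplectic_manifold X" and Y: "symplectic_manifold Y"
    and f: "submanifold k (prod_manifold X Y) f" "closedin (mtop (prod_manifold X Y)) f" and k: "2 * k = mdim X + mdim Y"
    and iso: "\<And>p u v. p \<in> f \<Longrightarrow> u \<in> tangent_subspace (prod_manifold X Y) f p \<Longrightarrow> v \<in> tangent_subspace (prod_manifold X Y) f p \<Longrightarrow>
      form X (fst p) (pushforward X fst p u) (pushforward X fst p v) = form Y (snd p) (pushforward Y snd p u) (pushforward Y snd p v)"
  shows "canonical_relation X Y f"
  unfolding canonical_relation_def smooth_relation_def closed_submanifold_def lagrangian_def prod_symplectic_cong
    prod_symplectic_simps prod_manifold_opposite opposite_simps opposite_cong
  using assms by (auto intro!: exI[of _ k])

lemma canonical_relationD:
  assumes f: "canonical_relation X Y f"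
  obtains k where "submanifold k (prod_manifold X Y) f" "closedin (mtop (prod_manifold X Y)) f" "2 * k = mdim X + mdim Y"
proof -
  show thesis
    using f that unfolding canonical_relation_def smooth_relation_def closed_submanifold_def lagrangian_def prod_symplectic_cong
      prod_symplectic_simps prod_manifold_opposite by auto
qed

lemma canonical_relation_isotropic:
  assumes f: "canonical_relation X Y f" and p: "p \<in> f"
    and uv: "u \<in> tangent_subspace (prod_manifold X Y) f p" "v \<in> tangent_subspace (prod_manifold X Y) f p"
  shows "form X (fst p) (pushforward X fst p u) (pushforward X fst p v) = form Y (snd p) (pushforward Y snd p u) (pushforward Y snd p v)"
proof -
  have X: "smooth_manifold X" and Y: "smooth_manifold Y" using f by (auto simp: canonical_relation_def symplectic_smooth)
  note XY = smooth_prod_manifold(1)[OF X Y]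
  obtain k where k: "submanifold k (prod_manifold X Y) f" using canonical_relationD[OF f] by metis
  have "form (prod_symplectic X (opposite Y)) p u v = 0"
    using f p uv unfolding canonical_relation_def lagrangian_def prod_symplectic_cong prod_manifold_opposite by blast
  moreover have "u \<in> tangent_space (prod_manifold X Y) p" "v \<in> tangent_space (prod_manifold X Y) p"
    using tangent_subspace_subset[OF XY k p] uv by blast+
  moreover have "p \<in> points (prod_manifold X Y)" using submanifold_subset(1)[OF k] p by blast
  ultimately show ?thesis
    unfolding prod_symplectic_simps prod_manifold_opposite opposite_simps opposite_cong by simp
qed

lemma canonical_relation_symplectic: "canonical_relation X Y f \<Longrightarrow> symplectic_manifold X \<and> symplectic_manifold Y"
  by (simp add: canonical_relation_def)

text \<open>The empty set is a submanifold of every dimension up to the ambient one. Half of the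
  ambient dimension is an integer because symplectic dimensions are even, also for empty
  manifolds.\<close>

lemma canonical_relation_empty:
  assumes "symplectic_manifold X" "symplectic_manifold Y" shows "canonical_relation X Y {}"
proof (rule canonical_relationI[OF assms])
  have "even (mdim X + mdim Y)" using assms by (simp add: symplectic_manifold_def)
  then show "2 * ((mdim X + mdim Y) div 2) = mdim X + mdim Y" by simp
  then show "submanifold ((mdim X + mdim Y) div 2) (prod_manifold X Y) {}" by (intro submanifold_empty) simp
qed auto

section \<open>Transposes, and relations presented by reduction data\<close>

lemma submanifold_converse:
  assumes X: "smooth_manifold X" and Y: "smooth_manifold Y" and f: "submanifold k (prod_manifold X Y) f"
  shows "submanifold k (prod_manifold Y X) (f\<inverse>)"
    and "(x, y) \<in> f \<Longrightarrow> tangent_subspace (prod_manifold Y X) (f\<inverse>) (y, x) = {u \<in> tangent_space (prod_manifold Y X) (y, x).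
      pushforward (prod_manifold X Y) prod.swap (y, x) u \<in> tangent_subspace (prod_manifold X Y) f (x, y)}"
    and "closedin (mtop (prod_manifold X Y)) f \<Longrightarrow> closedin (mtop (prod_manifold Y X)) (f\<inverse>)"
    and "u \<in> tangent_space (prod_manifold Y X) (y, x) \<Longrightarrow>
      pushforward X fst (x, y) (pushforward (prod_manifold X Y) prod.swap (y, x) u) = pushforward X snd (y, x) u"
    and "u \<in> tangent_space (prod_manifold Y X) (y, x) \<Longrightarrow>
      pushforward Y snd (x, y) (pushforward (prod_manifold X Y) prod.swap (y, x) u) = pushforward Y fst (y, x) u"
proof -
  note XY = smooth_prod_manifold(1)[OF X Y] and YX = smooth_prod_manifold(1)[OF Y X]
  have sw: "smooth_map (prod_manifold A B) (prod_manifold B A) prod.swap" if "smooth_manifold A" "smooth_manifold B" for A :: "('x, 'y) manifold_scheme" and B :: "('z, 'w) manifold_scheme"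
  proof -
    have "smooth_map (prod_manifold A B) (prod_manifold B A) (\<lambda>p. (snd p, fst p))"
      by (intro smooth_map_Pair smooth_map_fst smooth_map_snd smooth_prod_manifold(1) that)
    then show ?thesis by (simp add: prod.swap_def[abs_def])
  qed
  have c: "f\<inverse> = {p \<in> points (prod_manifold Y X). prod.swap p \<in> f}" using submanifold_subset(1)[OF f] by auto
  have dim: "mdim (prod_manifold Y X) = mdim (prod_manifold X Y)" by simp
  note d = submanifold_diffeo[OF YX XY sw[OF Y X] sw[OF X Y] _ _ dim f, folded c]
  show "submanifold k (prod_manifold Y X) (f\<inverse>)" by (rule d(1)) auto
  show "tangent_subspace (prod_manifold Y X) (f\<inverse>) (y, x) = {u \<in> tangent_space (prod_manifold Y X) (y, x).
      pushforward (prod_manifold X Y) prod.swap (y, x) u \<in> tangent_subspace (prod_manifold X Y) f (x, y)}" if "(x, y) \<in> f"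
    using d(2)[of "(y, x)"] submanifold_subset(1)[OF f] that by auto
  show "closedin (mtop (prod_manifold Y X)) (f\<inverse>)" if "closedin (mtop (prod_manifold X Y)) f"
    unfolding c by (rule closedin_continuous_map_preimage[OF smooth_map_continuous[OF sw[OF Y X]] that])
  assume u: "u \<in> tangent_space (prod_manifold Y X) (y, x)"
  note p = tangent_points[OF YX u]
  show "pushforward X fst (x, y) (pushforward (prod_manifold X Y) prod.swap (y, x) u) = pushforward X snd (y, x) u"
    using pushforward_compose[OF YX XY X sw[OF Y X] smooth_map_fst[OF X Y] p, of u] by simp
  show "pushforward Y snd (x, y) (pushforward (prod_manifold X Y) prod.swap (y, x) u) = pushforward Y fst (y, x) u"
    using pushforward_compose[OF YX XY Y sw[OF Y X] smooth_map_snd[OF X Y] p, of u] by simp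
qed

text \<open>A coisotropic closed submanifold \<open>K\<close> with a surjective submersion \<open>r\<close> onto its reduced space.\<close>

definition reduction_data :: "'a symplectic \<Rightarrow> 'b symplectic \<Rightarrow> 'b set \<Rightarrow> ('b \<Rightarrow> 'a) \<Rightarrow> bool" where
  "reduction_data X Q K r \<longleftrightarrow>
     symplectic_manifold X \<and> symplectic_manifold Q \<and> closedin (mtop Q) K \<and> smooth_map Q X r \<and>
     (\<exists>k. submanifold k Q K \<and> 2 * k = mdim X + mdim Q) \<and>
     (\<forall>q\<in>K. \<forall>u\<in>tangent_subspace Q K q. \<forall>v\<in>tangent_subspace Q K q.
        form Q q u v = form X (r q) (pushforward X r q u) (pushforward X r q v)) \<and>
     points X \<subseteq> r ` K \<and>
     (\<forall>q\<in>K. \<forall>\<xi>\<in>tangent_space X (r q). \<exists>u\<in>tangent_subspace Q K q. pushforward X r q u = \<xi>)"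

definition reduction_rel :: "'b set \<Rightarrow> ('b \<Rightarrow> 'a) \<Rightarrow> ('a \<times> 'b) set" where
  "reduction_rel K r = {(r q, q) | q. q \<in> K}"

lemma reduction_rel_converse: "(reduction_rel K r)\<inverse> = {(q, r q) | q. q \<in> K}"
  by (auto simp: reduction_rel_def)

text \<open>The transpose of \<open>reduction_rel K r\<close> is the graph of \<open>r\<close> over
  \<open>K\<close>; the relation itself follows by swapping the factors. Closedness rests on
  \<open>K\<close> being closed and \<open>X\<close> being Hausdorff.\<close>

lemma reduction_data_tangent:
  assumes R: "reduction_data X Q K r"
  obtains k where "submanifold k (prod_manifold Q X) ((reduction_rel K r)\<inverse>)" "submanifold k (prod_manifold X Q) (reduction_rel K r)"
    "submanifold k Q K" "2 * k = mdim X + mdim Q"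
    "closedin (mtop (prod_manifold Q X)) ((reduction_rel K r)\<inverse>)" "closedin (mtop (prod_manifold X Q)) (reduction_rel K r)"
    "\<forall>q\<in>K. tangent_subspace (prod_manifold Q X) ((reduction_rel K r)\<inverse>) (q, r q) =
      {u \<in> tangent_space (prod_manifold Q X) (q, r q). pushforward Q fst (q, r q) u \<in> tangent_subspace Q K q \<and>
         pushforward X snd (q, r q) u = pushforward X r q (pushforward Q fst (q, r q) u)}"
    "\<forall>q\<in>K. tangent_subspace (prod_manifold X Q) (reduction_rel K r) (r q, q) =
      {u \<in> tangent_space (prod_manifold X Q) (r q, q). pushforward Q snd (r q, q) u \<in> tangent_subspace Q K q \<and>
         pushforward X fst (r q, q) u = pushforward X r q (pushforward Q snd (r q, q) u)}"
proof -
  have X: "smooth_manifold X" and Q: "smooth_manifold Q" and r: "smooth_map Q X r" and cl: "closedin (mtop Q) K"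
    using R by (auto simp: reduction_data_def symplectic_smooth)
  obtain k where k: "submanifold k Q K" "2 * k = mdim X + mdim Q" using R unfolding reduction_data_def by blast
  note XQ = smooth_prod_manifold(1)[OF X Q] and QX = smooth_prod_manifold(1)[OF Q X]
  note G = submanifold_graph[OF Q X r k(1), folded reduction_rel_converse]
  have G1: "submanifold k (prod_manifold X Q) (reduction_rel K r)" using submanifold_converse(1)[OF Q X G(1)] by simp
  have KQ: "K \<subseteq> points Q" by (rule submanifold_subset(1)[OF k(1)])
  have c1: "closedin (mtop (prod_manifold Q X)) ((reduction_rel K r)\<inverse>)"
  proof -
    have "(reduction_rel K r)\<inverse> = {p \<in> points (prod_manifold Q X). fst p \<in> K} \<inter> {p \<in> points (prod_manifold Q X). r (fst p) = snd p}"
      unfolding reduction_rel_converse using KQ smooth_map_points[OF r] by auto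
    moreover have "closedin (mtop (prod_manifold Q X)) {p \<in> points (prod_manifold Q X). fst p \<in> K}"
      by (rule closedin_continuous_map_preimage[OF smooth_map_continuous[OF smooth_map_fst[OF Q X]] cl])
    moreover have "closedin (mtop (prod_manifold Q X)) {p \<in> points (prod_manifold Q X). r (fst p) = snd p}"
      by (rule closedin_continuous_maps_eq[OF _ smooth_map_continuous[OF smooth_map_compose[OF QX Q X smooth_map_fst[OF Q X] r]]
          smooth_map_continuous[OF smooth_map_snd[OF Q X]]]) (use X in \<open>simp add: smooth_manifold_def\<close>)
    ultimately show ?thesis by (simp add: closedin_Int)
  qed
  have c2: "closedin (mtop (prod_manifold X Q)) (reduction_rel K r)"
    using submanifold_converse(3)[OF Q X G(1) c1] by simp
  have T2: "tangent_subspace (prod_manifold X Q) (reduction_rel K r) (r q, q) =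
      {u \<in> tangent_space (prod_manifold X Q) (r q, q). pushforward Q snd (r q, q) u \<in> tangent_subspace Q K q \<and>
         pushforward X fst (r q, q) u = pushforward X r q (pushforward Q snd (r q, q) u)}" if q: "q \<in> K" for q
  proof -
    have qr: "(q, r q) \<in> (reduction_rel K r)\<inverse>" using q unfolding reduction_rel_converse by blast
    have sw: "smooth_map (prod_manifold X Q) (prod_manifold Q X) prod.swap"
    proof -
      have "smooth_map (prod_manifold X Q) (prod_manifold Q X) (\<lambda>p. (snd p, fst p))"
        by (intro smooth_map_Pair smooth_map_fst smooth_map_snd smooth_prod_manifold(1) X Q)
      then show ?thesis by (simp add: prod.swap_def[abs_def])
    qed
    show ?thesis
      using submanifold_converse(2)[OF Q X G(1) qr] submanifold_converse(4,5)[OF Q X G(1), of _ "r q" q]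
        pushforward_in[OF XQ QX sw, of _ "(r q, q)"]
      unfolding G(2)[OF q] converse_converse by auto
  qed
  show thesis by (rule that[OF G(1) G1 k c1 c2]) (use G(2) T2 in blast)+
qed

lemma reduction_data_canonical:
  assumes R: "reduction_data X Q K r"
  shows "canonical_relation X Q (reduction_rel K r)" "canonical_relation Q X ((reduction_rel K r)\<inverse>)"
    "reduction X Q (reduction_rel K r)" "coreduction Q X ((reduction_rel K r)\<inverse>)"
proof -
  have SX: "symplectic_manifold X" and SQ: "symplectic_manifold Q" and r: "smooth_map Q X r" and cl: "closedin (mtop Q) K"
    using R by (auto simp: reduction_data_def)
  note X = symplectic_smooth[OF SX] and Q = symplectic_smooth[OF SQ]
  have iso: "form Q q u v = form X (r q) (pushforward X r q u) (pushforward X r q v)"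
    if "q \<in> K" "u \<in> tangent_subspace Q K q" "v \<in> tangent_subspace Q K q" for q u v
    using R that unfolding reduction_data_def by blast
  have sub: "\<exists>q\<in>K. r q = x \<and> (\<exists>u\<in>tangent_subspace Q K q. pushforward X r q u = \<xi>)"
    if x: "x \<in> points X" "\<xi> \<in> tangent_space X x" for x \<xi>
  proof -
    have "points X \<subseteq> r ` K" and s: "\<forall>q\<in>K. \<forall>\<xi>\<in>tangent_space X (r q). \<exists>u\<in>tangent_subspace Q K q. pushforward X r q u = \<xi>"
      using R unfolding reduction_data_def by blast+
    then obtain q where q: "q \<in> K" "r q = x" using x(1) by blast
    then show ?thesis using s x(2) by blast
  qed
  let ?A = "reduction_rel K r"
  obtain k where s: "submanifold k (prod_manifold Q X) (?A\<inverse>)" "submanifold k (prod_manifold X Q) ?A"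
    and kK: "submanifold k Q K" and k: "2 * k = mdim X + mdim Q"
    and c: "closedin (mtop (prod_manifold Q X)) (?A\<inverse>)" "closedin (mtop (prod_manifold X Q)) ?A"
    and T1': "\<forall>q\<in>K. tangent_subspace (prod_manifold Q X) (?A\<inverse>) (q, r q) =
      {u \<in> tangent_space (prod_manifold Q X) (q, r q). pushforward Q fst (q, r q) u \<in> tangent_subspace Q K q \<and>
         pushforward X snd (q, r q) u = pushforward X r q (pushforward Q fst (q, r q) u)}"
    and T2': "\<forall>q\<in>K. tangent_subspace (prod_manifold X Q) ?A (r q, q) =
      {u \<in> tangent_space (prod_manifold X Q) (r q, q). pushforward Q snd (r q, q) u \<in> tangent_subspace Q K q \<and>
         pushforward X fst (r q, q) u = pushforward X r q (pushforward Q snd (r q, q) u)}"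
    by (rule reduction_data_tangent[OF R]) (rule that)
  note T1 = bspec[OF T1'] and T2 = bspec[OF T2']
  have KQ: "K \<subseteq> points Q" by (rule submanifold_subset(1)[OF kK])
  show "canonical_relation X Q ?A"
  proof (rule canonical_relationI[OF SX SQ s(2) c(2) k])
    fix p u v assume p: "p \<in> ?A" and uv: "u \<in> tangent_subspace (prod_manifold X Q) ?A p" "v \<in> tangent_subspace (prod_manifold X Q) ?A p"
    obtain q where q: "q \<in> K" "p = (r q, q)" using p by (auto simp: reduction_rel_def)
    show "form X (fst p) (pushforward X fst p u) (pushforward X fst p v) = form Q (snd p) (pushforward Q snd p u) (pushforward Q snd p v)"
      using uv iso[OF q(1)] unfolding q(2) T2[OF q(1)] by simp
  qed
  have k': "2 * k = mdim Q + mdim X" using k by simp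
  show "canonical_relation Q X (?A\<inverse>)"
  proof (rule canonical_relationI[OF SQ SX s(1) c(1) k'])
    fix p u v assume p: "p \<in> ?A\<inverse>" and uv: "u \<in> tangent_subspace (prod_manifold Q X) (?A\<inverse>) p" "v \<in> tangent_subspace (prod_manifold Q X) (?A\<inverse>) p"
    obtain q where q: "q \<in> K" "p = (q, r q)" using p by (auto simp: reduction_rel_def)
    show "form Q (fst p) (pushforward Q fst p u) (pushforward Q fst p v) = form X (snd p) (pushforward X snd p u) (pushforward X snd p v)"
      using uv iso[OF q(1)] unfolding q(2) T1[OF q(1)] by simp
  qed
  show red: "reduction X Q ?A"
    unfolding reduction_def
  proof (intro conjI)
    show "smooth_relation X Q ?A" using s(2) c(2) by (auto simp: smooth_relation_def closed_submanifold_def)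
    show "surjective_rel (points X) ?A"
      unfolding surjective_rel_def
    proof
      fix x assume x: "x \<in> points X"
      from sub[OF x tangent_zero[OF X x]] show "\<exists>y. (x, y) \<in> ?A" by (auto simp: reduction_rel_def)
    qed
    show "coinjective_rel ?A" by (auto simp: coinjective_rel_def reduction_rel_def)
    show "surjective_rel (tangent_bundle X) (tangent_relation X Q ?A)"
      unfolding surjective_rel_def
    proof
      fix a assume "a \<in> tangent_bundle X"
      then obtain x \<xi> where a: "a = (x, \<xi>)" "x \<in> points X" "\<xi> \<in> tangent_space X x" unfolding tangent_bundle_def by blast
      from sub[OF a(2,3)] obtain q u where q: "q \<in> K" "r q = x" "u \<in> tangent_subspace Q K q" "pushforward X r q u = \<xi>" by blast
      have uQ: "u \<in> tangent_space Q (snd (r q, q))" using tangent_subspace_subset[OF Q kK q(1)] q(3) by auto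
      have xi: "\<xi> \<in> tangent_space X (fst (r q, q))" using a(3) q(2) by simp
      obtain w where w: "w \<in> tangent_space (prod_manifold X Q) (r q, q)" "pushforward X fst (r q, q) w = \<xi>" "pushforward Q snd (r q, q) w = u"
        by (rule tangent_prod_ex[OF X Q xi uQ])
      have wA: "w \<in> tangent_subspace (prod_manifold X Q) ?A (r q, q)" unfolding T2[OF q(1)] using w q by simp
      have "(r q, q) \<in> ?A" using q(1) unfolding reduction_rel_def by blast
      then have "((r q, pushforward X fst (r q, q) w), (q, pushforward Q snd (r q, q) w)) \<in> tangent_relation X Q ?A"
        unfolding tangent_relation_def using wA by blast
      then have "((r q, \<xi>), (q, u)) \<in> tangent_relation X Q ?A" unfolding w(2,3) .
      then show "\<exists>y. (a, y) \<in> tangent_relation X Q ?A" unfolding a(1) q(2) by blast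
    qed
    show "coinjective_rel (tangent_relation X Q ?A)"
    proof -
      have e: "a = (r (fst b), pushforward X r (fst b) (snd b))" if ab: "(a, b) \<in> tangent_relation X Q ?A" for a b
      proof -
        obtain x q w where w: "a = (x, pushforward X fst (x, q) w)" "b = (q, pushforward Q snd (x, q) w)" "(x, q) \<in> ?A"
          "w \<in> tangent_subspace (prod_manifold X Q) ?A (x, q)" using ab unfolding tangent_relation_def by blast
        have q: "q \<in> K" "x = r q" using w(3) by (auto simp: reduction_rel_def)
        show ?thesis using w(4) unfolding w(1,2) q(2) T2[OF q(1)] by simp
      qed
      show ?thesis
        unfolding coinjective_rel_def
      proof (intro allI impI)
        fix b a a' assume "(a, b) \<in> tangent_relation X Q ?A" "(a', b) \<in> tangent_relation X Q ?A"
        from e[OF this(1)] e[OF this(2)] show "a = a'" by simp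
      qed
    qed
    \<comment> \<open>On the relation \<open>snd\<close> is injective, since the second component
      determines the first. It is closed, since the image of a closed part is a preimage under the
      map from \<open>q\<close> to \<open>(r q, q)\<close>, cut with the closed set
      \<open>K\<close>.\<close>
    show "proper_map (subtopology (prod_topology (mtop X) (mtop Q)) ?A) (mtop Q) snd"
    proof (rule closed_injective_imp_proper_map)
      show "inj_on snd (topspace (subtopology (prod_topology (mtop X) (mtop Q)) ?A))"
        by (auto simp: inj_on_def reduction_rel_def)
      show "closed_map (subtopology (prod_topology (mtop X) (mtop Q)) ?A) (mtop Q) snd"
        unfolding closed_map_def
      proof (intro allI impI)
        fix C assume "closedin (subtopology (prod_topology (mtop X) (mtop Q)) ?A) C"
        then obtain C' where C': "closedin (prod_topology (mtop X) (mtop Q)) C'" "C = C' \<inter> ?A" by (auto simp: closedin_subtopology)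
        have "continuous_map (mtop Q) (prod_topology (mtop X) (mtop Q)) (\<lambda>q. (r q, q))"
          using smooth_map_continuous[OF r] by (simp add: continuous_map_pairedI)
        from closedin_continuous_map_preimage[OF this C'(1)]
        have "closedin (mtop Q) ({q \<in> points Q. (r q, q) \<in> C'} \<inter> K)" using cl by (rule closedin_Int)
        moreover have "snd ` C = {q \<in> points Q. (r q, q) \<in> C'} \<inter> K"
          unfolding C'(2) reduction_rel_def using KQ by force
        ultimately show "closedin (mtop Q) (snd ` C)" by simp
      qed
    qed
  qed
  show "coreduction Q X (?A\<inverse>)"
    unfolding coreduction_def using red s(1) c(1) by (auto simp: smooth_relation_def closed_submanifold_def)
qed

lemma tangent_subspace_zero:
  assumes M: "smooth_manifold M" and S: "submanifold k M S" and p: "p \<in> S"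
  shows "(\<lambda>g. 0) \<in> tangent_subspace M S p"
  using submanifold_subset(1)[OF S] p tangent_zero[OF M, of p]
  unfolding tangent_subspace_eq_conormal_kernel(1)[OF M S p] conormal_kernel_def by auto

lemma pushforward_zero: "pushforward N F p (\<lambda>g. 0) = (\<lambda>g. 0)"
  by (auto simp: pushforward_def)

lemma reduction_data_id:
  assumes X: "symplectic_manifold X" shows "reduction_data X X (points X) (\<lambda>x. x)"
  unfolding reduction_data_def
proof (intro conjI ballI exI[of _ "mdim X"])
  note M = symplectic_smooth[OF X]
  show "submanifold (mdim X) X (points X)" by (rule submanifold_whole[OF M])
  show "smooth_map X X (\<lambda>x. x)" by (rule smooth_map_id[OF M])
  show "form X q u v = form X q (pushforward X (\<lambda>x. x) q u) (pushforward X (\<lambda>x. x) q v)"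
    if "q \<in> points X" "u \<in> tangent_subspace X (points X) q" "v \<in> tangent_subspace X (points X) q" for q u v
    using that unfolding tangent_subspace_whole[OF M that(1)] by (simp add: pushforward_id)
  show "\<exists>u\<in>tangent_subspace X (points X) x. pushforward X (\<lambda>x. x) x u = \<xi>"
    if x: "x \<in> points X" "\<xi> \<in> tangent_space X x" for x \<xi>
    using x tangent_subspace_whole[OF M x(1)] pushforward_id[OF x(2)] by auto
qed (use X in auto)

lemma canonical_relation_Id:
  assumes X: "symplectic_manifold X" shows "canonical_relation X X (Id_on (points X))"
proof -
  have "reduction_rel (points X) (\<lambda>x. x) = Id_on (points X)" by (auto simp: reduction_rel_def)
  then show ?thesis using reduction_data_canonical(1)[OF reduction_data_id[OF X]] by simp
qed

section \<open>Closed two-forms on manifolds\<close>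

text \<open>Like \<open>form_coeff\<close>, but for a form that is not a field of a record: forms
  are pulled back and added before a symplectic manifold exists.\<close>

definition two_form_coeff ::
    "('a, 'm) manifold_scheme \<Rightarrow> ('a \<Rightarrow> 'a tvec \<Rightarrow> 'a tvec \<Rightarrow> real) \<Rightarrow> 'a chart \<Rightarrow> nat \<Rightarrow> nat \<Rightarrow> (nat \<Rightarrow> real) \<Rightarrow> real" where
  "two_form_coeff M \<theta> = (\<lambda>(U, \<phi>) i j x. \<theta> (inv_into U \<phi> x)
     (coord_vector M (U, \<phi>) (inv_into U \<phi> x) (\<lambda>l. if l = i then 1 else 0))
     (coord_vector M (U, \<phi>) (inv_into U \<phi> x) (\<lambda>l. if l = j then 1 else 0)))"

definition bilinear_at :: "('a, 'm) manifold_scheme \<Rightarrow> ('a \<Rightarrow> 'a tvec \<Rightarrow> 'a tvec \<Rightarrow> real) \<Rightarrow> 'a \<Rightarrow> bool" where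
  "bilinear_at M \<theta> p \<longleftrightarrow> (\<forall>u\<in>tangent_space M p. \<forall>v\<in>tangent_space M p.
        \<theta> p u u = 0 \<and> \<theta> p v u = - \<theta> p u v \<and>
        (\<forall>w\<in>tangent_space M p. \<forall>a b. \<theta> p (\<lambda>g. a * u g + b * v g) w = a * \<theta> p u w + b * \<theta> p v w))"

definition nondegenerate_at :: "('a, 'm) manifold_scheme \<Rightarrow> ('a \<Rightarrow> 'a tvec \<Rightarrow> 'a tvec \<Rightarrow> real) \<Rightarrow> 'a \<Rightarrow> bool" where
  "nondegenerate_at M \<theta> p \<longleftrightarrow> (\<forall>u\<in>tangent_space M p. (\<forall>v\<in>tangent_space M p. \<theta> p u v = 0) \<longrightarrow> u = (\<lambda>g. 0))"

text \<open>Relative to an open set \<open>A\<close>, because a form may be given by different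
  formulas on different components. The coefficients are tested as germs at points of
  \<open>A\<close>, so the charts may reach beyond \<open>A\<close>.\<close>

definition closed_two_form_on :: "('a, 'm) manifold_scheme \<Rightarrow> 'a set \<Rightarrow> ('a \<Rightarrow> 'a tvec \<Rightarrow> 'a tvec \<Rightarrow> real) \<Rightarrow> bool" where
  "closed_two_form_on M A \<theta> \<longleftrightarrow> openin (mtop M) A \<and> (\<forall>p\<in>A. bilinear_at M \<theta> p) \<and>
     (\<forall>U \<phi> p. (U, \<phi>) \<in> matlas M \<longrightarrow> p \<in> U \<inter> A \<longrightarrow> closed_form_at (mdim M) (two_form_coeff M \<theta> (U, \<phi>)) (\<phi> p))"

lemma bilinear_atD:
  assumes "bilinear_at M \<theta> p" "u \<in> tangent_space M p" "v \<in> tangent_space M p"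
  shows "\<theta> p u u = 0" "\<theta> p v u = - \<theta> p u v"
    "w \<in> tangent_space M p \<Longrightarrow> \<theta> p (\<lambda>g. a * u g + b * v g) w = a * \<theta> p u w + b * \<theta> p v w"
  using assms unfolding bilinear_at_def by blast+

lemma bilinear_zero:
  assumes "bilinear_at M \<theta> p" "u \<in> tangent_space M p"
  shows "\<theta> p (\<lambda>g. 0) u = 0" "(\<lambda>g. 0) \<in> tangent_space M p \<Longrightarrow> \<theta> p u (\<lambda>g. 0) = 0"
proof -
  show 1: "\<theta> p (\<lambda>g. 0) u = 0" using bilinear_atD(3)[OF assms assms(2,2), of 0 0] by simp
  assume "(\<lambda>g. 0) \<in> tangent_space M p"
  then have "\<theta> p u (\<lambda>g. 0) = - \<theta> p (\<lambda>g. 0) u" by (rule bilinear_atD(2)[OF assms(1) _ assms(2)])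
  with 1 show "\<theta> p u (\<lambda>g. 0) = 0" by simp
qed

abbreviation unit_vec :: "nat \<Rightarrow> nat \<Rightarrow> real" where "unit_vec i \<equiv> (\<lambda>l. if l = i then 1 else 0)"

lemma coord_vector_Suc:
  "coord_vector M c p (\<lambda>i. if i < Suc k then v i else 0) =
   (\<lambda>g. 1 * coord_vector M c p (\<lambda>i. if i < k then v i else 0) g + v k * coord_vector M c p (unit_vec k) g)"
proof
  fix g
  obtain U \<phi> where c: "c = (U, \<phi>)" by (cases c)
  show "coord_vector M c p (\<lambda>i. if i < Suc k then v i else 0) g =
     1 * coord_vector M c p (\<lambda>i. if i < k then v i else 0) g + v k * coord_vector M c p (unit_vec k) g"
  proof (cases "smooth_near M p g")
    case True
    show ?thesis
      unfolding c coord_vector_apply[OF True] sum_distrib_left sum.distrib[symmetric]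
      by (rule sum.cong[OF refl]) (auto simp: less_Suc_eq)
  qed (simp add: c coord_vector_def)
qed

text \<open>Linearity in the first argument is unfolded one coordinate at a time with
  \<open>coord_vector_Suc\<close>; antisymmetry transfers the result to the second argument.\<close>

lemma bilinear_coord:
  assumes M: "smooth_manifold M" and c: "(U, \<phi>) \<in> matlas M" "p \<in> U" and b: "bilinear_at M \<theta> p"
  shows "\<theta> p (coord_vector M (U, \<phi>) p v) (coord_vector M (U, \<phi>) p w) =
    (\<Sum>a<mdim M. \<Sum>b<mdim M. \<theta> p (coord_vector M (U, \<phi>) p (unit_vec a)) (coord_vector M (U, \<phi>) p (unit_vec b)) * (v a * w b))"
proof -
  let ?c = "coord_vector M (U, \<phi>) p"
  have T: "?c v \<in> tangent_space M p" for v by (rule coord_vector_in[OF c])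
  have k: "\<theta> p (?c (\<lambda>i. if i < k then v i else 0)) u = (\<Sum>a<k. v a * \<theta> p (?c (unit_vec a)) u)"
    if u: "u \<in> tangent_space M p" for u v k
  proof (induction k)
    case 0
    have "?c (\<lambda>i. if i < 0 then v i else 0) = (\<lambda>g. 0)" by (auto simp: coord_vector_def)
    then show ?case using bilinear_zero(1)[OF b u] by simp
  next
    case (Suc k)
    show ?case unfolding coord_vector_Suc bilinear_atD(3)[OF b T T u] Suc.IH by simp
  qed
  have tr: "?c (\<lambda>i. if i < mdim M then v i else 0) = ?c v" for v by (rule coord_vector_cong) simp
  have 1: "\<theta> p (?c v) u = (\<Sum>a<mdim M. v a * \<theta> p (?c (unit_vec a)) u)" if "u \<in> tangent_space M p" for u v
    using k[OF that, of "mdim M" v] by (simp add: tr)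
  have 2: "\<theta> p u (?c w) = (\<Sum>a<mdim M. w a * \<theta> p u (?c (unit_vec a)))" if u: "u \<in> tangent_space M p" for u
  proof -
    have "\<theta> p u (?c w) = - \<theta> p (?c w) u" by (rule bilinear_atD(2)[OF b T u])
    also have "\<dots> = - (\<Sum>a<mdim M. w a * \<theta> p (?c (unit_vec a)) u)" by (rule arg_cong[OF 1[OF u]])
    also have "\<dots> = (\<Sum>a<mdim M. w a * (- \<theta> p (?c (unit_vec a)) u))" by (simp add: sum_negf)
    also have "\<dots> = (\<Sum>a<mdim M. w a * \<theta> p u (?c (unit_vec a)))"
      by (rule sum.cong[OF refl]) (simp add: bilinear_atD(2)[OF b T u])
    finally show ?thesis .
  qed
  show ?thesis
  proof -
    have "\<theta> p (?c v) (?c w) = (\<Sum>a<mdim M. v a * \<theta> p (?c (unit_vec a)) (?c w))" by (rule 1[OF T])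
    also have "\<dots> = (\<Sum>a<mdim M. v a * (\<Sum>b<mdim M. w b * \<theta> p (?c (unit_vec a)) (?c (unit_vec b))))"
      by (intro sum.cong refl arg_cong2[of _ _ _ _ "(*)"] 2[OF T])
    finally show ?thesis by (simp add: sum_distrib_left mult_ac)
  qed
qed

text \<open>\<open>F\<close> sends the i-th coordinate vector to the i-th column of the Jacobian of
  its coordinate expression \<open>f\<close>, so the coefficients are those treated in
  \<open>closed_form_at_pullback\<close>.\<close>

lemma closed_two_form_pullback:
  assumes N: "smooth_manifold N" and M: "smooth_manifold M" and F: "smooth_map N M F"
    and \<theta>: "closed_two_form_on M A \<theta>" and B: "openin (mtop N) B" and BA: "\<And>p. p \<in> B \<Longrightarrow> F p \<in> A"
  shows "closed_two_form_on N B (\<lambda>p u v. \<theta> (F p) (pushforward M F p u) (pushforward M F p v))"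
  unfolding closed_two_form_on_def
proof (intro conjI B ballI allI impI)
  have bil: "bilinear_at M \<theta> (F p)" if "p \<in> B" for p using \<theta> BA[OF that] unfolding closed_two_form_on_def by blast
  show "bilinear_at N (\<lambda>p u v. \<theta> (F p) (pushforward M F p u) (pushforward M F p v)) p" if p: "p \<in> B" for p
    unfolding bilinear_at_def pushforward_linear_comb
  proof (intro ballI conjI allI)
    fix u v assume uv: "u \<in> tangent_space N p" "v \<in> tangent_space N p"
    note T = pushforward_in[OF N M F uv(1)] pushforward_in[OF N M F uv(2)]
    show "\<theta> (F p) (pushforward M F p u) (pushforward M F p u) = 0" by (rule bilinear_atD(1)[OF bil[OF p] T])
    show "\<theta> (F p) (pushforward M F p v) (pushforward M F p u) = - \<theta> (F p) (pushforward M F p u) (pushforward M F p v)"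
      by (rule bilinear_atD(2)[OF bil[OF p] T])
    show "\<theta> (F p) (\<lambda>g. a * pushforward M F p u g + b * pushforward M F p v g) (pushforward M F p w) =
        a * \<theta> (F p) (pushforward M F p u) (pushforward M F p w) + b * \<theta> (F p) (pushforward M F p v) (pushforward M F p w)"
      if "w \<in> tangent_space N p" for w a b
      by (rule bilinear_atD(3)[OF bil[OF p] T pushforward_in[OF N M F that]])
  qed
  fix U \<phi> p assume c: "(U, \<phi>) \<in> matlas N" and p: "p \<in> U \<inter> B"
  let ?n = "mdim N" and ?m = "mdim M"
  have pU: "p \<in> U" and pB: "p \<in> B" using p by auto
  note C = matlas_chartD[OF N c]
  have pN: "p \<in> points N" using C(2) pU by blast
  obtain V \<psi> where d: "(V, \<psi>) \<in> matlas M" "F p \<in> V" using chart_exists[OF M smooth_map_points[OF F pN]] by metis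
  note D = matlas_chartD[OF M d(1)]
  have t: "trunc ?m (\<lambda>j. \<psi> q j) = \<psi> q" if "q \<in> V" for q using trunc_id[OF D(5)[OF that]] by simp
  define f where "f a x = \<psi> (F (inv_into U \<phi> x)) a" for a x
  let ?\<omega> = "two_form_coeff M \<theta> (V, \<psi>)"
  have fp: "trunc ?m (\<lambda>a. f a (\<phi> p)) = \<psi> (F p)" unfolding f_def C(6)[OF pU] by (rule t[OF d(2)])
  have fs: "smooth_at ?n (f a) (\<phi> p)" if "a < ?m" for a
    using iffD1[OF smooth_near_iff[OF N c pU] smooth_mapD[OF F pN d that]] unfolding f_def[abs_def] .
  have cl: "closed_form_at ?m ?\<omega> (trunc ?m (\<lambda>a. f a (\<phi> p)))"
    unfolding fp using \<theta> d BA[OF pB] unfolding closed_two_form_on_def by blast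
  have anti: "?\<omega> j i (trunc ?m (\<lambda>a. f a (\<phi> p))) = - ?\<omega> i j (trunc ?m (\<lambda>a. f a (\<phi> p)))" for i j
    unfolding fp two_form_coeff_def split D(6)[OF d(2)]
    by (rule bilinear_atD(2)[OF bil[OF pB] coord_vector_in[OF d] coord_vector_in[OF d]])
  have "closed_form_at ?n (\<lambda>i j x. \<Sum>a<?m. \<Sum>b<?m. ?\<omega> a b (trunc ?m (\<lambda>a. f a x)) * (partial_deriv i (f a) x * partial_deriv j (f b) x)) (\<phi> p)"
    by (rule closed_form_at_pullback[OF C(5)[OF pU] cl fs anti])
  \<comment> \<open>The formula for the coefficients is needed only near \<open>\<phi> p\<close>,
    where the point stays in the chart and in \<open>B\<close> and its image stays in the single
    chart \<open>V\<close>.\<close>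
  moreover have "\<forall>\<^sub>F x in near_eucl ?n (\<phi> p). \<forall>i<?n. \<forall>j<?n.
     (\<Sum>a<?m. \<Sum>b<?m. ?\<omega> a b (trunc ?m (\<lambda>a. f a x)) * (partial_deriv i (f a) x * partial_deriv j (f b) x)) =
     two_form_coeff N (\<lambda>p u v. \<theta> (F p) (pushforward M F p u) (pushforward M F p v)) (U, \<phi>) i j x"
  proof -
    have "\<forall>\<^sub>F q in nhdsin (mtop N) p. F q \<in> V"
      by (rule eventually_continuous_map[OF smooth_map_continuous[OF F] pN eventually_in_open[OF D(1) d(2)]])
    moreover have "\<forall>\<^sub>F q in nhdsin (mtop N) p. q \<in> B" by (rule eventually_in_open[OF B pB])
    ultimately have "\<forall>\<^sub>F q in nhdsin (mtop N) p. F q \<in> V \<and> q \<in> B" by eventually_elim simp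
    then have "\<forall>\<^sub>F x in near_eucl ?n (\<phi> p). F (inv_into U \<phi> x) \<in> V \<and> inv_into U \<phi> x \<in> B"
      using eventually_chart[OF matlas_chart_on[OF N c] pU, of "\<lambda>q. F q \<in> V \<and> q \<in> B"] by blast
    moreover have "\<forall>\<^sub>F x in near_eucl ?n (\<phi> p). x \<in> \<phi> ` U"
      by (rule eventually_in_open[OF C(3)]) (use pU in blast)
    ultimately have "\<forall>\<^sub>F x in near_eucl ?n (\<phi> p). x \<in> \<phi> ` U \<and> F (inv_into U \<phi> x) \<in> V \<and> inv_into U \<phi> x \<in> B"
      by eventually_elim simp
    then show ?thesis
    proof (rule eventually_mono, intro allI impI)
      fix x i j assume x: "x \<in> \<phi> ` U \<and> F (inv_into U \<phi> x) \<in> V \<and> inv_into U \<phi> x \<in> B" and ij: "i < ?n" "j < ?n"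
      define q where "q = inv_into U \<phi> x"
      have q: "q \<in> U" "F q \<in> V" "q \<in> B" "\<phi> q = x" using x unfolding q_def by (auto simp: inv_into_into f_inv_into_f)
      have qN: "q \<in> points N" using C(2) q(1) by blast
      have e: "pushforward M F q (coord_vector N (U, \<phi>) q (unit_vec i)) = coord_vector M (V, \<psi>) (F q) (\<lambda>a. partial_deriv i (f a) x)"
        if i: "i < ?n" for i
      proof -
        have w: "pushforward M F q (coord_vector N (U, \<phi>) q (unit_vec i)) \<in> tangent_space M (F q)"
          by (rule pushforward_in[OF N M F coord_vector_in[OF c q(1)]])
        have ea: "pushforward M F q (coord_vector N (U, \<phi>) q (unit_vec i)) (\<lambda>y. \<psi> y a) = partial_deriv i (f a) x" if a: "a < ?m" for a
        proof -
          have s: "smooth_near N q (\<lambda>y. \<psi> (F y) a)" by (rule smooth_mapD[OF F qN d(1) q(2) a])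
          have "pushforward M F q (coord_vector N (U, \<phi>) q (unit_vec i)) (\<lambda>y. \<psi> y a) = coord_vector N (U, \<phi>) q (unit_vec i) (\<lambda>y. \<psi> (F y) a)"
            by (rule pushforward_apply[of M F q, OF smooth_near_coord[OF M d(1) q(2)]])
          also have "\<dots> = partial_deriv i (f a) x"
            unfolding coord_vector_apply[OF s] q(4) f_def[abs_def] using i by (simp add: if_distrib[of "\<lambda>x. x * _"] sum.delta cong: if_cong)
          finally show ?thesis .
        qed
        show ?thesis
          by (rule trans[OF tangent_eq_coord_vector[OF M w d(1) q(2)] coord_vector_cong[OF ea]])
      qed
      have tq: "trunc ?m (\<lambda>a. f a x) = \<psi> (F q)" unfolding f_def q_def[symmetric] by (rule t[OF q(2)])
      show "(\<Sum>a<?m. \<Sum>b<?m. ?\<omega> a b (trunc ?m (\<lambda>a. f a x)) * (partial_deriv i (f a) x * partial_deriv j (f b) x)) =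
         two_form_coeff N (\<lambda>p u v. \<theta> (F p) (pushforward M F p u) (pushforward M F p v)) (U, \<phi>) i j x"
        unfolding tq two_form_coeff_def split D(6)[OF q(2)] q_def[symmetric] e[OF ij(1)] e[OF ij(2)]
        by (rule bilinear_coord[OF M d(1) q(2) bil[OF q(3)], symmetric])
    qed
  qed
  ultimately show "closed_form_at ?n (two_form_coeff N (\<lambda>p u v. \<theta> (F p) (pushforward M F p u) (pushforward M F p v)) (U, \<phi>)) (\<phi> p)"
    by (rule closed_form_at_cong[rotated 1, OF _ C(5)[OF pU]])
qed

lemma closed_two_form_add:
  assumes "closed_two_form_on M A \<theta>" "closed_two_form_on M A \<eta>"
  shows "closed_two_form_on M A (\<lambda>p u v. \<theta> p u v + \<eta> p u v)"
proof -
  have "closed_form_at (mdim M) (two_form_coeff M (\<lambda>p u v. \<theta> p u v + \<eta> p u v) (U, \<phi>)) (\<phi> p)"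
    if "(U, \<phi>) \<in> matlas M" "p \<in> U \<inter> A" for U \<phi> p
  proof -
    have "closed_form_at (mdim M) (\<lambda>i j x. two_form_coeff M \<theta> (U, \<phi>) i j x + two_form_coeff M \<eta> (U, \<phi>) i j x) (\<phi> p)"
      by (rule closed_form_at_add) (use assms that in \<open>auto simp: closed_two_form_on_def\<close>)
    then show ?thesis by (simp add: two_form_coeff_def)
  qed
  moreover have "bilinear_at M (\<lambda>p u v. \<theta> p u v + \<eta> p u v) p" if "p \<in> A" for p
  proof -
    have b: "bilinear_at M \<theta> p" "bilinear_at M \<eta> p" using assms that unfolding closed_two_form_on_def by blast+
    show ?thesis unfolding bilinear_at_def
    proof (intro ballI conjI allI)
      fix u v assume uv: "u \<in> tangent_space M p" "v \<in> tangent_space M p"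
      note 1 = bilinear_atD[OF b(1) uv] and 2 = bilinear_atD[OF b(2) uv]
      show "\<theta> p u u + \<eta> p u u = 0" using 1(1) 2(1) by linarith
      show "\<theta> p v u + \<eta> p v u = - (\<theta> p u v + \<eta> p u v)" using 1(2) 2(2) by linarith
      show "\<theta> p (\<lambda>g. a * u g + b * v g) w + \<eta> p (\<lambda>g. a * u g + b * v g) w = a * (\<theta> p u w + \<eta> p u w) + b * (\<theta> p v w + \<eta> p v w)"
        if "w \<in> tangent_space M p" for w a b unfolding 1(3)[OF that] 2(3)[OF that] by (simp add: algebra_simps)
    qed
  qed
  ultimately show ?thesis using assms by (auto simp: closed_two_form_on_def)
qed

lemma closed_two_form_minus:
  assumes "closed_two_form_on M A \<theta>" shows "closed_two_form_on M A (\<lambda>p u v. - \<theta> p u v)"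
proof -
  have "closed_form_at (mdim M) (two_form_coeff M (\<lambda>p u v. - \<theta> p u v) (U, \<phi>)) (\<phi> p)"
    if "(U, \<phi>) \<in> matlas M" "p \<in> U \<inter> A" for U \<phi> p
  proof -
    have "closed_form_at (mdim M) (\<lambda>i j x. (-1) * two_form_coeff M \<theta> (U, \<phi>) i j x) (\<phi> p)"
      by (rule closed_form_at_cmult) (use assms that in \<open>auto simp: closed_two_form_on_def\<close>)
    then show ?thesis by (simp add: two_form_coeff_def)
  qed
  moreover have "bilinear_at M (\<lambda>p u v. - \<theta> p u v) p" if "p \<in> A" for p
  proof -
    have b: "bilinear_at M \<theta> p" using assms that unfolding closed_two_form_on_def by blast
    show ?thesis unfolding bilinear_at_def
    proof (intro ballI conjI allI)
      fix u v assume uv: "u \<in> tangent_space M p" "v \<in> tangent_space M p"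
      note 1 = bilinear_atD[OF b uv]
      show "- \<theta> p u u = 0" using 1(1) by linarith
      show "- \<theta> p v u = - (- \<theta> p u v)" using 1(2) by linarith
      show "- \<theta> p (\<lambda>g. a * u g + b * v g) w = a * (- \<theta> p u w) + b * (- \<theta> p v w)"
        if "w \<in> tangent_space M p" for w a b unfolding 1(3)[OF that] by (simp add: algebra_simps)
    qed
  qed
  ultimately show ?thesis using assms by (auto simp: closed_two_form_on_def)
qed

lemma closed_two_form_cong:
  assumes M: "smooth_manifold M" and \<theta>: "closed_two_form_on M A \<theta>"
    and eq: "\<And>p u v. p \<in> A \<Longrightarrow> u \<in> tangent_space M p \<Longrightarrow> v \<in> tangent_space M p \<Longrightarrow> \<theta> p u v = \<eta> p u v"
  shows "closed_two_form_on M A \<eta>"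
proof -
  have A: "openin (mtop M) A" using \<theta> by (simp add: closed_two_form_on_def)
  have "closed_form_at (mdim M) (two_form_coeff M \<eta> (U, \<phi>)) (\<phi> p)" if c: "(U, \<phi>) \<in> matlas M" "p \<in> U \<inter> A" for U \<phi> p
  proof (rule closed_form_at_cong)
    note C = matlas_chartD[OF M c(1)]
    show "closed_form_at (mdim M) (two_form_coeff M \<theta> (U, \<phi>)) (\<phi> p)" using \<theta> c by (auto simp: closed_two_form_on_def)
    show "\<phi> p \<in> eucl (mdim M)" using C(5) c(2) by blast
    have "p \<in> U" "p \<in> A" using c(2) by auto
    have "\<forall>\<^sub>F x in near_eucl (mdim M) (\<phi> p). inv_into U \<phi> x \<in> A"
      using eventually_chart[OF matlas_chart_on[OF M c(1)] \<open>p \<in> U\<close>, of "\<lambda>q. q \<in> A"] eventually_in_open[OF A \<open>p \<in> A\<close>] by blast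
    moreover have "\<forall>\<^sub>F x in near_eucl (mdim M) (\<phi> p). x \<in> \<phi> ` U"
      by (rule eventually_in_open[OF C(3)]) (use \<open>p \<in> U\<close> in blast)
    ultimately show "\<forall>\<^sub>F x in near_eucl (mdim M) (\<phi> p). \<forall>i<mdim M. \<forall>j<mdim M.
        two_form_coeff M \<theta> (U, \<phi>) i j x = two_form_coeff M \<eta> (U, \<phi>) i j x"
    proof eventually_elim
      case (elim x)
      then have "inv_into U \<phi> x \<in> U" by (simp add: inv_into_into)
      then show ?case unfolding two_form_coeff_def split using eq[OF elim(1) coord_vector_in[OF c(1)] coord_vector_in[OF c(1)]] by blast
    qed
  qed
  moreover have "bilinear_at M \<eta> p" if "p \<in> A" for p
  proof -
    have b: "bilinear_at M \<theta> p" using \<theta> that unfolding closed_two_form_on_def by blast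
    show ?thesis unfolding bilinear_at_def
    proof (intro ballI conjI allI)
      fix u v assume uv: "u \<in> tangent_space M p" "v \<in> tangent_space M p"
      note 1 = bilinear_atD[OF b uv]
      show "\<eta> p u u = 0" using 1(1) eq[OF that uv(1,1)] by linarith
      show "\<eta> p v u = - \<eta> p u v" using 1(2) eq[OF that uv] eq[OF that uv(2,1)] by linarith
      show "\<eta> p (\<lambda>g. a * u g + b * v g) w = a * \<eta> p u w + b * \<eta> p v w"
        if w: "w \<in> tangent_space M p" for w a b
        using 1(3)[OF w] eq[OF \<open>p \<in> A\<close> tangent_linear_comb[OF M uv] w] eq[OF \<open>p \<in> A\<close> uv(1) w] eq[OF \<open>p \<in> A\<close> uv(2) w] by simp
    qed
  qed
  ultimately show ?thesis using A by (auto simp: closed_two_form_on_def)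
qed

lemma symplectic_closed_two_form:
  assumes M: "symplectic_manifold M"
  shows "closed_two_form_on M (points M) (form M)" "p \<in> points M \<Longrightarrow> nondegenerate_at M (form M) p"
proof -
  note MS = symplectic_smooth[OF M]
  show "nondegenerate_at M (form M) p" if "p \<in> points M"
    using M that unfolding symplectic_manifold_def nondegenerate_at_def by blast
  have bil: "bilinear_at M (form M) p" if "p \<in> points M" for p
    using M that unfolding symplectic_manifold_def bilinear_at_def by blast
  have co: "two_form_coeff M (form M) (U, \<phi>) = form_coeff M (U, \<phi>)" for U \<phi>
    by (auto simp: two_form_coeff_def form_coeff_def Let_def fun_eq_iff)
  have "closed_form_at (mdim M) (form_coeff M (U, \<phi>)) (\<phi> p)" if c: "(U, \<phi>) \<in> matlas M" "p \<in> U" for U \<phi> p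
    unfolding closed_form_at_def
  proof (intro conjI allI impI)
    note C = matlas_chartD[OF MS c(1)]
    fix i j assume ij: "i < mdim M" "j < mdim M"
    have "smooth_on (mdim M) (\<phi> ` U) (form_coeff M (U, \<phi>) i j)" using M c(1) ij unfolding symplectic_manifold_def by blast
    then show "smooth_at (mdim M) (form_coeff M (U, \<phi>) i j) (\<phi> p)" unfolding smooth_on_iff_at[OF C(3)] using c(2) by blast
    fix k assume "k < mdim M"
    then show "partial_deriv i (form_coeff M (U, \<phi>) j k) (\<phi> p) + partial_deriv j (form_coeff M (U, \<phi>) k i) (\<phi> p) +
        partial_deriv k (form_coeff M (U, \<phi>) i j) (\<phi> p) = 0"
      using M c ij unfolding symplectic_manifold_def by blast
  qed
  then show "closed_two_form_on M (points M) (form M)" unfolding closed_two_form_on_def co using bil by auto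
qed

section \<open>Criteria for symplectic manifolds\<close>

text \<open>Smoothness and closedness of coefficients are conditions on germs, so a cover by open
  sets on which the form is closed suffices.\<close>

lemma symplectic_manifoldI:
  assumes M: "smooth_manifold M" and ev: "even (mdim M)"
    and guard: "\<And>p u v. \<not> (p \<in> points M \<and> u \<in> tangent_space M p \<and> v \<in> tangent_space M p) \<Longrightarrow> form M p u v = 0"
    and cov: "\<And>p. p \<in> points M \<Longrightarrow> \<exists>A. p \<in> A \<and> closed_two_form_on M A (form M)"
    and nd: "\<And>p. p \<in> points M \<Longrightarrow> nondegenerate_at M (form M) p"
  shows "symplectic_manifold M"
proof -
  have bil: "bilinear_at M (form M) p" if "p \<in> points M" for p
    using cov[OF that] unfolding closed_two_form_on_def by blast
  have co: "two_form_coeff M (form M) (U, \<phi>) = form_coeff M (U, \<phi>)" for U \<phi>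
    by (auto simp: two_form_coeff_def form_coeff_def Let_def fun_eq_iff)
  have cl: "closed_form_at (mdim M) (form_coeff M (U, \<phi>)) (\<phi> p)" if c: "(U, \<phi>) \<in> matlas M" "p \<in> U" for U \<phi> p
  proof -
    have "p \<in> points M" using matlas_chartD(2)[OF M c(1)] c(2) by blast
    then obtain A where "p \<in> A" "closed_two_form_on M A (form M)" using cov by blast
    then show ?thesis unfolding closed_two_form_on_def co using c by blast
  qed
  have sm: "smooth_on (mdim M) (\<phi> ` U) (form_coeff M (U, \<phi>) i j)" if "(U, \<phi>) \<in> matlas M" "i < mdim M" "j < mdim M" for U \<phi> i j
    unfolding smooth_on_iff_at[OF matlas_chartD(3)[OF M that(1)]] using cl[OF that(1)] that(2,3)
    unfolding closed_form_at_def by blast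
  show ?thesis
    unfolding symplectic_manifold_def
  proof (intro conjI M ev)
    show "\<forall>p u v. \<not> (p \<in> points M \<and> u \<in> tangent_space M p \<and> v \<in> tangent_space M p) \<longrightarrow> form M p u v = 0"
      using guard by blast
    show "\<forall>p\<in>points M. \<forall>u\<in>tangent_space M p. \<forall>v\<in>tangent_space M p.
        form M p u u = 0 \<and> form M p v u = - form M p u v \<and>
        (\<forall>w\<in>tangent_space M p. \<forall>a b.
           form M p (\<lambda>g. a * u g + b * v g) w = a * form M p u w + b * form M p v w)"
      using bil unfolding bilinear_at_def by blast
    show "\<forall>p\<in>points M. \<forall>u\<in>tangent_space M p. (\<forall>v\<in>tangent_space M p. form M p u v = 0) \<longrightarrow> u = (\<lambda>g. 0)"
      using nd unfolding nondegenerate_at_def by blast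
    show "\<forall>(U, \<phi>)\<in>matlas M. \<forall>i<mdim M. \<forall>j<mdim M. smooth_on (mdim M) (\<phi> ` U) (form_coeff M (U, \<phi>) i j)"
      using sm by blast
    show "\<forall>(U, \<phi>)\<in>matlas M. \<forall>x\<in>\<phi> ` U. \<forall>i<mdim M. \<forall>j<mdim M. \<forall>k<mdim M.
        partial_deriv i (form_coeff M (U, \<phi>) j k) x + partial_deriv j (form_coeff M (U, \<phi>) k i) x +
        partial_deriv k (form_coeff M (U, \<phi>) i j) x = 0"
      using cl unfolding closed_form_at_def by blast
  qed
qed

text \<open>Each component of \<open>u\<close> is tested against vectors whose other component is 0.
  \<open>F\<close> and \<open>G\<close> stand for the projections of a space that is a product only
  up to a copy.\<close>

lemma nondegenerate_sum:
  assumes Q: "smooth_manifold Q" and M: "smooth_manifold M" and N: "smooth_manifold N"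
    and F: "smooth_map Q M F" and G: "smooth_map Q N G" and p: "p \<in> points Q"
    and ex: "\<And>a b. a \<in> tangent_space M (F p) \<Longrightarrow> b \<in> tangent_space N (G p) \<Longrightarrow>
      \<exists>u\<in>tangent_space Q p. pushforward M F p u = a \<and> pushforward N G p u = b"
    and un: "\<And>u v. u \<in> tangent_space Q p \<Longrightarrow> v \<in> tangent_space Q p \<Longrightarrow> pushforward M F p u = pushforward M F p v \<Longrightarrow>
      pushforward N G p u = pushforward N G p v \<Longrightarrow> u = v"
    and b: "bilinear_at M \<theta> (F p)" "bilinear_at N \<eta> (G p)"
    and nd: "nondegenerate_at M \<theta> (F p)" "nondegenerate_at N \<eta> (G p)"
    and eq: "\<And>u v. u \<in> tangent_space Q p \<Longrightarrow> v \<in> tangent_space Q p \<Longrightarrow>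
      \<zeta> p u v = \<theta> (F p) (pushforward M F p u) (pushforward M F p v) + \<eta> (G p) (pushforward N G p u) (pushforward N G p v)"
  shows "nondegenerate_at Q \<zeta> p"
  unfolding nondegenerate_at_def
proof (intro ballI impI)
  fix u assume u: "u \<in> tangent_space Q p" and z: "\<forall>v\<in>tangent_space Q p. \<zeta> p u v = 0"
  have uF: "pushforward M F p u \<in> tangent_space M (F p)" and uG: "pushforward N G p u \<in> tangent_space N (G p)"
    using pushforward_in[OF Q M F u] pushforward_in[OF Q N G u] by auto
  note zM = tangent_zero[OF M smooth_map_points[OF F p]] and zN = tangent_zero[OF N smooth_map_points[OF G p]]
  have "\<theta> (F p) (pushforward M F p u) a = 0" if a: "a \<in> tangent_space M (F p)" for a
  proof -
    obtain v where v: "v \<in> tangent_space Q p" "pushforward M F p v = a" "pushforward N G p v = (\<lambda>g. 0)" using ex[OF a zN] by blast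
    have "\<zeta> p u v = \<theta> (F p) (pushforward M F p u) a + \<eta> (G p) (pushforward N G p u) (\<lambda>g. 0)" unfolding eq[OF u v(1)] v ..
    then show ?thesis using z v(1) bilinear_zero(2)[OF b(2) uG zN] by simp
  qed
  then have 1: "pushforward M F p u = (\<lambda>g. 0)" using nd(1) uF unfolding nondegenerate_at_def by blast
  have "\<eta> (G p) (pushforward N G p u) a = 0" if a: "a \<in> tangent_space N (G p)" for a
  proof -
    obtain v where v: "v \<in> tangent_space Q p" "pushforward M F p v = (\<lambda>g. 0)" "pushforward N G p v = a" using ex[OF zM a] by blast
    have "\<zeta> p u v = \<theta> (F p) (pushforward M F p u) (\<lambda>g. 0) + \<eta> (G p) (pushforward N G p u) a" unfolding eq[OF u v(1)] v ..
    then show ?thesis using z v(1) bilinear_zero(2)[OF b(1) uF zM] by simp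
  qed
  then have 2: "pushforward N G p u = (\<lambda>g. 0)" using nd(2) uG unfolding nondegenerate_at_def by blast
  show "u = (\<lambda>g. 0)"
    by (rule un[OF u tangent_zero[OF Q p]]) (simp_all only: 1 2 pushforward_zero)
qed

text \<open>The charts of a copy are charts of \<open>M\<close> read through \<open>inv t\<close>,
  so vectors on both sides have the same components.\<close>

lemma tangent_copy:
  assumes M: "smooth_manifold M" and t: "bij t" and W: "openin (mtop M) W" and p: "inv t p \<in> W"
  shows "\<And>a. a \<in> tangent_space M (inv t p) \<Longrightarrow> \<exists>u\<in>tangent_space (copy_manifold t W M) p. pushforward M (inv t) p u = a"
    and "inj_on (pushforward M (inv t) p) (tangent_space (copy_manifold t W M) p)"
proof -
  let ?C = "copy_manifold t W M"
  note CM = smooth_copy_manifold(1)[OF M t W]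
  have tp: "t (inv t p) = p" using t by (simp add: bij_is_surj surj_f_inv_f)
  obtain U0 \<phi> where c0: "(U0, \<phi>) \<in> matlas M" "inv t p \<in> U0" using chart_exists[OF M] p openin_subset[OF W] by blast
  define U where "U = U0 \<inter> W"
  have c: "(U, \<phi>) \<in> matlas M" "inv t p \<in> U" unfolding U_def
    using chart_restrict[OF M c0(1), of "U0 \<inter> W"] matlas_chartD(1)[OF M c0(1)] W c0(2) p by auto
  have d: "(t ` U, \<lambda>p. \<phi> (inv t p)) \<in> matlas ?C"
    by (rule smooth_copy_manifold(2)[OF M t W c(1)]) (simp add: U_def)
  have pU: "p \<in> t ` U" using c(2) tp by (metis imageI)
  have push: "pushforward M (inv t) p u (\<lambda>q. \<phi> q j) = u (\<lambda>q. \<phi> (inv t q) j)" for u j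
    by (rule pushforward_apply[of M "inv t" p, OF smooth_near_coord[OF M c]])
  note T = pushforward_in[OF CM M smooth_map_from_copy[OF M t W]]
  show "inj_on (pushforward M (inv t) p) (tangent_space ?C p)"
  proof (rule inj_onI)
    fix u v assume uv: "u \<in> tangent_space ?C p" "v \<in> tangent_space ?C p" "pushforward M (inv t) p u = pushforward M (inv t) p v"
    show "u = v" by (rule tangent_eqI[OF CM uv(1,2) d pU]) (simp only: push[symmetric] uv(3))
  qed
  fix a assume a: "a \<in> tangent_space M (inv t p)"
  define u where "u = coord_vector ?C (t ` U, \<lambda>p. \<phi> (inv t p)) p (\<lambda>j. a (\<lambda>q. \<phi> q j))"
  have u: "u \<in> tangent_space ?C p" unfolding u_def by (rule coord_vector_in[OF d pU])
  have "pushforward M (inv t) p u = a"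
  proof (rule tangent_eqI[OF M T[OF u] a c])
    fix j assume "j < mdim M"
    then show "pushforward M (inv t) p u (\<lambda>q. \<phi> q j) = a (\<lambda>q. \<phi> q j)"
      unfolding push u_def using coord_vector_coord[OF CM d pU, of j] by simp
  qed
  then show "\<exists>u\<in>tangent_space ?C p. pushforward M (inv t) p u = a" using u by blast
qed

section \<open>Composition with reductions and coreductions\<close>

lemma tangent_minus: "smooth_manifold M \<Longrightarrow> u \<in> tangent_space M p \<Longrightarrow> (\<lambda>g. - u g) \<in> tangent_space M p"
  using tangent_linear_comb[of M u p u "-1" 0] by simp

lemma reduction_data_smooth:
  assumes "reduction_data X Q K r"
  shows "smooth_manifold X" "smooth_manifold Q" "symplectic_manifold X" "symplectic_manifold Q" "smooth_map Q X r"
    "points X \<subseteq> r ` K" "\<And>q \<xi>. q \<in> K \<Longrightarrow> \<xi> \<in> tangent_space X (r q) \<Longrightarrow> \<exists>u\<in>tangent_subspace Q K q. pushforward X r q u = \<xi>"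
    "closedin (mtop Q) K" "K \<subseteq> points Q"
  using assms submanifold_subset(1) unfolding reduction_data_def by (auto intro: symplectic_smooth)

lemma reduction_data_lift:
  assumes R: "reduction_data X Q K r" and q: "q \<in> K" and u: "u \<in> tangent_subspace Q K q"
  shows "\<exists>w\<in>tangent_subspace (prod_manifold X Q) (reduction_rel K r) (r q, q).
      pushforward X fst (r q, q) w = pushforward X r q u \<and> pushforward Q snd (r q, q) w = u"
    and "\<exists>w\<in>tangent_subspace (prod_manifold Q X) ((reduction_rel K r)\<inverse>) (q, r q).
      pushforward Q fst (q, r q) w = u \<and> pushforward X snd (q, r q) w = pushforward X r q u"
proof -
  note S = reduction_data_smooth[OF R]
  obtain k where "submanifold k (prod_manifold Q X) ((reduction_rel K r)\<inverse>)" "submanifold k (prod_manifold X Q) (reduction_rel K r)"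
    and kK: "submanifold k Q K" and "2 * k = mdim X + mdim Q"
    "closedin (mtop (prod_manifold Q X)) ((reduction_rel K r)\<inverse>)" "closedin (mtop (prod_manifold X Q)) (reduction_rel K r)"
    and T1: "\<forall>q\<in>K. tangent_subspace (prod_manifold Q X) ((reduction_rel K r)\<inverse>) (q, r q) =
      {u \<in> tangent_space (prod_manifold Q X) (q, r q). pushforward Q fst (q, r q) u \<in> tangent_subspace Q K q \<and>
         pushforward X snd (q, r q) u = pushforward X r q (pushforward Q fst (q, r q) u)}"
    and T2: "\<forall>q\<in>K. tangent_subspace (prod_manifold X Q) (reduction_rel K r) (r q, q) =
      {u \<in> tangent_space (prod_manifold X Q) (r q, q). pushforward Q snd (r q, q) u \<in> tangent_subspace Q K q \<and>
         pushforward X fst (r q, q) u = pushforward X r q (pushforward Q snd (r q, q) u)}"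
    by (rule reduction_data_tangent[OF R]) (rule that)
  have uQ: "u \<in> tangent_space Q q" using tangent_subspace_subset[OF S(2) kK q] u by blast
  then have rX: "pushforward X r q u \<in> tangent_space X (r q)" by (rule pushforward_in[OF S(2,1,5)])
  obtain w where "w \<in> tangent_space (prod_manifold X Q) (r q, q)" "pushforward X fst (r q, q) w = pushforward X r q u" "pushforward Q snd (r q, q) w = u"
    using tangent_prod_ex[OF S(1,2), of "pushforward X r q u" "(r q, q)" u] rX uQ by auto
  then show "\<exists>w\<in>tangent_subspace (prod_manifold X Q) (reduction_rel K r) (r q, q).
      pushforward X fst (r q, q) w = pushforward X r q u \<and> pushforward Q snd (r q, q) w = u"
    unfolding bspec[OF T2 q] using u by auto
  obtain w where "w \<in> tangent_space (prod_manifold Q X) (q, r q)" "pushforward Q fst (q, r q) w = u" "pushforward X snd (q, r q) w = pushforward X r q u"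
    using tangent_prod_ex[OF S(2,1), of u "(q, r q)" "pushforward X r q u"] rX uQ by auto
  then show "\<exists>w\<in>tangent_subspace (prod_manifold Q X) ((reduction_rel K r)\<inverse>) (q, r q).
      pushforward Q fst (q, r q) w = u \<and> pushforward X snd (q, r q) w = pushforward X r q u"
    unfolding bspec[OF T1 q] using u by auto
qed

lemma canonical_relation_smooth:
  assumes "canonical_relation X Y f"
  shows "smooth_manifold X" "smooth_manifold Y" "symplectic_manifold X" "symplectic_manifold Y"
    "smooth_manifold (prod_manifold X Y)" "smooth_relation X Y f" "f \<subseteq> points X \<times> points Y"
proof -
  show s: "symplectic_manifold X" "symplectic_manifold Y" "smooth_relation X Y f" using assms by (auto simp: canonical_relation_def)
  show m: "smooth_manifold X" "smooth_manifold Y" by (rule symplectic_smooth[OF s(1)], rule symplectic_smooth[OF s(2)])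
  show "smooth_manifold (prod_manifold X Y)" by (rule smooth_prod_manifold(1)[OF m])
  obtain k where k: "submanifold k (prod_manifold X Y) f" by (rule canonical_relationD[OF assms])
  show "f \<subseteq> points X \<times> points Y" using submanifold_subset(1)[OF k] by simp
qed

text \<open>The intermediate point is \<open>r q\<close>, a smooth function of the outer point
  \<open>q\<close>. As \<open>r\<close> is a submersion on \<open>K\<close>, the coreduction alone
  supplies every tangent vector of \<open>X\<close>, and the side of \<open>f\<close> contributes
  the zero vector.\<close>

lemma strongly_transversal_coreduction:
  assumes R: "reduction_data X Q K r" and f: "canonical_relation X Z f"
    and h: "canonical_relation Q Z ((reduction_rel K r)\<inverse> O f)"
  shows "strongly_transversal Q X Z ((reduction_rel K r)\<inverse>) f"
proof -
  note S = reduction_data_smooth[OF R] and F = canonical_relation_smooth[OF f]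
  obtain k where B: "submanifold k (prod_manifold Q X) ((reduction_rel K r)\<inverse>)" "closedin (mtop (prod_manifold Q X)) ((reduction_rel K r)\<inverse>)"
    by (rule canonical_relationD[OF reduction_data_canonical(2)[OF R]])
  obtain l where C: "submanifold l (prod_manifold X Z) f" "closedin (mtop (prod_manifold X Z)) f" by (rule canonical_relationD[OF f])
  obtain m where D: "submanifold m (prod_manifold Q Z) ((reduction_rel K r)\<inverse> O f)" "closedin (mtop (prod_manifold Q Z)) ((reduction_rel K r)\<inverse> O f)"
    by (rule canonical_relationD[OF h])
  have s: "smooth_map (prod_manifold Q Z) X (\<lambda>p. r (fst p))"
    by (rule smooth_map_compose[OF smooth_prod_manifold(1)[OF S(2) F(2)] S(2,1) smooth_map_fst[OF S(2) F(2)] S(5)])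
  show ?thesis
  proof (rule strongly_transversalI[OF S(2,1) F(2) B C D s])
    show "x = r (fst (q, z))" if "(q, x) \<in> (reduction_rel K r)\<inverse>" for q x z using that by (auto simp: reduction_rel_def)
    fix q x z \<eta> assume qx: "(q, x) \<in> (reduction_rel K r)\<inverse>" and xz: "(x, z) \<in> f" and \<eta>: "\<eta> \<in> tangent_space X x"
    have q: "q \<in> K" "x = r q" using qx by (auto simp: reduction_rel_def)
    obtain u where u: "u \<in> tangent_subspace Q K q" "pushforward X r q u = \<eta>" using S(7)[OF q(1)] \<eta> q(2) by blast
    obtain w where w: "w \<in> tangent_subspace (prod_manifold Q X) ((reduction_rel K r)\<inverse>) (q, x)" "pushforward X snd (q, x) w = \<eta>"
      using reduction_data_lift(2)[OF R q(1) u(1)] u(2) unfolding q(2) by blast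
    have z: "(\<lambda>g. 0) \<in> tangent_subspace (prod_manifold X Z) f (x, z)" by (rule tangent_subspace_zero[OF F(5) C(1) xz])
    show "\<exists>a\<in>tangent_subspace (prod_manifold Q X) ((reduction_rel K r)\<inverse>) (q, x). \<exists>b\<in>tangent_subspace (prod_manifold X Z) f (x, z).
        \<eta> = (\<lambda>g. pushforward X snd (q, x) a g - pushforward X fst (x, z) b g)"
      by (rule bexI[OF bexI[OF _ z] w(1)]) (simp add: w(2) pushforward_zero)
  qed
qed

text \<open>Mirror image of \<open>strongly_transversal_coreduction\<close>: now the reduction on
  the right determines the intermediate point and supplies its tangent vectors.\<close>

lemma strongly_transversal_reduction:
  assumes R: "reduction_data X Q K r" and f: "canonical_relation Z X f"
    and h: "canonical_relation Z Q (f O reduction_rel K r)"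
  shows "strongly_transversal Z X Q f (reduction_rel K r)"
proof -
  note S = reduction_data_smooth[OF R] and F = canonical_relation_smooth[OF f]
  obtain k where B: "submanifold k (prod_manifold X Q) (reduction_rel K r)" "closedin (mtop (prod_manifold X Q)) (reduction_rel K r)"
    by (rule canonical_relationD[OF reduction_data_canonical(1)[OF R]])
  obtain l where C: "submanifold l (prod_manifold Z X) f" "closedin (mtop (prod_manifold Z X)) f" by (rule canonical_relationD[OF f])
  obtain m where D: "submanifold m (prod_manifold Z Q) (f O reduction_rel K r)" "closedin (mtop (prod_manifold Z Q)) (f O reduction_rel K r)"
    by (rule canonical_relationD[OF h])
  have s: "smooth_map (prod_manifold Z Q) X (\<lambda>p. r (snd p))"
    by (rule smooth_map_compose[OF smooth_prod_manifold(1)[OF F(1) S(2)] S(2,1) smooth_map_snd[OF F(1) S(2)] S(5)])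
  show ?thesis
  proof (rule strongly_transversalI[OF F(1) S(1,2) C B D s])
    show "x = r (snd (z, q))" if "(x, q) \<in> reduction_rel K r" for q x z using that by (auto simp: reduction_rel_def)
    fix z x q \<eta> assume zx: "(z, x) \<in> f" and xq: "(x, q) \<in> reduction_rel K r" and \<eta>: "\<eta> \<in> tangent_space X x"
    have q: "q \<in> K" "x = r q" using xq by (auto simp: reduction_rel_def)
    \<comment> \<open>The second relation enters the difference with a minus sign, hence the lift of
      \<open>- \<eta>\<close>.\<close>
    obtain u where u: "u \<in> tangent_subspace Q K q" "pushforward X r q u = (\<lambda>g. - \<eta> g)"
      using S(7)[OF q(1)] tangent_minus[OF S(1) \<eta>] q(2) by blast
    obtain w where w: "w \<in> tangent_subspace (prod_manifold X Q) (reduction_rel K r) (x, q)" "pushforward X fst (x, q) w = (\<lambda>g. - \<eta> g)"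
      using reduction_data_lift(1)[OF R q(1) u(1)] u(2) unfolding q(2) by metis
    have z: "(\<lambda>g. 0) \<in> tangent_subspace (prod_manifold Z X) f (z, x)" by (rule tangent_subspace_zero[OF F(5) C(1) zx])
    show "\<exists>a\<in>tangent_subspace (prod_manifold Z X) f (z, x). \<exists>b\<in>tangent_subspace (prod_manifold X Q) (reduction_rel K r) (x, q).
        \<eta> = (\<lambda>g. pushforward X snd (z, x) a g - pushforward X fst (x, q) b g)"
      by (rule bexI[OF bexI[OF _ w(1)] z]) (simp add: w(2) pushforward_zero)
  qed
qed

section \<open>Bending a canonical relation\<close>

text \<open>Cuts the form off outside the tangent spaces, which \<open>symplectic_manifold\<close>
  demands so that equal forms give equal records.\<close>

definition symplectic_extend :: "'a manifold \<Rightarrow> ('a \<Rightarrow> 'a tvec \<Rightarrow> 'a tvec \<Rightarrow> real) \<Rightarrow> 'a symplectic" where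
  "symplectic_extend M \<theta> = manifold.extend M \<lparr>form = \<lambda>p u v.
     if p \<in> points M \<and> u \<in> tangent_space M p \<and> v \<in> tangent_space M p then \<theta> p u v else 0\<rparr>"

lemma symplectic_extend_simps [simp]:
  "mtop (symplectic_extend M \<theta>) = mtop M" "mdim (symplectic_extend M \<theta>) = mdim M" "matlas (symplectic_extend M \<theta>) = matlas M"
  by (simp_all add: symplectic_extend_def manifold.extend_def)

lemmas symplectic_extend_cong = manifold_scheme_cong[OF symplectic_extend_simps]

lemma form_symplectic_extend:
  "form (symplectic_extend M \<theta>) p u v =
     (if p \<in> points M \<and> u \<in> tangent_space M p \<and> v \<in> tangent_space M p then \<theta> p u v else 0)"
  by (simp add: symplectic_extend_def manifold.extend_def)

lemma smooth_symplectic_extend: "smooth_manifold (symplectic_extend M \<theta>) = smooth_manifold M"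
  by (simp add: smooth_manifold_def)

lemma smooth_map_symplectic_extend:
  "smooth_map (symplectic_extend M \<theta>) N F = smooth_map M N F" "smooth_map N (symplectic_extend M \<theta>) G = smooth_map N M G"
  by (simp_all add: smooth_map_def symplectic_extend_cong)

lemma symplectic_manifold_extend:
  assumes M: "smooth_manifold M" and ev: "even (mdim M)"
    and cov: "\<And>p. p \<in> points M \<Longrightarrow> \<exists>A. p \<in> A \<and> closed_two_form_on M A \<theta>"
    and nd: "\<And>p. p \<in> points M \<Longrightarrow> nondegenerate_at M \<theta> p"
  shows "symplectic_manifold (symplectic_extend M \<theta>)"
proof (rule symplectic_manifoldI)
  let ?S = "symplectic_extend M \<theta>"
  have c: "closed_two_form_on ?S A \<eta> = closed_two_form_on M A \<eta>" for A \<eta>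
    by (simp add: closed_two_form_on_def bilinear_at_def two_form_coeff_def symplectic_extend_cong)
  show "smooth_manifold ?S" using M by (simp add: smooth_symplectic_extend)
  show "even (mdim ?S)" using ev by simp
  show "form ?S p u v = 0" if "\<not> (p \<in> points ?S \<and> u \<in> tangent_space ?S p \<and> v \<in> tangent_space ?S p)" for p u v
    using that by (auto simp: form_symplectic_extend symplectic_extend_cong)
  show "\<exists>A. p \<in> A \<and> closed_two_form_on ?S A (form ?S)" if p: "p \<in> points ?S" for p
  proof -
    obtain A where A: "p \<in> A" "closed_two_form_on M A \<theta>" using cov p by auto
    have "A \<subseteq> points M" using A(2) openin_subset by (auto simp: closed_two_form_on_def)
    then have "closed_two_form_on M A (form ?S)"
      by (intro closed_two_form_cong[OF M A(2)]) (auto simp: form_symplectic_extend)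
    then show ?thesis using A(1) c by blast
  qed
  show "nondegenerate_at ?S (form ?S) p" if p: "p \<in> points ?S" for p
  proof -
    have p': "p \<in> points M" using p by simp
    show ?thesis using nd[OF p'] p' unfolding nondegenerate_at_def symplectic_extend_cong form_symplectic_extend by simp
  qed
qed

text \<open>The points of \<open>Q \<times> Y\<^sup>- \<times> Y\<close>, moved into the universe by \<open>t\<close>, with the three projections.\<close>

definition bent1 :: "(('a \<times> 'a) \<times> 'a \<Rightarrow> 'a) \<Rightarrow> 'a \<Rightarrow> 'a" where "bent1 t p = fst (fst (inv t p))"
definition bent2 :: "(('a \<times> 'a) \<times> 'a \<Rightarrow> 'a) \<Rightarrow> 'a \<Rightarrow> 'a" where "bent2 t p = snd (fst (inv t p))"
definition bent3 :: "(('a \<times> 'a) \<times> 'a \<Rightarrow> 'a) \<Rightarrow> 'a \<Rightarrow> 'a" where "bent3 t p = snd (inv t p)"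

text \<open>Adding a negated term, rather than subtracting, matches
  \<open>closed_two_form_add\<close> and \<open>closed_two_form_minus\<close>.\<close>

definition bent :: "(('a \<times> 'a) \<times> 'a \<Rightarrow> 'a) \<Rightarrow> 'a symplectic \<Rightarrow> 'a symplectic \<Rightarrow> 'a symplectic" where
  "bent t Q Y = (let M = prod_manifold (prod_manifold Q Y) Y in
     symplectic_extend (copy_manifold t (points M) M) (\<lambda>p u v.
       form Q (bent1 t p) (pushforward Q (bent1 t) p u) (pushforward Q (bent1 t) p v)
       + - form Y (bent2 t p) (pushforward Y (bent2 t) p u) (pushforward Y (bent2 t) p v)
       + form Y (bent3 t p) (pushforward Y (bent3 t) p u) (pushforward Y (bent3 t) p v)))"

context
  fixes t :: "('a \<times> 'a) \<times> 'a \<Rightarrow> 'a" and Q Y :: "'a symplectic"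
  assumes t: "bij t" and SQ: "symplectic_manifold Q" and SY: "symplectic_manifold Y"
begin

private abbreviation "QY \<equiv> prod_manifold Q Y"
private abbreviation "QYY \<equiv> bent t Q Y"
private abbreviation "M \<equiv> prod_manifold (prod_manifold Q Y) Y"
private abbreviation "C \<equiv> copy_manifold t (points M) M"

private lemma it [simp]: "inv t (t x) = x" using bij_is_inj[OF t] by simp
private lemma ti [simp]: "t (inv t p) = p" using bij_is_surj[OF t] by (simp add: surj_f_inv_f)

text \<open>Numbered in this order: \<open>Q\<close>, \<open>Y\<close>, their product, the triple
  product.\<close>

private lemmas smooths = symplectic_smooth[OF SQ] symplectic_smooth[OF SY]
  smooth_prod_manifold(1)[OF symplectic_smooth[OF SQ] symplectic_smooth[OF SY]]
  smooth_prod_manifold(1)[OF smooth_prod_manifold(1)[OF symplectic_smooth[OF SQ] symplectic_smooth[OF SY]] symplectic_smooth[OF SY]]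

private lemma C: "smooth_manifold C" "points C = t ` points M"
  using smooth_copy_manifold[OF smooths(4) t openin_topspace] by auto

lemma mdim_bent: "mdim QYY = mdim Q + 2 * mdim Y"
  by (simp add: bent_def Let_def)

lemma points_bent: "p \<in> points QYY \<longleftrightarrow> bent1 t p \<in> points Q \<and> bent2 t p \<in> points Y \<and> bent3 t p \<in> points Y"
proof -
  have "points QYY = t ` points M" using C(2) by (simp add: bent_def Let_def)
  moreover have "p \<in> t ` points M \<longleftrightarrow> inv t p \<in> points M" by (metis (mono_tags) image_iff it ti)
  ultimately show ?thesis by (simp add: bent1_def bent2_def bent3_def mem_Times_iff)
qed

private lemma smooth_C:
  "smooth_map C M (inv t)" "smooth_map C QY (\<lambda>p. fst (inv t p))" "smooth_map C Q (bent1 t)" "smooth_map C Y (bent2 t)" "smooth_map C Y (bent3 t)"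
proof -
  show i: "smooth_map C M (inv t)" by (rule smooth_map_from_copy[OF smooths(4) t openin_topspace])
  show f: "smooth_map C QY (\<lambda>p. fst (inv t p))"
    by (rule smooth_map_compose[OF C(1) smooths(4,3) i smooth_map_fst[OF smooths(3,2)]])
  show "smooth_map C Q (bent1 t)" unfolding bent1_def[abs_def]
    by (rule smooth_map_compose[OF C(1) smooths(3,1) f smooth_map_fst[OF smooths(1,2)]])
  show "smooth_map C Y (bent2 t)" unfolding bent2_def[abs_def]
    by (rule smooth_map_compose[OF C(1) smooths(3,2) f smooth_map_snd[OF smooths(1,2)]])
  show "smooth_map C Y (bent3 t)" unfolding bent3_def[abs_def]
    by (rule smooth_map_compose[OF C(1) smooths(4,2) i smooth_map_snd[OF smooths(3,2)]])
qed

private lemma push_C: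
  assumes "p \<in> points C"
  shows "pushforward QY fst (inv t p) (pushforward M (inv t) p u) = pushforward QY (\<lambda>p. fst (inv t p)) p u"
    "pushforward Q fst (fst (inv t p)) (pushforward QY (\<lambda>p. fst (inv t p)) p u) = pushforward Q (bent1 t) p u"
    "pushforward Y snd (fst (inv t p)) (pushforward QY (\<lambda>p. fst (inv t p)) p u) = pushforward Y (bent2 t) p u"
    "pushforward Y snd (inv t p) (pushforward M (inv t) p u) = pushforward Y (bent3 t) p u"
  using pushforward_compose[OF C(1) smooths(4,3) smooth_C(1) smooth_map_fst[OF smooths(3,2)] assms, of u]
    pushforward_compose[OF C(1) smooths(3,1) smooth_C(2) smooth_map_fst[OF smooths(1,2)] assms, of u]
    pushforward_compose[OF C(1) smooths(3,2) smooth_C(2) smooth_map_snd[OF smooths(1,2)] assms, of u]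
    pushforward_compose[OF C(1) smooths(4,2) smooth_C(1) smooth_map_snd[OF smooths(3,2)] assms, of u]
  by (simp_all add: bent1_def[abs_def] bent2_def[abs_def] bent3_def[abs_def])

private lemma inv_in: "p \<in> points C \<Longrightarrow> inv t p \<in> points M" unfolding C(2) by auto

private lemma tangent_C_ex:
  assumes p: "p \<in> points C" and a: "a \<in> tangent_space QY (fst (inv t p))" and b: "b \<in> tangent_space Y (bent3 t p)"
  shows "\<exists>u\<in>tangent_space C p. pushforward QY (\<lambda>p. fst (inv t p)) p u = a \<and> pushforward Y (bent3 t) p u = b"
proof -
  obtain w where w: "w \<in> tangent_space M (inv t p)" "pushforward QY fst (inv t p) w = a" "pushforward Y snd (inv t p) w = b"
    by (rule tangent_prod_ex[OF smooths(3,2) a b[unfolded bent3_def]])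
  obtain u where u: "u \<in> tangent_space C p" "pushforward M (inv t) p u = w"
    using tangent_copy(1)[OF smooths(4) t openin_topspace inv_in[OF p] w(1)] by blast
  then show ?thesis using push_C[OF p, of u] w by auto
qed

private lemma tangent_C_eqI:
  assumes u: "u \<in> tangent_space C p" "v \<in> tangent_space C p"
    and "pushforward QY (\<lambda>p. fst (inv t p)) p u = pushforward QY (\<lambda>p. fst (inv t p)) p v"
    "pushforward Y (bent3 t) p u = pushforward Y (bent3 t) p v"
  shows "u = v"
proof -
  have p: "p \<in> points C" by (rule tangent_points[OF C(1) u(1)])
  have "pushforward M (inv t) p u = pushforward M (inv t) p v"
    by (rule tangent_prod_eqI[OF smooths(3,2) pushforward_in[OF C(1) smooths(4) smooth_C(1) u(1)] pushforward_in[OF C(1) smooths(4) smooth_C(1) u(2)]])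
      (simp_all only: push_C[OF p] assms)
  then show ?thesis using inj_onD[OF tangent_copy(2)[OF smooths(4) t openin_topspace inv_in[OF p]]] u by blast
qed

lemma tangent_bent_ex:
  assumes p: "p \<in> points QYY" and a: "a \<in> tangent_space Q (bent1 t p)" and b: "b \<in> tangent_space Y (bent2 t p)"
    and c: "c \<in> tangent_space Y (bent3 t p)"
  shows "\<exists>u\<in>tangent_space QYY p. pushforward Q (bent1 t) p u = a \<and> pushforward Y (bent2 t) p u = b \<and> pushforward Y (bent3 t) p u = c"
proof -
  have pC: "p \<in> points C" using p by (simp add: bent_def Let_def)
  obtain w where w: "w \<in> tangent_space QY (fst (inv t p))" "pushforward Q fst (fst (inv t p)) w = a" "pushforward Y snd (fst (inv t p)) w = b"
    by (rule tangent_prod_ex[OF smooths(1,2) a[unfolded bent1_def] b[unfolded bent2_def]])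
  obtain u where "u \<in> tangent_space C p" "pushforward QY (\<lambda>p. fst (inv t p)) p u = w" "pushforward Y (bent3 t) p u = c"
    using tangent_C_ex[OF pC w(1) c] by blast
  then show ?thesis using push_C[OF pC, of u] w unfolding bent_def Let_def symplectic_extend_cong by auto
qed

lemma smooth_bent:
  "smooth_map QYY M (inv t)" "smooth_map QYY Q (bent1 t)" "smooth_map QYY Y (bent2 t)" "smooth_map QYY Y (bent3 t)"
  "smooth_map QYY QY (\<lambda>p. fst (inv t p))" "smooth_map M QYY t" "smooth_manifold QYY"
  unfolding bent_def Let_def smooth_map_symplectic_extend smooth_symplectic_extend
  using smooth_C C(1) smooth_map_into_copy[OF smooths(4) t openin_topspace smooths(4) smooth_map_id[OF smooths(4)]] by auto

lemma push_bent:
  assumes "p \<in> points QYY"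
  shows "pushforward QY fst (inv t p) (pushforward M (inv t) p u) = pushforward QY (\<lambda>p. fst (inv t p)) p u"
    "pushforward Q fst (fst (inv t p)) (pushforward QY (\<lambda>p. fst (inv t p)) p u) = pushforward Q (bent1 t) p u"
    "pushforward Y snd (fst (inv t p)) (pushforward QY (\<lambda>p. fst (inv t p)) p u) = pushforward Y (bent2 t) p u"
    "pushforward Y snd (inv t p) (pushforward M (inv t) p u) = pushforward Y (bent3 t) p u"
  using push_C[of p u] assms by (simp_all add: bent_def Let_def)

lemma form_bent:
  assumes "u \<in> tangent_space QYY p" "v \<in> tangent_space QYY p"
  shows "form QYY p u v = form Q (bent1 t p) (pushforward Q (bent1 t) p u) (pushforward Q (bent1 t) p v)
       - form Y (bent2 t p) (pushforward Y (bent2 t) p u) (pushforward Y (bent2 t) p v)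
       + form Y (bent3 t p) (pushforward Y (bent3 t) p u) (pushforward Y (bent3 t) p v)"
  using assms tangent_points[OF smooth_bent(7) assms(1)]
  unfolding bent_def Let_def symplectic_extend_cong symplectic_extend_simps form_symplectic_extend by simp

text \<open>The form is built from pullbacks along the three projections by sums and a sign, so it
  is closed. For nondegeneracy \<open>nondegenerate_sum\<close> is applied twice: inside
  \<open>QY\<close> for the form \<open>?\<zeta>\<close>, and then to \<open>QY\<close> and the last
  factor.\<close>

lemma symplectic_bent: "symplectic_manifold QYY"
  unfolding bent_def Let_def
proof (rule symplectic_manifold_extend[OF C(1)])
  have "even (mdim Q)" using SQ by (simp add: symplectic_manifold_def)
  then show "even (mdim C)" by simp
  note cQ = symplectic_closed_two_form[OF SQ] and cY = symplectic_closed_two_form[OF SY]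
  note cmY = closed_two_form_minus[OF cY(1)]
  note pts = smooth_map_points[OF smooth_C(3)] smooth_map_points[OF smooth_C(4)] smooth_map_points[OF smooth_C(5)]
  let ?\<theta> = "\<lambda>p u v. form Q (bent1 t p) (pushforward Q (bent1 t) p u) (pushforward Q (bent1 t) p v)
       + - form Y (bent2 t p) (pushforward Y (bent2 t) p u) (pushforward Y (bent2 t) p v)
       + form Y (bent3 t p) (pushforward Y (bent3 t) p u) (pushforward Y (bent3 t) p v)"
  have "closed_two_form_on C (points C) ?\<theta>"
    by (intro closed_two_form_add closed_two_form_minus
        closed_two_form_pullback[OF C(1) smooths(1) smooth_C(3) cQ(1) openin_topspace pts(1)]
        closed_two_form_pullback[OF C(1) smooths(2) smooth_C(4) cY(1) openin_topspace pts(2)]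
        closed_two_form_pullback[OF C(1) smooths(2) smooth_C(5) cY(1) openin_topspace pts(3)])
  then show "\<exists>A. p \<in> A \<and> closed_two_form_on C A ?\<theta>" if "p \<in> points C" for p using that by blast
  let ?\<zeta> = "\<lambda>p u v. form Q (fst p) (pushforward Q fst p u) (pushforward Q fst p v) + - form Y (snd p) (pushforward Y snd p u) (pushforward Y snd p v)"
  have pts': "fst p \<in> points Q" "snd p \<in> points Y" if "p \<in> points QY" for p using that by auto
  have cz: "closed_two_form_on QY (points QY) ?\<zeta>"
    by (intro closed_two_form_add closed_two_form_minus
        closed_two_form_pullback[OF smooths(3,1) smooth_map_fst[OF smooths(1,2)] cQ(1) openin_topspace pts'(1)]
        closed_two_form_pullback[OF smooths(3,2) smooth_map_snd[OF smooths(1,2)] cY(1) openin_topspace pts'(2)])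
  have bil: "bilinear_at Q (form Q) p" if "p \<in> points Q" for p using cQ(1) that unfolding closed_two_form_on_def by blast
  have bilY: "bilinear_at Y (form Y) p" "bilinear_at Y (\<lambda>p u v. - form Y p u v) p" if "p \<in> points Y" for p
    using cY(1) cmY that unfolding closed_two_form_on_def by blast+
  have ndm: "nondegenerate_at Y (\<lambda>p u v. - form Y p u v) p" if "p \<in> points Y" for p
    using cY(2)[OF that] unfolding nondegenerate_at_def by simp
  have nz: "nondegenerate_at QY ?\<zeta> p" if p: "p \<in> points QY" for p
  proof (rule nondegenerate_sum[OF smooths(3,1,2) smooth_map_fst[OF smooths(1,2)] smooth_map_snd[OF smooths(1,2)] p])
    show "\<exists>u\<in>tangent_space QY p. pushforward Q fst p u = a \<and> pushforward Y snd p u = b"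
      if ab: "a \<in> tangent_space Q (fst p)" "b \<in> tangent_space Y (snd p)" for a b
      by (rule tangent_prod_ex[OF smooths(1,2) ab]) blast
    show "u = v" if "u \<in> tangent_space QY p" "v \<in> tangent_space QY p" "pushforward Q fst p u = pushforward Q fst p v"
      "pushforward Y snd p u = pushforward Y snd p v" for u v
      by (rule tangent_prod_eqI[OF smooths(1,2) that])
    show "bilinear_at Q (form Q) (fst p)" "bilinear_at Y (\<lambda>p u v. - form Y p u v) (snd p)"
      using bil bilY(2) pts'[OF p] by auto
    show "nondegenerate_at Q (form Q) (fst p)" "nondegenerate_at Y (\<lambda>p u v. - form Y p u v) (snd p)"
      using cQ(2) ndm pts'[OF p] by auto
  qed simp
  show "nondegenerate_at C ?\<theta> p" if p: "p \<in> points C" for p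
  proof (rule nondegenerate_sum[OF C(1) smooths(3,2) smooth_C(2,5) p])
    show "\<exists>u\<in>tangent_space C p. pushforward QY (\<lambda>p. fst (inv t p)) p u = a \<and> pushforward Y (bent3 t) p u = b"
      if "a \<in> tangent_space QY (fst (inv t p))" "b \<in> tangent_space Y (bent3 t p)" for a b
      by (rule tangent_C_ex[OF p that])
    show "u = v" if "u \<in> tangent_space C p" "v \<in> tangent_space C p"
      "pushforward QY (\<lambda>p. fst (inv t p)) p u = pushforward QY (\<lambda>p. fst (inv t p)) p v"
      "pushforward Y (bent3 t) p u = pushforward Y (bent3 t) p v" for u v
      by (rule tangent_C_eqI[OF that])
    have pq: "fst (inv t p) \<in> points QY" "bent3 t p \<in> points Y" using smooth_map_points[OF smooth_C(2) p] pts(3)[OF p] by auto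
    show "bilinear_at QY ?\<zeta> (fst (inv t p))" using cz pq(1) unfolding closed_two_form_on_def by blast
    show "bilinear_at Y (form Y) (bent3 t p)" by (rule bilY(1)[OF pq(2)])
    show "nondegenerate_at QY ?\<zeta> (fst (inv t p))" by (rule nz[OF pq(1)])
    show "nondegenerate_at Y (form Y) (bent3 t p)" by (rule cY(2)[OF pq(2)])
    show "?\<theta> p u v = ?\<zeta> (fst (inv t p)) (pushforward QY (\<lambda>p. fst (inv t p)) p u) (pushforward QY (\<lambda>p. fst (inv t p)) p v) +
       form Y (bent3 t p) (pushforward Y (bent3 t) p u) (pushforward Y (bent3 t) p v)" for u v
      unfolding push_C[OF p] by (simp add: bent1_def bent2_def)
  qed
qed

section \<open>The two reductions of a bent space\<close>

lemma bent_preimage: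
  assumes S: "submanifold k M S" and cl: "closedin (mtop M) S"
  shows "submanifold k QYY {p \<in> points QYY. inv t p \<in> S}"
    "closedin (mtop QYY) {p \<in> points QYY. inv t p \<in> S}"
    "p \<in> points QYY \<Longrightarrow> inv t p \<in> S \<Longrightarrow> tangent_subspace QYY {p \<in> points QYY. inv t p \<in> S} p =
      {u \<in> tangent_space QYY p. pushforward M (inv t) p u \<in> tangent_subspace M S (inv t p)}"
proof -
  have dim: "mdim QYY = mdim M" by (simp add: mdim_bent)
  note d = submanifold_diffeo[OF smooth_bent(7) smooths(4) smooth_bent(1,6) _ _ dim S]
  show "submanifold k QYY {p \<in> points QYY. inv t p \<in> S}" by (rule d(1)) auto
  show "closedin (mtop QYY) {p \<in> points QYY. inv t p \<in> S}"
    by (rule closedin_continuous_map_preimage[OF smooth_map_continuous[OF smooth_bent(1)] cl])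
  show "p \<in> points QYY \<Longrightarrow> inv t p \<in> S \<Longrightarrow> tangent_subspace QYY {p \<in> points QYY. inv t p \<in> S} p =
      {u \<in> tangent_space QYY p. pushforward M (inv t) p u \<in> tangent_subspace M S (inv t p)}" by (rule d(2)) auto
qed

lemma bent_inv_push: "p \<in> points QYY \<Longrightarrow> u \<in> tangent_space QYY p \<Longrightarrow> pushforward M (inv t) p u \<in> tangent_space M (inv t p)"
  by (rule pushforward_in[OF smooth_bent(7) smooths(4) smooth_bent(1)])

text \<open>Read through \<open>inv t\<close>, the set is the graph of the second projection over
  \<open>K \<times> points Y\<close>.\<close>

lemma bent_diagonal:
  assumes K: "submanifold k Q K" "closedin (mtop Q) K"
  defines "K' \<equiv> {p \<in> points QYY. bent1 t p \<in> K \<and> bent2 t p = bent3 t p}"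
  shows "submanifold (k + mdim Y) QYY K'" "closedin (mtop QYY) K'"
    "p \<in> K' \<Longrightarrow> tangent_subspace QYY K' p = {u \<in> tangent_space QYY p.
      pushforward Q (bent1 t) p u \<in> tangent_subspace Q K (bent1 t p) \<and> pushforward Y (bent2 t) p u = pushforward Y (bent3 t) p u}"
proof -
  have KQ: "K \<subseteq> points Q" by (rule submanifold_subset(1)[OF K(1)])
  note W = submanifold_whole[OF smooths(2)]
  note P = submanifold_prod[OF smooths(1,2) K(1) W]
  let ?G = "{(a, snd a) | a. a \<in> K \<times> points Y}"
  note G = submanifold_graph[OF smooths(3,2) smooth_map_snd[OF smooths(1,2)] P(1)]
  have iG: "inv t p \<in> ?G \<longleftrightarrow> bent1 t p \<in> K \<and> bent2 t p \<in> points Y \<and> bent2 t p = bent3 t p" for p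
    by (cases "inv t p") (auto simp: bent1_def bent2_def bent3_def)
  have eq: "K' = {p \<in> points QYY. inv t p \<in> ?G}" unfolding K'_def iG by (auto simp: points_bent)
  have cl: "closedin (mtop M) ?G"
  proof -
    have "?G = {q \<in> points M. fst (fst q) \<in> K} \<inter> {q \<in> points M. snd (fst q) = snd q}" using KQ by auto
    moreover have "closedin (mtop M) {q \<in> points M. fst (fst q) \<in> K}"
      by (rule closedin_continuous_map_preimage[OF smooth_map_continuous[OF smooth_map_compose[OF smooths(4,3,1)
              smooth_map_fst[OF smooths(3,2)] smooth_map_fst[OF smooths(1,2)]]] K(2)])
    moreover have "closedin (mtop M) {q \<in> points M. snd (fst q) = snd q}"
      by (rule closedin_continuous_maps_eq[OF _ smooth_map_continuous[OF smooth_map_compose[OF smooths(4,3,2)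
              smooth_map_fst[OF smooths(3,2)] smooth_map_snd[OF smooths(1,2)]]] smooth_map_continuous[OF smooth_map_snd[OF smooths(3,2)]]])
        (use smooths(2) in \<open>simp add: smooth_manifold_def\<close>)
    ultimately show ?thesis by (simp only: closedin_Int)
  qed
  note B = bent_preimage[OF G(1) cl, folded eq]
  show "submanifold (k + mdim Y) QYY K'" "closedin (mtop QYY) K'" by (rule B(1), rule B(2))
  assume p: "p \<in> K'"
  then have pB: "p \<in> points QYY" and pG: "inv t p \<in> ?G" unfolding eq by auto
  then have fa: "fst (inv t p) \<in> K \<times> points Y" and e: "(fst (inv t p), snd (fst (inv t p))) = inv t p" by auto
  have K1: "fst (fst (inv t p)) = bent1 t p" by (simp add: bent1_def)
  have "pushforward M (inv t) p u \<in> tangent_subspace M ?G (inv t p) \<longleftrightarrow>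
      pushforward Q (bent1 t) p u \<in> tangent_subspace Q K (bent1 t p) \<and> pushforward Y (bent2 t) p u = pushforward Y (bent3 t) p u"
    if u: "u \<in> tangent_space QYY p" for u
  proof -
    have y: "snd (fst (inv t p)) \<in> points Y" using fa by auto
    have 1: "pushforward M (inv t) p u \<in> tangent_space M (inv t p)" by (rule bent_inv_push[OF pB u])
    have 2: "pushforward QY (\<lambda>p. fst (inv t p)) p u \<in> tangent_space QY (fst (inv t p))"
      by (rule pushforward_in[OF smooth_bent(7) smooths(3) smooth_bent(5) u])
    have 3: "pushforward Y (bent2 t) p u \<in> tangent_space Y (snd (fst (inv t p)))"
      using pushforward_in[OF smooth_bent(7) smooths(2) smooth_bent(3) u] by (simp add: bent2_def)
    show ?thesis
      unfolding G(2)[OF fa, unfolded e] P(2)[OF fa] tangent_subspace_whole[OF smooths(2) y] mem_Collect_eq push_bent[OF pB] K1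
      using 1 2 3 by auto
  qed
  then show "tangent_subspace QYY K' p = {u \<in> tangent_space QYY p.
      pushforward Q (bent1 t) p u \<in> tangent_subspace Q K (bent1 t p) \<and> pushforward Y (bent2 t) p u = pushforward Y (bent3 t) p u}"
    unfolding B(3)[OF pB pG] by blast
qed

text \<open>On the diagonal the two \<open>Y\<close>-terms of the form cancel, which leaves the form
  of \<open>Q\<close> along \<open>K\<close>, and that is pulled back from \<open>X\<close>. With
  \<open>K = points Q\<close> and the identity as \<open>r\<close> this is the plain bent diagonal;
  for general \<open>K\<close> it is the diagonal composed with a reduction already at hand.\<close>

lemma reduction_data_bent:
  assumes R: "reduction_data X Q K r" and ne: "points Y \<noteq> {}"
  shows "reduction_data X QYY {p \<in> points QYY. bent1 t p \<in> K \<and> bent2 t p = bent3 t p} (\<lambda>p. r (bent1 t p))"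
proof -
  let ?K = "{p \<in> points QYY. bent1 t p \<in> K \<and> bent2 t p = bent3 t p}"
  note S = reduction_data_smooth[OF R]
  obtain k where k: "submanifold k Q K" "2 * k = mdim X + mdim Q" using R unfolding reduction_data_def by blast
  have iso: "form Q q u v = form X (r q) (pushforward X r q u) (pushforward X r q v)"
    if "q \<in> K" "u \<in> tangent_subspace Q K q" "v \<in> tangent_subspace Q K q" for q u v
    using R that unfolding reduction_data_def by blast
  note D = bent_diagonal[OF k(1) S(8)]
  have push: "pushforward X (\<lambda>p. r (bent1 t p)) p u = pushforward X r (bent1 t p) (pushforward Q (bent1 t) p u)" if "p \<in> points QYY" for p u
    by (rule pushforward_compose[OF smooth_bent(7) smooths(1) S(1) smooth_bent(2) S(5) that, symmetric])
  show ?thesis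
    unfolding reduction_data_def
  proof (intro conjI ballI S(3) symplectic_bent D(2) exI[of _ "k + mdim Y"] D(1))
    show "smooth_map QYY X (\<lambda>p. r (bent1 t p))" by (rule smooth_map_compose[OF smooth_bent(7) smooths(1) S(1) smooth_bent(2) S(5)])
    show "2 * (k + mdim Y) = mdim X + mdim QYY" using k(2) by (simp add: mdim_bent)
    fix p assume p: "p \<in> ?K"
    then have pB: "p \<in> points QYY" "bent1 t p \<in> K" "bent2 t p = bent3 t p" by auto
    show "form QYY p u v = form X (r (bent1 t p)) (pushforward X (\<lambda>p. r (bent1 t p)) p u) (pushforward X (\<lambda>p. r (bent1 t p)) p v)"
      if "u \<in> tangent_subspace QYY ?K p" "v \<in> tangent_subspace QYY ?K p" for u v
      using that iso[OF pB(2)] unfolding D(3)[OF p] push[OF pB(1)] by (simp add: form_bent pB(3))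
    fix \<xi> assume "\<xi> \<in> tangent_space X (r (bent1 t p))"
    then obtain a where a: "a \<in> tangent_subspace Q K (bent1 t p)" "pushforward X r (bent1 t p) a = \<xi>" using S(7)[OF pB(2)] by blast
    have aT: "a \<in> tangent_space Q (bent1 t p)" using a(1) tangent_subspace_subset[OF smooths(1) k(1) pB(2)] by blast
    have "bent2 t p \<in> points Y" "bent3 t p \<in> points Y" using pB(1) by (simp_all add: points_bent)
    \<comment> \<open>Zero components in both copies of \<open>Y\<close> keep the lift tangent to
      the diagonal.\<close>
    then obtain u where u: "u \<in> tangent_space QYY p" "pushforward Q (bent1 t) p u = a" "pushforward Y (bent2 t) p u = (\<lambda>g. 0)"
      "pushforward Y (bent3 t) p u = (\<lambda>g. 0)"
      using tangent_bent_ex[OF pB(1) aT tangent_zero[OF smooths(2)] tangent_zero[OF smooths(2)]] by blast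
    then show "\<exists>u\<in>tangent_subspace QYY ?K p. pushforward X (\<lambda>p. r (bent1 t p)) p u = \<xi>"
      unfolding D(3)[OF p] push[OF pB(1)] using a by auto
  next
    show "points X \<subseteq> (\<lambda>p. r (bent1 t p)) ` ?K"
    proof
      fix x assume "x \<in> points X"
      then obtain q where q: "q \<in> K" "x = r q" using S(6) by blast
      \<comment> \<open>Any point of \<open>Y\<close> may serve as the common value of the two last
        components.\<close>
      obtain y where y: "y \<in> points Y" using ne by blast
      have "t ((q, y), y) \<in> ?K" using q y S(9) by (auto simp: points_bent bent1_def bent2_def bent3_def)
      moreover have "x = r (bent1 t (t ((q, y), y)))" by (simp add: bent1_def q)
      ultimately show "x \<in> (\<lambda>p. r (bent1 t p)) ` ?K" by (rule rev_image_eqI)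
    qed
  qed
qed

text \<open>Read through \<open>inv t\<close>, the set is \<open>c \<times> points Y\<close>, so its
  tangent vectors are unrestricted in the last factor.\<close>

lemma bent_cylinder:
  assumes c: "submanifold k QY c" "closedin (mtop QY) c"
  defines "K' \<equiv> {p \<in> points QYY. (bent1 t p, bent2 t p) \<in> c}"
  shows "submanifold (k + mdim Y) QYY K'" "closedin (mtop QYY) K'"
    "p \<in> K' \<Longrightarrow> tangent_subspace QYY K' p = {u \<in> tangent_space QYY p.
      pushforward QY (\<lambda>p. fst (inv t p)) p u \<in> tangent_subspace QY c (fst (inv t p))}"
proof -
  note W = submanifold_whole[OF smooths(2)]
  note P = submanifold_prod[OF smooths(3,2) c(1) W]
  have f: "(bent1 t p, bent2 t p) = fst (inv t p)" for p by (simp add: bent1_def bent2_def)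
  have eq: "K' = {p \<in> points QYY. inv t p \<in> c \<times> points Y}"
    unfolding K'_def f by (auto simp: points_bent bent3_def mem_Times_iff)
  have "closedin (mtop M) (c \<times> points Y)" using c(2) by (simp add: closedin_prod_Times_iff)
  note B = bent_preimage[OF P(1) this, folded eq]
  show "submanifold (k + mdim Y) QYY K'" "closedin (mtop QYY) K'" by (rule B(1), rule B(2))
  assume p: "p \<in> K'"
  then have pB: "p \<in> points QYY" and pG: "inv t p \<in> c \<times> points Y" unfolding eq by auto
  have "pushforward M (inv t) p u \<in> tangent_subspace M (c \<times> points Y) (inv t p) \<longleftrightarrow>
      pushforward QY (\<lambda>p. fst (inv t p)) p u \<in> tangent_subspace QY c (fst (inv t p))"
    if u: "u \<in> tangent_space QYY p" for u
  proof -
    have y: "snd (inv t p) \<in> points Y" using pG by auto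
    have 1: "pushforward M (inv t) p u \<in> tangent_space M (inv t p)" by (rule bent_inv_push[OF pB u])
    have 3: "pushforward Y (bent3 t) p u \<in> tangent_space Y (snd (inv t p))"
      using pushforward_in[OF smooth_bent(7) smooths(2) smooth_bent(4) u] by (simp add: bent3_def)
    show ?thesis
      unfolding P(2)[OF pG] tangent_subspace_whole[OF smooths(2) y] mem_Collect_eq push_bent[OF pB] using 1 3 by auto
  qed
  then show "tangent_subspace QYY K' p = {u \<in> tangent_space QYY p.
      pushforward QY (\<lambda>p. fst (inv t p)) p u \<in> tangent_subspace QY c (fst (inv t p))}"
    unfolding B(3)[OF pB pG] by blast
qed

lemma bent_isotropic:
  assumes c: "canonical_relation Q Y c" and p: "p \<in> points QYY" "(bent1 t p, bent2 t p) \<in> c"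
    and "pushforward QY (\<lambda>p. fst (inv t p)) p u \<in> tangent_subspace QY c (fst (inv t p))"
    "pushforward QY (\<lambda>p. fst (inv t p)) p v \<in> tangent_subspace QY c (fst (inv t p))"
  shows "form Q (bent1 t p) (pushforward Q (bent1 t) p u) (pushforward Q (bent1 t) p v) =
    form Y (bent2 t p) (pushforward Y (bent2 t) p u) (pushforward Y (bent2 t) p v)"
proof -
  have f: "(bent1 t p, bent2 t p) = fst (inv t p)" by (simp add: bent1_def bent2_def)
  from canonical_relation_isotropic[OF c p(2)[unfolded f] assms(4,5)] show ?thesis
    unfolding push_bent[OF p(1)] by (simp add: bent1_def bent2_def)
qed

text \<open>On the cylinder the terms of \<open>Q\<close> and of the first \<open>Y\<close> cancel
  because \<open>c\<close> is lagrangian, and the form of the last factor remains. A point of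
  \<open>c\<close>, completed by an arbitrary third component, reaches every point of
  \<open>Y\<close>.\<close>

lemma reduction_data_bent_cylinder:
  assumes c: "canonical_relation Q Y c" and ne: "c \<noteq> {}"
  shows "reduction_data Y QYY {p \<in> points QYY. (bent1 t p, bent2 t p) \<in> c} (bent3 t)"
proof -
  let ?K = "{p \<in> points QYY. (bent1 t p, bent2 t p) \<in> c}"
  obtain k where k: "submanifold k QY c" "closedin (mtop QY) c" "2 * k = mdim Q + mdim Y" by (rule canonical_relationD[OF c])
  note D = bent_cylinder[OF k(1,2)]
  show ?thesis
    unfolding reduction_data_def
  proof (intro conjI ballI SY symplectic_bent D(2) exI[of _ "k + mdim Y"] D(1) smooth_bent(4))
    show "2 * (k + mdim Y) = mdim Y + mdim QYY" using k(3) by (simp add: mdim_bent)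
    fix p assume p: "p \<in> ?K"
    then have pB: "p \<in> points QYY" "(bent1 t p, bent2 t p) \<in> c" by auto
    show "form QYY p u v = form Y (bent3 t p) (pushforward Y (bent3 t) p u) (pushforward Y (bent3 t) p v)"
      if "u \<in> tangent_subspace QYY ?K p" "v \<in> tangent_subspace QYY ?K p" for u v
      using that bent_isotropic[OF c pB] unfolding D(3)[OF p] by (simp add: form_bent)
    fix \<xi> assume \<xi>: "\<xi> \<in> tangent_space Y (bent3 t p)"
    have "bent1 t p \<in> points Q" "bent2 t p \<in> points Y" using pB(1) by (simp_all add: points_bent)
    \<comment> \<open>A vector moving only the last factor projects to the zero vector of
      \<open>QY\<close>, hence it is tangent to the cylinder.\<close>
    then obtain u where u: "u \<in> tangent_space QYY p" "pushforward Q (bent1 t) p u = (\<lambda>g. 0)" "pushforward Y (bent2 t) p u = (\<lambda>g. 0)"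
      "pushforward Y (bent3 t) p u = \<xi>"
      using tangent_bent_ex[OF pB(1) tangent_zero[OF smooths(1)] tangent_zero[OF smooths(2)] \<xi>] by blast
    have z: "pushforward QY (\<lambda>p. fst (inv t p)) p u = (\<lambda>g. 0)"
    proof (rule tangent_prod_eqI[OF smooths(1,2) pushforward_in[OF smooth_bent(7) smooths(3) smooth_bent(5) u(1)]])
      show "(\<lambda>g. 0) \<in> tangent_space QY (fst (inv t p))"
        by (rule tangent_zero[OF smooths(3) smooth_map_points[OF smooth_bent(5) pB(1)]])
    qed (simp_all only: push_bent[OF pB(1)] u pushforward_zero)
    have "fst (inv t p) \<in> c" using pB(2) by (simp add: bent1_def bent2_def)
    from tangent_subspace_zero[OF smooths(3) k(1) this]
    show "\<exists>u\<in>tangent_subspace QYY ?K p. pushforward Y (bent3 t) p u = \<xi>"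
      unfolding D(3)[OF p] using u z by auto
  next
    show "points Y \<subseteq> bent3 t ` ?K"
    proof
      fix y assume y: "y \<in> points Y"
      obtain q y' where q: "(q, y') \<in> c" using ne by fast
      then have "q \<in> points Q" "y' \<in> points Y" using canonical_relation_smooth(7)[OF c] by auto
      then have "t ((q, y'), y) \<in> ?K" using q y by (auto simp: points_bent bent1_def bent2_def bent3_def)
      moreover have "y = bent3 t (t ((q, y'), y))" by (simp add: bent3_def)
      ultimately show "y \<in> bent3 t ` ?K" by (rule rev_image_eqI)
    qed
  qed
qed

text \<open>Regrouping the factors turns the set into \<open>c \<times> f\<close>. As to isotropy,
  \<open>c\<close> makes the first two terms of the bent form cancel, and \<open>f\<close> matches
  the third with the form of \<open>Z\<close>. With \<open>strongly_transversal_coreduction\<close>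
  this permits composing the cylinder coreduction with the next entry of a path.\<close>

lemma canonical_relation_bent_product:
  assumes c: "canonical_relation Q Y c" and f: "canonical_relation Y Z f"
  shows "canonical_relation QYY Z {(p, z). p \<in> points QYY \<and> (bent1 t p, bent2 t p) \<in> c \<and> (bent3 t p, z) \<in> f}"
proof -
  let ?B = "QYY"
  have SZ: "symplectic_manifold Z" and Z: "smooth_manifold Z" using canonical_relation_smooth[OF f] by auto
  note YZ = smooth_prod_manifold(1)[OF smooths(2) Z]
  obtain k where k: "submanifold k QY c" "closedin (mtop QY) c" "2 * k = mdim Q + mdim Y" by (rule canonical_relationD[OF c])
  obtain l where l: "submanifold l (prod_manifold Y Z) f" "closedin (mtop (prod_manifold Y Z)) f" "2 * l = mdim Y + mdim Z"
    by (rule canonical_relationD[OF f])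
  let ?D = "prod_manifold QY (prod_manifold Y Z)" and ?E = "prod_manifold ?B Z"
  note D = smooth_prod_manifold(1)[OF smooths(3) YZ] and E = smooth_prod_manifold(1)[OF smooth_bent(7) Z]
  note P = submanifold_prod[OF smooths(3) YZ k(1) l(1)]
  \<comment> \<open>The first two components of the bent point form the pair tested against
    \<open>c\<close>; the third is paired with \<open>z\<close> and tested against
    \<open>f\<close>.\<close>
  let ?\<Phi> = "\<lambda>e. (fst (inv t (fst e)), (bent3 t (fst e), snd e))"
  let ?\<Psi> = "\<lambda>d. (t (fst d, fst (snd d)), snd (snd d))"
  have E1: "smooth_map ?E QY (\<lambda>e. fst (inv t (fst e)))"
    by (rule smooth_map_compose[OF E smooth_bent(7) smooths(3) smooth_map_fst[OF smooth_bent(7) Z] smooth_bent(5)])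
  have E2: "smooth_map ?E Y (\<lambda>e. bent3 t (fst e))"
    by (rule smooth_map_compose[OF E smooth_bent(7) smooths(2) smooth_map_fst[OF smooth_bent(7) Z] smooth_bent(4)])
  have E3: "smooth_map ?E (prod_manifold Y Z) (\<lambda>e. (bent3 t (fst e), snd e))"
    by (rule smooth_map_Pair[OF E smooths(2) Z E2 smooth_map_snd[OF smooth_bent(7) Z]])
  have \<Phi>: "smooth_map ?E ?D ?\<Phi>" by (rule smooth_map_Pair[OF E smooths(3) YZ E1 E3])
  have D1: "smooth_map ?D M (\<lambda>d. (fst d, fst (snd d)))"
    by (intro smooth_map_Pair[OF D smooths(3,2)] smooth_map_fst[OF smooths(3) YZ]
        smooth_map_compose[OF D YZ smooths(2) smooth_map_snd[OF smooths(3) YZ] smooth_map_fst[OF smooths(2) Z]])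
  have \<Psi>: "smooth_map ?D ?E ?\<Psi>"
    by (intro smooth_map_Pair[OF D smooth_bent(7) Z] smooth_map_compose[OF D smooths(4) smooth_bent(7) D1 smooth_bent(6)]
        smooth_map_compose[OF D YZ Z smooth_map_snd[OF smooths(3) YZ] smooth_map_snd[OF smooths(2) Z]])
  have dim: "mdim ?E = mdim ?D" by (simp add: mdim_bent)
  have \<Psi>\<Phi>: "?\<Psi> (?\<Phi> e) = e" for e by (simp add: bent3_def)
  have \<Phi>\<Psi>: "?\<Phi> (?\<Psi> d) = d" for d by (simp add: bent3_def)
  note T = submanifold_diffeo[OF E D \<Phi> \<Psi> \<Psi>\<Phi> \<Phi>\<Psi> dim P(1)]
  let ?S = "{(p, z). p \<in> points ?B \<and> (bent1 t p, bent2 t p) \<in> c \<and> (bent3 t p, z) \<in> f}"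
  have b: "(bent1 t p, bent2 t p) = fst (inv t p)" for p by (simp add: bent1_def bent2_def)
  have eq: "?S = {e \<in> points ?E. ?\<Phi> e \<in> c \<times> f}"
    unfolding b using canonical_relation_smooth(7)[OF f] by auto
  note T = T[folded eq]
  show ?thesis
  proof (rule canonical_relationI[OF symplectic_bent SZ T(1)])
    have "closedin (mtop ?D) (c \<times> f)" using k(2) l(2) by (simp add: closedin_prod_Times_iff)
    from closedin_continuous_map_preimage[OF smooth_map_continuous[OF \<Phi>] this]
    show "closedin (mtop ?E) ?S" unfolding eq .
    show "2 * (k + l) = mdim ?B + mdim Z" using k(3) l(3) by (simp add: mdim_bent)
    fix e u v assume e: "e \<in> ?S" and uv: "u \<in> tangent_subspace ?E ?S e" "v \<in> tangent_subspace ?E ?S e"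
    have eE: "e \<in> points ?E" "?\<Phi> e \<in> c \<times> f" using e unfolding eq by auto
    have pB: "fst e \<in> points ?B" "(bent1 t (fst e), bent2 t (fst e)) \<in> c" "(bent3 t (fst e), snd e) \<in> f" using e by auto
    have uv': "w \<in> tangent_space ?E e \<and> pushforward QY (\<lambda>p. fst (inv t p)) (fst e) (pushforward ?B fst e w) \<in> tangent_subspace QY c (fst (inv t (fst e))) \<and>
        pushforward (prod_manifold Y Z) (\<lambda>e. (bent3 t (fst e), snd e)) e w \<in> tangent_subspace (prod_manifold Y Z) f (bent3 t (fst e), snd e)"
      if w: "w \<in> tangent_subspace ?E ?S e" for w
    proof -
      have wT: "w \<in> tangent_space ?E e" and "pushforward ?D ?\<Phi> e w \<in> tangent_subspace ?D (c \<times> f) (?\<Phi> e)" using w unfolding T(2)[OF eE] by auto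
      then have "pushforward QY fst (?\<Phi> e) (pushforward ?D ?\<Phi> e w) \<in> tangent_subspace QY c (fst (?\<Phi> e))"
        "pushforward (prod_manifold Y Z) snd (?\<Phi> e) (pushforward ?D ?\<Phi> e w) \<in> tangent_subspace (prod_manifold Y Z) f (snd (?\<Phi> e))"
        unfolding P(2)[OF eE(2)] by auto
      then show ?thesis
        unfolding pushforward_compose[OF E D smooths(3) \<Phi> smooth_map_fst[OF smooths(3) YZ] eE(1)]
          pushforward_compose[OF E D YZ \<Phi> smooth_map_snd[OF smooths(3) YZ] eE(1)] fst_conv snd_conv
          pushforward_compose[OF E smooth_bent(7) smooths(3) smooth_map_fst[OF smooth_bent(7) Z] smooth_bent(5) eE(1)]
        using wT by simp
    qed
    note U = uv'[OF uv(1)] uv'[OF uv(2)]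
    have uB: "pushforward ?B fst e w \<in> tangent_space ?B (fst e)" if "w \<in> tangent_space ?E e" for w
      by (rule pushforward_in[OF E smooth_bent(7) smooth_map_fst[OF smooth_bent(7) Z] that])
    have "form ?B (fst e) (pushforward ?B fst e u) (pushforward ?B fst e v) =
        form Y (bent3 t (fst e)) (pushforward Y (bent3 t) (fst e) (pushforward ?B fst e u)) (pushforward Y (bent3 t) (fst e) (pushforward ?B fst e v))"
      using form_bent[OF uB uB] bent_isotropic[OF c pB(1,2)] U by simp
    also have "\<dots> = form Z (snd e) (pushforward Z snd e u) (pushforward Z snd e v)"
    proof -
      let ?h = "\<lambda>e. (bent3 t (fst e), snd e)"
      have f1: "pushforward Y fst (?h e) (pushforward (prod_manifold Y Z) ?h e w) = pushforward Y (bent3 t) (fst e) (pushforward ?B fst e w)" for w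
        using pushforward_compose[OF E YZ smooths(2) E3 smooth_map_fst[OF smooths(2) Z] eE(1), of w]
          pushforward_compose[OF E smooth_bent(7) smooths(2) smooth_map_fst[OF smooth_bent(7) Z] smooth_bent(4) eE(1), of w] by simp
      have f2: "pushforward Z snd (?h e) (pushforward (prod_manifold Y Z) ?h e w) = pushforward Z snd e w" for w
        using pushforward_compose[OF E YZ Z E3 smooth_map_snd[OF smooths(2) Z] eE(1), of w] by simp
      show ?thesis
        using canonical_relation_isotropic[OF f pB(3) U(1)[THEN conjunct2, THEN conjunct2] U(2)[THEN conjunct2, THEN conjunct2]]
        unfolding f1 f2 by simp
    qed
    finally show "form ?B (fst e) (pushforward ?B fst e u) (pushforward ?B fst e v) = form Z (snd e) (pushforward Z snd e u) (pushforward Z snd e v)" .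
  qed
qed

text \<open>The outer pair (q, y) determines the intermediate point as the image under
  \<open>t\<close> of ((q, y), y). For transversality, a vector with components (u1, u2, u3) is the
  difference of (u1, u2, u2), which is tangent to the diagonal, and (0, 0, u2 - u3), which is
  tangent to the cylinder.\<close>

lemma strongly_transversal_bent:
  assumes c: "canonical_relation Q Y c" and ne: "c \<noteq> {}"
  defines "A \<equiv> reduction_rel {p \<in> points QYY. bent1 t p \<in> points Q \<and> bent2 t p = bent3 t p} (bent1 t)"
    and "B \<equiv> (reduction_rel {p \<in> points QYY. (bent1 t p, bent2 t p) \<in> c} (bent3 t))\<inverse>"
  shows "A O B = c" "strongly_transversal Q QYY Y A B"
proof -
  have cQ: "c \<subseteq> points Q \<times> points Y" by (rule canonical_relation_smooth(7)[OF c])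
  then have neY: "points Y \<noteq> {}" using ne by auto
  let ?K = "{p \<in> points QYY. bent1 t p \<in> points Q \<and> bent2 t p = bent3 t p}"
  let ?L = "{p \<in> points QYY. (bent1 t p, bent2 t p) \<in> c}"
  have RA: "reduction_data Q QYY ?K (bent1 t)" using reduction_data_bent[OF reduction_data_id[OF SQ] neY] by simp
  note RB = reduction_data_bent_cylinder[OF c ne]
  show AB: "A O B = c"
  proof (intro set_eqI iffI)
    fix x assume "x \<in> A O B"
    then show "x \<in> c" unfolding A_def B_def reduction_rel_def by auto
  next
    fix x assume x: "x \<in> c"
    obtain q y where e: "x = (q, y)" by (cases x)
    have "q \<in> points Q" "y \<in> points Y" using cQ x e by auto
    then have "(q, t ((q, y), y)) \<in> A" "(t ((q, y), y), y) \<in> B"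
      using x e unfolding A_def B_def reduction_rel_def by (auto simp: points_bent bent1_def bent2_def bent3_def)
    then show "x \<in> A O B" using e by blast
  qed
  obtain k where k: "submanifold k (prod_manifold Q QYY) A" "closedin (mtop (prod_manifold Q QYY)) A"
    unfolding A_def by (rule canonical_relationD[OF reduction_data_canonical(1)[OF RA]])
  obtain l where l: "submanifold l (prod_manifold QYY Y) B" "closedin (mtop (prod_manifold QYY Y)) B"
    unfolding B_def by (rule canonical_relationD[OF reduction_data_canonical(2)[OF RB]])
  obtain m where m: "submanifold m QY c" "closedin (mtop QY) c" by (rule canonical_relationD[OF c])
  have s: "smooth_map QY QYY (\<lambda>x. t (x, snd x))"
    by (rule smooth_map_compose[OF smooths(3,4) smooth_bent(7) smooth_map_Pair[OF smooths(3,3,2) smooth_map_id[OF smooths(3)] smooth_map_snd[OF smooths(1,2)]] smooth_bent(6)])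
  show "strongly_transversal Q QYY Y A B"
  proof (rule strongly_transversalI[OF smooths(1) smooth_bent(7) smooths(2) k l _ _ s])
    show "submanifold m QY (A O B)" "closedin (mtop QY) (A O B)" unfolding AB by (rule m)+
    fix q p y assume qp: "(q, p) \<in> A" and py: "(p, y) \<in> B"
    have p: "p \<in> ?K" "p \<in> ?L" "q = bent1 t p" "y = bent3 t p" using qp py unfolding A_def B_def reduction_rel_def by auto
    then have "((q, y), snd (q, y)) = inv t p" by (simp add: bent1_def bent2_def bent3_def prod_eq_iff)
    then show "p = t ((q, y), snd (q, y))" using ti by metis
    fix \<eta> assume \<eta>: "\<eta> \<in> tangent_space QYY p"
    have pB: "p \<in> points QYY" using p by blast
    have e23: "bent2 t p = bent3 t p" using p by blast
    note P1 = pushforward_in[OF smooth_bent(7) smooths(1) smooth_bent(2) \<eta>] and P2 = pushforward_in[OF smooth_bent(7) smooths(2) smooth_bent(3) \<eta>]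
    obtain a where a: "a \<in> tangent_space QYY p" "pushforward Q (bent1 t) p a = pushforward Q (bent1 t) p \<eta>"
      "pushforward Y (bent2 t) p a = pushforward Y (bent2 t) p \<eta>" "pushforward Y (bent3 t) p a = pushforward Y (bent2 t) p \<eta>"
      using tangent_bent_ex[OF pB P1 P2 P2[unfolded e23]] by blast
    have b: "(\<lambda>g. 1 * a g + (-1) * \<eta> g) \<in> tangent_space QYY p" by (rule tangent_linear_comb[OF smooth_bent(7) a(1) \<eta>])
    have aK: "a \<in> tangent_subspace QYY ?K p"
    proof -
      have "bent1 t p \<in> points Q" using p by blast
      then show ?thesis
        unfolding bent_diagonal(3)[OF submanifold_whole[OF smooths(1)] closedin_topspace p(1)]
          tangent_subspace_whole[OF smooths(1) \<open>bent1 t p \<in> points Q\<close>] using a P1 by simp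
    qed
    have bL: "(\<lambda>g. 1 * a g + (-1) * \<eta> g) \<in> tangent_subspace QYY ?L p"
    proof -
      have "pushforward QY (\<lambda>p. fst (inv t p)) p (\<lambda>g. 1 * a g + (-1) * \<eta> g) = (\<lambda>g. 0)"
      proof (rule tangent_prod_eqI[OF smooths(1,2) pushforward_in[OF smooth_bent(7) smooths(3) smooth_bent(5) b]])
        show "(\<lambda>g. 0) \<in> tangent_space QY (fst (inv t p))"
          by (rule tangent_zero[OF smooths(3) smooth_map_points[OF smooth_bent(5) pB]])
      qed (unfold push_bent[OF pB] pushforward_linear_comb pushforward_zero a, simp_all)
      moreover have "fst (inv t p) \<in> c" using p(2) by (simp add: bent1_def bent2_def)
      note tangent_subspace_zero[OF smooths(3) m(1) this]
      ultimately show ?thesis unfolding bent_cylinder(3)[OF m p(2)] using b by simp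
    qed
    obtain v where v: "v \<in> tangent_subspace (prod_manifold Q QYY) A (q, p)" "pushforward QYY snd (q, p) v = a"
      using reduction_data_lift(1)[OF RA p(1) aK] unfolding A_def p(3) by blast
    obtain w where w: "w \<in> tangent_subspace (prod_manifold QYY Y) B (p, y)" "pushforward QYY fst (p, y) w = (\<lambda>g. 1 * a g + (-1) * \<eta> g)"
      using reduction_data_lift(2)[OF RB p(2) bL] unfolding B_def p(4) by blast
    show "\<exists>a\<in>tangent_subspace (prod_manifold Q QYY) A (q, p). \<exists>b\<in>tangent_subspace (prod_manifold QYY Y) B (p, y).
        \<eta> = (\<lambda>w. pushforward QYY snd (q, p) a w - pushforward QYY fst (p, y) b w)"
      by (rule bexI[OF bexI[OF _ w(1)] v(1)]) (simp add: v(2) w(2))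
  qed
qed

end

section \<open>The empty relation\<close>

lemma ex_bij_Times:
  includes cardinal_syntax
  assumes "infinite (UNIV :: 'a set)" and B: "|UNIV :: 'b set| \<le>o |UNIV :: 'a set|"
  shows "\<exists>t :: 'a \<times> 'b \<Rightarrow> 'a. bij t"
proof -
  have "|(UNIV :: 'a set) \<times> (UNIV :: 'b set)| =o |UNIV :: 'a set|"
    by (rule card_of_Times_infinite(1)[THEN conjunct1, OF assms(1) _ B]) simp
  then show ?thesis unfolding card_of_ordIso[symmetric] UNIV_Times_UNIV by blast
qed

text \<open>The product of an infinite set with itself, or with a two-element set, has the
  cardinality of the set; triples are packed in two rounds.\<close>

lemma ex_bij_bent:
  includes cardinal_syntax
  shows "\<exists>t :: (('a::infinite) \<times> 'a) \<times> 'a \<Rightarrow> 'a. bij t" and "\<exists>t :: (('a::infinite) \<times> 'a) \<times> bool \<Rightarrow> 'a. bij t"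
proof -
  have i: "infinite (UNIV :: 'a set)" by (rule infinite_UNIV)
  obtain s :: "'a \<times> 'a \<Rightarrow> 'a" where s: "bij s" using ex_bij_Times[OF i card_of_refl[THEN ordIso_imp_ordLeq]] by blast
  have f: "|UNIV :: bool set| <o natLeq" by (rule iffD1[OF finite_iff_ordLess_natLeq finite])
  have g: "natLeq \<le>o |UNIV :: 'a set|" using infinite_iff_natLeq_ordLeq[of "UNIV :: 'a set"] i by blast
  have "|UNIV :: bool set| \<le>o |UNIV :: 'a set|"
    by (rule ordLess_imp_ordLeq[OF ordLess_ordLeq_trans[OF f g]])
  then obtain b :: "'a \<times> bool \<Rightarrow> 'a" where b: "bij b" using ex_bij_Times[OF i] by blast
  have m: "bij (map_prod s (\<lambda>x. x))" using bij_betw_map_prod[OF s bij_id] by (simp add: id_def)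
  from bij_comp[OF m s] show "\<exists>t :: ('a \<times> 'a) \<times> 'a \<Rightarrow> 'a. bij t" by blast
  have m: "bij (map_prod s (\<lambda>x. x))" using bij_betw_map_prod[OF s bij_id] by (simp add: id_def)
  from bij_comp[OF m b] show "\<exists>t :: ('a \<times> 'a) \<times> bool \<Rightarrow> 'a. bij t" by blast
qed

section \<open>The constant symplectic form of a chart\<close>

text \<open>Matrix of the standard symplectic form, pairing each even coordinate with its odd
  successor. Numbered this way the entries do not depend on the dimension, and the odd coordinates
  cut out a lagrangian plane.\<close>

definition std_coeff :: "nat \<Rightarrow> nat \<Rightarrow> real" where
  "std_coeff a b = (if even a \<and> b = Suc a then 1 else if even b \<and> a = Suc b then -1 else 0)"

lemma std_coeff_antisym: "std_coeff b a = - std_coeff a b"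
  by (auto simp: std_coeff_def)

text \<open>A vector applied to the function \<open>\<psi> q a\<close> of \<open>q\<close> is its
  a-th component in the chart, so this form has constant coefficients in that chart.\<close>

definition std_form :: "('a, 'm) manifold_scheme \<Rightarrow> ('a \<Rightarrow> nat \<Rightarrow> real) \<Rightarrow> 'a \<Rightarrow> 'a tvec \<Rightarrow> 'a tvec \<Rightarrow> real" where
  "std_form M \<psi> p u v = (\<Sum>a<mdim M. \<Sum>b<mdim M. std_coeff a b * (u (\<lambda>q. \<psi> q a) * v (\<lambda>q. \<psi> q b)))"

lemma bilinear_std_form: "bilinear_at M (std_form M \<psi>) p"
proof -
  have anti: "std_form M \<psi> p v u = - std_form M \<psi> p u v" for u v
  proof -
    have "std_form M \<psi> p v u = (\<Sum>b<mdim M. \<Sum>a<mdim M. std_coeff a b * (v (\<lambda>q. \<psi> q a) * u (\<lambda>q. \<psi> q b)))"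
      unfolding std_form_def by (rule sum.swap)
    also have "\<dots> = - std_form M \<psi> p u v"
      unfolding std_form_def sum_negf[symmetric]
      by (intro sum.cong refl) (subst std_coeff_antisym, simp)
    finally show ?thesis .
  qed
  show ?thesis
    unfolding bilinear_at_def
  proof (intro ballI conjI allI)
    fix u v w a b
    show "std_form M \<psi> p u u = 0" using anti[of u u] by simp
    show "std_form M \<psi> p v u = - std_form M \<psi> p u v" by (rule anti)
    show "std_form M \<psi> p (\<lambda>g. a * u g + b * v g) w = a * std_form M \<psi> p u w + b * std_form M \<psi> p v w"
      unfolding std_form_def by (simp add: sum_distrib_left sum.distrib[symmetric] algebra_simps)
  qed
qed

text \<open>In any other chart the coefficients are those of a constant form pulled back under the
  coordinate change, which \<open>closed_form_at_pullback\<close> covers.\<close>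

lemma closed_std_form:
  assumes M: "smooth_manifold M" and c: "(V, \<psi>) \<in> matlas M"
  shows "closed_two_form_on M V (std_form M \<psi>)"
  unfolding closed_two_form_on_def
proof (intro conjI ballI allI impI bilinear_std_form)
  note cV = matlas_chartD[OF M c]
  show "openin (mtop M) V" by (rule cV(1))
  fix U \<phi> p assume d: "(U, \<phi>) \<in> matlas M" and p: "p \<in> U \<inter> V"
  note cU = matlas_chartD[OF M d]
  have pU: "p \<in> U" and pV: "p \<in> V" using p by auto
  let ?n = "mdim M" and ?F = "\<lambda>a x. \<psi> (inv_into U \<phi> x) a"
  have F: "smooth_at ?n (?F a) (\<phi> p)" for a
    by (rule iffD1[OF smooth_near_iff[OF M d pU] smooth_near_coord[OF M c pV]])
  have pull: "closed_form_at ?n (\<lambda>i j x. \<Sum>a<?n. \<Sum>b<?n. std_coeff a b * (partial_deriv i (?F a) x * partial_deriv j (?F b) x)) (\<phi> p)"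
    by (rule closed_form_at_pullback[OF cU(5)[OF pU] closed_form_at_const[OF trunc_in] F std_coeff_antisym])
  show "closed_form_at ?n (two_form_coeff M (std_form M \<psi>) (U, \<phi>)) (\<phi> p)"
  proof (rule closed_form_at_cong[OF _ pull cU(5)[OF pU]])
    have "\<forall>\<^sub>F q in nhdsin (mtop M) p. q \<in> U \<inter> V"
      by (rule eventually_in_open[OF openin_Int[OF cU(1) cV(1)] p])
    then have ev: "\<forall>\<^sub>F x in near_eucl ?n (\<phi> p). inv_into U \<phi> x \<in> U \<inter> V"
      by (rule iffD1[OF eventually_chart[OF matlas_chart_on[OF M d] pU]])
    have ev2: "\<forall>\<^sub>F x in near_eucl ?n (\<phi> p). x \<in> \<phi> ` U"
      by (rule eventually_in_open[OF cU(3) imageI[OF pU]])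
    show "\<forall>\<^sub>F x in near_eucl ?n (\<phi> p). \<forall>i<?n. \<forall>j<?n.
       (\<Sum>a<?n. \<Sum>b<?n. std_coeff a b * (partial_deriv i (?F a) x * partial_deriv j (?F b) x)) =
       two_form_coeff M (std_form M \<psi>) (U, \<phi>) i j x"
    proof (rule eventually_mono[OF eventually_conj[OF ev ev2]], intro allI impI)
      fix x i j assume x: "inv_into U \<phi> x \<in> U \<inter> V \<and> x \<in> \<phi> ` U" and ij: "i < ?n" "j < ?n"
      have e: "coord_vector M (U, \<phi>) (inv_into U \<phi> x) (unit_vec i) (\<lambda>q. \<psi> q a) = partial_deriv i (?F a) x" if "i < ?n" for i a
      proof -
        have "coord_vector M (U, \<phi>) (inv_into U \<phi> x) (unit_vec i) (\<lambda>q. \<psi> q a) =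
            (\<Sum>l<?n. (if l = i then 1 else 0) * partial_deriv l (?F a) (\<phi> (inv_into U \<phi> x)))"
          by (rule coord_vector_apply) (use x in \<open>auto intro: smooth_near_coord[OF M c]\<close>)
        also have "\<dots> = (\<Sum>l<?n. if l = i then partial_deriv l (?F a) x else 0)"
          using x by (intro sum.cong refl) (simp add: f_inv_into_f)
        finally show ?thesis using that by (simp add: sum.delta)
      qed
      show "(\<Sum>a<?n. \<Sum>b<?n. std_coeff a b * (partial_deriv i (?F a) x * partial_deriv j (?F b) x)) =
         two_form_coeff M (std_form M \<psi>) (U, \<phi>) i j x"
        unfolding two_form_coeff_def split_conv std_form_def by (simp only: e[OF ij(1)] e[OF ij(2)])
    qed
  qed
qed

lemma nondegenerate_std_form:
  assumes M: "smooth_manifold M" and c: "(V, \<psi>) \<in> matlas M" "p \<in> V" and ev: "even (mdim M)"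
  shows "nondegenerate_at M (std_form M \<psi>) p"
  unfolding nondegenerate_at_def
proof (intro ballI impI)
  fix u assume u: "u \<in> tangent_space M p" and z: "\<forall>v\<in>tangent_space M p. std_form M \<psi> p u v = 0"
  let ?n = "mdim M"
  have pM: "p \<in> points M" by (rule tangent_points[OF M u])
  show "u = (\<lambda>g. 0)"
  proof (rule tangent_eqI[OF M u tangent_zero[OF M pM] c])
    fix a assume a: "a < ?n"
    \<comment> \<open>The partner of \<open>a\<close> under \<open>std_coeff\<close>; even dimension
      keeps it in range. Pairing \<open>u\<close> with the unit vector at \<open>?b\<close> isolates
      component \<open>a\<close> of \<open>u\<close>.\<close>
    let ?b = "if even a then Suc a else a - 1"
    have b: "?b < ?n" using a ev by (auto elim!: evenE oddE)
    let ?e = "coord_vector M (V, \<psi>) p (unit_vec ?b)"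
    have e: "?e (\<lambda>q. \<psi> q j) = (if j = ?b then 1 else 0)" if "j < ?n" for j
      by (rule coord_vector_coord[OF M c that])
    have "std_form M \<psi> p u ?e = (\<Sum>i<?n. \<Sum>j<?n. if j = ?b then std_coeff i j * u (\<lambda>q. \<psi> q i) else 0)"
      unfolding std_form_def by (intro sum.cong refl) (simp add: e)
    also have "\<dots> = (\<Sum>i<?n. std_coeff i ?b * u (\<lambda>q. \<psi> q i))"
      using b by (intro sum.cong refl) (simp add: sum.delta del: if_split_eq1)
    also have "\<dots> = (\<Sum>i<?n. if i = a then std_coeff a ?b * u (\<lambda>q. \<psi> q a) else 0)"
    proof (intro sum.cong refl)
      fix i show "std_coeff i ?b * u (\<lambda>q. \<psi> q i) = (if i = a then std_coeff a ?b * u (\<lambda>q. \<psi> q a) else 0)"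
        by (cases "i = a"; cases "even a") (auto simp: std_coeff_def elim!: oddE, presburger?)
    qed
    also have "\<dots> = std_coeff a ?b * u (\<lambda>q. \<psi> q a)" using a by simp
    finally have "std_coeff a ?b * u (\<lambda>q. \<psi> q a) = 0" using z coord_vector_in[OF c] by auto
    moreover have "std_coeff a ?b \<noteq> 0" by (auto simp: std_coeff_def elim!: oddE)
    ultimately show "u (\<lambda>q. \<psi> q a) = 0" by simp
  qed
qed

lemma card_odd_below: "card {j. j < n \<and> odd j} = n div 2" for n :: nat
proof (induction n)
  case (Suc n)
  have "{j. j < Suc n \<and> odd j} = (if odd n then insert n {j. j < n \<and> odd j} else {j. j < n \<and> odd j})"
    by (auto simp: less_Suc_eq)
  then show ?case using Suc by auto
qed simp

section \<open>Coordinate slices as reductions\<close>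

text \<open>\<open>std_form\<close> pairs even with odd coordinates, so it vanishes where all odd
  ones do: this slice is lagrangian in the chart, and its preimage in \<open>P\<close> reduces to
  \<open>Z\<close> by \<open>F\<close>. \<open>P\<close> is intended to be a component of
  \<open>Q\<close> on which \<open>F\<close> and \<open>G\<close> act as the two projections of a
  product, and \<open>s\<close> is the index at which the coordinates of \<open>N\<close> begin in
  the charts of \<open>Q\<close>.\<close>

lemma reduction_data_slice:
  assumes SQ: "symplectic_manifold Q" and SZ: "symplectic_manifold Z" and N: "smooth_manifold N" and ev: "even (mdim N)"
    and F: "smooth_map Q Z F" and G: "smooth_map Q N G" and c: "(V, \<psi>) \<in> matlas N"
    and P: "closedin (mtop Q) P" "\<And>p. p \<in> P \<Longrightarrow> G p \<in> V"
    and y0: "y0 \<in> V" "\<And>j. j < mdim N \<Longrightarrow> \<psi> y0 j = 0"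
    and sur: "\<And>z. z \<in> points Z \<Longrightarrow> \<exists>p\<in>P. F p = z \<and> G p = y0"
    and ex: "\<And>p a b. p \<in> P \<Longrightarrow> a \<in> tangent_space Z (F p) \<Longrightarrow> b \<in> tangent_space N (G p) \<Longrightarrow>
      \<exists>u\<in>tangent_space Q p. pushforward Z F p u = a \<and> pushforward N G p u = b"
    and fm: "\<And>p u v. p \<in> P \<Longrightarrow> u \<in> tangent_space Q p \<Longrightarrow> v \<in> tangent_space Q p \<Longrightarrow>
      form Q p u v = form Z (F p) (pushforward Z F p u) (pushforward Z F p v) + std_form N \<psi> (G p) (pushforward N G p u) (pushforward N G p v)"
    and ch: "\<And>p. p \<in> P \<Longrightarrow> \<exists>E \<kappa>. (E, \<kappa>) \<in> matlas Q \<and> p \<in> E \<and> E \<subseteq> P \<and> (\<forall>q\<in>E. \<forall>j<mdim N. \<kappa> q (s + j) = \<psi> (G q) j)"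
    and s: "s + mdim N \<le> mdim Q" and dim: "mdim Q = mdim Z + mdim N"
  shows "reduction_data Z Q {p \<in> P. \<forall>j<mdim N. odd j \<longrightarrow> \<psi> (G p) j = 0} F"
proof -
  let ?K = "{p \<in> P. \<forall>j<mdim N. odd j \<longrightarrow> \<psi> (G p) j = 0}" and ?O = "{j. j < mdim N \<and> odd j}"
  have Q: "smooth_manifold Q" by (rule symplectic_smooth[OF SQ])
  have PQ: "P \<subseteq> points Q" by (rule closedin_subset[OF P(1)])
  have near: "smooth_near N (G p) (\<lambda>y. \<psi> y j)" if "p \<in> P" for p j by (rule smooth_near_coord[OF N c P(2)[OF that]])
  have ad: "\<exists>E \<kappa>. adapted_chart Q ?K p E \<kappa> ((+) s ` ?O) \<and> E \<subseteq> P \<and> (\<forall>q\<in>E. \<forall>j<mdim N. \<kappa> q (s + j) = \<psi> (G q) j)" if p: "p \<in> P" for p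
  proof -
    obtain E \<kappa> where E: "(E, \<kappa>) \<in> matlas Q" "p \<in> E" "E \<subseteq> P" "\<forall>q\<in>E. \<forall>j<mdim N. \<kappa> q (s + j) = \<psi> (G q) j" using ch[OF p] by auto
    have "adapted_chart Q ?K p E \<kappa> ((+) s ` ?O)"
      unfolding adapted_chart_def using E s by auto
    then show ?thesis using E by blast
  qed
  \<comment> \<open>Half of the coordinates of \<open>N\<close> are odd, which gives the slice the
    dimension of a coisotropic set reducing to \<open>Z\<close>.\<close>
  have cd: "card ((+) s ` ?O) + (mdim Z + mdim N div 2) = mdim Q"
    using dim ev by (subst card_image) (auto simp: card_odd_below elim!: evenE)
  have sub: "submanifold (mdim Z + mdim N div 2) Q ?K"
  proof (rule adapted_submanifold[OF Q])
    show "\<exists>U \<phi> J. adapted_chart Q ?K p U \<phi> J \<and> card J + (mdim Z + mdim N div 2) = mdim Q" if p: "p \<in> ?K" for p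
    proof -
      have "p \<in> P" using p by blast
      then show ?thesis using ad cd by blast
    qed
  qed (use PQ dim in auto)
  have tan: "tangent_subspace Q ?K p = {u \<in> tangent_space Q p. \<forall>j\<in>?O. pushforward N G p u (\<lambda>y. \<psi> y j) = 0}" if p: "p \<in> ?K" for p
  proof -
    have pP: "p \<in> P" using p by blast
    obtain E \<kappa> where E: "adapted_chart Q ?K p E \<kappa> ((+) s ` ?O)" "E \<subseteq> P" "\<forall>q\<in>E. \<forall>j<mdim N. \<kappa> q (s + j) = \<psi> (G q) j"
      using ad[OF pP] by blast
    have E': "(E, \<kappa>) \<in> matlas Q" "p \<in> E" using E(1) by (auto simp: adapted_chart_def)
    have "u (\<lambda>q. \<kappa> q (s + j)) = pushforward N G p u (\<lambda>y. \<psi> y j)" if u: "u \<in> tangent_space Q p" and j: "j < mdim N" for u j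
    proof -
      have "\<forall>\<^sub>F q in nhdsin (mtop Q) p. q \<in> E" by (rule eventually_in_open[OF matlas_chartD(1)[OF Q E'(1)] E'(2)])
      then have "\<forall>\<^sub>F q in nhdsin (mtop Q) p. \<kappa> q (s + j) = \<psi> (G q) j" by (rule eventually_mono) (use E(3) j in blast)
      from tangent_cong[OF Q u this] show ?thesis unfolding pushforward_apply[where g = "\<lambda>y. \<psi> y j" and F = G and u = u, OF near[OF pP]] .
    qed
    then show ?thesis unfolding tangent_subspace_adapted[OF Q sub p E(1)] by auto
  qed
  show ?thesis
    unfolding reduction_data_def
  proof (intro conjI ballI SQ SZ F exI[of _ "mdim Z + mdim N div 2"] sub)
    show "2 * (mdim Z + mdim N div 2) = mdim Z + mdim Q" using dim ev by auto
    show "closedin (mtop Q) ?K"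
    proof -
      \<comment> \<open>The coordinates are continuous where \<open>G\<close> stays in
        \<open>V\<close>, so closedness is obtained relative to \<open>P\<close> first and then
        passed to \<open>Q\<close>.\<close>
      have "continuous_map (subtopology (mtop Q) P) (subtopology (mtop N) V) G"
        using smooth_map_continuous[OF G] P(2) by (auto simp: continuous_map_in_subtopology continuous_map_from_subtopology)
      from continuous_map_compose[OF this chart_on_component[OF matlas_chart_on[OF N c]]]
      have cont: "continuous_map (subtopology (mtop Q) P) euclideanreal (\<lambda>p. \<psi> (G p) j)" for j by (simp add: o_def)
      have tsP: "topspace (subtopology (mtop Q) P) = P" using PQ by auto
      have "closedin (subtopology (mtop Q) P) {p \<in> P. \<psi> (G p) j = 0}" for j
        using closedin_continuous_map_preimage[OF cont, of "{0}" j] unfolding tsP by simp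
      then have "closedin (mtop Q) {p \<in> P. \<psi> (G p) j = 0}" for j by (rule closedin_trans_full[OF _ P(1)])
      \<comment> \<open>\<open>P\<close> itself keeps the family nonempty when there is no odd
        index.\<close>
      then have "closedin (mtop Q) (\<Inter> (insert P ((\<lambda>j. {p \<in> P. \<psi> (G p) j = 0}) ` ?O)))" using P(1) by (intro closedin_Inter) auto
      also have "\<Inter> (insert P ((\<lambda>j. {p \<in> P. \<psi> (G p) j = 0}) ` ?O)) = ?K" by auto
      finally show ?thesis .
    qed
    show "points Z \<subseteq> F ` ?K"
    proof
      fix z assume "z \<in> points Z"
      then obtain p where p: "p \<in> P" "F p = z" "G p = y0" using sur by blast
      have "p \<in> ?K" using p y0(2) by simp
      then show "z \<in> F ` ?K" using p(2) by blast
    qed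
    fix p assume p: "p \<in> ?K"
    have pP: "p \<in> P" using p by blast
    show "form Q p u v = form Z (F p) (pushforward Z F p u) (pushforward Z F p v)"
      if "u \<in> tangent_subspace Q ?K p" "v \<in> tangent_subspace Q ?K p" for u v
    proof -
      have uv: "u \<in> tangent_space Q p" "v \<in> tangent_space Q p"
        "\<forall>j\<in>?O. pushforward N G p u (\<lambda>y. \<psi> y j) = 0" "\<forall>j\<in>?O. pushforward N G p v (\<lambda>y. \<psi> y j) = 0" using that unfolding tan[OF p] by auto
      have "std_form N \<psi> (G p) (pushforward N G p u) (pushforward N G p v) = 0"
        unfolding std_form_def
      proof (intro sum.neutral ballI)
        fix a b assume ab: "a \<in> {..<mdim N}" "b \<in> {..<mdim N}"
        show "std_coeff a b * (pushforward N G p u (\<lambda>q. \<psi> q a) * pushforward N G p v (\<lambda>q. \<psi> q b)) = 0"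
          using uv(3,4) ab by (cases "odd a"; cases "odd b") (auto simp: std_coeff_def)
      qed
      then show ?thesis using fm[OF pP uv(1,2)] by simp
    qed
    fix \<xi> assume \<xi>: "\<xi> \<in> tangent_space Z (F p)"
    obtain u where u: "u \<in> tangent_space Q p" "pushforward Z F p u = \<xi>" "pushforward N G p u = (\<lambda>g. 0)"
      using ex[OF pP \<xi> tangent_zero[OF N smooth_map_points[OF G]]] PQ pP by blast
    show "\<exists>u\<in>tangent_subspace Q ?K p. pushforward Z F p u = \<xi>"
      unfolding tan[OF p] using u by auto
  qed
qed

section \<open>A disjoint union with two disjoint coisotropic sets\<close>

text \<open>Labels the two components of a disjoint union; of dimension 0, so that it adds no
  tangent directions.\<close>

definition two_points :: "bool manifold" where
  "two_points = \<lparr>mtop = discrete_topology UNIV, mdim = 0, matlas = maximal_atlas (discrete_topology UNIV) 0 {({s}, \<lambda>_ _. 0) | s. True}\<rparr>"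

lemma two_points: "smooth_manifold two_points" "({s}, \<lambda>_ _. 0) \<in> matlas two_points"
  "mtop two_points = discrete_topology UNIV" "mdim two_points = 0"
proof -
  have E0: "eucl 0 = {\<lambda>_. 0}" by (auto simp: topspace_Euclidean_space)
  have ch: "chart_on (discrete_topology UNIV) 0 ({s}, \<lambda>_ _. 0)" for s :: bool
  proof (rule chart_onI)
    fix W assume "W \<subseteq> {s}"
    \<comment> \<open>\<open>Euclidean_space 0\<close> is a single point, so both possible images
      are open.\<close>
    then have "(\<lambda>_ _. 0) ` W = {} \<or> (\<lambda>_ _. 0 :: real) ` W = eucl 0" unfolding E0 by auto
    then show "open_eucl 0 ((\<lambda>_ _. 0) ` W)" using openin_topspace openin_empty by metis
  qed (simp_all add: topspace_Euclidean_space)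
  have sc: "second_countable (discrete_topology (UNIV :: bool set))"
    unfolding second_countable_def
    by (rule exI[of _ "UNIV"]) auto
  let ?A = "{({s}, \<lambda>_ _. 0) | s. True} :: bool chart set"
  note at = smooth_manifold_atlasI[OF Hausdorff_space_discrete_topology sc, of ?A 0]
  have A: "chart_on (discrete_topology UNIV) 0 c" if "c \<in> ?A" for c using that ch by blast
  have cov: "\<exists>c\<in>?A. p \<in> fst c" for p :: bool by (rule bexI[of _ "({p}, \<lambda>_ _. 0)"]) auto
  have tr: "smooth_transition_at 0 c d p" for c d and p :: bool by (simp add: smooth_transition_at_def)
  show "smooth_manifold two_points" unfolding two_points_def by (rule at(1)[OF A cov tr])
  have "?A \<subseteq> matlas two_points" unfolding two_points_def manifold.simps by (rule at(2)[OF A cov tr])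
  then show "({s}, \<lambda>_ _. 0) \<in> matlas two_points" by blast
qed (simp_all add: two_points_def)

lemma two_points_tangent: "u \<in> tangent_space two_points s \<Longrightarrow> u = (\<lambda>g. 0)"
  by (auto simp: tangent_space_def coord_vector_def two_points(4) split: prod.splits)

text \<open>The coordinate domain in each component carries the constant form of the chart, not the given form, so that a
  coordinate slice is lagrangian without Darboux' theorem.\<close>

context
  fixes t :: "('a \<times> 'a) \<times> bool \<Rightarrow> 'a" and X Y :: "'a symplectic" and U V \<phi> \<psi> x0 y0
  assumes t: "bij t" and SX: "symplectic_manifold X" and SY: "symplectic_manifold Y"
    and cU: "(U, \<phi>) \<in> matlas X" and cV: "(V, \<psi>) \<in> matlas Y"
    and x0: "x0 \<in> U" "\<phi> x0 = (\<lambda>_. 0)" and y0: "y0 \<in> V" "\<psi> y0 = (\<lambda>_. 0)"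
begin

private abbreviation "XY \<equiv> prod_manifold X Y"
private abbreviation "XYS \<equiv> prod_manifold XY two_points"
text \<open>The disjoint union of \<open>U \<times> points Y\<close> and
  \<open>points X \<times> V\<close>, as an open subset of a product with
  \<open>two_points\<close>.\<close>

private definition "W = (U \<times> points Y) \<times> {True} \<union> (points X \<times> V) \<times> {False}"
private abbreviation "D \<equiv> copy_manifold t W XYS"
private definition "px p = fst (fst (inv t p))"
private definition "py p = snd (fst (inv t p))"
private definition "side p = snd (inv t p)"

private lemma inv_t [simp]: "inv t (t x) = x" using bij_is_inj[OF t] by simp
private lemma t_inv [simp]: "t (inv t p) = p" using bij_is_surj[OF t] by (simp add: surj_f_inv_f)

private lemmas X = symplectic_smooth[OF SX]
private lemmas Y = symplectic_smooth[OF SY]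
private lemmas XY = smooth_prod_manifold(1)[OF X Y]
private lemmas XYS = smooth_prod_manifold(1)[OF XY two_points(1)]
private lemmas U = matlas_chartD[OF X cU]
private lemmas V = matlas_chartD[OF Y cV]

private lemma W: "openin (mtop XYS) W"
  unfolding W_def prod_manifold_simps two_points(3)
  by (intro openin_Un) (auto simp: openin_prod_Times_iff U(1) V(1))

private lemma D: "smooth_manifold D" "points D = t ` W"
  using smooth_copy_manifold[OF XYS t W] by auto

private lemma inv_in_W: "p \<in> points D \<longleftrightarrow> inv t p \<in> W"
  unfolding D(2) by (metis (mono_tags) image_iff inv_t t_inv)

private lemma points_D: "p \<in> points D \<longleftrightarrow> px p \<in> points X \<and> py p \<in> points Y \<and> (if side p then px p \<in> U else py p \<in> V)"
  unfolding inv_in_W using U(2) V(2) by (cases "inv t p") (auto simp: W_def px_def py_def side_def)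

private lemma smooth_D: "smooth_map D XY (\<lambda>p. fst (inv t p))" "smooth_map D X px" "smooth_map D Y py" "smooth_map D two_points side"
proof -
  note i = smooth_map_from_copy[OF XYS t W]
  show f: "smooth_map D XY (\<lambda>p. fst (inv t p))" by (rule smooth_map_compose[OF D(1) XYS XY i smooth_map_fst[OF XY two_points(1)]])
  show "smooth_map D X px" unfolding px_def[abs_def] by (rule smooth_map_compose[OF D(1) XY X f smooth_map_fst[OF X Y]])
  show "smooth_map D Y py" unfolding py_def[abs_def] by (rule smooth_map_compose[OF D(1) XY Y f smooth_map_snd[OF X Y]])
  show "smooth_map D two_points side" unfolding side_def[abs_def]
    by (rule smooth_map_compose[OF D(1) XYS two_points(1) i smooth_map_snd[OF XY two_points(1)]])
qed

private lemma push_D: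
  assumes "p \<in> points D"
  shows "pushforward XY fst (inv t p) (pushforward XYS (inv t) p u) = pushforward XY (\<lambda>p. fst (inv t p)) p u"
    "pushforward X fst (fst (inv t p)) (pushforward XY (\<lambda>p. fst (inv t p)) p u) = pushforward X px p u"
    "pushforward Y snd (fst (inv t p)) (pushforward XY (\<lambda>p. fst (inv t p)) p u) = pushforward Y py p u"
  using pushforward_compose[OF D(1) XYS XY smooth_map_from_copy[OF XYS t W] smooth_map_fst[OF XY two_points(1)] assms, of u]
    pushforward_compose[OF D(1) XY X smooth_D(1) smooth_map_fst[OF X Y] assms, of u]
    pushforward_compose[OF D(1) XY Y smooth_D(1) smooth_map_snd[OF X Y] assms, of u]
  by (simp_all add: px_def[abs_def] py_def[abs_def])

private lemma tangent_D_ex: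
  assumes p: "p \<in> points D" and a: "a \<in> tangent_space X (px p)" and b: "b \<in> tangent_space Y (py p)"
  shows "\<exists>u\<in>tangent_space D p. pushforward X px p u = a \<and> pushforward Y py p u = b"
proof -
  obtain w where w: "w \<in> tangent_space XY (fst (inv t p))" "pushforward X fst (fst (inv t p)) w = a" "pushforward Y snd (fst (inv t p)) w = b"
    by (rule tangent_prod_ex[OF X Y a[unfolded px_def] b[unfolded py_def]])
  have z: "(\<lambda>g. 0) \<in> tangent_space two_points (snd (inv t p))"
    by (rule tangent_zero[OF two_points(1)]) (simp add: two_points(3))
  obtain v where v: "v \<in> tangent_space XYS (inv t p)" "pushforward XY fst (inv t p) v = w"
    by (rule tangent_prod_ex[OF XY two_points(1) w(1) z])
  have iW: "inv t p \<in> W" using p by (simp add: inv_in_W)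
  obtain u where u: "u \<in> tangent_space D p" "pushforward XYS (inv t) p u = v"
    using tangent_copy(1)[OF XYS t W iW v(1)] by blast
  then show ?thesis using push_D[OF p, of u] w v by auto
qed

text \<open>The label contributes only zero vectors, so the components in \<open>X\<close> and
  \<open>Y\<close> determine a tangent vector.\<close>

private lemma tangent_D_eqI:
  assumes u: "u \<in> tangent_space D p" "v \<in> tangent_space D p"
    and e: "pushforward X px p u = pushforward X px p v" "pushforward Y py p u = pushforward Y py p v"
  shows "u = v"
proof -
  have p: "p \<in> points D" by (rule tangent_points[OF D(1) u(1)])
  have iW: "inv t p \<in> W" using p by (simp add: inv_in_W)
  note P = pushforward_in[OF D(1) XY smooth_D(1)] and PM = pushforward_in[OF D(1) XYS smooth_map_from_copy[OF XYS t W]]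
  have e1: "pushforward XY (\<lambda>p. fst (inv t p)) p u = pushforward XY (\<lambda>p. fst (inv t p)) p v"
    by (rule tangent_prod_eqI[OF X Y P[OF u(1)] P[OF u(2)]]) (simp_all only: push_D[OF p] e)
  have "pushforward XYS (inv t) p u = pushforward XYS (inv t) p v"
  proof (rule tangent_prod_eqI[OF XY two_points(1) PM[OF u(1)] PM[OF u(2)]])
    show "pushforward XY fst (inv t p) (pushforward XYS (inv t) p u) = pushforward XY fst (inv t p) (pushforward XYS (inv t) p v)"
      by (simp only: push_D[OF p] e1)
    have "pushforward two_points snd (inv t p) (pushforward XYS (inv t) p w) = (\<lambda>g. 0)" if w: "w \<in> tangent_space D p" for w
      by (rule two_points_tangent, rule pushforward_in[OF XYS two_points(1) smooth_map_snd[OF XY two_points(1)] PM[OF w]])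
    then show "pushforward two_points snd (inv t p) (pushforward XYS (inv t) p u) = pushforward two_points snd (inv t p) (pushforward XYS (inv t) p v)"
      using u by metis
  qed
  then show ?thesis using inj_onD[OF tangent_copy(2)[OF XYS t W iW]] u by blast
qed

private definition "half s = {p \<in> points D. side p = s}"

text \<open>\<open>side\<close> is continuous into a discrete space. Openness of the components lets
  the form be treated piecewise, closedness makes the slices closed in the whole space.\<close>

private lemma half: "openin (mtop D) (half s)" "closedin (mtop D) (half s)"
proof -
  have c: "continuous_map (mtop D) (discrete_topology UNIV) side" using smooth_map_continuous[OF smooth_D(4)] by (simp add: two_points(3))
  show "openin (mtop D) (half s)" using openin_continuous_map_preimage[OF c, of "{s}"] by (simp add: half_def)
  show "closedin (mtop D) (half s)" using closedin_continuous_map_preimage[OF c, of "{s}"] by (simp add: half_def)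
qed

private lemma halfD: "p \<in> half s \<Longrightarrow> p \<in> points D \<and> px p \<in> points X \<and> py p \<in> points Y \<and> side p = s"
  using points_D by (auto simp: half_def)

private lemma half_UV: "p \<in> half True \<Longrightarrow> px p \<in> U" "p \<in> half False \<Longrightarrow> py p \<in> V"
  using points_D by (auto simp: half_def)

text \<open>Product chart with a fixed label. The offsets 0 and \<open>mdim X\<close> tell where the
  coordinates of the two factors begin, in the format that \<open>reduction_data_slice\<close>
  expects.\<close>

private lemma half_chart:
  assumes c: "(U', \<phi>') \<in> matlas X" and d: "(V', \<psi>') \<in> matlas Y" and p: "p \<in> half s" "px p \<in> U'" "py p \<in> V'"
    and s: "if s then U' \<subseteq> U else V' \<subseteq> V"
  shows "\<exists>E \<kappa>. (E, \<kappa>) \<in> matlas D \<and> p \<in> E \<and> E \<subseteq> half s \<and>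
    (\<forall>q\<in>E. (\<forall>j<mdim X. \<kappa> q (0 + j) = \<phi>' (px q) j) \<and> (\<forall>j<mdim Y. \<kappa> q (mdim X + j) = \<psi>' (py q) j))"
proof -
  let ?\<kappa> = "\<lambda>m. join (mdim XY) (join (mdim X) (\<phi>' (fst (fst m))) (\<psi>' (snd (fst m)))) (\<lambda>_. 0)"
  let ?E = "(U' \<times> V') \<times> {s}"
  have ch: "(?E, ?\<kappa>) \<in> matlas XYS"
    by (rule prod_chart_matlas[OF XY two_points(1) prod_chart_matlas[OF X Y c d] two_points(2)])
  have UV: "U' \<subseteq> points X" "V' \<subseteq> points Y" by (rule matlas_chartD(2)[OF X c], rule matlas_chartD(2)[OF Y d])
  have EW: "?E \<subseteq> W" using s UV by (auto simp: W_def split: if_splits)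
  have "(t ` ?E, \<lambda>p. ?\<kappa> (inv t p)) \<in> matlas D" by (rule smooth_copy_manifold(2)[OF XYS t W ch EW])
  moreover have "p \<in> t ` ?E"
    by (rule image_eqI[of _ _ "inv t p"]) (use halfD[OF p(1)] p(2,3) in \<open>auto simp: px_def py_def side_def mem_Times_iff\<close>)
  moreover have "t ` ?E \<subseteq> half s"
  proof (rule image_subsetI)
    fix m assume m: "m \<in> ?E"
    have "snd m = s" using m by auto
    then show "t m \<in> half s" unfolding half_def mem_Collect_eq inv_in_W side_def inv_t using subsetD[OF EW m] by blast
  qed
  ultimately show ?thesis
    by (intro exI[of _ "t ` ?E"] exI[of _ "\<lambda>p. ?\<kappa> (inv t p)"]) (auto simp: join_def px_def py_def)
qed

private definition "\<theta> p u v = (if side p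
  then std_form X \<phi> (px p) (pushforward X px p u) (pushforward X px p v) + form Y (py p) (pushforward Y py p u) (pushforward Y py p v)
  else form X (px p) (pushforward X px p u) (pushforward X px p v) + std_form Y \<psi> (py p) (pushforward Y py p u) (pushforward Y py p v))"

private abbreviation "Q \<equiv> symplectic_extend D \<theta>"

text \<open>Each point has its component as an open neighbourhood, and there \<open>\<theta>\<close>
  is a sum of two pullbacks: one of a given form, one of the constant form of a chart.\<close>

private lemma symplectic_Q: "symplectic_manifold Q"
proof (rule symplectic_manifold_extend[OF D(1)])
  have evX: "even (mdim X)" and evY: "even (mdim Y)" using SX SY by (simp_all add: symplectic_manifold_def)
  then show "even (mdim D)" by (simp add: two_points(4))
  note cX = symplectic_closed_two_form[OF SX] and cY = symplectic_closed_two_form[OF SY]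
  fix p assume p: "p \<in> points D"
  have pH: "p \<in> half (side p)" using p by (simp add: half_def)
  have pts: "px p \<in> points X" "py p \<in> points Y" using halfD[OF pH] by auto
  show "\<exists>A. p \<in> A \<and> closed_two_form_on D A \<theta>"
  proof (cases "side p")
    case True
    have "closed_two_form_on D (half True) (\<lambda>p u v. std_form X \<phi> (px p) (pushforward X px p u) (pushforward X px p v)
        + form Y (py p) (pushforward Y py p u) (pushforward Y py p v))"
      by (intro closed_two_form_add closed_two_form_pullback[OF D(1) X smooth_D(2) closed_std_form[OF X cU] half(1) half_UV(1)]
          closed_two_form_pullback[OF D(1) Y smooth_D(3) cY(1) half(1)]) (use halfD in blast)+
    then have "closed_two_form_on D (half True) \<theta>"
      by (rule closed_two_form_cong[OF D(1)]) (simp add: \<theta>_def half_def)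
    then show ?thesis using pH True by auto
  next
    case False
    have "closed_two_form_on D (half False) (\<lambda>p u v. form X (px p) (pushforward X px p u) (pushforward X px p v)
        + std_form Y \<psi> (py p) (pushforward Y py p u) (pushforward Y py p v))"
      by (intro closed_two_form_add closed_two_form_pullback[OF D(1) X smooth_D(2) cX(1) half(1)]
          closed_two_form_pullback[OF D(1) Y smooth_D(3) closed_std_form[OF Y cV] half(1) half_UV(2)]) (use halfD in blast)+
    then have "closed_two_form_on D (half False) \<theta>"
      by (rule closed_two_form_cong[OF D(1)]) (simp add: \<theta>_def half_def)
    then show ?thesis using pH False by auto
  qed
  have bX: "bilinear_at X (form X) (px p)" and bY: "bilinear_at Y (form Y) (py p)"
    using cX(1) cY(1) pts by (auto simp: closed_two_form_on_def)
  show "nondegenerate_at D \<theta> p"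
  proof (cases "side p")
    case True
    then have pU: "px p \<in> U" using half_UV(1) pH by simp
    show ?thesis
      by (rule nondegenerate_sum[OF D(1) X Y smooth_D(2,3) p tangent_D_ex[OF p] tangent_D_eqI bilinear_std_form bY
            nondegenerate_std_form[OF X cU pU evX] cY(2)[OF pts(2)]]) (simp_all add: \<theta>_def True)
  next
    case False
    then have pV: "py p \<in> V" using half_UV(2) pH by simp
    show ?thesis
      by (rule nondegenerate_sum[OF D(1) X Y smooth_D(2,3) p tangent_D_ex[OF p] tangent_D_eqI bX bilinear_std_form
            cX(2)[OF pts(1)] nondegenerate_std_form[OF Y cV pV evY]]) (simp_all add: \<theta>_def False)
  qed
qed

text \<open>\<open>X\<close> arises from the component \<open>points X \<times> V\<close> by a slice
  in \<open>V\<close>, and \<open>Y\<close> from \<open>U \<times> points Y\<close> by a slice in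
  \<open>U\<close>. Lying in different components, the two coisotropic sets are disjoint.\<close>

lemma disjoint_reductions_charts:
  "\<exists>(Q :: 'a symplectic) K r L s. reduction_data X Q K r \<and> reduction_data Y Q L s \<and> K \<inter> L = {}"
proof (intro exI conjI)
  have evX: "even (mdim X)" and evY: "even (mdim Y)" using SX SY by (simp_all add: symplectic_manifold_def)
  let ?K = "{p \<in> half False. \<forall>j<mdim Y. odd j \<longrightarrow> \<psi> (py p) j = 0}"
  let ?L = "{p \<in> half True. \<forall>j<mdim X. odd j \<longrightarrow> \<phi> (px p) j = 0}"
  have mQ: "smooth_map Q X px" "smooth_map Q Y py" unfolding smooth_map_symplectic_extend by (rule smooth_D(2), rule smooth_D(3))
  have f: "form Q p u v = \<theta> p u v" if "p \<in> half s" "u \<in> tangent_space Q p" "v \<in> tangent_space Q p" for p u v s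
    using that halfD[of p s] unfolding form_symplectic_extend symplectic_extend_cong by simp
  show "reduction_data X Q ?K px"
  \<comment> \<open>The coordinates of \<open>Y\<close> follow those of \<open>X\<close>, hence the
    offset \<open>mdim X\<close>; in the second reduction the sliced factor comes first and the
    offset is 0.\<close>
  proof (rule reduction_data_slice[OF symplectic_Q SX Y evY mQ cV _ half_UV(2) y0(1), where s = "mdim X"])
    show "closedin (mtop Q) (half False)" by (simp add: half(2))
    show "\<exists>p\<in>half False. px p = z \<and> py p = y0" if "z \<in> points X" for z
      by (rule bexI[of _ "t ((z, y0), False)"]) (use that y0 V(2) in \<open>auto simp: half_def points_D px_def py_def side_def\<close>)
    show "\<exists>u\<in>tangent_space Q p. pushforward X px p u = a \<and> pushforward Y py p u = b"
      if "p \<in> half False" "a \<in> tangent_space X (px p)" "b \<in> tangent_space Y (py p)" for p a b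
      unfolding symplectic_extend_cong using tangent_D_ex halfD[OF that(1)] that by blast
    show "form Q p u v = form X (px p) (pushforward X px p u) (pushforward X px p v) + std_form Y \<psi> (py p) (pushforward Y py p u) (pushforward Y py p v)"
      if "p \<in> half False" "u \<in> tangent_space Q p" "v \<in> tangent_space Q p" for p u v
      using f[OF that] halfD[OF that(1)] by (simp add: \<theta>_def)
    show "\<exists>E \<kappa>. (E, \<kappa>) \<in> matlas Q \<and> p \<in> E \<and> E \<subseteq> half False \<and> (\<forall>q\<in>E. \<forall>j<mdim Y. \<kappa> q (mdim X + j) = \<psi> (py q) j)"
      if p: "p \<in> half False" for p
    proof -
      have pX: "px p \<in> points X" using halfD[OF p] by blast
      obtain U' \<phi>' where c: "(U', \<phi>') \<in> matlas X" "px p \<in> U'" by (rule chart_exists[OF X pX])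
      have "if False then U' \<subseteq> U else V \<subseteq> V" by simp
      from half_chart[OF c(1) cV p c(2) half_UV(2)[OF p] this] obtain E \<kappa> where E: "(E, \<kappa>) \<in> matlas D" "p \<in> E" "E \<subseteq> half False"
        "\<forall>q\<in>E. (\<forall>j<mdim X. \<kappa> q (0 + j) = \<phi>' (px q) j) \<and> (\<forall>j<mdim Y. \<kappa> q (mdim X + j) = \<psi> (py q) j)" by (elim exE conjE) (rule that)
      show ?thesis by (intro exI[of _ E] exI[of _ \<kappa>]) (use E in \<open>simp only: symplectic_extend_simps, blast\<close>)
    qed
  qed (use y0 in \<open>simp_all add: two_points(4)\<close>)
  show "reduction_data Y Q ?L py"
  proof (rule reduction_data_slice[OF symplectic_Q SY X evX mQ(2,1) cU _ half_UV(1) x0(1), where s = 0])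
    show "closedin (mtop Q) (half True)" by (simp add: half(2))
    show "\<exists>p\<in>half True. py p = z \<and> px p = x0" if "z \<in> points Y" for z
      by (rule bexI[of _ "t ((x0, z), True)"]) (use that x0 U(2) in \<open>auto simp: half_def points_D px_def py_def side_def\<close>)
    show "\<exists>u\<in>tangent_space Q p. pushforward Y py p u = a \<and> pushforward X px p u = b"
      if "p \<in> half True" "a \<in> tangent_space Y (py p)" "b \<in> tangent_space X (px p)" for p a b
      unfolding symplectic_extend_cong using tangent_D_ex halfD[OF that(1)] that by blast
    show "form Q p u v = form Y (py p) (pushforward Y py p u) (pushforward Y py p v) + std_form X \<phi> (px p) (pushforward X px p u) (pushforward X px p v)"
      if "p \<in> half True" "u \<in> tangent_space Q p" "v \<in> tangent_space Q p" for p u v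
      using f[OF that] halfD[OF that(1)] by (simp add: \<theta>_def)
    show "\<exists>E \<kappa>. (E, \<kappa>) \<in> matlas Q \<and> p \<in> E \<and> E \<subseteq> half True \<and> (\<forall>q\<in>E. \<forall>j<mdim X. \<kappa> q (0 + j) = \<phi> (px q) j)"
      if p: "p \<in> half True" for p
    proof -
      have pY: "py p \<in> points Y" using halfD[OF p] by blast
      obtain V' \<psi>' where d: "(V', \<psi>') \<in> matlas Y" "py p \<in> V'" by (rule chart_exists[OF Y pY])
      have "if True then U \<subseteq> U else V' \<subseteq> V" by simp
      from half_chart[OF cU d(1) p half_UV(1)[OF p] d(2) this] obtain E \<kappa> where E: "(E, \<kappa>) \<in> matlas D" "p \<in> E" "E \<subseteq> half True"
        "\<forall>q\<in>E. (\<forall>j<mdim X. \<kappa> q (0 + j) = \<phi> (px q) j) \<and> (\<forall>j<mdim Y. \<kappa> q (mdim X + j) = \<psi>' (py q) j)" by (elim exE conjE) (rule that)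
      show ?thesis by (intro exI[of _ E] exI[of _ \<kappa>]) (use E in \<open>simp only: symplectic_extend_simps, blast\<close>)
    qed
  qed (use x0 in \<open>simp_all add: two_points(4)\<close>)
  show "?K \<inter> ?L = {}" by (auto simp: half_def)
qed

end

text \<open>A translated chart puts the given point on the slice of vanishing odd coordinates, so
  that the slice projects onto the whole other factor.\<close>

lemma centered_chart:
  assumes M: "smooth_manifold M" and p: "p \<in> points M"
  obtains U \<phi> where "(U, \<phi>) \<in> matlas M" "p \<in> U" "\<phi> p = (\<lambda>_. 0)"
proof -
  obtain U \<phi> where c: "(U, \<phi>) \<in> matlas M" "p \<in> U" by (rule chart_exists[OF M p])
  note D = matlas_chartD[OF M c(1)]
  let ?n = "mdim M"
  let ?\<Theta> = "\<lambda>x i. x i - \<phi> p i" and ?\<Xi> = "\<lambda>x i. x i + \<phi> p i"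
  have E: "?\<Theta> x \<in> eucl ?n" "?\<Xi> x \<in> eucl ?n" if "x \<in> eucl ?n" for x
    using that D(5)[OF c(2)] by (auto simp: in_Euclidean_space)
  have "(U, \<lambda>q. ?\<Theta> (\<phi> q)) \<in> matlas M"
  proof (rule matlas_change_coordinates[OF M c(1), where \<Theta> = ?\<Theta> and \<Xi> = ?\<Xi>])
    show "open_eucl ?n (?\<Theta> ` \<phi> ` U)"
    proof -
      have op: "open_eucl ?n {x \<in> eucl ?n. ?\<Xi> x \<in> \<phi> ` U}"
      proof -
        have "{x \<in> eucl ?n. ?\<Xi> x \<in> \<phi> ` U} =
            {x \<in> eucl ?n. trunc ?n (\<lambda>j. x j + \<phi> p j) \<in> \<phi> ` U}"
          by (intro Collect_cong conj_cong refl) (simp only: trunc_id[OF E(2)])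
        also have "open_eucl ?n \<dots>"
        proof (rule smooth_preimage_open[OF openin_topspace _ D(3)])
          fix j
          show "smooth_on ?n (eucl ?n) (\<lambda>x. x j + \<phi> p j)"
            unfolding smooth_on_iff_at[OF openin_topspace] by (intro ballI smooth_at_add smooth_at_coord smooth_at_const)
        qed
        finally show ?thesis .
      qed
      have "?\<Theta> ` \<phi> ` U = {x \<in> eucl ?n. ?\<Xi> x \<in> \<phi> ` U}" (is "_ = ?R")
      proof (intro set_eqI iffI)
        fix x assume "x \<in> ?\<Theta> ` \<phi> ` U"
        then obtain q where q: "q \<in> U" "x = ?\<Theta> (\<phi> q)" by auto
        have "?\<Xi> x = \<phi> q" using q(2) by auto
        then show "x \<in> ?R" using q E(1)[OF D(5)[OF q(1)]] by auto
      next
        fix x assume x: "x \<in> ?R"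
        have "x = ?\<Theta> (?\<Xi> x)" by auto
        then show "x \<in> ?\<Theta> ` \<phi> ` U" using x by (intro image_eqI[of x ?\<Theta> "?\<Xi> x"]) auto
      qed
      then show ?thesis using op by simp
    qed
    show "smooth_at ?n (\<lambda>x. ?\<Theta> x j) (\<phi> q)" if "q \<in> U" for q j
      using D(5)[OF that] by (intro smooth_at_diff smooth_at_coord smooth_at_const)
    show "smooth_at ?n (\<lambda>x. ?\<Xi> x j) (?\<Theta> (\<phi> q))" if "q \<in> U" for q j
      using E(1)[OF D(5)[OF that]] by (intro smooth_at_add smooth_at_coord smooth_at_const)
  qed (use E D(5) in auto)
  then show thesis using c(2) by (intro that[of U "\<lambda>q. ?\<Theta> (\<phi> q)"]) auto
qed

lemma disjoint_reductions:
  fixes X Y :: "('a::infinite) symplectic"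
  assumes SX: "symplectic_manifold X" and SY: "symplectic_manifold Y" and ne: "points X \<noteq> {}" "points Y \<noteq> {}"
  shows "\<exists>(Q :: 'a symplectic) K r L s. reduction_data X Q K r \<and> reduction_data Y Q L s \<and> K \<inter> L = {}"
proof -
  obtain x y where x: "x \<in> points X" and y: "y \<in> points Y" using ne by blast
  obtain U \<phi> where U: "(U, \<phi>) \<in> matlas X" "x \<in> U" "\<phi> x = (\<lambda>_. 0)" by (rule centered_chart[OF symplectic_smooth[OF SX] x])
  obtain V \<psi> where V: "(V, \<psi>) \<in> matlas Y" "y \<in> V" "\<psi> y = (\<lambda>_. 0)" by (rule centered_chart[OF symplectic_smooth[OF SY] y])
  obtain t :: "('a \<times> 'a) \<times> bool \<Rightarrow> 'a" where t: "bij t" using ex_bij_bent(2) by blast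
  show ?thesis by (rule disjoint_reductions_charts[OF t SX SY U(1) V(1) U(2,3) V(2,3)])
qed

lemma reduction_data_empty:
  fixes X Q :: "'a symplectic"
  assumes SX: "symplectic_manifold X" and SQ: "symplectic_manifold Q" and e: "points X = {}"
  shows "reduction X Q {}" "coreduction Q X {}"
proof -
  have "smooth_relation X Q {}" "smooth_relation Q X {}"
    using canonical_relation_smooth(6)[OF canonical_relation_empty[OF SX SQ]] canonical_relation_smooth(6)[OF canonical_relation_empty[OF SQ SX]] by auto
  moreover have "proper_map (subtopology (prod_topology (mtop X) (mtop Q)) {}) (mtop Q) snd"
    by (simp add: proper_map_def closed_map_def)
  ultimately show "reduction X Q {}" by (auto simp: reduction_def surjective_rel_def coinjective_rel_def tangent_relation_def tangent_bundle_def e)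
  then show "coreduction Q X {}" using \<open>smooth_relation Q X {}\<close> by (simp add: coreduction_def)
qed

text \<open>If \<open>X\<close> is empty, the empty relation is itself a reduction onto it and the
  identity of \<open>Y\<close> serves as coreduction; the case of empty \<open>Y\<close> is
  symmetric. Otherwise the reduction and the coreduction live on disjoint parts of \<open>Q\<close>,
  so no point links them.\<close>

lemma empty_factorization:
  fixes X Y :: "('a::infinite) symplectic"
  assumes SX: "symplectic_manifold X" and SY: "symplectic_manifold Y"
  shows "\<exists>(Q :: 'a symplectic) A B. symplectic_manifold Q \<and> canonical_relation X Q A \<and> canonical_relation Q Y B \<and>
    reduction X Q A \<and> coreduction Q Y B \<and> A O B = {}"
proof -
  consider "points X = {}" | "points Y = {}" | "points X \<noteq> {}" "points Y \<noteq> {}" by blast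
  then show ?thesis
  proof cases
    case 1
    note R = reduction_data_canonical[OF reduction_data_id[OF SY]]
    show ?thesis
      by (intro exI[of _ Y] exI[of _ "{}"] exI[of _ "(reduction_rel (points Y) (\<lambda>x. x))\<inverse>"] conjI SY canonical_relation_empty[OF SX SY]
          R(2,4) reduction_data_empty(1)[OF SX SY 1]) simp
  next
    case 2
    note R = reduction_data_canonical[OF reduction_data_id[OF SX]]
    show ?thesis
      by (intro exI[of _ X] exI[of _ "{}"] exI[of _ "reduction_rel (points X) (\<lambda>x. x)"] conjI SX canonical_relation_empty[OF SX SY]
          R(1,3) reduction_data_empty(2)[OF SY SX 2]) simp
  next
    case 3
    obtain Q :: "'a symplectic" and K r L s where R: "reduction_data X Q K r" "reduction_data Y Q L s" and KL: "K \<inter> L = {}"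
      using disjoint_reductions[OF SX SY 3] by blast
    note RA = reduction_data_canonical[OF R(1)] and RB = reduction_data_canonical[OF R(2)]
    have "reduction_rel K r O (reduction_rel L s)\<inverse> = {}" using KL by (auto simp: reduction_rel_def)
    then show ?thesis
      by (intro exI[of _ Q] exI[of _ "reduction_rel K r"] exI[of _ "(reduction_rel L s)\<inverse>"] conjI
          reduction_data_smooth(4)[OF R(1)] RA(1,3) RB(2,4))
  qed
qed

section \<open>Words in the Wehrheim-Woodward category\<close>

abbreviation canonical_srel :: "'a srel \<Rightarrow> bool" where
  "canonical_srel g \<equiv> canonical_relation (tgt g) (src g) (rel g)"

abbreviation strongly_transversal_srel :: "'a srel \<Rightarrow> 'a srel \<Rightarrow> bool" where
  "strongly_transversal_srel p q \<equiv> strongly_transversal (tgt p) (src p) (src q) (rel p) (rel q)"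

definition canonical_word :: "'a srel list \<Rightarrow> bool" where
  "canonical_word fs \<longleftrightarrow> fs \<noteq> [] \<and> (\<forall>g\<in>set fs. canonical_srel g) \<and> successively (\<lambda>g h. src g = tgt h) fs"

text \<open>An equivalence, so that it serves for merging two entries as well as for splitting
  one.\<close>

lemma canonical_word_compose:
  "src p = tgt q \<Longrightarrow> canonical_word (xs @ p # q # ys) \<and> canonical_srel (srel_comp p q) \<longleftrightarrow>
     canonical_word (xs @ srel_comp p q # ys) \<and> canonical_srel p \<and> canonical_srel q"
  by (cases ys) (auto simp: canonical_word_def successively_append_iff srel_comp_def)

lemma canonical_path_of_list:
  assumes fs: "canonical_word fs"
  shows "canonical_path (path_of_list fs)"
proof -
  have ne: "fs \<noteq> []" and can: "\<And>g. g \<in> set fs \<Longrightarrow> canonical_srel g" using fs by (auto simp: canonical_word_def)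
  have adj: "src (fs ! i) = tgt (fs ! Suc i)" if "Suc i < length fs" for i
    using fs that by (auto simp: canonical_word_def successively_conv_nth)
  have id: "canonical_srel (srel_id X)" if "symplectic_manifold X" for X :: "'a symplectic"
    using canonical_relation_Id[OF that] by (simp add: srel_id_def)
  have sym: "symplectic_manifold (tgt (hd fs))" "symplectic_manifold (src (last fs))"
    using canonical_relation_symplectic[OF can[OF hd_in_set[OF ne]]] canonical_relation_symplectic[OF can[OF last_in_set[OF ne]]] by auto
  let ?c = "path_of_list fs"
  show ?thesis
    unfolding canonical_path_def
  proof (intro conjI allI)
    fix j
    show "canonical_srel (?c j)"
      using id[OF sym(1)] id[OF sym(2)] can by (auto simp: path_of_list_def)
    consider "j < - 1" | "j = - 1" | "0 \<le> j" "j + 1 < int (length fs)" | "0 \<le> j" "j + 1 = int (length fs)" | "int (length fs) \<le> j"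
      by linarith
    then show "src (?c j) = tgt (?c (j + 1))"
    proof cases
      case 3
      then have "nat (j + 1) = Suc (nat j)" by simp
      then show ?thesis using 3 adj[of "nat j"] by (simp add: path_of_list_def)
    next
      case 4
      then have "nat j = length fs - 1" by simp
      then show ?thesis using 4 ne by (simp add: path_of_list_def srel_id_def last_conv_nth)
    qed (use ne in \<open>auto simp: path_of_list_def srel_id_def hd_conv_nth\<close>)
  next
    have "{j. ?c j \<noteq> srel_id (tgt (?c j))} \<subseteq> {0..<int (length fs)}"
    proof
      fix j assume "j \<in> {j. ?c j \<noteq> srel_id (tgt (?c j))}"
      then show "j \<in> {0..<int (length fs)}" by (cases "j < 0"; cases "j < int (length fs)") (simp_all add: path_of_list_def srel_id_def)
    qed
    then show "finite {j. ?c j \<noteq> srel_id (tgt (?c j))}" by (rule finite_subset) simp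
  qed
qed

lemma compose_at_path_of_list:
  "compose_at (int (length xs)) (path_of_list (xs @ p # q # ys)) = path_of_list (xs @ srel_comp p q # ys)"
proof
  fix i
  let ?n = "int (length xs)"
  have hd: "tgt (hd (xs @ p # q # ys)) = tgt (hd (xs @ srel_comp p q # ys))" by (cases xs) (simp_all add: srel_comp_def)
  have lt: "src (last (xs @ p # q # ys)) = src (last (xs @ srel_comp p q # ys))" by (cases ys) (simp_all add: srel_comp_def)
  consider "i < 0" | "0 \<le> i" "i < ?n" | "i = ?n" | "?n < i" by linarith
  then show "compose_at ?n (path_of_list (xs @ p # q # ys)) i = path_of_list (xs @ srel_comp p q # ys) i"
  proof cases
    case 1
    then show ?thesis by (simp add: compose_at_def path_of_list_def hd)
  next
    case 2
    then have "nat i < length xs" by simp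
    then show ?thesis using 2 by (simp add: compose_at_def path_of_list_def nth_append)
  next
    case 3
    have "nat (1 + ?n) = Suc (length xs)" by simp
    then show ?thesis using 3 by (simp add: compose_at_def path_of_list_def nth_append add.commute)
  next
    case 4
    \<comment> \<open>\<open>k\<close> counts the places behind the merged entry, where
      \<open>compose_at\<close> reads one place further to the right.\<close>
    define k where "k = nat (i - ?n - 1)"
    have i: "i = ?n + 1 + int k" using 4 by (simp add: k_def)
    have n: "nat (?n + 1 + int k) = length xs + Suc k" "nat (2 + (?n + int k)) = length xs + Suc (Suc k)" by simp_all
    have "src (last (p # q # ys)) = src (last (srel_comp p q # ys))" using lt by (simp only: last_append list.distinct if_False)
    then show ?thesis unfolding i by (simp add: compose_at_def path_of_list_def nth_append n del: nat_add_distrib last.simps)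
  qed
qed

text \<open>One generating step connects the two path classes, so their equivalence classes
  coincide. Being an equation, it also permits splitting an entry.\<close>

lemma WW_class_compose:
  assumes w: "canonical_word (xs @ p # q # ys)" and c: "canonical_srel (srel_comp p q)" and pq: "src p = tgt q"
    and st: "strongly_transversal_srel p q"
  shows "WW_class (xs @ p # q # ys) = WW_class (xs @ srel_comp p q # ys)"
proof -
  let ?c = "path_of_list (xs @ p # q # ys)" and ?d = "path_of_list (xs @ srel_comp p q # ys)"
  have w': "canonical_word (xs @ srel_comp p q # ys)" using canonical_word_compose[OF pq] w c by blast
  have n: "?c (int (length xs)) = p" "?c (int (length xs) + 1) = q"
    by (simp_all add: path_of_list_def nth_append nat_add_distrib)
  have "WW_step (path_class ?c) (path_class ?d)"
    unfolding WW_step_def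
    by (rule exI[of _ ?c], rule exI[of _ ?d], rule exI[of _ "int (length xs)"])
      (simp only: n st canonical_path_of_list[OF w] canonical_path_of_list[OF w'] compose_at_path_of_list)
  then have e: "equivclp WW_step (path_class ?c) (path_class ?d)" by (rule r_into_equivclp)
  have "equivclp WW_step (path_class ?c) P = equivclp WW_step (path_class ?d) P" for P
    by (rule iffI) (erule equivclp_trans[OF equivclp_sym[OF e]], erule equivclp_trans[OF e])
  then show ?thesis unfolding WW_class_def by (rule Collect_cong)
qed

text \<open>An empty entry and a neighbour form a strongly transversal pair, and their composite is
  empty again. The word thus shrinks around the empty entry until one letter is left.\<close>

lemma WW_class_empty:
  "canonical_word fs \<Longrightarrow> g \<in> set fs \<Longrightarrow> rel g = {} \<Longrightarrow>
    WW_class fs = WW_class [\<lparr>tgt = tgt (hd fs), rel = {}, src = src (last fs)\<rparr>]"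
proof (induction "length fs" arbitrary: fs g rule: less_induct)
  case less
  note w = less.prems(1)
  have merge: "WW_class (xs @ p # q # ys) = WW_class (xs @ srel_comp p q # ys)" "canonical_word (xs @ srel_comp p q # ys)"
    if f: "fs = xs @ p # q # ys" and e: "rel p = {} \<or> rel q = {}" for xs p q ys
  proof -
    have c: "canonical_srel p" "canonical_srel q" "src p = tgt q" using w f by (auto simp: canonical_word_def successively_append_iff)
    note s = canonical_relation_smooth[OF c(1)] canonical_relation_smooth[OF c(2)]
    have r: "rel p O rel q = {}" using e by auto
    have "canonical_relation (tgt p) (src q) (rel p O rel q)" unfolding r by (rule canonical_relation_empty[OF s(3) s(11)])
    then have cc: "canonical_srel (srel_comp p q)" by (simp add: srel_comp_def)
    have st: "strongly_transversal_srel p q"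
      by (rule strongly_transversal_empty[OF s(1,2,9) s(6) s(13)[folded c(3)] r])
    show "WW_class (xs @ p # q # ys) = WW_class (xs @ srel_comp p q # ys)" by (rule WW_class_compose[OF w[unfolded f] cc c(3) st])
    show "canonical_word (xs @ srel_comp p q # ys)" using canonical_word_compose[OF c(3)] w f cc by blast
  qed
  have step: ?case if f: "fs = xs @ p # q # ys" and e: "rel p = {} \<or> rel q = {}" for xs p q ys
  proof -
    have "WW_class (xs @ srel_comp p q # ys) =
        WW_class [\<lparr>tgt = tgt (hd (xs @ srel_comp p q # ys)), rel = {}, src = src (last (xs @ srel_comp p q # ys))\<rparr>]"
      by (rule less.hyps[OF _ merge(2)[OF f e], of "srel_comp p q"]) (use f e in \<open>auto simp: srel_comp_def\<close>)
    moreover have "tgt (hd fs) = tgt (hd (xs @ srel_comp p q # ys))" unfolding f by (cases xs) (simp_all add: srel_comp_def)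
    moreover have "src (last fs) = src (last (xs @ srel_comp p q # ys))" unfolding f by (cases ys) (simp_all add: srel_comp_def)
    ultimately show ?thesis using merge(1)[OF f e] f by simp
  qed
  \<comment> \<open>The empty entry merges with its right neighbour if there is one, otherwise with
    the left one; a word of one letter already has the required form.\<close>
  obtain us vs where f: "fs = us @ g # vs" using less.prems(2) by (meson split_list)
  show ?case
  proof (cases vs)
    case (Cons h vs')
    show ?thesis by (rule step[of us g h vs']) (use f Cons less.prems(3) in auto)
  next
    case Nil
    show ?thesis
    proof (cases us rule: rev_cases)
      case (snoc us' h)
      show ?thesis by (rule step[of us' h g "[]"]) (use f Nil snoc less.prems(3) in auto)
    next
      case Nil
      then show ?thesis using f \<open>vs = []\<close> less.prems(3) by (cases g) simp
    qed
  qed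
qed

section \<open>Shortening a path from the left\<close>

abbreviation (input) srel_of :: "'a symplectic \<Rightarrow> ('a \<times> 'a) set \<Rightarrow> 'a symplectic \<Rightarrow> 'a srel" where
  "srel_of X f Y \<equiv> \<lparr>tgt = X, rel = f, src = Y\<rparr>"

definition bent_diagonal_rel :: "(('a \<times> 'a) \<times> 'a \<Rightarrow> 'a) \<Rightarrow> 'a symplectic \<Rightarrow> 'a symplectic \<Rightarrow> ('a \<times> 'a) set" where
  "bent_diagonal_rel t Q Y = reduction_rel {p \<in> points (bent t Q Y). bent1 t p \<in> points Q \<and> bent2 t p = bent3 t p} (bent1 t)"

definition bent_cylinder :: "(('a \<times> 'a) \<times> 'a \<Rightarrow> 'a) \<Rightarrow> 'a symplectic \<Rightarrow> 'a symplectic \<Rightarrow> ('a \<times> 'a) set \<Rightarrow> 'a set" where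
  "bent_cylinder t Q Y c = {p \<in> points (bent t Q Y). (bent1 t p, bent2 t p) \<in> c}"

abbreviation bent_corel :: "(('a \<times> 'a) \<times> 'a \<Rightarrow> 'a) \<Rightarrow> 'a symplectic \<Rightarrow> 'a symplectic \<Rightarrow> ('a \<times> 'a) set \<Rightarrow> ('a \<times> 'a) set" where
  "bent_corel t Q Y c \<equiv> (reduction_rel (bent_cylinder t Q Y c) (bent3 t))\<inverse>"

context
  fixes t :: "('a \<times> 'a) \<times> 'a \<Rightarrow> 'a"
  assumes t: "bij t"
begin

lemma WW_class_split:
  assumes c: "canonical_relation Q Y c" "c \<noteq> {}" and w: "canonical_word (xs @ srel_of Q c Y # ys)"
  defines "A \<equiv> srel_of Q (bent_diagonal_rel t Q Y) (bent t Q Y)"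
    and "B \<equiv> srel_of (bent t Q Y) (bent_corel t Q Y c) Y"
  shows "WW_class (xs @ srel_of Q c Y # ys) = WW_class (xs @ A # B # ys)" "canonical_word (xs @ A # B # ys)"
proof -
  note s = canonical_relation_smooth[OF c(1)]
  have ne: "points Y \<noteq> {}" using s(7) c(2) by auto
  note st = strongly_transversal_bent[OF t s(3,4) c, folded bent_diagonal_rel_def bent_cylinder_def]
  have pq: "src A = tgt B" by (simp add: A_def B_def)
  have AB: "srel_comp A B = srel_of Q c Y" by (simp add: srel_comp_def A_def B_def st(1))
  have cA: "canonical_srel A"
    using reduction_data_canonical(1)[OF reduction_data_bent[OF t s(3,4) reduction_data_id[OF s(3)] ne]]
    by (simp add: A_def bent_diagonal_rel_def)
  have cB: "canonical_srel B"
    using reduction_data_canonical(2)[OF reduction_data_bent_cylinder[OF t s(3,4) c]] by (simp add: B_def bent_cylinder_def)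
  show cw: "canonical_word (xs @ A # B # ys)"
    using canonical_word_compose[OF pq, of xs ys] w cA cB c(1) unfolding AB by simp
  show "WW_class (xs @ srel_of Q c Y # ys) = WW_class (xs @ A # B # ys)"
    using WW_class_compose[OF cw _ pq] c(1) st(2) unfolding AB by (simp add: A_def B_def)
qed

text \<open>Bending \<open>c\<close> produces a reduction onto \<open>Q\<close>, which merges with
  the given reduction onto \<open>X\<close>. What remains behind it is again a coreduction of
  cylinder type.\<close>

lemma WW_class_factor:
  assumes R: "reduction_data X Q K r" and c: "canonical_relation Q Y c" "c \<noteq> {}"
    and w: "canonical_word (srel_of X (reduction_rel K r) Q # srel_of Q c Y # ys)"
  shows "\<exists>K' r'. reduction_data X (bent t Q Y) K' r' \<and>
    WW_class (srel_of X (reduction_rel K r) Q # srel_of Q c Y # ys) =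
    WW_class (srel_of X (reduction_rel K' r') (bent t Q Y) #
      srel_of (bent t Q Y) (bent_corel t Q Y c) Y # ys) \<and>
    canonical_word (srel_of X (reduction_rel K' r') (bent t Q Y) #
      srel_of (bent t Q Y) (bent_corel t Q Y c) Y # ys)"
proof -
  note s = canonical_relation_smooth[OF c(1)] and S = reduction_data_smooth[OF R]
  have ne: "points Y \<noteq> {}" using s(7) c(2) by auto
  let ?B = "bent t Q Y" and ?K = "{p \<in> points (bent t Q Y). bent1 t p \<in> K \<and> bent2 t p = bent3 t p}"
  let ?r = "\<lambda>p. r (bent1 t p)"
  let ?P = "srel_of X (reduction_rel K r) Q" and ?A = "srel_of Q (bent_diagonal_rel t Q Y) ?B"
    and ?C = "srel_of ?B (bent_corel t Q Y c) Y"
  note R' = reduction_data_bent[OF t s(3,4) R ne]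
  have RA: "reduction_data Q ?B {p \<in> points ?B. bent1 t p \<in> points Q \<and> bent2 t p = bent3 t p} (bent1 t)"
    using reduction_data_bent[OF t s(3,4) reduction_data_id[OF s(3)] ne] by simp
  \<comment> \<open>Composing the relations composes the maps \<open>r\<close> and
    \<open>bent1 t\<close>, over the points of the diagonal whose first component lies in
    \<open>K\<close>.\<close>
  have comp: "reduction_rel K r O bent_diagonal_rel t Q Y = reduction_rel ?K ?r"
    using S(9) by (auto simp: reduction_rel_def bent_diagonal_rel_def)
  have st: "strongly_transversal X Q ?B (reduction_rel K r) (bent_diagonal_rel t Q Y)"
    unfolding bent_diagonal_rel_def
    by (rule strongly_transversal_reduction[OF RA reduction_data_canonical(1)[OF R]])
      (unfold comp[unfolded bent_diagonal_rel_def], rule reduction_data_canonical(1)[OF R'])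
  note sp = WW_class_split[OF c, of "[?P]" ys, unfolded append_Cons append_Nil, OF w]
  have PA: "srel_comp ?P ?A = srel_of X (reduction_rel ?K ?r) ?B" by (simp add: srel_comp_def comp)
  have cPA: "canonical_srel (srel_comp ?P ?A)" unfolding PA using reduction_data_canonical(1)[OF R'] by simp
  have "WW_class (?P # ?A # ?C # ys) = WW_class (srel_comp ?P ?A # ?C # ys)"
    by (rule WW_class_compose[of "[]" ?P ?A "?C # ys", unfolded append_Nil, OF sp(2) cPA]) (simp_all add: st)
  moreover have "canonical_word (srel_comp ?P ?A # ?C # ys)"
    using canonical_word_compose[of ?P ?A "[]" "?C # ys"] sp(2) cPA by simp
  ultimately show ?thesis
    using sp(1) R' unfolding PA by (intro exI[of _ ?K] exI[of _ ?r]) simp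
qed

text \<open>Invariant of an induction over prefixes, with the unread entries \<open>ys\<close>
  carried along: the prefix has become a reduction onto \<open>X 0\<close> and the cylinder
  coreduction of some nonempty \<open>c\<close>. Remembering the cylinder form, and not just a
  coreduction, is what lets \<open>canonical_relation_bent_product\<close> accept the next
  entry.\<close>

lemma WW_class_reduction_coreduction:
  assumes "1 \<le> n" and "\<forall>i. 1 \<le> i \<longrightarrow> i \<le> n \<longrightarrow> f i \<noteq> {}"
    and "\<forall>i. 1 \<le> i \<longrightarrow> i \<le> n \<longrightarrow> canonical_relation (X (i - 1)) (X i) (f i)"
    and "canonical_word (map (\<lambda>i. srel_of (X (i - 1)) (f i) (X i)) [1..<n + 1] @ ys)"
  shows "\<exists>Q c K r. canonical_relation Q (X n) c \<and> c \<noteq> {} \<and> reduction_data (X 0) (bent t Q (X n)) K r \<and>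
      canonical_word (srel_of (X 0) (reduction_rel K r) (bent t Q (X n)) #
        srel_of (bent t Q (X n)) (bent_corel t Q (X n) c) (X n) # ys) \<and>
      WW_class (map (\<lambda>i. srel_of (X (i - 1)) (f i) (X i)) [1..<n + 1] @ ys) =
      WW_class (srel_of (X 0) (reduction_rel K r) (bent t Q (X n)) #
        srel_of (bent t Q (X n)) (bent_corel t Q (X n) c) (X n) # ys)"
  using assms
proof (induction n arbitrary: ys rule: dec_induct)
  case base
  have c: "canonical_relation (X 0) (X 1) (f 1)" "f 1 \<noteq> {}" using base by auto
  note s = canonical_relation_smooth[OF c(1)]
  have ne: "points (X 1) \<noteq> {}" using s(7) c(2) by auto
  have m: "map (\<lambda>i. srel_of (X (i - 1)) (f i) (X i)) [1..<1 + 1] @ ys = srel_of (X 0) (f 1) (X 1) # ys" by simp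
  note sp = WW_class_split[OF c, of "[]" ys, unfolded append_Nil, OF base(3)[unfolded m]]
  have RA: "reduction_data (X 0) (bent t (X 0) (X 1)) {p \<in> points (bent t (X 0) (X 1)). bent1 t p \<in> points (X 0) \<and> bent2 t p = bent3 t p} (bent1 t)"
    using reduction_data_bent[OF t s(3,4) reduction_data_id[OF s(3)] ne] by simp
  show ?case
    unfolding m
    by (rule exI[of _ "X 0"], rule exI[of _ "f 1"], rule exI, rule exI, intro conjI,
        rule c(1), rule c(2), rule RA, rule sp(2)[unfolded bent_diagonal_rel_def], rule sp(1)[unfolded bent_diagonal_rel_def])
next
  case (step i)
  let ?F = "\<lambda>i. srel_of (X (i - 1)) (f i) (X i)" and ?f = "f (Suc i)" and ?Z = "X (Suc i)"
  have f: "canonical_relation (X i) ?Z ?f" "?f \<noteq> {}" using spec[OF step(5), of "Suc i"] spec[OF step(4), of "Suc i"] by auto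
  have m: "map ?F [1..<Suc i + 1] @ ys = map ?F [1..<i + 1] @ (srel_of (X i) ?f ?Z # ys)"
    using step(1) by simp
  have p: "\<forall>j. 1 \<le> j \<longrightarrow> j \<le> i \<longrightarrow> f j \<noteq> {}" "\<forall>j. 1 \<le> j \<longrightarrow> j \<le> i \<longrightarrow> canonical_relation (X (j - 1)) (X j) (f j)"
    using step(4,5) by auto
  obtain Q c K r where I: "canonical_relation Q (X i) c" "c \<noteq> {}" "reduction_data (X 0) (bent t Q (X i)) K r"
    "canonical_word (srel_of (X 0) (reduction_rel K r) (bent t Q (X i)) #
        srel_of (bent t Q (X i)) (bent_corel t Q (X i) c) (X i) # srel_of (X i) ?f ?Z # ys)"
    "WW_class (map ?F [1..<i + 1] @ srel_of (X i) ?f ?Z # ys) =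
      WW_class (srel_of (X 0) (reduction_rel K r) (bent t Q (X i)) #
        srel_of (bent t Q (X i)) (bent_corel t Q (X i) c) (X i) # srel_of (X i) ?f ?Z # ys)"
    using step(3)[OF p step(6)[unfolded m]] by (elim exE conjE) (rule that)
  let ?B = "bent t Q (X i)" and ?b = "(reduction_rel (bent_cylinder t Q (X i) c) (bent3 t))\<inverse>"
  let ?P = "srel_of (X 0) (reduction_rel K r) ?B" and ?p = "srel_of ?B ?b (X i)" and ?q = "srel_of (X i) ?f ?Z"
  note s = canonical_relation_smooth[OF I(1)]
  note L = reduction_data_bent_cylinder[OF t s(3,4) I(1,2), folded bent_cylinder_def]
  note C = canonical_relation_bent_product[OF t s(3,4) I(1) f(1)]
  have comp: "{(p, z). p \<in> points ?B \<and> (bent1 t p, bent2 t p) \<in> c \<and> (bent3 t p, z) \<in> ?f} = ?b O ?f"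
    by (auto simp: reduction_rel_def bent_cylinder_def)
  note C = C[unfolded comp]
  \<comment> \<open>The cylinder projects onto all of \<open>X i\<close>, in particular onto a point
    that is related by the next entry.\<close>
  have ne: "?b O ?f \<noteq> {}"
  proof -
    obtain y z where yz: "(y, z) \<in> ?f" using f(2) by fast
    then have "y \<in> points (X i)" using canonical_relation_smooth(7)[OF f(1)] by auto
    then obtain p where "p \<in> bent_cylinder t Q (X i) c" "y = bent3 t p" using reduction_data_smooth(6)[OF L] by blast
    then show ?thesis using yz by (auto simp: reduction_rel_def)
  qed
  have st: "strongly_transversal_srel ?p ?q"
    using strongly_transversal_coreduction[OF L f(1) C] by simp
  have pq: "srel_comp ?p ?q = srel_of ?B (?b O ?f) ?Z" by (simp add: srel_comp_def)
  have cc: "canonical_srel (srel_comp ?p ?q)" unfolding pq using C by simp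
  have w: "canonical_word (?P # srel_of ?B (?b O ?f) ?Z # ys)"
    using canonical_word_compose[of ?p ?q "[?P]" ys] I(4) cc unfolding pq by simp
  have W: "WW_class (?P # ?p # ?q # ys) = WW_class (?P # srel_of ?B (?b O ?f) ?Z # ys)"
    using WW_class_compose[of "[?P]" ?p ?q ys] I(4) cc st unfolding pq by simp
  \<comment> \<open>The composite with the next entry takes over the role of \<open>c\<close> for a
    further bending, with \<open>?B\<close> as the new \<open>Q\<close>.\<close>
  obtain K' r' where R: "reduction_data (X 0) (bent t ?B ?Z) K' r'"
    "WW_class (?P # srel_of ?B (?b O ?f) ?Z # ys) =
      WW_class (srel_of (X 0) (reduction_rel K' r') (bent t ?B ?Z) #
        srel_of (bent t ?B ?Z) (bent_corel t ?B ?Z (?b O ?f)) ?Z # ys)"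
    "canonical_word (srel_of (X 0) (reduction_rel K' r') (bent t ?B ?Z) #
        srel_of (bent t ?B ?Z) (bent_corel t ?B ?Z (?b O ?f)) ?Z # ys)"
    using WW_class_factor[OF I(3) C ne w] by (elim exE conjE) (rule that)
  show ?case
    unfolding m I(5) W R(2)
    by (rule exI[of _ ?B], rule exI[of _ "?b O ?f"], rule exI[of _ K'], rule exI[of _ r'], intro conjI C ne R(1,3) refl)
qed

end

theorem theorem6p1:
  fixes X :: "nat \<Rightarrow> ('a::infinite) symplectic"
    and f :: "nat \<Rightarrow> ('a \<times> 'a) set"
    and r :: nat
  assumes "r \<ge> 1"
    and "\<And>i. i \<le> r \<Longrightarrow> symplectic_manifold (X i)"
    and "\<And>i. 1 \<le> i \<Longrightarrow> i \<le> r \<Longrightarrow> canonical_relation (X (i - 1)) (X i) (f i)"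
  shows "\<exists>(Q :: 'a symplectic) A B.
           symplectic_manifold Q \<and>
           canonical_relation (X 0) Q A \<and> canonical_relation Q (X r) B \<and>
           reduction (X 0) Q A \<and> coreduction Q (X r) B \<and>
           WW_class (map (\<lambda>i. \<lparr>tgt = X (i - 1), rel = f i, src = X i\<rparr>) [1..<r + 1]) =
           WW_class [\<lparr>tgt = X 0, rel = A, src = Q\<rparr>, \<lparr>tgt = Q, rel = B, src = X r\<rparr>]"
proof -
  let ?fs = "map (\<lambda>i. srel_of (X (i - 1)) (f i) (X i)) [1..<r + 1]"
  have w: "canonical_word ?fs"
    using assms(1,3) by (auto simp: canonical_word_def successively_conv_nth simp del: upt_Suc)
  have sym: "symplectic_manifold (X 0)" "symplectic_manifold (X r)" using assms(2) by auto
  show ?thesis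
  proof (cases "\<exists>i. 1 \<le> i \<and> i \<le> r \<and> f i = {}")
    case True
    then obtain i where i: "1 \<le> i" "i \<le> r" "f i = {}" by blast
    have "srel_of (X (i - 1)) (f i) (X i) \<in> set ?fs" using i(1,2) by (auto simp del: upt_Suc)
    from WW_class_empty[OF w this] i(3)
    have "WW_class ?fs = WW_class [\<lparr>tgt = tgt (hd ?fs), rel = {}, src = src (last ?fs)\<rparr>]" by simp
    moreover have e: "[1..<r + 1] \<noteq> []" "hd [1..<r + 1] = 1" "last [1..<r + 1] = r" using assms(1) by (simp_all add: hd_append upt_conv_Cons)
    then have "tgt (hd ?fs) = X 0" "src (last ?fs) = X r"
      unfolding hd_map[OF e(1)] last_map[OF e(1)] e by simp_all
    ultimately have fs: "WW_class ?fs = WW_class [srel_of (X 0) {} (X r)]" by simp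
    obtain Q :: "'a symplectic" and A B where Q: "symplectic_manifold Q" "canonical_relation (X 0) Q A" "canonical_relation Q (X r) B"
      "reduction (X 0) Q A" "coreduction Q (X r) B" "A O B = {}"
      using empty_factorization[OF sym] by (elim exE conjE) (rule that)
    let ?A = "srel_of (X 0) A Q" and ?B = "srel_of Q B (X r)"
    note s = canonical_relation_smooth[OF Q(2)] canonical_relation_smooth[OF Q(3)]
    have AB: "srel_comp ?A ?B = srel_of (X 0) {} (X r)" by (simp add: srel_comp_def Q(6))
    \<comment> \<open>The factorization is used backwards: the pair composes to the empty relation,
      so its class is the class of the one-letter word.\<close>
    have "WW_class ([] @ ?A # ?B # []) = WW_class ([] @ srel_comp ?A ?B # [])"
    proof (rule WW_class_compose)
      show "canonical_word ([] @ ?A # ?B # [])" using Q(2,3) by (simp add: canonical_word_def)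
      show "canonical_srel (srel_comp ?A ?B)" unfolding AB using canonical_relation_empty[OF sym] by simp
      show "strongly_transversal_srel ?A ?B" using strongly_transversal_empty[OF s(1,2,9) s(6,13) Q(6)] by simp
    qed simp
    then show ?thesis using Q(1-5) fs unfolding AB by (intro exI[of _ Q] exI[of _ A] exI[of _ B]) simp
  next
    case False
    obtain t :: "('a \<times> 'a) \<times> 'a \<Rightarrow> 'a" where t: "bij t" using ex_bij_bent(1) by blast
    have ne: "\<forall>i. 1 \<le> i \<longrightarrow> i \<le> r \<longrightarrow> f i \<noteq> {}" using False by blast
    have can: "\<forall>i. 1 \<le> i \<longrightarrow> i \<le> r \<longrightarrow> canonical_relation (X (i - 1)) (X i) (f i)" using assms(3) by blast
    have w': "canonical_word (?fs @ [])" using w by simp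
    obtain Q c K \<rho> where Q: "canonical_relation Q (X r) c" "c \<noteq> {}" "reduction_data (X 0) (bent t Q (X r)) K \<rho>"
      "WW_class (?fs @ []) = WW_class [srel_of (X 0) (reduction_rel K \<rho>) (bent t Q (X r)),
        srel_of (bent t Q (X r)) (bent_corel t Q (X r) c) (X r)]"
      using WW_class_reduction_coreduction[OF t assms(1) ne can w'] by (elim exE conjE) (rule that)
    note s = canonical_relation_smooth[OF Q(1)]
    note A = reduction_data_canonical[OF Q(3)]
      and B = reduction_data_canonical[OF reduction_data_bent_cylinder[OF t s(3,4) Q(1,2), folded bent_cylinder_def]]
    show ?thesis
      by (rule exI[of _ "bent t Q (X r)"], rule exI, rule exI, intro conjI, rule reduction_data_smooth(4)[OF Q(3)],
          rule A(1), rule B(2), rule A(3), rule B(4), rule Q(4)[unfolded append_Nil2])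
  qed
qed

end
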